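(* For any $m,n\geq 1$ the group $\operatorname{Aut}(X_{m,n})$ is discrete if and only if $\gcd(m,n)=1$. When this occurs, there is a short exact sequence $$1\to BS(m,n)\to\operatorname{Aut}(X_{m,n})\overset{\chi}{\to}\{\pm1\}\to 1,$$ where $\chi$ is the orientation character.
   Context: The complex $X_{m,n}$. For positive integers $m,n$ let $k=\gcd(m,n)$. Let $Z_{m,n}$ be the 2-complex with one vertex, 1-cells $a,t_0,\dots,t_{k-1}$, and $k$ 2-cells attached along the words $t_i a^{m/k}t_{i+1}^{-1}a^{-n/k}$ (indices modulo $k$). Its fundamental group is $BS(m,n)=\langle a,t\mid ta^mt^{-1}=a^n\rangle$ (with $t=t_0$). $X_{m,n}$ is the universal cover of $Z_{m,n}$ with the induced cell structure. The group $BS(m,n)$ acts freely and cocompactly on $X_{m,n}$ by deck transformations, and in this way is regarded as a subgroup of $\operatorname{Aut}(X_{m,n})$. Automorphism group. For a CW complex $X$, $\operatorname{Aut}(X)$ is the group of cell-structure-preserving homeomorphisms modulo those inducing the identity permutation on the set of cells, with the topology generated by the sets $\{f\mid f(\sigma)=\tau\}$ for cells $\sigma,\tau$. Orientation character. The lifts of the 1-cell $a$ are called horizontal; the connected components of the union of horizontal 1-cells are lines, called branching lines. $X_{m,n}$ is homeomorphic to $T\times\mathbb{R}$, where $T$ is the Bass–Serre tree of $BS(m,n)$, the branching lines being the lines over the vertices of $T$; orient all branching lines consistently. Every $g\in\operatorname{Aut}(X_{m,n})$ either preserves the orientations of all branching lines ($\chi(g)=1$) or reverses all of them ($\chi(g)=-1$);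 this defines the homomorphism $\chi\colon\operatorname{Aut}(X_{m,n})\to\{\pm1\}$. (This definition of $\chi$ is given for complexes other than $X_{1,1}$; $X_{1,1}$ is the Euclidean plane tiled by unit squares, whose automorphisms need not preserve the branching lines.)
   Formalization: The short exact sequence is asserted only for (m,n) ≠ (1,1): for the square tiling X_{1,1} the character χ is undefined and BS(1,1) has index 8 in Aut(X_{1,1}), so the sequence fails; the discreteness claim still covers (1,1). *)

theory Defs
  imports "HOL-Analysis.Analysis" "HOL-Algebra.Bij" "HOL-Algebra.Sym_Groups"
begin

section \<open>Groups given by generators and relators\<close>

text \<open>A word is a list of signed letters: \<open>(g, True)\<close> stands for \<open>g\<close> and \<open>(g, False)\<close> for the
  inverse of \<open>g\<close>. All elements of the letter type are generators.\<close>

type_synonym 'g word = "('g \<times> bool) list"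

inductive pres_eq :: "'g word set \<Rightarrow> 'g word \<Rightarrow> 'g word \<Rightarrow> bool" for R where
  refl: "pres_eq R u u"
| sym: "pres_eq R u v \<Longrightarrow> pres_eq R v u"
| trans: "pres_eq R u v \<Longrightarrow> pres_eq R v w \<Longrightarrow> pres_eq R u w"
| cancel: "pres_eq R (u @ [(g, b), (g, \<not> b)] @ v) (u @ v)"
| relator: "r \<in> R \<Longrightarrow> pres_eq R (u @ r @ v) (u @ v)"

definition word_class :: "'g word set \<Rightarrow> 'g word \<Rightarrow> 'g word set" where
  "word_class R u = {v. pres_eq R u v}"

definition presented_group :: "'g word set \<Rightarrow> 'g word set monoid" where
  "presented_group R =
    \<lparr>carrier = range (word_class R),
     mult = (\<lambda>C D. \<Union>u\<in>C. \<Union>v\<in>D. word_class R (u @ v)),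
     one = word_class R []\<rparr>"

datatype bs_gen = Gen_a | Gen_t

definition bs_relators :: "nat \<Rightarrow> nat \<Rightarrow> bs_gen word set" where
  "bs_relators m n =
    {[(Gen_t, True)] @ replicate m (Gen_a, True) @ [(Gen_t, False)] @ replicate n (Gen_a, False)}"

definition BS :: "nat \<Rightarrow> nat \<Rightarrow> bs_gen word set monoid" where
  "BS m n = presented_group (bs_relators m n)"

definition bs_elem :: "nat \<Rightarrow> nat \<Rightarrow> bs_gen \<Rightarrow> bs_gen word set" where
  "bs_elem m n g = word_class (bs_relators m n) [(g, True)]"


section \<open>2-complexes with one vertex\<close>

datatype ('e, 'f) cell_index = Vertex | Edge 'e | Face 'f

text \<open>Characteristic maps of edges are defined on the unit interval, those of faces on the closed
  unit disc of the complex plane.\<close>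

fun open_cell ::
  "'z \<Rightarrow> ('e \<Rightarrow> real \<Rightarrow> 'z) \<Rightarrow> ('f \<Rightarrow> complex \<Rightarrow> 'z) \<Rightarrow> ('e, 'f) cell_index \<Rightarrow> 'z set" where
  "open_cell v \<phi> \<psi> Vertex = {v}"
| "open_cell v \<phi> \<psi> (Edge e) = \<phi> e ` {0<..<1}"
| "open_cell v \<phi> \<psi> (Face f) = \<psi> f ` ball 0 1"

definition cell_indices :: "'e set \<Rightarrow> 'f set \<Rightarrow> ('e, 'f) cell_index set" where
  "cell_indices E F = {Vertex} \<union> Edge ` E \<union> Face ` F"

definition letter_path :: "('e \<Rightarrow> real \<Rightarrow> 'z) \<Rightarrow> 'e \<times> bool \<Rightarrow> real \<Rightarrow> 'z" where
  "letter_path \<phi> l s = (if snd l then \<phi> (fst l) s else \<phi> (fst l) (1 - s))"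

text \<open>The face \<open>f\<close> is attached along the word \<open>w f\<close>: the unit circle is divided into
  \<open>length (w f)\<close> equal arcs, and the \<open>j\<close>-th arc traverses the edge named by the \<open>j\<close>-th letter, in
  the direction given by its sign. The last conjunct says that \<open>Z\<close> carries the weak topology.\<close>

definition one_vertex_complex ::
  "'z::topological_space set \<Rightarrow> 'z \<Rightarrow> ('e \<Rightarrow> real \<Rightarrow> 'z) \<Rightarrow> ('f \<Rightarrow> complex \<Rightarrow> 'z)
    \<Rightarrow> 'e set \<Rightarrow> 'f set \<Rightarrow> ('f \<Rightarrow> 'e word) \<Rightarrow> bool" where
  "one_vertex_complex Z v \<phi> \<psi> E F w \<longleftrightarrow>
     (\<forall>e\<in>E. continuous_on {0..1} (\<phi> e) \<and> inj_on (\<phi> e) {0<..<1} \<and> \<phi> e 0 = v \<and> \<phi> e 1 = v) \<and>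
     (\<forall>f\<in>F. continuous_on (cball 0 1) (\<psi> f) \<and> inj_on (\<psi> f) (ball 0 1) \<and>
        (\<forall>j<length (w f). \<forall>s\<in>{0..1}.
           \<psi> f (cis (2 * pi * (real j + s) / real (length (w f)))) = letter_path \<phi> (w f ! j) s)) \<and>
     disjoint_family_on (open_cell v \<phi> \<psi>) (cell_indices E F) \<and>
     (\<Union>c\<in>cell_indices E F. open_cell v \<phi> \<psi> c) = Z \<and>
     (\<forall>A\<subseteq>Z. closedin (top_of_set Z) A \<longleftrightarrow>
        (\<forall>e\<in>E. closed {s\<in>{0..1}. \<phi> e s \<in> A}) \<and> (\<forall>f\<in>F. closed {y\<in>cball 0 1. \<psi> f y \<in> A}))"


section \<open>The complex $Z_{m,n}$ and its universal cover\<close>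

datatype z_edge = Edge_a | Edge_t nat

definition z_edges :: "nat \<Rightarrow> nat \<Rightarrow> z_edge set" where
  "z_edges m n = {Edge_a} \<union> Edge_t ` {..<gcd m n}"

definition z_word :: "nat \<Rightarrow> nat \<Rightarrow> nat \<Rightarrow> z_edge word" where
  "z_word m n i =
    [(Edge_t i, True)] @ replicate (m div gcd m n) (Edge_a, True) @
    [(Edge_t ((i + 1) mod gcd m n), False)] @ replicate (n div gcd m n) (Edge_a, False)"

definition is_Z ::
  "nat \<Rightarrow> nat \<Rightarrow> 'z::topological_space set \<Rightarrow> 'z \<Rightarrow> (z_edge \<Rightarrow> real \<Rightarrow> 'z) \<Rightarrow> (nat \<Rightarrow> complex \<Rightarrow> 'z)
    \<Rightarrow> bool" where
  "is_Z m n Z v \<phi> \<psi> \<longleftrightarrow> one_vertex_complex Z v \<phi> \<psi> (z_edges m n) {..<gcd m n} (z_word m n)"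

definition z_cells ::
  "nat \<Rightarrow> nat \<Rightarrow> 'z \<Rightarrow> (z_edge \<Rightarrow> real \<Rightarrow> 'z) \<Rightarrow> (nat \<Rightarrow> complex \<Rightarrow> 'z) \<Rightarrow> 'z set set" where
  "z_cells m n v \<phi> \<psi> = open_cell v \<phi> \<psi> ` cell_indices (z_edges m n) {..<gcd m n}"

definition universal_cover ::
  "'x::topological_space set \<Rightarrow> ('x \<Rightarrow> 'z::topological_space) \<Rightarrow> 'z set \<Rightarrow> bool" where
  "universal_cover X p Z \<longleftrightarrow> covering_space X p Z \<and> simply_connected X"

text \<open>The induced cell structure on a cover: its open cells are the connected components of the
  preimages of the open cells of the base.\<close>

definition lifted_cells ::
  "'x::topological_space set \<Rightarrow> ('x \<Rightarrow> 'z) \<Rightarrow> 'z set set \<Rightarrow> 'x set set" where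
  "lifted_cells X p K = (\<Union>e\<in>K. components (X \<inter> p -` e))"


section \<open>The automorphism group of a cell complex\<close>

text \<open>A cell complex is given by its underlying space \<open>X\<close> and its set \<open>C\<close> of open cells.\<close>

definition cell_homeos ::
  "'x::topological_space set \<Rightarrow> 'x set set \<Rightarrow> ('x \<Rightarrow> 'x) monoid" where
  "cell_homeos X C =
    BijGroup X \<lparr>carrier := {f \<in> Bij X. (\<exists>g. homeomorphism X X f g) \<and> (\<lambda>\<sigma>. f ` \<sigma>) ` C = C}\<rparr>"

definition cell_trivial :: "'x::topological_space set \<Rightarrow> 'x set set \<Rightarrow> ('x \<Rightarrow> 'x) set" where
  "cell_trivial X C = {f \<in> carrier (cell_homeos X C). \<forall>\<sigma>\<in>C. f ` \<sigma> = \<sigma>}"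

definition Aut :: "'x::topological_space set \<Rightarrow> 'x set set \<Rightarrow> ('x \<Rightarrow> 'x) set monoid" where
  "Aut X C = cell_homeos X C Mod cell_trivial X C"

definition aut_class ::
  "'x::topological_space set \<Rightarrow> 'x set set \<Rightarrow> ('x \<Rightarrow> 'x) \<Rightarrow> ('x \<Rightarrow> 'x) set" where
  "aut_class X C f = cell_trivial X C #>\<^bsub>cell_homeos X C\<^esub> f"

text \<open>Elements of the automorphism group are classes of homeomorphisms, all of whose members
  induce the same permutation of the cells.\<close>

definition aut_topology ::
  "'x::topological_space set \<Rightarrow> 'x set set \<Rightarrow> ('x \<Rightarrow> 'x) set topology" where
  "aut_topology X C =
    topology_generated_by
      {{\<alpha> \<in> carrier (Aut X C). \<forall>f\<in>\<alpha>. f ` \<sigma> = \<tau>} | \<sigma> \<tau>. \<sigma> \<in> C \<and> \<tau> \<in> C}"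

definition aut_discrete :: "'x::topological_space set \<Rightarrow> 'x set set \<Rightarrow> bool" where
  "aut_discrete X C \<longleftrightarrow> aut_topology X C = discrete_topology (carrier (Aut X C))"


section \<open>The orientation character\<close>

text \<open>Here \<open>a\<close> is the characteristic map of the 1-cell $a$, and \<open>p\<close> the covering map.\<close>

definition branching_lines ::
  "'x::topological_space set \<Rightarrow> ('x \<Rightarrow> 'z) \<Rightarrow> (real \<Rightarrow> 'z) \<Rightarrow> 'x set set" where
  "branching_lines X p a = components (X \<inter> p -` (a ` {0..1}))"

text \<open>The consistent orientation of the branching lines is the one in which every lift of the
  1-cell $a$ is traversed in the direction of \<open>a\<close>. On a branching line \<open>L\<close> it is represented by
  the homeomorphisms from the real line that lift the map wrapping the real line around $a$.\<close>

definition line_param ::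
  "('x::topological_space \<Rightarrow> 'z) \<Rightarrow> (real \<Rightarrow> 'z) \<Rightarrow> 'x set \<Rightarrow> (real \<Rightarrow> 'x) \<Rightarrow> bool" where
  "line_param p a L h \<longleftrightarrow> (\<exists>h'. homeomorphism UNIV L h h') \<and> (\<forall>s. p (h s) = a (frac s))"

definition preserves_orientation ::
  "('x::topological_space \<Rightarrow> 'z) \<Rightarrow> (real \<Rightarrow> 'z) \<Rightarrow> ('x \<Rightarrow> 'x) \<Rightarrow> 'x set \<Rightarrow> bool" where
  "preserves_orientation p a f L \<longleftrightarrow>
     (\<exists>h h' u. line_param p a L h \<and> line_param p a (f ` L) h' \<and>
        (\<forall>s. f (h s) = h' (u s)) \<and> (\<forall>s t. s < t \<longrightarrow> (u s :: real) < u t))"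

definition reverses_orientation ::
  "('x::topological_space \<Rightarrow> 'z) \<Rightarrow> (real \<Rightarrow> 'z) \<Rightarrow> ('x \<Rightarrow> 'x) \<Rightarrow> 'x set \<Rightarrow> bool" where
  "reverses_orientation p a f L \<longleftrightarrow>
     (\<exists>h h' u. line_param p a L h \<and> line_param p a (f ` L) h' \<and>
        (\<forall>s. f (h s) = h' (u s)) \<and> (\<forall>s t. s < t \<longrightarrow> (u t :: real) < u s))"

text \<open>The value 0 is a dummy for the case that an automorphism neither preserves all orientations
  nor reverses all of them; it is not an element of \<open>sign_img\<close>.\<close>

definition orientation_character ::
  "'x::topological_space set \<Rightarrow> ('x \<Rightarrow> 'z) \<Rightarrow> (real \<Rightarrow> 'z) \<Rightarrow> ('x \<Rightarrow> 'x) set \<Rightarrow> int" where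
  "orientation_character X p a \<alpha> =
     (if \<forall>f\<in>\<alpha>. \<forall>L\<in>branching_lines X p a. preserves_orientation p a f L then 1
      else if \<forall>f\<in>\<alpha>. \<forall>L\<in>branching_lines X p a. reverses_orientation p a f L then - 1
      else 0)"


section \<open>The action of $BS(m,n)$ by deck transformations\<close>

definition deck_transformations ::
  "'x::topological_space set \<Rightarrow> ('x \<Rightarrow> 'z) \<Rightarrow> ('x \<Rightarrow> 'x) set" where
  "deck_transformations X p =
     {f \<in> Bij X. (\<exists>g. homeomorphism X X f g) \<and> (\<forall>x\<in>X. p (f x) = p x)}"

definition deck_along ::
  "'x::topological_space set \<Rightarrow> ('x \<Rightarrow> 'z) \<Rightarrow> 'x \<Rightarrow> (real \<Rightarrow> 'z) \<Rightarrow> ('x \<Rightarrow> 'x) \<Rightarrow> bool" where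
  "deck_along X p x0 \<gamma> f \<longleftrightarrow> f \<in> deck_transformations X p \<and>
     (\<exists>c. path c \<and> path_image c \<subseteq> X \<and> pathstart c = x0 \<and> pathfinish c = f x0 \<and>
          (\<forall>s\<in>{0..1}. p (c s) = \<gamma> s))"

text \<open>The usual identification of the fundamental group of the base with the group of deck
  transformations, relative to the base point \<open>x0\<close> of the cover: the class of a loop \<open>\<gamma>\<close> acts by
  the deck transformation taking \<open>x0\<close> to the end of the lift of \<open>\<gamma>\<close> at \<open>x0\<close>. The generators $a$
  and $t$ of $BS(m,n)$ are the loops $a$ and $t_0$.\<close>

definition bs_deck_action ::
  "nat \<Rightarrow> nat \<Rightarrow> 'x::topological_space set \<Rightarrow> 'x set set \<Rightarrow> ('x \<Rightarrow> 'z) \<Rightarrow> (z_edge \<Rightarrow> real \<Rightarrow> 'z) \<Rightarrow> 'x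
    \<Rightarrow> (bs_gen word set \<Rightarrow> ('x \<Rightarrow> 'x) set) \<Rightarrow> bool" where
  "bs_deck_action m n X C p \<phi> x0 \<iota> \<longleftrightarrow>
     \<iota> \<in> hom (BS m n) (Aut X C) \<and>
     (\<forall>g\<in>carrier (BS m n). \<exists>f\<in>deck_transformations X p. \<iota> g = aut_class X C f) \<and>
     (\<exists>f. deck_along X p x0 (\<phi> Edge_a) f \<and> \<iota> (bs_elem m n Gen_a) = aut_class X C f) \<and>
     (\<exists>f. deck_along X p x0 (\<phi> (Edge_t 0)) f \<and> \<iota> (bs_elem m n Gen_t) = aut_class X C f)"


section \<open>Short exact sequences\<close>

text \<open>The library's \<open>short_exact_sequence\<close> requires all groups to have the same element type.\<close>

definition short_exact ::
  "('g, 'i) monoid_scheme \<Rightarrow> ('g \<Rightarrow> 'h) \<Rightarrow> ('h, 'j) monoid_scheme \<Rightarrow> ('h \<Rightarrow> 'k) \<Rightarrow>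
    ('k, 'l) monoid_scheme \<Rightarrow> bool" where
  "short_exact A f B g C \<longleftrightarrow>
     group A \<and> group B \<and> group C \<and> f \<in> mon A B \<and> g \<in> epi B C \<and> f ` carrier A = kernel B C g"

end

theory Submission
  imports Defs
begin

text \<open>Maps from cells, and from \<open>X\<close> itself, lift through the covering, so \<open>X\<close> carries the weak
  topology of the lifted cells, and everything can be described by the lifted 1-skeleton, a graph on
  the fibre of the vertex. Vertices are told apart by labellings: a family of permutations, one for
  each edge of the base, such that the attaching words act trivially is the monodromy of a covering
  of the base, which is trivial over the simply connected \<open>X\<close>.

  Let \<open>k = gcd m n\<close>. If \<open>k \<ge> 2\<close>, then rotating the edges \<open>t_i\<close> and the faces that start at one fixed
  height yields automorphisms that fix everything below that height, so the group is not discrete.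
  If \<open>k = 1\<close> and \<open>m \<noteq> n\<close>, then \<open>a\<close>-edges and \<open>t\<close>-edges differ in the number of faces they lie on, and
  the lengths \<open>m\<close> and \<open>n\<close> of the two horizontal sides of a face force every automorphism to commute
  with the \<open>t\<close>-edges and to multiply all horizontal translations by one sign. Automorphisms of sign 1
  agree with deck transformations, and reflecting the faces gives one of sign -1. For \<open>m = n = 1\<close> an
  automorphism fixing a vertex and its neighbours is trivial.\<close>

section \<open>Lifting through coverings of general topological spaces\<close>

text \<open>The spaces are bare topological spaces without separation axioms; where uniqueness of
  lifts would use such an axiom, the sheets of the covering separate the points of a fibre.
  \<open>X\<close> is given only by its covering property, so at the outset nothing is known of its
  shape, not even that two walks end at different vertices. This knowledge comes from three
  labellings: integer heights, affine maps, and the elements of BS(m,n) under right multiplication.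
  The last one yields injectivity of the action. Automorphisms are found by lifting maps from
  \<open>X\<close> to \<open>Z\<close> other than \<open>p\<close>: the composite of
  \<open>p\<close> with a reflection of \<open>Z\<close> for sign -1, and a rotation of indices
  restricted to one height if the gcd is at least 2. The restriction is consistent because all
  \<open>t\<close>-edges of a face start at the height of its base. Given automorphisms are analysed
  through closures of cells. Closures are topological, so incidence is preserved, and counting
  incident cells or comparing side lengths constrains the automorphism. For \<open>m = n = 1\<close>
  both invariants are lost, since \<open>a\<close> and \<open>t\<close> become interchangeable; the
  grid structure replaces them.\<close>

lemma covering_space_sheets:
  assumes "covering_space C p S" "y \<in> S"
  obtains D where "open D" "y \<in> D"
    "\<And>b. b \<in> C \<Longrightarrow> p b \<in> D \<Longrightarrow> \<exists>W q. open W \<and> b \<in> W \<and> homeomorphism (C \<inter> W) (S \<inter> D) p q"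
    "\<And>b c. b \<in> C \<Longrightarrow> c \<in> C \<Longrightarrow> p b = p c \<Longrightarrow> p b \<in> D \<Longrightarrow> b \<noteq> c \<Longrightarrow>
       \<exists>V W. open V \<and> open W \<and> b \<in> V \<and> c \<in> W \<and> C \<inter> V \<inter> W = {}"
proof -
  obtain T v where T: "y \<in> T" "openin (top_of_set S) T" "\<Union>v = C \<inter> p -` T"
    "\<forall>u \<in> v. openin (top_of_set C) u" "pairwise disjnt v" "\<forall>u \<in> v. \<exists>q. homeomorphism u T p q"
    using assms unfolding covering_space_def by (elim conjE) (drule bspec, assumption, elim exE conjE, blast)
  obtain D where D: "open D" "T = S \<inter> D" using T(2) by (auto simp: openin_open)
  have pS: "p b \<in> S" if "b \<in> C" for b using covering_space_imp_surjective[OF assms(1)] that by auto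
  have sheet: "\<exists>u\<in>v. \<exists>W. b \<in> u \<and> open W \<and> u = C \<inter> W" if "b \<in> C" "p b \<in> D" for b
  proof -
    have "b \<in> \<Union>v" using T(3) D pS that by auto
    then obtain u where u: "u \<in> v" "b \<in> u" by blast
    with T(4) show ?thesis by (auto simp: openin_open)
  qed
  show ?thesis
  proof
    show "open D" "y \<in> D" using D T(1) by auto
    show "\<exists>W q. open W \<and> b \<in> W \<and> homeomorphism (C \<inter> W) (S \<inter> D) p q" if b: "b \<in> C" "p b \<in> D" for b
    proof -
      obtain u W where u: "u \<in> v" "b \<in> u" "open W" "u = C \<inter> W" using sheet[OF b] by blast
      then obtain q where "homeomorphism u T p q" using T(6) by blast
      with u D show ?thesis by (intro exI[of _ W] exI[of _ q]) auto
    qed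
    \<comment> \<open>Two points of one fibre lie in different sheets, and sheets are disjoint. This
      separation stands in for a Hausdorff property of \<open>C\<close>.\<close>
    show "\<exists>V W. open V \<and> open W \<and> b \<in> V \<and> c \<in> W \<and> C \<inter> V \<inter> W = {}"
      if b: "b \<in> C" "c \<in> C" "p b = p c" "p b \<in> D" "b \<noteq> c" for b c
    proof -
      obtain u W where u: "u \<in> v" "b \<in> u" "open W" "u = C \<inter> W" using sheet[OF b(1,4)] by blast
      have "p c \<in> D" using b by simp
      then obtain u' W' where u': "u' \<in> v" "c \<in> u'" "open W'" "u' = C \<inter> W'" using sheet[OF b(2)] by blast
      obtain q where "homeomorphism u T p q" using T(6) u by blast
      then have "c \<notin> u" using b u(2) unfolding homeomorphism_def by metis
      then have "u \<noteq> u'" using u' by auto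
      then have "u \<inter> u' = {}" using pairwiseD[OF T(5) u(1) u'(1)] by (auto simp: disjnt_def)
      then have "C \<inter> W \<inter> W' = {}" using u(4) u'(4) by blast
      then show ?thesis using u u' by (intro exI[of _ W] exI[of _ W']) auto
    qed
  qed
qed

text \<open>The truth value of \<open>g x = h x\<close> is locally constant. Where the lifts agree
  they keep agreeing because \<open>p\<close> is injective on a sheet; where they differ they keep
  differing because two points of one fibre have neighbourhoods that are disjoint inside
  \<open>C\<close>.\<close>

lemma covering_lift_unique:
  fixes g h :: "'b::topological_space \<Rightarrow> 'a::topological_space" and p :: "'a \<Rightarrow> 'c::topological_space"
  assumes cov: "covering_space C p S" and T: "connected T"
    and g: "continuous_on T g" "g ` T \<subseteq> C" and h: "continuous_on T h" "h ` T \<subseteq> C"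
    and eq: "\<And>x. x \<in> T \<Longrightarrow> p (g x) = p (h x)" and a: "a \<in> T" "g a = h a" and x: "x \<in> T"
  shows "g x = h x"
proof -
  have "(g a = h a) = (g x = h x)"
  proof (rule connected_local_const[OF T a(1) x, of "\<lambda>x. g x = h x"], intro ballI)
    fix a assume a: "a \<in> T"
    have "p (g a) \<in> S" using covering_space_imp_surjective[OF cov] g(2) a by auto
    then obtain D where D: "open D" "p (g a) \<in> D"
    "\<And>b. b \<in> C \<Longrightarrow> p b \<in> D \<Longrightarrow> \<exists>W q. open W \<and> b \<in> W \<and> homeomorphism (C \<inter> W) (S \<inter> D) p q"
    "\<And>b c. b \<in> C \<Longrightarrow> c \<in> C \<Longrightarrow> p b = p c \<Longrightarrow> p b \<in> D \<Longrightarrow> b \<noteq> c \<Longrightarrow>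
       \<exists>V W. open V \<and> open W \<and> b \<in> V \<and> c \<in> W \<and> C \<inter> V \<inter> W = {}"
      by (rule covering_space_sheets[OF cov]) (rule that)
    have ev: "\<forall>\<^sub>F x in at a within T. f x \<in> W" if "continuous_on T f" "open W" "f a \<in> W"
      for W and f :: "'b \<Rightarrow> 'a"
      using that a unfolding continuous_on_def tendsto_def by blast
    have inT: "\<forall>\<^sub>F x in at a within T. x \<in> T" by (simp add: eventually_at_filter)
    show "\<forall>\<^sub>F b in at a within T. (g a = h a) = (g b = h b)"
    proof (cases "g a = h a")
      case True
      have gaC: "g a \<in> C" using g a by blast
      from D(3)[OF gaC D(2)] obtain W q where W: "open W" "g a \<in> W" "homeomorphism (C \<inter> W) (S \<inter> D) p q"
        by blast
      have inj: "inj_on p (C \<inter> W)" using W(3) unfolding homeomorphism_def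
        by (intro inj_on_inverseI[of _ q]) auto
      then have *: "g b = h b" if "b \<in> T" "g b \<in> W" "h b \<in> W" for b
        using that g(2) h(2) eq[OF that(1)] by (intro inj_onD[OF inj]) auto
      show ?thesis
        using inT ev[OF g(1) W(1,2)] ev[OF h(1) W(1) W(2)[unfolded True]]
        by eventually_elim (use * True in auto)
    next
      case False
      have gaC: "g a \<in> C" "h a \<in> C" using g h a by blast+
      from D(4)[OF this eq[OF a] D(2) False] obtain V W where W: "open V" "open W" "g a \<in> V" "h a \<in> W" "C \<inter> V \<inter> W = {}"
        by blast
      have *: "g b \<noteq> h b" if "b \<in> T" "g b \<in> V" "h b \<in> W" for b
        using that g(2) W(5) by (metis IntI empty_iff image_subset_iff)
      show ?thesis
        using inT ev[OF g(1) W(1,3)] ev[OF h(1) W(2,4)]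
        by eventually_elim (use * False in auto)
    qed
  qed
  then show ?thesis using a by simp
qed

text \<open>Every point above \<open>f a\<close>, for every \<open>a\<close>, may be prescribed, so
  that lifts over pieces can be continued from any common point.\<close>

definition liftable :: "'b::topological_space set \<Rightarrow> ('b \<Rightarrow> 'c) \<Rightarrow> ('a::topological_space \<Rightarrow> 'c) \<Rightarrow> 'a set \<Rightarrow> bool" where
  "liftable C p f T \<longleftrightarrow> (\<forall>a\<in>T. \<forall>b\<in>C. p b = f a \<longrightarrow>
     (\<exists>g. continuous_on T g \<and> g ` T \<subseteq> C \<and> g a = b \<and> (\<forall>x\<in>T. p (g x) = f x)))"

lemma liftableE:
  assumes "liftable C p f T" "a \<in> T" "b \<in> C" "p b = f a"
  obtains g where "continuous_on T g" "g ` T \<subseteq> C" "g a = b" "\<And>x. x \<in> T \<Longrightarrow> p (g x) = f x"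
proof -
  from assms(1)[unfolded liftable_def, rule_format, OF assms(2-4)] that show ?thesis by auto
qed

text \<open>The lift over \<open>A\<close> prescribes the value at one point of the overlap for a
  lift over \<open>B\<close>. By uniqueness the two agree on the whole overlap, which is why it has
  to be connected.\<close>

lemma liftable_Un_aux:
  assumes cov: "covering_space C p S"
    and cl: "closedin (top_of_set (A \<union> B)) A" "closedin (top_of_set (A \<union> B)) B"
    and AB: "connected (A \<inter> B)" "A \<inter> B \<noteq> {}"
    and lA: "liftable C p f A" and lB: "liftable C p f B"
    and a: "a \<in> A" "b \<in> C" "p b = f a"
  shows "\<exists>g. continuous_on (A \<union> B) g \<and> g ` (A \<union> B) \<subseteq> C \<and> g a = b \<and> (\<forall>x\<in>A \<union> B. p (g x) = f x)"
proof -
  obtain g where g: "continuous_on A g" "g ` A \<subseteq> C" "g a = b" "\<And>x. x \<in> A \<Longrightarrow> p (g x) = f x"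
    using liftableE[OF lA a] by metis
  obtain c where c: "c \<in> A" "c \<in> B" using AB(2) by blast
  have "g c \<in> C" using g c by blast
  from liftableE[OF lB c(2) this] obtain h where
    h: "continuous_on B h" "h ` B \<subseteq> C" "h c = g c" "\<And>x. x \<in> B \<Longrightarrow> p (h x) = f x"
    using g(4) c by metis
  have gh: "g x = h x" if "x \<in> A \<inter> B" for x
  proof (rule covering_lift_unique[OF cov AB(1), where a = c])
    show "continuous_on (A \<inter> B) g" "continuous_on (A \<inter> B) h"
      using g h by (auto intro: continuous_on_subset)
    show "g ` (A \<inter> B) \<subseteq> C" "h ` (A \<inter> B) \<subseteq> C" using g h by auto
  qed (use that c g h in auto)
  let ?k = "\<lambda>x. if x \<in> A then g x else h x"
  have "continuous_on (A \<union> B) ?k"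
    by (rule continuous_on_cases_local[OF cl g(1) h(1)]) (use gh in auto)
  then show ?thesis using g h a by (intro exI[of _ ?k]) auto
qed

lemma liftable_Un:
  assumes cov: "covering_space C p S"
    and cl: "closedin (top_of_set (A \<union> B)) A" "closedin (top_of_set (A \<union> B)) B"
    and AB: "connected (A \<inter> B)" "A \<inter> B \<noteq> {}"
    and lA: "liftable C p f A" and lB: "liftable C p f B"
  shows "liftable C p f (A \<union> B)"
  unfolding liftable_def
proof (intro ballI impI)
  fix a b assume a: "a \<in> A \<union> B" "b \<in> C" "p b = f a"
  show "\<exists>g. continuous_on (A \<union> B) g \<and> g ` (A \<union> B) \<subseteq> C \<and> g a = b \<and> (\<forall>x\<in>A \<union> B. p (g x) = f x)"
  proof (cases "a \<in> A")
    case True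
    show ?thesis by (rule liftable_Un_aux[OF cov cl AB lA lB True a(2,3)])
  next
    case False
    then have "a \<in> B" using a by auto
    from liftable_Un_aux[OF cov cl(2,1)[unfolded Un_commute[of A]] AB[unfolded Int_commute[of A]] lB lA this]
    show ?thesis using a by (simp add: Un_commute)
  qed
qed

text \<open>Near \<open>x\<close> the map takes values in an evenly covered set and is composed with
  a local inverse of \<open>p\<close>. The neighbourhood serves all subsets of \<open>T\<close>
  inside it, because the rectangles placed in it later are not known in advance.\<close>

lemma liftable_local:
  assumes cov: "covering_space C p S" and f: "continuous_on T f" "f ` T \<subseteq> S" and x: "x \<in> T"
  obtains N where "open N" "x \<in> N" "\<And>T'. T' \<subseteq> T \<inter> N \<Longrightarrow> liftable C p f T'"
proof -
  have fx: "f x \<in> S" using f x by auto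
  obtain D where D: "open D" "f x \<in> D"
    "\<And>b. b \<in> C \<Longrightarrow> p b \<in> D \<Longrightarrow> \<exists>W q. open W \<and> b \<in> W \<and> homeomorphism (C \<inter> W) (S \<inter> D) p q"
    using fx by (rule covering_space_sheets[OF cov]) (rule that)
  obtain N where N: "open N" "N \<inter> T = f -` D \<inter> T"
    using f(1) D(1) by (auto simp: continuous_on_open_invariant)
  show ?thesis
  proof
    show "open N" "x \<in> N" using N x D by auto
    show "liftable C p f T'" if T': "T' \<subseteq> T \<inter> N" for T'
      unfolding liftable_def
    proof (intro ballI impI)
      fix a b assume a: "a \<in> T'" "b \<in> C" "p b = f a"
      have fT': "f ` T' \<subseteq> S \<inter> D" using T' N f(2) by blast
      have "p b \<in> D" using a fT' by auto
      from D(3)[OF a(2) this] obtain W q where W: "open W" "b \<in> W" "homeomorphism (C \<inter> W) (S \<inter> D) p q"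
        by blast
      have "continuous_on (f ` T') q"
        using W(3) fT' unfolding homeomorphism_def by (meson continuous_on_subset)
      then have "continuous_on T' (q \<circ> f)"
        using T' f(1) by (intro continuous_on_compose) (auto intro: continuous_on_subset)
      moreover have "(q \<circ> f) ` T' \<subseteq> C"
        using W(3) fT' unfolding homeomorphism_def by (auto simp: image_subset_iff)
      moreover have "q (p b) = b" using W a(2) unfolding homeomorphism_def by auto
      then have "(q \<circ> f) a = b" using a(3) by simp
      moreover have "\<forall>x\<in>T'. p ((q \<circ> f) x) = f x"
        using W(3) fT' unfolding homeomorphism_def by (auto simp: image_subset_iff)
      ultimately show "\<exists>g. continuous_on T' g \<and> g ` T' \<subseteq> C \<and> g a = b \<and> (\<forall>x\<in>T'. p (g x) = f x)"
        by blast
    qed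
  qed
qed

text \<open>Bisection in both coordinates. Small rectangles over one abscissa are stacked
  vertically, the admissible width shrinking at each union; the resulting strips are then put side
  by side.\<close>

lemma liftable_rectangle:
  fixes f :: "real \<times> real \<Rightarrow> 'c::topological_space"
  assumes cov: "covering_space C p S" and f: "continuous_on UNIV f" "range f \<subseteq> S"
    and ab: "a \<le> b" and cd: "c \<le> d"
  shows "liftable C p f ({a..b} \<times> {c..d})"
proof -
  have loc: "\<exists>e>0. \<forall>T. T \<subseteq> {x - e<..<x + e} \<times> {y - e<..<y + e} \<longrightarrow> liftable C p f T" for x y
  proof -
    obtain N where N: "open N" "(x, y) \<in> N" "\<And>T. T \<subseteq> N \<Longrightarrow> liftable C p f T"
      using liftable_local[OF cov f, of "(x,y)"] by auto
    obtain A B where AB: "open A" "open B" "x \<in> A" "y \<in> B" "A \<times> B \<subseteq> N"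
      using N(1,2) by (metis open_prod_elim mem_Times_iff fst_conv snd_conv)
    obtain e1 where e1: "e1 > 0" "ball x e1 \<subseteq> A" using AB by (meson openE)
    obtain e2 where e2: "e2 > 0" "ball y e2 \<subseteq> B" using AB by (meson openE)
    have "{x - min e1 e2<..<x + min e1 e2} \<times> {y - min e1 e2<..<y + min e1 e2} \<subseteq> N"
      using e1 e2 AB by (force simp: dist_real_def ball_def)
    then show ?thesis using e1 e2 N(3)
      by (intro exI[of _ "min e1 e2"]) auto
  qed
  define Q where "Q x c d \<longleftrightarrow> (\<exists>e>0. \<forall>a b. a \<le> x \<and> x \<le> b \<and> b - a < e \<longrightarrow> liftable C p f ({a..b} \<times> {c..d}))" for x c d
  have Q: "Q x c d" for x
    using cd
  proof (induction rule: Bolzano)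
    case (trans c d d')
    from trans(1) obtain e1 where e1: "e1 > 0"
       "\<And>a b. a \<le> x \<and> x \<le> b \<and> b - a < e1 \<Longrightarrow> liftable C p f ({a..b} \<times> {c..d})" unfolding Q_def by blast
    from trans(2) obtain e2 where e2: "e2 > 0"
       "\<And>a b. a \<le> x \<and> x \<le> b \<and> b - a < e2 \<Longrightarrow> liftable C p f ({a..b} \<times> {d..d'})" unfolding Q_def by blast
    show ?case unfolding Q_def
    proof (intro exI[of _ "min e1 e2"] conjI allI impI)
      fix a b assume ab: "a \<le> x \<and> x \<le> b \<and> b - a < min e1 e2"
      have eq: "{a..b} \<times> {c..d'} = {a..b} \<times> {c..d} \<union> {a..b} \<times> {d..d'}" using trans by auto
      have int: "{a..b} \<times> {c..d} \<inter> {a..b} \<times> {d..d'} = {a..b} \<times> {d}" using trans by auto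
      show "liftable C p f ({a..b} \<times> {c..d'})" unfolding eq
      proof (rule liftable_Un[OF cov])
        show "connected ({a..b} \<times> {c..d} \<inter> {a..b} \<times> {d..d'})" unfolding int
          by (intro connected_Times) auto
        show "{a..b} \<times> {c..d} \<inter> {a..b} \<times> {d..d'} \<noteq> {}" unfolding int using ab by auto
      qed (use ab e1 e2 in \<open>auto intro!: closed_subset closed_Times\<close>)
    qed (use e1 e2 in auto)
  next
    case (local y)
    obtain e where e: "e > 0" "\<And>T. T \<subseteq> {x - e<..<x + e} \<times> {y - e<..<y + e} \<Longrightarrow> liftable C p f T"
      using loc[of x y] by blast
    show ?case unfolding Q_def
      by (intro exI[of _ e] conjI e(1) allI impI e(2)) auto
  qed
  show ?thesis using ab
  proof (induction rule: Bolzano)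
    case (trans a b b')
    have eq: "{a..b'} \<times> {c..d} = {a..b} \<times> {c..d} \<union> {b..b'} \<times> {c..d}" using trans by auto
    have int: "{a..b} \<times> {c..d} \<inter> {b..b'} \<times> {c..d} = {b} \<times> {c..d}" using trans by auto
    show ?case unfolding eq
    proof (rule liftable_Un[OF cov])
      show "connected ({a..b} \<times> {c..d} \<inter> {b..b'} \<times> {c..d})" unfolding int
        by (intro connected_Times) auto
      show "{a..b} \<times> {c..d} \<inter> {b..b'} \<times> {c..d} \<noteq> {}" unfolding int using cd by auto
    qed (use trans in \<open>auto intro!: closed_subset closed_Times\<close>)
  next
    case (local x)
    show ?case using Q[of x] unfolding Q_def by blast
  qed
qed

text \<open>The nearest-point retraction onto \<open>K\<close> extends \<open>f\<close> to the whole
  plane without enlarging its image; the extension is lifted over a square around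
  \<open>K\<close>.\<close>

lemma liftable_convex_plane:
  fixes f :: "real \<times> real \<Rightarrow> 'c::topological_space"
  assumes cov: "covering_space C p S" and K: "compact K" "convex K"
    and f: "continuous_on K f" "f ` K \<subseteq> S"
  shows "liftable C p f K"
  unfolding liftable_def
proof (intro ballI impI)
  fix a b assume a: "a \<in> K" "b \<in> C" "p b = f a"
  let ?c = "closest_point K"
  have cK: "?c x \<in> K" for x using K a by (intro closest_point_in_set) (auto simp: compact_imp_closed)
  have cc: "continuous_on UNIV ?c" using K a by (intro continuous_on_closest_point) (auto simp: compact_imp_closed)
  have cid: "?c x = x" if "x \<in> K" for x using that by (rule closest_point_self)
  have cf: "continuous_on UNIV (f \<circ> ?c)"
    using cc f(1) cK by (intro continuous_on_compose) (auto intro: continuous_on_subset)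
  have rf: "range (f \<circ> ?c) \<subseteq> S" using cK f by auto
  obtain B where B: "\<And>x. x \<in> K \<Longrightarrow> norm x \<le> B" using K(1) compact_imp_bounded bounded_iff by metis
  have B0: "B \<ge> 0" using B[OF a(1)] norm_ge_zero order_trans by blast
  have KB: "K \<subseteq> {-B..B} \<times> {-B..B}"
  proof
    fix x assume x: "x \<in> K"
    have "\<bar>fst x\<bar> \<le> B" "\<bar>snd x\<bar> \<le> B"
      using B[OF x] norm_fst_le[of "fst x" "snd x"] norm_snd_le[of "snd x" "fst x"] by auto
    then show "x \<in> {-B..B} \<times> {-B..B}" by (auto simp: mem_Times_iff abs_le_iff)
  qed
  have L: "liftable C p (f \<circ> ?c) ({-B..B} \<times> {-B..B})"
    by (rule liftable_rectangle[OF cov cf rf]) (use B0 in auto)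
  have "a \<in> {-B..B} \<times> {-B..B}" "p b = (f \<circ> ?c) a" using KB a cid by auto
  then obtain g where g: "continuous_on ({-B..B} \<times> {-B..B}) g" "g ` ({-B..B} \<times> {-B..B}) \<subseteq> C" "g a = b"
    "\<And>x. x \<in> {-B..B} \<times> {-B..B} \<Longrightarrow> p (g x) = (f \<circ> ?c) x" by (rule liftableE[OF L _ a(2)]) (rule that)
  have "g ` K \<subseteq> C" using g(2) KB by (meson image_mono order_trans)
  moreover have "p (g x) = f x" if "x \<in> K" for x using g(4)[of x] that KB cid by auto
  ultimately show "\<exists>g. continuous_on K g \<and> g ` K \<subseteq> C \<and> g a = b \<and> (\<forall>x\<in>K. p (g x) = f x)"
    using g(1,3) KB by (intro exI[of _ g]) (auto intro: continuous_on_subset)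
qed

lemma liftable_convex_complex:
  fixes f :: "complex \<Rightarrow> 'c::topological_space"
  assumes cov: "covering_space C p S" and K: "compact K" "convex K"
    and f: "continuous_on K f" "f ` K \<subseteq> S"
  shows "liftable C p f K"
  unfolding liftable_def
proof (intro ballI impI)
  fix a b assume a: "a \<in> K" "b \<in> C" "p b = f a"
  let ?r = "\<lambda>u. (Re u, Im u)" and ?c = "\<lambda>x. Complex (fst x) (snd x)"
  have lin: "linear ?r" by (rule linearI) auto
  have cc: "continuous_on A ?c" for A
    unfolding Complex_eq by (intro continuous_intros)
  have cr: "continuous_on A ?r" for A by (intro continuous_intros)
  have ck: "?c ` ?r ` K = K" by (auto simp: image_image)
  have "liftable C p (f \<circ> ?c) (?r ` K)"
  proof (rule liftable_convex_plane[OF cov])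
    show "compact (?r ` K)" using K cr by (intro compact_continuous_image)
    show "convex (?r ` K)" using K lin by (intro convex_linear_image)
    show "continuous_on (?r ` K) (f \<circ> ?c)" using cc f ck by (intro continuous_on_compose) auto
    show "(f \<circ> ?c) ` ?r ` K \<subseteq> S" using f(2) by (auto simp: image_subset_iff)
  qed
  from liftableE[OF this, of "?r a" b] obtain g where g: "continuous_on (?r ` K) g" "g ` ?r ` K \<subseteq> C" "g (?r a) = b"
    "\<And>x. x \<in> ?r ` K \<Longrightarrow> p (g x) = (f \<circ> ?c) x" using a by auto
  have "continuous_on K (g \<circ> ?r)" by (intro continuous_on_compose cr g(1))
  then show "\<exists>g. continuous_on K g \<and> g ` K \<subseteq> C \<and> g a = b \<and> (\<forall>x\<in>K. p (g x) = f x)"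
    using g by (intro exI[of _ "g \<circ> ?r"]) (auto simp: image_subset_iff)
qed

text \<open>The interval is treated as the degenerate rectangle
  \<open>{0..1} \<times> {0}\<close>.\<close>

lemma liftable_path:
  fixes g :: "real \<Rightarrow> 'c::topological_space"
  assumes cov: "covering_space C p S" and f: "continuous_on {0..1} g" "g ` {0..1} \<subseteq> S"
  shows "liftable C p g {0..1}"
  unfolding liftable_def
proof (intro ballI impI)
  fix a b assume a: "a \<in> {0..1}" "b \<in> C" "p b = g a"
  have im: "fst ` ({0..1::real} \<times> {0::real}) = {0..1}" by force
  have cg: "continuous_on ({0..1} \<times> {0::real}) (g \<circ> fst)"
    using f(1) im by (intro continuous_on_compose continuous_intros) auto
  have "liftable C p (g \<circ> fst) ({0..1} \<times> {0::real})"
    by (rule liftable_convex_plane[OF cov _ _ cg])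
      (use f(2) in \<open>auto intro!: compact_Times convex_Times\<close>)
  from liftableE[OF this, of "(a,0)" b] obtain h where h: "continuous_on ({0..1} \<times> {0::real}) h" "h ` ({0..1} \<times> {0::real}) \<subseteq> C" "h (a,0) = b"
    "\<And>x. x \<in> {0..1} \<times> {0::real} \<Longrightarrow> p (h x) = (g \<circ> fst) x" using a by auto
  have "continuous_on {0..1} (h \<circ> (\<lambda>s. (s, 0::real)))"
    by (intro continuous_on_compose continuous_intros) (use h(1) in \<open>auto intro: continuous_on_subset\<close>)
  then show "\<exists>h. continuous_on {0..1} h \<and> h ` {0..1} \<subseteq> C \<and> h a = b \<and> (\<forall>x\<in>{0..1}. p (h x) = g x)"
    using h by (intro exI[of _ "h \<circ> (\<lambda>s. (s, 0::real))"]) (auto simp: image_subset_iff)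
qed

section \<open>Lifting over simply connected spaces\<close>

lemma simply_connected_lift_loop:
  fixes f :: "'a::topological_space \<Rightarrow> 'c::topological_space"
  assumes cov: "covering_space C p S" and U: "simply_connected U"
    and f: "continuous_on U f" "f ` U \<subseteq> S"
    and r: "path r" "path_image r \<subseteq> U" "pathfinish r = pathstart r"
    and h: "path h" "path_image h \<subseteq> C" "\<And>t. t \<in> {0..1} \<Longrightarrow> p (h t) = f (r t)"
  shows "h 1 = h 0"
proof -
  have r0U: "r 0 \<in> U" using r by (auto simp: path_image_def)
  have "path (\<lambda>t::real. r 0)" by (simp add: path_def)
  then have "homotopic_loops U r (\<lambda>t. r 0)"
    using U r r0U unfolding simply_connected_def
    by (auto simp: path_image_def pathfinish_def pathstart_def)
  then obtain H where H: "continuous_on ({0..1::real} \<times> {0..1::real}) H" "H \<in> {0..1} \<times> {0..1} \<rightarrow> U"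
    "\<forall>x\<in>{0..1}. H (0, x) = r x" "\<forall>x\<in>{0..1}. H (1, x) = r 0"
    "\<forall>t\<in>{0..1}. pathfinish (H \<circ> Pair t) = pathstart (H \<circ> Pair t)"
    unfolding homotopic_loops by (elim exE conjE) (rule that; assumption)
  define Q where "Q = {0..1::real} \<times> {0..1::real}"
  have HQ: "continuous_on Q H" "H ` Q \<subseteq> U" using H unfolding Q_def by auto
  \<comment> \<open>The contraction of \<open>r\<close> is lifted over the square. The lift is
    constant over the side on which \<open>H\<close> is constant. The two sides swept by the ends of
    the loops carry the same path of \<open>U\<close>, so their lifts agree, and the lift of
    \<open>r\<close> joins their other ends.\<close>
  have "liftable C p (f \<circ> H) Q"
  proof (rule liftable_convex_plane[OF cov])
    show "compact Q" "convex Q" unfolding Q_def by (auto intro: compact_Times convex_Times)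
    show "continuous_on Q (f \<circ> H)" using HQ f by (intro continuous_on_compose) (auto intro: continuous_on_subset)
    show "(f \<circ> H) ` Q \<subseteq> S" using HQ f by auto
  qed
  moreover have "p (h 0) = (f \<circ> H) (0,0)" "h 0 \<in> C" using h H(3) by (auto simp: path_image_def)
  moreover have "(0,0) \<in> Q" by (auto simp: Q_def)
  ultimately obtain k where k: "continuous_on Q k" "k ` Q \<subseteq> C" "k (0,0) = h 0"
    "\<And>x. x \<in> Q \<Longrightarrow> p (k x) = (f \<circ> H) x" using liftableE[of C p "f \<circ> H" Q "(0,0)" "h 0"] by metis
  have conQ: "continuous_on {0..1} (\<lambda>t. k (t, c))" "continuous_on {0..1} (\<lambda>t. k (c, t))" if "c \<in> {0..1}" for c
  proof -
    show "continuous_on {0..1} (\<lambda>t. k (t, c))"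
      by (rule continuous_on_compose2[OF k(1)]) (use that in \<open>auto intro!: continuous_intros simp: Q_def\<close>)
    show "continuous_on {0..1} (\<lambda>t. k (c, t))"
      by (rule continuous_on_compose2[OF k(1)]) (use that in \<open>auto intro!: continuous_intros simp: Q_def\<close>)
  qed
  have kC: "k (s,t) \<in> C" "p (k (s,t)) = f (H (s,t))" if "s \<in> {0..1}" "t \<in> {0..1}" for s t
    using k that by (auto simp: Q_def)
  have top: "k (1,t) = k (1,0)" if "t \<in> {0..1}" for t
    by (rule covering_lift_unique[OF cov, of "{0..1}" "\<lambda>t. k (1,t)" "\<lambda>t. k (1,0)" 0])
      (use conQ[of 1] kC H(4) that in \<open>auto\<close>)
  have H5: "H (t,1) = H (t,0)" if "t \<in> {0..1}" for t
    using H(5) that by (auto simp: pathfinish_def pathstart_def)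
  have k11: "k (1,1) = k (1,0)" by (rule top) simp
  have sides: "k (t,1) = k (t,0)" if "t \<in> {0..1}" for t
    by (rule covering_lift_unique[OF cov, of "{0..1}" "\<lambda>t. k (t,1)" "\<lambda>t. k (t,0)" 1])
      (use conQ[of 0] conQ[of 1] kC H5 k11 that in \<open>auto\<close>)
  have bot: "h t = k (0,t)" if "t \<in> {0..1}" for t
    by (rule covering_lift_unique[OF cov, of "{0..1}" h "\<lambda>t. k (0,t)" 0])
      (use conQ[of 0] kC H(3) h k(3) that in \<open>auto simp: path_def path_image_def\<close>)
  show ?thesis using bot[of 0] bot[of 1] sides[of 0] by simp
qed

text \<open>Simple connectedness says that any two loops are freely homotopic. A homotopy between
  the constant loops at \<open>x\<close> and \<open>y\<close> traces out a path.\<close>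

lemma simply_connected_path_exists:
  assumes U: "simply_connected U" "x \<in> U" "y \<in> U"
  obtains r where "path r" "path_image r \<subseteq> U" "pathstart r = x" "pathfinish r = y"
proof -
  have pc: "path (\<lambda>t::real. c)" for c :: 'a by (simp add: path_def)
  have "homotopic_loops U (\<lambda>t. x) (\<lambda>t. y)" using U pc unfolding simply_connected_def
    by (auto simp: path_image_def pathfinish_def pathstart_def)
  then obtain H where H: "continuous_on ({0..1::real} \<times> {0..1::real}) H" "H \<in> {0..1} \<times> {0..1} \<rightarrow> U"
    "\<forall>t\<in>{0..1}. H (0, t) = x" "\<forall>t\<in>{0..1}. H (1, t) = y"
    unfolding homotopic_loops by (elim exE conjE) (rule that; assumption)
  have "continuous_on {0..1} (\<lambda>t. H (t, 0))"
    by (rule continuous_on_compose2[OF H(1)]) (auto intro!: continuous_intros)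
  then show ?thesis using H by (intro that[of "\<lambda>t. H (t, 0)"])
    (auto simp: path_def path_image_def pathstart_def pathfinish_def)
qed

text \<open>The loop \<open>r\<close> followed by the reverse of \<open>r'\<close> lifts to a closed
  path. Its first half is \<open>h\<close>, and its second half read backwards is
  \<open>h'\<close>.\<close>

lemma simply_connected_lift_paths_eq:
  assumes cov: "covering_space C p S" and U: "simply_connected U"
    and f: "continuous_on U f" "f ` U \<subseteq> S"
    and r: "path r" "path_image r \<subseteq> U" "path r'" "path_image r' \<subseteq> U" "r' 0 = r 0" "r' 1 = r 1"
    and h: "path h" "path_image h \<subseteq> C" "\<And>t. t \<in> {0..1} \<Longrightarrow> p (h t) = f (r t)"
    and h': "path h'" "path_image h' \<subseteq> C" "\<And>t. t \<in> {0..1} \<Longrightarrow> p (h' t) = f (r' t)"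
    and 0: "h' 0 = h 0"
  shows "h' 1 = h 1"
proof -
  let ?r = "r +++ reversepath r'"
  have pr: "path ?r"
  proof (rule path_join_imp)
    show "path (reversepath r')" using r by simp
    show "pathfinish r = pathstart (reversepath r')" using r by (simp add: pathfinish_def pathstart_def reversepath_def)
  qed (rule r(1))
  have ir: "path_image ?r \<subseteq> U" using r by (intro subset_path_image_join) auto
  have fr: "continuous_on {0..1} (f \<circ> ?r)" using pr ir f(1)
    by (intro continuous_on_compose) (auto simp: path_def path_image_def intro: continuous_on_subset)
  have im: "(f \<circ> ?r) ` {0..1} \<subseteq> S" using ir f(2) by (auto simp: path_image_def)
  have "h 0 \<in> C" "p (h 0) = (f \<circ> ?r) 0" using h by (auto simp: path_image_def joinpaths_def)
  then obtain k where k: "continuous_on {0..1} k" "k ` {0..1} \<subseteq> C" "k 0 = h 0"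
    "\<And>x. x \<in> {0..1} \<Longrightarrow> p (k x) = (f \<circ> ?r) x" using liftableE[OF liftable_path[OF cov fr im], of 0 "h 0"] by auto
  have k1: "k 1 = k 0"
    by (rule simply_connected_lift_loop[OF cov U f pr ir])
      (use k r in \<open>auto simp: path_def path_image_def pathstart_def pathfinish_def joinpaths_def reversepath_def\<close>)
  have "h t = k (t/2)" if "t \<in> {0..1}" for t
  proof (rule covering_lift_unique[OF cov, of "{0..1}" h "\<lambda>t. k (t/2)" 0])
    show "continuous_on {0..1} (\<lambda>t. k (t/2))"
      by (rule continuous_on_compose2[OF k(1)]) (auto intro!: continuous_intros)
  qed (use h k that in \<open>auto simp: path_def path_image_def joinpaths_def\<close>)
  from this[of 1] have 1: "h 1 = k (1/2)" by simp
  have "h' t = k (1 - t/2)" if "t \<in> {0..1}" for t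
  proof (rule covering_lift_unique[OF cov, of "{0..1}" h' "\<lambda>t. k (1 - t/2)" 0])
    show "continuous_on {0..1} (\<lambda>t. k (1 - t/2))"
      by (rule continuous_on_compose2[OF k(1)]) (auto intro!: continuous_intros)
    show "p (h' s) = p (k (1 - s / 2))" if "s \<in> {0..1}" for s
      using that h'(3)[of s] k(4)[of "1 - s/2"] r(6)
      by (cases "s = 1") (auto simp: joinpaths_def reversepath_def algebra_simps)
  qed (use h' k k1 0 that in \<open>auto simp: path_def path_image_def\<close>)
  from this[of 1] show ?thesis using 1 by simp
qed

text \<open>The value at \<open>y\<close> is the end of the lift along any path from
  \<open>z\<close> to \<open>y\<close>, independent of the path by
  \<open>simply_connected_lift_paths_eq\<close>. Local path connectedness serves for continuity:
  nearby points are reached by short extensions of one path.\<close>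

theorem simply_connected_lift:
  fixes f :: "'a::topological_space \<Rightarrow> 'c::topological_space"
  assumes cov: "covering_space C p S" and U: "simply_connected U" "locally path_connected U"
    and f: "continuous_on U f" "f ` U \<subseteq> S"
  shows "liftable C p f U"
  unfolding liftable_def
proof (intro ballI impI)
  fix z b assume z: "z \<in> U" "b \<in> C" "p b = f z"
  define R where "R y c \<longleftrightarrow> (\<exists>r h. path r \<and> path_image r \<subseteq> U \<and> r 0 = z \<and> r 1 = y \<and>
     path h \<and> path_image h \<subseteq> C \<and> (\<forall>t\<in>{0..1}. p (h t) = f (r t)) \<and> h 0 = b \<and> h 1 = c)" for y c
  have Runique: "c = c'" if Ra: "R y c" and Rb: "R y c'" for y c c'
  proof -
    obtain r h where 1: "path r" "path_image r \<subseteq> U" "r 0 = z" "r 1 = y"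
     "path h" "path_image h \<subseteq> C" "\<And>t. t\<in>{0..1} \<Longrightarrow> p (h t) = f (r t)" "h 0 = b" "h 1 = c"
      using Ra unfolding R_def by blast
    obtain r' h' where 2: "path r'" "path_image r' \<subseteq> U" "r' 0 = z" "r' 1 = y"
     "path h'" "path_image h' \<subseteq> C" "\<And>t. t\<in>{0..1} \<Longrightarrow> p (h' t) = f (r' t)" "h' 0 = b" "h' 1 = c'"
      using Rb unfolding R_def by blast
    have "h' 1 = h 1"
      by (rule simply_connected_lift_paths_eq[OF cov U(1) f 1(1,2) 2(1,2) _ _ 1(5-7) 2(5-7)])
        (use 1 2 in auto)
    then show ?thesis using 1 2 by simp
  qed
  have Rex: "\<exists>c. R y c" if y: "y \<in> U" for y
  proof -
    obtain r where r: "path r" "path_image r \<subseteq> U" "pathstart r = z" "pathfinish r = y"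
      using simply_connected_path_exists[OF U(1) z(1) y] .
    have "continuous_on {0..1} (f \<circ> r)" using r f(1)
      by (intro continuous_on_compose) (auto simp: path_def path_image_def intro: continuous_on_subset)
    moreover have "(f \<circ> r) ` {0..1} \<subseteq> S" using r f(2) by (auto simp: path_image_def)
    ultimately have "liftable C p (f \<circ> r) {0..1}" by (rule liftable_path[OF cov])
    from liftableE[OF this, of 0 b] obtain h where "continuous_on {0..1} h" "h ` {0..1} \<subseteq> C" "h 0 = b"
     "\<And>x. x \<in> {0..1} \<Longrightarrow> p (h x) = (f \<circ> r) x" using z r by (auto simp: pathstart_def)
    then have "R y (h 1)" unfolding R_def using r
      by (intro exI[of _ r] exI[of _ h]) (auto simp: path_def path_image_def pathstart_def pathfinish_def)
    then show ?thesis by blast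
  qed
  define g where "g y = (SOME c. R y c)" for y
  have Rg: "R y (g y)" if "y \<in> U" for y unfolding g_def using Rex[OF that] by (rule someI_ex)
  have g: "g y \<in> C \<and> p (g y) = f y" if yU: "y \<in> U" for y
  proof -
    obtain r h where "path h" "path_image h \<subseteq> C" "\<And>t. t\<in>{0..1} \<Longrightarrow> p (h t) = f (r t)" "r 1 = y" "h 1 = g y"
      using Rg[OF yU] unfolding R_def by blast
    moreover from this(2) have "h 1 \<in> C" by (auto simp: path_image_def)
    ultimately show ?thesis by (metis atLeastAtMost_iff order_refl zero_le_one)
  qed
  have Rext: "R y' (h 1)" if Ry: "R y c" and s: "path s" "path_image s \<subseteq> U" "s 0 = y" "s 1 = y'"
    and h: "path h" "path_image h \<subseteq> C" "h 0 = c" "\<And>t. t \<in> {0..1} \<Longrightarrow> p (h t) = f (s t)" for y c y' s h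
  proof -
    obtain r k where 1: "path r" "path_image r \<subseteq> U" "r 0 = z" "r 1 = y"
     "path k" "path_image k \<subseteq> C" "\<forall>t\<in>{0..1}. p (k t) = f (r t)" "k 0 = b" "k 1 = c"
      using Ry unfolding R_def by (elim exE conjE) (rule that)
    show ?thesis unfolding R_def
    proof (intro exI[of _ "r +++ s"] exI[of _ "k +++ h"] conjI ballI)
      show "path (r +++ s)" "path (k +++ h)" using 1 s h
        by (auto intro!: path_join_imp simp: pathstart_def pathfinish_def)
      show "path_image (r +++ s) \<subseteq> U" by (rule subset_path_image_join[OF 1(2) s(2)])
      show "path_image (k +++ h) \<subseteq> C" by (rule subset_path_image_join[OF 1(6) h(2)])
      show "p ((k +++ h) t) = f ((r +++ s) t)" if "t \<in> {0..1}" for t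
        using 1(7)[rule_format, of "2*t"] h(4)[of "2*t - 1"] that by (auto simp: joinpaths_def)
    qed (use 1 s in \<open>auto simp: joinpaths_def\<close>)
  qed
  have gz: "g z = b"
  proof (rule Runique[OF Rg[OF z(1)]])
    show "R z b" unfolding R_def using z
      by (intro exI[of _ "\<lambda>t. z"] exI[of _ "\<lambda>t. b"]) (auto simp: path_def path_image_def)
  qed
  have "continuous_on U g"
    unfolding continuous_on_def tendsto_def
  proof (intro ballI allI impI)
    fix y B assume y: "y \<in> U" and B: "open B" "g y \<in> B"
    have fy: "f y \<in> S" using f y by auto
    obtain D where D: "open D" "f y \<in> D"
    "\<And>b. b \<in> C \<Longrightarrow> p b \<in> D \<Longrightarrow> \<exists>W q. open W \<and> b \<in> W \<and> homeomorphism (C \<inter> W) (S \<inter> D) p q"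
      using fy by (rule covering_space_sheets[OF cov]) (rule that)
    obtain W q where W: "open W" "g y \<in> W" "homeomorphism (C \<inter> W) (S \<inter> D) p q"
      using D(3)[of "g y"] g[OF y] D(2) by auto
    have q: "continuous_on (S \<inter> D) q" "\<And>d. d \<in> S \<inter> D \<Longrightarrow> q d \<in> C \<inter> W \<and> p (q d) = d" "\<And>c. c \<in> C \<inter> W \<Longrightarrow> q (p c) = c"
      using W(3) unfolding homeomorphism_def by auto
    have qy: "q (f y) = g y" using q(3)[of "g y"] W g[OF y] by auto
    have cqf: "continuous_on (U \<inter> f -` D) (q \<circ> f)"
      by (rule continuous_on_compose) (use q(1) f in \<open>auto intro: continuous_on_subset\<close>)
    obtain N where N: "open N" "N \<inter> U = f -` D \<inter> U"
      using f(1) D(1) by (auto simp: continuous_on_open_invariant)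
    have opN: "openin (top_of_set U) (U \<inter> N)" using N by (auto simp: openin_open)
    have "\<exists>M. openin (top_of_set (U \<inter> f -` D)) M \<and> y \<in> M \<and> (\<forall>x\<in>M. q (f x) \<in> B)"
    proof (intro exI[of _ "(U \<inter> f -` D) \<inter> (q \<circ> f) -` B"] conjI)
      show "openin (top_of_set (U \<inter> f -` D)) ((U \<inter> f -` D) \<inter> (q \<circ> f) -` B)"
        using cqf B(1) by (rule continuous_openin_preimage_gen)
    qed (use y D(2) qy B in auto)
    then obtain M where M: "openin (top_of_set (U \<inter> f -` D)) M" "y \<in> M" "\<And>x. x \<in> M \<Longrightarrow> q (f x) \<in> B" by blast
    have "U \<inter> f -` D = U \<inter> N" using N by auto
    with M(1) opN have opM: "openin (top_of_set U) M" by (metis openin_trans)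
    \<comment> \<open>Points of \<open>P\<close> are reached from \<open>y\<close> inside an evenly
      covered region, where the local inverse \<open>q\<close> lifts the extension of the path;
      hence \<open>g\<close> is \<open>q\<close> after \<open>f\<close> on \<open>P\<close>.\<close>
    obtain P where P: "openin (top_of_set U) P" "path_connected P" "y \<in> P" "P \<subseteq> M"
      using locally_path_connected_3[OF _ opM M(2)] U(2) locally_path_connected_2 by metis
    obtain P' where P': "open P'" "P = U \<inter> P'" using P(1) by (auto simp: openin_open)
    have gB: "g x \<in> B" if x: "x \<in> P" for x
    proof -
      obtain s where s: "path s" "path_image s \<subseteq> P" "pathstart s = y" "pathfinish s = x"
        using P(2,3) x unfolding path_connected_def by blast
      have MU: "M \<subseteq> U \<inter> f -` D" using M(1) openin_imp_subset by blast
      have sU: "path_image s \<subseteq> U \<inter> f -` D" using s(2) P(4) MU by blast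
      have "path (q \<circ> f \<circ> s)" unfolding path_def
        by (rule continuous_on_compose) (use s(1) continuous_on_subset[OF cqf sU] in \<open>auto simp: path_def path_image_def\<close>)
      then have "R x ((q \<circ> f \<circ> s) 1)"
        by (rule Rext[OF Rg[OF y] s(1), rotated 3])
         (use s sU q(2) f(2) qy in \<open>auto simp: pathstart_def pathfinish_def path_image_def image_subset_iff\<close>)
      then have "g x = q (f x)" using s(4) Runique[OF Rg] x P'(2) by (auto simp: pathfinish_def)
      then show ?thesis using M(3) x P(4) by auto
    qed
    show "\<forall>\<^sub>F x in at y within U. g x \<in> B"
      unfolding eventually_at_topological
      using P' P(3) gB by (intro exI[of _ P']) auto
  qed
  then show "\<exists>g. continuous_on U g \<and> g ` U \<subseteq> C \<and> g z = b \<and> (\<forall>x\<in>U. p (g x) = f x)"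
    using g gz by (intro exI[of _ g]) auto
qed

section \<open>Spaces with the weak topology of a family of cells\<close>

text \<open>All cells are parametrised by compact convex sets of complex numbers, so that vertices,
  edges and faces are treated alike. The last clause is the substantial half of the weak topology;
  the other half is the continuity of the maps.\<close>

definition weak_top :: "'z::topological_space set \<Rightarrow> 'i set \<Rightarrow> ('i \<Rightarrow> complex set) \<Rightarrow> ('i \<Rightarrow> complex \<Rightarrow> 'z) \<Rightarrow> bool" where
  "weak_top Z I D k \<longleftrightarrow> (\<forall>i\<in>I. compact (D i) \<and> convex (D i) \<and> continuous_on (D i) (k i)) \<and>
     (\<Union>i\<in>I. k i ` D i) = Z \<and>
     (\<forall>A\<subseteq>Z. (\<forall>i\<in>I. openin (top_of_set (D i)) (D i \<inter> k i -` A)) \<longrightarrow> openin (top_of_set Z) A)"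

lemma weak_topD:
  assumes "weak_top Z I D k" "i \<in> I"
  shows "compact (D i)" "convex (D i)" "continuous_on (D i) (k i)" "k i ` D i \<subseteq> Z"
  using assms unfolding weak_top_def by auto

lemma weak_top_surj: "weak_top Z I D k \<Longrightarrow> (\<Union>i\<in>I. k i ` D i) = Z"
  unfolding weak_top_def by simp

lemma weak_top_open:
  assumes "weak_top Z I D k" "A \<subseteq> Z" "\<And>i. i \<in> I \<Longrightarrow> openin (top_of_set (D i)) (D i \<inter> k i -` A)"
  shows "openin (top_of_set Z) A"
  using assms unfolding weak_top_def by simp

lemma weak_top_closed:
  assumes w: "weak_top Z I D k" and A: "A \<subseteq> Z" and cl: "\<And>i. i \<in> I \<Longrightarrow> closed (D i \<inter> k i -` A)"
  shows "closedin (top_of_set Z) A"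
proof -
  have "openin (top_of_set Z) (Z - A)"
  proof (rule weak_top_open[OF w])
    fix i assume i: "i \<in> I"
    have "D i \<inter> k i -` (Z - A) = D i - (D i \<inter> k i -` A)" using weak_topD(4)[OF w i] by auto
    moreover have "closedin (top_of_set (D i)) (D i \<inter> k i -` A)"
      using cl[OF i] by (intro closed_subset) auto
    ultimately show "openin (top_of_set (D i)) (D i \<inter> k i -` (Z - A))"
      by (metis openin_diff openin_subtopology_self)
  qed auto
  then show ?thesis using A by (simp add: closedin_def)
qed

lemma weak_top_continuous:
  assumes w: "weak_top Z I D k" and g: "\<And>i. i \<in> I \<Longrightarrow> continuous_on (D i) (\<lambda>u. g (k i u))"
  shows "continuous_on Z g"
  unfolding continuous_on_open_invariant
proof (intro allI impI)
  fix B :: "'c set" assume B: "open B"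
  have "openin (top_of_set Z) (Z \<inter> g -` B)"
  proof (rule weak_top_open[OF w])
    fix i assume i: "i \<in> I"
    have "D i \<inter> k i -` (Z \<inter> g -` B) = D i \<inter> (\<lambda>u. g (k i u)) -` B" using weak_topD(4)[OF w i] by auto
    then show "openin (top_of_set (D i)) (D i \<inter> k i -` (Z \<inter> g -` B))"
      using continuous_openin_preimage_gen[OF g[OF i] B] by simp
  qed auto
  then show "\<exists>A. open A \<and> A \<inter> Z = g -` B \<inter> Z" unfolding openin_open by auto
qed

text \<open>A path component of an open set has an open preimage in each cell, because short
  straight segments in the convex parameter domain map to paths inside that open set.\<close>

lemma weak_top_locally_path_connected:
  assumes w: "weak_top Z I D k"
  shows "locally path_connected Z"
  unfolding locally_path_connected_open_path_component
proof (intro allI impI, elim conjE)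
  fix T x assume T: "openin (top_of_set Z) T" and x: "x \<in> T"
  have TZ: "T \<subseteq> Z" using T openin_imp_subset by blast
  have PT: "path_component_set T x \<subseteq> T" by (rule path_component_subset)
  show "openin (top_of_set Z) (path_component_set T x)"
  proof (rule weak_top_open[OF w])
    show "path_component_set T x \<subseteq> Z" using PT TZ by auto
    fix i assume i: "i \<in> I"
    note wi = weak_topD[OF w i]
    have op: "openin (top_of_set (D i)) (D i \<inter> k i -` T)"
      by (rule continuous_openin_preimage[OF wi(3) _ T]) (use wi(4) in auto)
    show "openin (top_of_set (D i)) (D i \<inter> k i -` path_component_set T x)"
      unfolding openin_euclidean_subtopology_iff
    proof (intro conjI ballI)
      fix u assume u: "u \<in> D i \<inter> k i -` path_component_set T x"
      then have uT: "u \<in> D i \<inter> k i -` T" using PT by auto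
      obtain e where e: "e > 0" "\<And>u'. u' \<in> D i \<Longrightarrow> dist u' u < e \<Longrightarrow> k i u' \<in> T"
        using op[unfolded openin_euclidean_subtopology_iff, THEN conjunct2, rule_format, OF uT] by auto
      show "\<exists>e>0. \<forall>u'\<in>D i. dist u' u < e \<longrightarrow> u' \<in> D i \<inter> k i -` path_component_set T x"
      proof (intro exI[of _ e] conjI e(1) ballI impI)
        fix u' assume u': "u' \<in> D i" "dist u' u < e"
        have seg: "closed_segment u u' \<subseteq> D i \<inter> ball u e"
          using u u' e(1) wi(2) by (intro closed_segment_subset convex_Int convex_ball) (auto simp: dist_commute)
        then have segT: "k i ` closed_segment u u' \<subseteq> T"
          by (intro image_subsetI e(2)) (auto simp: subset_iff dist_commute)
        have "path_component T (k i u) (k i u')" unfolding path_component_def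
        proof (intro exI[of _ "k i \<circ> linepath u u'"] conjI)
          show "path (k i \<circ> linepath u u')"
            using seg by (intro path_continuous_image continuous_on_subset[OF wi(3)]) auto
          show "path_image (k i \<circ> linepath u u') \<subseteq> T" using segT by (simp add: path_image_compose)
        qed (auto simp: pathstart_def pathfinish_def linepath_def)
        moreover have "path_component T x (k i u)" using u by simp
        ultimately have "path_component T x (k i u')" by (meson path_component_trans)
        then show "u' \<in> D i \<inter> k i -` path_component_set T x" using u' by simp
      qed
    qed auto
  qed
qed

text \<open>Openness in \<open>X\<close> is decided on a sheet, which \<open>p\<close> identifies
  with an open set of \<open>Z\<close>. There the weak topology of \<open>Z\<close> applies: a cell
  of \<open>Z\<close> through \<open>p y\<close> lifts to a cell through \<open>y\<close>, on which
  openness is assumed.\<close>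

lemma weak_top_covering:
  assumes w: "weak_top Z I D k" and cov: "covering_space X p Z"
    and lift: "\<And>j. j \<in> J \<Longrightarrow> idx j \<in> I \<and> continuous_on (D (idx j)) (l j) \<and> l j ` D (idx j) \<subseteq> X \<and>
        (\<forall>u\<in>D (idx j). p (l j u) = k (idx j) u)"
    and through: "\<And>i u x. i \<in> I \<Longrightarrow> u \<in> D i \<Longrightarrow> x \<in> X \<Longrightarrow> p x = k i u \<Longrightarrow> \<exists>j\<in>J. idx j = i \<and> l j u = x"
  shows "weak_top X J (\<lambda>j. D (idx j)) l"
  unfolding weak_top_def
proof (intro conjI ballI allI impI)
  fix j assume "j \<in> J"
  note j = lift[OF this]
  show "compact (D (idx j))" "convex (D (idx j))" "continuous_on (D (idx j)) (l j)"
    using j weak_topD[OF w] by blast+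
next
  show "(\<Union>j\<in>J. l j ` D (idx j)) = X"
  proof
    show "(\<Union>j\<in>J. l j ` D (idx j)) \<subseteq> X" using lift by blast
    show "X \<subseteq> (\<Union>j\<in>J. l j ` D (idx j))"
    proof
      fix x assume x: "x \<in> X"
      have "p x \<in> Z" using covering_space_imp_surjective[OF cov] x by auto
      then have "p x \<in> (\<Union>i\<in>I. k i ` D i)" using weak_top_surj[OF w] by simp
      then obtain i u where iu: "i \<in> I" "u \<in> D i" "p x = k i u" by (elim UN_E imageE)
      obtain j where "j \<in> J" "idx j = i" "l j u = x" using through[OF iu(1,2) x iu(3)] by blast
      then show "x \<in> (\<Union>j\<in>J. l j ` D (idx j))" using iu by auto
    qed
  qed
next
  fix A assume A: "A \<subseteq> X" and op: "\<forall>j\<in>J. openin (top_of_set (D (idx j))) (D (idx j) \<inter> l j -` A)"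
  have pX: "p ` X = Z" by (rule covering_space_imp_surjective[OF cov])
  show "openin (top_of_set X) A"
  proof (subst openin_subopen, intro ballI)
    fix x assume x: "x \<in> A"
    obtain W q U where W: "x \<in> W" "openin (top_of_set X) W" "p x \<in> U" "openin (top_of_set Z) U" "homeomorphism W U p q"
      by (rule covering_space_local_homeomorphism[OF cov]) (use x A in auto)
    have UZ: "U \<subseteq> Z" and WX: "W \<subseteq> X" using W(2,4) openin_imp_subset by blast+
    have qp: "q (p y) = y" if "y \<in> W" for y using W(5) that by (simp add: homeomorphism_def)
    have pW: "p y \<in> U" if "y \<in> W" for y using W(5) that unfolding homeomorphism_def by auto
    have op2: "openin (top_of_set Z) (p ` (A \<inter> W))"
    proof (rule weak_top_open[OF w])
      show "p ` (A \<inter> W) \<subseteq> Z" using A pX by auto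
      fix i assume i: "i \<in> I"
      show "openin (top_of_set (D i)) (D i \<inter> k i -` p ` (A \<inter> W))"
      proof (subst openin_subopen, intro ballI)
        fix u assume u: "u \<in> D i \<inter> k i -` p ` (A \<inter> W)"
        then obtain y where y: "y \<in> A" "y \<in> W" "p y = k i u" by auto
        obtain j where j: "j \<in> J" "idx j = i" "l j u = y" using through[OF i _ _ y(3)] u y A by auto
        note lj = lift[OF j(1), unfolded j(2)]
        have "openin (top_of_set (D i)) (D i \<inter> l j -` A)" using op j(1,2) by auto
        moreover have "openin (top_of_set (D i)) (D i \<inter> l j -` W)"
          by (rule continuous_openin_preimage[OF _ _ W(2)]) (use lj in auto)
        ultimately have "openin (top_of_set (D i)) ((D i \<inter> l j -` A) \<inter> (D i \<inter> l j -` W))" by (rule openin_Int)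
        moreover have "u \<in> (D i \<inter> l j -` A) \<inter> (D i \<inter> l j -` W)" using u y j(3) by auto
        moreover have "(D i \<inter> l j -` A) \<inter> (D i \<inter> l j -` W) \<subseteq> D i \<inter> k i -` p ` (A \<inter> W)"
        proof
          fix u' assume u': "u' \<in> (D i \<inter> l j -` A) \<inter> (D i \<inter> l j -` W)"
          then have "k i u' = p (l j u')" "l j u' \<in> A \<inter> W" using lj by auto
          then show "u' \<in> D i \<inter> k i -` p ` (A \<inter> W)" using u' by auto
        qed
        ultimately show "\<exists>T. openin (top_of_set (D i)) T \<and> u \<in> T \<and> T \<subseteq> D i \<inter> k i -` p ` (A \<inter> W)" by blast
      qed
    qed
    have "continuous_on W p" using covering_space_imp_continuous[OF cov] WX continuous_on_subset by blast
    then have "openin (top_of_set W) (W \<inter> p -` p ` (A \<inter> W))"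
      by (rule continuous_openin_preimage[where T = Z]) (use pW UZ op2 in auto)
    then have "openin (top_of_set X) (W \<inter> p -` p ` (A \<inter> W))" using W(2) by (rule openin_trans)
    moreover have "W \<inter> p -` p ` (A \<inter> W) \<subseteq> A"
    proof
      fix y assume "y \<in> W \<inter> p -` p ` (A \<inter> W)"
      then obtain a where "y \<in> W" "a \<in> A" "a \<in> W" "p y = p a" by auto
      then show "y \<in> A" using qp by metis
    qed
    ultimately show "\<exists>T. openin (top_of_set X) T \<and> x \<in> T \<and> T \<subseteq> A" using W(1) x by blast
  qed
qed

text \<open>A connected set that meets a part stays inside it, because both the part and the union
  of the others are closed. For infinitely many parts the second closedness does not follow from the
  first.\<close>

lemma components_of_clopen_partition:
  assumes S: "S = \<Union>\<F>" and con: "\<And>A. A \<in> \<F> \<Longrightarrow> connected A \<and> A \<noteq> {}"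
    and cl: "\<And>A. A \<in> \<F> \<Longrightarrow> closedin (top_of_set S) A \<and> closedin (top_of_set S) (S - A)"
  shows "components S = \<F>"
proof -
  have sub: "A \<subseteq> S" if "A \<in> \<F>" for A using S that by auto
  have max: "T \<subseteq> A" if A: "A \<in> \<F>" and T: "connected T" "T \<subseteq> S" "T \<inter> A \<noteq> {}" for A T
  proof (rule ccontr)
    assume "\<not> T \<subseteq> A"
    have "closedin (top_of_set T) (T \<inter> A)" "closedin (top_of_set T) (T \<inter> (S - A))"
      using cl[OF A] T(2) by (auto intro: closedin_subset_trans closedin_closed_Int simp: closedin_closed)
    moreover have "T \<subseteq> (T \<inter> A) \<union> (T \<inter> (S - A))" "(T \<inter> A) \<inter> (T \<inter> (S - A)) = {}" using T by auto
    moreover have "T \<inter> (S - A) \<noteq> {}" using \<open>\<not> T \<subseteq> A\<close> T by auto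
    ultimately show False using T(1,3) unfolding connected_closedin by blast
  qed
  have comp: "A \<in> components S" if A: "A \<in> \<F>" for A
  proof -
    have "\<exists>c\<in>components S. A \<subseteq> c"
      using exists_component_superset[of A S] con[OF A] sub[OF A] by blast
    then obtain c where c: "c \<in> components S" "A \<subseteq> c" by blast
    have "c \<subseteq> A" using max[OF A in_components_connected[OF c(1)] in_components_subset[OF c(1)]] con[OF A] c(2) by blast
    then show ?thesis using c by auto
  qed
  show ?thesis
  proof (intro equalityI subsetI)
    fix c assume c: "c \<in> components S"
    then obtain x where x: "x \<in> c" using in_components_nonempty by blast
    then have "x \<in> S" using in_components_subset[OF c] by auto
    then obtain A where A: "A \<in> \<F>" "x \<in> A" using S by auto
    have "A = c" using components_eq[OF comp[OF A(1)] c] A(2) x by blast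
    then show "c \<in> \<F>" using A by simp
  qed (rule comp)
qed

section \<open>Cells of a one-vertex complex\<close>

fun cell_dom :: "('e, 'f) cell_index \<Rightarrow> complex set" where
  "cell_dom Vertex = {0}"
| "cell_dom (Edge e) = of_real ` {0..1}"
| "cell_dom (Face f) = cball 0 1"

fun cell_int :: "('e, 'f) cell_index \<Rightarrow> complex set" where
  "cell_int Vertex = {0}"
| "cell_int (Edge e) = of_real ` {0<..<1}"
| "cell_int (Face f) = ball 0 1"

text \<open>The parameter that is mapped to the vertex of the base complex; for a face it is the
  start of the attaching word. A lifted cell is named by the point of the cover at this parameter,
  so lifted cells are indexed by a cell index and a vertex.\<close>

fun cell_base :: "('e, 'f) cell_index \<Rightarrow> complex" where
  "cell_base Vertex = 0"
| "cell_base (Edge e) = 0"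
| "cell_base (Face f) = 1"

fun cell_map :: "'z \<Rightarrow> ('e \<Rightarrow> real \<Rightarrow> 'z) \<Rightarrow> ('f \<Rightarrow> complex \<Rightarrow> 'z) \<Rightarrow> ('e, 'f) cell_index \<Rightarrow> complex \<Rightarrow> 'z" where
  "cell_map v \<phi> \<psi> Vertex u = v"
| "cell_map v \<phi> \<psi> (Edge e) u = \<phi> e (Re u)"
| "cell_map v \<phi> \<psi> (Face f) u = \<psi> f u"

lemma compact_cell_dom: "compact (cell_dom i)"
  by (cases i) (auto intro!: compact_continuous_image continuous_intros)

lemma convex_cell_dom: "convex (cell_dom i)"
proof (cases i)
  case (Edge e)
  have "linear complex_of_real" by (rule linearI) (auto simp: scaleR_conv_of_real)
  then show ?thesis using Edge by (auto intro!: convex_linear_image)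
qed auto

lemma cell_int_subset: "cell_int i \<subseteq> cell_dom i"
  by (cases i) (auto)

lemma cell_base_in: "cell_base i \<in> cell_dom i"
  by (cases i) (auto simp: image_iff)

lemma connected_cell_int: "connected (cell_int i)"
  by (cases i) (auto intro!: connected_continuous_image continuous_intros)

lemma cell_int_nonempty: "cell_int i \<noteq> {}"
  by (cases i) auto

lemma cell_dom_subset_closure: "cell_dom i \<subseteq> closure (cell_int i)"
proof (cases i)
  case (Edge e)
  have "complex_of_real ` closure {0<..<1} \<subseteq> closure (complex_of_real ` {0<..<1})"
    by (rule image_closure_subset) (auto intro!: continuous_intros closure_subset)
  then show ?thesis using Edge by simp
qed auto

lemma open_cell_eq: "open_cell v \<phi> \<psi> i = cell_map v \<phi> \<psi> i ` cell_int i"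
  by (cases i) (auto simp: image_image)

lemma circle_arc:
  assumes N: "N > (0::nat)" and u: "norm u = 1"
  obtains j s where "j < N" "s \<in> {0..<1}" "u = cis (2 * pi * (real j + s) / real N)"
proof -
  define t where "t = Arg2pi u * N / (2 * pi)"
  have t0: "t \<ge> 0" unfolding t_def using Arg2pi_ge_0[of u] by simp
  have tN: "t < N" unfolding t_def using Arg2pi_lt_2pi[of u] N by (simp add: field_simps)
  show ?thesis
  proof
    show "nat \<lfloor>t\<rfloor> < N" using t0 tN by (simp add: nat_less_iff floor_less_iff)
    show "frac t \<in> {0..<1}" by (simp add: frac_lt_1)
    have "real (nat \<lfloor>t\<rfloor>) + frac t = t" using t0 by (simp add: frac_def)
    moreover have "2 * pi * t / N = Arg2pi u" unfolding t_def using N by simp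
    moreover have "u = cis (Arg2pi u)" using Arg2pi_eq[of u] u by (simp add: cis_conv_exp)
    ultimately show "u = cis (2 * pi * (real (nat \<lfloor>t\<rfloor>) + frac t) / real N)" by simp
  qed
qed

locale one_vertex =
  fixes Z :: "'z::topological_space set" and v :: 'z
    and \<phi> :: "'e \<Rightarrow> real \<Rightarrow> 'z" and \<psi> :: "'f \<Rightarrow> complex \<Rightarrow> 'z" and E :: "'e set" and F :: "'f set"
    and w :: "'f \<Rightarrow> 'e word"
  assumes complex: "one_vertex_complex Z v \<phi> \<psi> E F w"
    and word_nonempty: "f \<in> F \<Longrightarrow> w f \<noteq> []"
    and word_letters: "f \<in> F \<Longrightarrow> l \<in> set (w f) \<Longrightarrow> fst l \<in> E"
begin

abbreviation I :: "('e, 'f) cell_index set" where "I \<equiv> cell_indices E F"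
abbreviation \<kappa> :: "('e, 'f) cell_index \<Rightarrow> complex \<Rightarrow> 'z" where "\<kappa> \<equiv> cell_map v \<phi> \<psi>"

definition arc :: "'f \<Rightarrow> nat \<Rightarrow> real \<Rightarrow> complex" where
  "arc f j s = cis (2 * pi * (real j + s) / real (length (w f)))"

lemma in_I [simp]: "Vertex \<in> I" "Edge e \<in> I \<longleftrightarrow> e \<in> E" "Face f \<in> I \<longleftrightarrow> f \<in> F"
  by (auto simp: cell_indices_def)

lemma edge_map: "e \<in> E \<Longrightarrow> continuous_on {0..1} (\<phi> e) \<and> inj_on (\<phi> e) {0<..<1} \<and> \<phi> e 0 = v \<and> \<phi> e 1 = v"
  and face_map: "f \<in> F \<Longrightarrow> continuous_on (cball 0 1) (\<psi> f) \<and> inj_on (\<psi> f) (ball 0 1)"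
  and face_arc: "f \<in> F \<Longrightarrow> j < length (w f) \<Longrightarrow> s \<in> {0..1} \<Longrightarrow> \<psi> f (arc f j s) = letter_path \<phi> (w f ! j) s"
  and disjoint_cells: "disjoint_family_on (open_cell v \<phi> \<psi>) I"
  and cells_cover: "(\<Union>c\<in>I. open_cell v \<phi> \<psi> c) = Z"
  and closedin_Z: "A \<subseteq> Z \<Longrightarrow> closedin (top_of_set Z) A \<longleftrightarrow>
        (\<forall>e\<in>E. closed {s\<in>{0..1}. \<phi> e s \<in> A}) \<and> (\<forall>f\<in>F. closed {y\<in>cball 0 1. \<psi> f y \<in> A})"
  using complex unfolding one_vertex_complex_def arc_def by blast+

lemma norm_arc [simp]: "norm (arc f j s) = 1"
  by (simp add: arc_def)

lemma face_base: "f \<in> F \<Longrightarrow> \<psi> f 1 = v"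
proof -
  assume f: "f \<in> F"
  have len: "0 < length (w f)" using word_nonempty[OF f] by simp
  have "fst (w f ! 0) \<in> E" using word_letters[OF f] len by simp
  then show "\<psi> f 1 = v"
    using face_arc[OF f len, of 0] edge_map by (auto simp: arc_def letter_path_def)
qed

lemma \<kappa>_base: "i \<in> I \<Longrightarrow> \<kappa> i (cell_base i) = v"
  by (cases i) (auto simp: edge_map face_base)

lemma continuous_\<kappa>: "i \<in> I \<Longrightarrow> continuous_on (cell_dom i) (\<kappa> i)"
proof (cases i)
  case (Edge e)
  assume "i \<in> I"
  then have "continuous_on {0..1} (\<phi> e)" using Edge edge_map by simp
  then have "continuous_on (cell_dom i) (\<lambda>u. \<phi> e (Re u))"
    by (rule continuous_on_compose2) (auto intro!: continuous_intros simp: Edge)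
  then show ?thesis using Edge by (simp add: cell_map.simps(2)[abs_def])
qed (auto simp: face_map cell_map.simps[abs_def])

lemma \<kappa>_inj:
  assumes "i \<in> I" "j \<in> I" "u \<in> cell_int i" "u' \<in> cell_int j" "\<kappa> i u = \<kappa> j u'"
  shows "i = j" "u = u'"
proof -
  have "\<kappa> i u \<in> open_cell v \<phi> \<psi> i" unfolding open_cell_eq using assms(3) by (rule imageI)
  moreover have "\<kappa> i u \<in> open_cell v \<phi> \<psi> j" unfolding open_cell_eq assms(5) using assms(4) by (rule imageI)
  ultimately show ij: "i = j" using disjoint_cells assms(1,2) unfolding disjoint_family_on_def by blast
  show "u = u'"
  proof (cases i)
    case (Edge e)
    then have "\<phi> e (Re u) = \<phi> e (Re u')" "Re u \<in> {0<..<1}" "Re u' \<in> {0<..<1}" using assms ij by auto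
    then have "Re u = Re u'" using edge_map[of e] assms(1) Edge unfolding inj_on_def by auto
    then show ?thesis using assms Edge ij by auto
  next
    case (Face f)
    then show ?thesis using face_map[of f] assms ij unfolding inj_on_def by auto
  qed (use assms ij in auto)
qed

lemma \<kappa>_cover:
  assumes "z \<in> Z"
  obtains i u where "i \<in> I" "u \<in> cell_int i" "z = \<kappa> i u"
  using assms cells_cover unfolding open_cell_eq by blast

lemma \<kappa>_int_in_Z: "i \<in> I \<Longrightarrow> u \<in> cell_int i \<Longrightarrow> \<kappa> i u \<in> Z"
  using cells_cover unfolding open_cell_eq by blast

lemma v_in_Z: "v \<in> Z"
  using \<kappa>_int_in_Z[of Vertex 0] by simp

lemma edge_in_Z:
  assumes "e \<in> E" "s \<in> {0..1}"
  shows "\<phi> e s \<in> Z"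
proof -
  consider "s = 0" | "s = 1" | "s \<in> {0<..<1}" using assms by fastforce
  then show ?thesis
    using edge_map[OF assms(1)] v_in_Z \<kappa>_int_in_Z[of "Edge e" "of_real s"] assms(1) by cases auto
qed

text \<open>Boundary points are traced along an arc to an edge and from its ends to the vertex. That
  the cell found is never a face later makes the union of the open faces open.\<close>

lemma boundary_\<kappa>:
  assumes "i \<in> I" "u \<in> cell_dom i" "u \<notin> cell_int i"
  obtains j u' where "j \<in> I" "u' \<in> cell_int j" "\<kappa> i u = \<kappa> j u'" "j \<noteq> i" "\<And>f. j \<noteq> Face f"
proof -
  note goal = that
  have edge: thesis if e: "e \<in> E" and s: "s \<in> {0..1}" and eq: "\<kappa> i u = \<phi> e s" and i: "i \<noteq> Vertex" and ie: "s \<in> {0<..<1} \<Longrightarrow> i \<noteq> Edge e" for e s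
  proof (cases "s \<in> {0<..<1}")
    case True
    then show ?thesis using e eq ie by (intro goal[of "Edge e" "of_real s"]) auto
  next
    case False
    then have "s = 0 \<or> s = 1" using s by auto
    then have "\<kappa> i u = v" using edge_map[OF e] eq by auto
    then show ?thesis using i by (intro goal[of Vertex 0]) auto
  qed
  show ?thesis
  proof (cases i)
    case (Edge e)
    then obtain s where s: "u = of_real s" "s \<in> {0..1}" using assms(2) by auto
    show ?thesis by (rule edge[of e s]) (use assms s Edge in auto)
  next
    case (Face f)
    then have nu: "norm u = 1" and f: "f \<in> F" using assms by auto
    have len: "0 < length (w f)" using word_nonempty[OF f] by simp
    obtain j s where j: "j < length (w f)" "s \<in> {0..<1}" "u = arc f j s"
      using circle_arc[OF len nu] unfolding arc_def by metis
    have s: "s \<in> {0..1}" using j by auto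
    have e: "fst (w f ! j) \<in> E" using word_letters[OF f] j by simp
    have "\<kappa> i u = \<phi> (fst (w f ! j)) (if snd (w f ! j) then s else 1 - s)"
      using face_arc[OF f j(1) s] j(3) Face by (simp add: letter_path_def)
    then show ?thesis by (intro edge[OF e]) (use Face s in auto)
  qed (use assms in auto)
qed

lemma \<kappa>_in_Z: "i \<in> I \<Longrightarrow> u \<in> cell_dom i \<Longrightarrow> \<kappa> i u \<in> Z"
  by (metis boundary_\<kappa> \<kappa>_int_in_Z)

lemma \<kappa>_int_iff:
  assumes "i \<in> I" "u \<in> cell_dom i"
  shows "\<kappa> i u \<in> open_cell v \<phi> \<psi> i \<longleftrightarrow> u \<in> cell_int i"
proof
  assume "\<kappa> i u \<in> open_cell v \<phi> \<psi> i"
  then obtain u1 where u1: "u1 \<in> cell_int i" "\<kappa> i u = \<kappa> i u1" unfolding open_cell_eq by blast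
  show "u \<in> cell_int i"
  proof (rule ccontr)
    assume "u \<notin> cell_int i"
    then obtain j u' where "j \<in> I" "u' \<in> cell_int j" "\<kappa> i u = \<kappa> j u'" "j \<noteq> i"
      using boundary_\<kappa>[OF assms] by metis
    then show False using \<kappa>_inj(1)[OF assms(1) _ u1(1)] u1(2) by metis
  qed
qed (auto simp: open_cell_eq)

text \<open>An edge is parametrised by a real interval in the definition of the complex and by a
  segment of complex numbers here; compactness carries closedness from one to the other.\<close>

lemma weak_Z: "weak_top Z I cell_dom \<kappa>"
  unfolding weak_top_def
proof (intro conjI ballI allI impI compact_cell_dom convex_cell_dom continuous_\<kappa>)
  show "(\<Union>i\<in>I. \<kappa> i ` cell_dom i) = Z"
  proof
    show "(\<Union>i\<in>I. \<kappa> i ` cell_dom i) \<subseteq> Z" using \<kappa>_in_Z by blast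
    show "Z \<subseteq> (\<Union>i\<in>I. \<kappa> i ` cell_dom i)" using cell_int_subset by (auto elim!: \<kappa>_cover)
  qed
  fix A assume A: "A \<subseteq> Z" and op: "\<forall>i\<in>I. openin (top_of_set (cell_dom i)) (cell_dom i \<inter> \<kappa> i -` A)"
  have cl: "closed {u \<in> cell_dom i. \<kappa> i u \<in> Z - A}" if i: "i \<in> I" for i
  proof -
    have "{u \<in> cell_dom i. \<kappa> i u \<in> Z - A} = cell_dom i - (cell_dom i \<inter> \<kappa> i -` A)" using \<kappa>_in_Z[OF i] by auto
    moreover have "closedin (top_of_set (cell_dom i)) (cell_dom i - (cell_dom i \<inter> \<kappa> i -` A))"
      using op i by (intro closedin_diff) auto
    ultimately show ?thesis using closedin_closed_trans compact_imp_closed[OF compact_cell_dom] by metis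
  qed
  have "closedin (top_of_set Z) (Z - A)"
    unfolding closedin_Z[OF Diff_subset]
  proof (intro conjI ballI)
    fix e assume e: "e \<in> E"
    let ?i = "Edge e :: ('e, 'f) cell_index"
    have "{s \<in> {0..1}. \<phi> e s \<in> Z - A} = Re ` (cell_dom ?i \<inter> {u \<in> cell_dom ?i. \<kappa> ?i u \<in> Z - A})"
      by (force simp: image_iff)
    moreover have "compact (cell_dom ?i \<inter> {u \<in> cell_dom ?i. \<kappa> ?i u \<in> Z - A})"
      by (rule compact_Int_closed[OF compact_cell_dom cl]) (use e in simp)
    ultimately show "closed {s \<in> {0..1}. \<phi> e s \<in> Z - A}"
      by (auto intro!: compact_imp_closed compact_continuous_image continuous_intros)
  next
    fix f assume "f \<in> F"
    then show "closed {y \<in> cball 0 1. \<psi> f y \<in> Z - A}" using cl[of "Face f"] by simp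
  qed
  then show "openin (top_of_set Z) A"
    using A openin_closedin_eq[of "top_of_set Z" A] by simp
qed auto

end

section \<open>The induced cell structure on a covering\<close>

locale cell_cover = one_vertex Z v \<phi> \<psi> E F w
  for Z :: "'z::topological_space set" and v :: 'z
    and \<phi> :: "'e \<Rightarrow> real \<Rightarrow> 'z" and \<psi> :: "'f \<Rightarrow> complex \<Rightarrow> 'z" and E :: "'e set" and F :: "'f set"
    and w :: "'f \<Rightarrow> 'e word" +
  fixes X :: "'x::topological_space set" and p :: "'x \<Rightarrow> 'z"
  assumes covering: "covering_space X p Z"
begin

definition V :: "'x set" where "V = {x \<in> X. p x = v}"

definition lft :: "('e, 'f) cell_index \<Rightarrow> 'x \<Rightarrow> complex \<Rightarrow> 'x" where
  "lft i x = (SOME g. continuous_on (cell_dom i) g \<and> g ` cell_dom i \<subseteq> X \<and> g (cell_base i) = x \<and>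
     (\<forall>u\<in>cell_dom i. p (g u) = \<kappa> i u))"

definition cell :: "('e, 'f) cell_index \<Rightarrow> 'x \<Rightarrow> 'x set" where
  "cell i x = lft i x ` cell_int i"

lemma V_in_X: "x \<in> V \<Longrightarrow> x \<in> X" and p_V: "x \<in> V \<Longrightarrow> p x = v"
  by (auto simp: V_def)

lemma p_in_Z: "x \<in> X \<Longrightarrow> p x \<in> Z"
  using covering_space_imp_surjective[OF covering] by auto

lemma liftable_\<kappa>: "i \<in> I \<Longrightarrow> liftable X p (\<kappa> i) (cell_dom i)"
  using \<kappa>_in_Z by (intro liftable_convex_complex[OF covering compact_cell_dom convex_cell_dom continuous_\<kappa>]) auto

lemma lft:
  assumes "i \<in> I" "x \<in> V"
  shows "continuous_on (cell_dom i) (lft i x)" "lft i x ` cell_dom i \<subseteq> X" "lft i x (cell_base i) = x"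
    "\<And>u. u \<in> cell_dom i \<Longrightarrow> p (lft i x u) = \<kappa> i u"
proof -
  have "p x = \<kappa> i (cell_base i)" using assms \<kappa>_base p_V by simp
  from liftableE[OF liftable_\<kappa>[OF assms(1)] cell_base_in V_in_X[OF assms(2)] this]
  have "\<exists>g. continuous_on (cell_dom i) g \<and> g ` cell_dom i \<subseteq> X \<and> g (cell_base i) = x \<and>
     (\<forall>u\<in>cell_dom i. p (g u) = \<kappa> i u)" by metis
  from someI_ex[OF this, folded lft_def]
  show "continuous_on (cell_dom i) (lft i x)" "lft i x ` cell_dom i \<subseteq> X" "lft i x (cell_base i) = x"
    "\<And>u. u \<in> cell_dom i \<Longrightarrow> p (lft i x u) = \<kappa> i u" by auto
qed

lemma lft_in_X: "i \<in> I \<Longrightarrow> x \<in> V \<Longrightarrow> u \<in> cell_dom i \<Longrightarrow> lft i x u \<in> X"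
  using lft(2) by blast

lemma lft_unique:
  assumes i: "i \<in> I" and g: "continuous_on (cell_dom i) g" "g ` cell_dom i \<subseteq> X" "\<And>u. u \<in> cell_dom i \<Longrightarrow> p (g u) = \<kappa> i u"
  shows "g (cell_base i) \<in> V" "u \<in> cell_dom i \<Longrightarrow> g u = lft i (g (cell_base i)) u"
proof -
  show V: "g (cell_base i) \<in> V"
    using g(2) g(3)[OF cell_base_in] cell_base_in[of i] \<kappa>_base[OF i] by (auto simp: V_def)
  note l = lft[OF i V]
  assume u: "u \<in> cell_dom i"
  show "g u = lft i (g (cell_base i)) u"
    by (rule covering_lift_unique[OF covering convex_connected[OF convex_cell_dom] g(1,2) l(1,2) _ cell_base_in _ u])
      (use g(3) l(3,4) in auto)
qed

lemma lft_through:
  assumes "i \<in> I" "u \<in> cell_dom i" "y \<in> X" "p y = \<kappa> i u"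
  obtains x where "x \<in> V" "lft i x u = y"
proof -
  obtain g where g: "continuous_on (cell_dom i) g" "g ` cell_dom i \<subseteq> X" "g u = y" "\<And>u. u \<in> cell_dom i \<Longrightarrow> p (g u) = \<kappa> i u"
    using liftableE[OF liftable_\<kappa>[OF assms(1)] assms(2-4)] by metis
  show ?thesis
    using lft_unique[OF assms(1) g(1,2,4)] g(3) assms(2) by (intro that[of "g (cell_base i)"]) auto
qed

lemma lft_eq:
  assumes i: "i \<in> I" and x: "x \<in> V" "y \<in> V" and u: "u \<in> cell_dom i" "lft i x u = lft i y u"
  shows "x = y"
proof -
  have "lft i x (cell_base i) = lft i y (cell_base i)"
    by (rule covering_lift_unique[OF covering convex_connected[OF convex_cell_dom[of i]] lft(1)[OF i x(1)] lft(2)[OF i x(1)]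
     lft(1)[OF i x(2)] lft(2)[OF i x(2)] _ u(1)]) (use lft(4) i x u cell_base_in in auto)
  then show ?thesis using lft(3) i x by simp
qed

lemma lft_inj:
  assumes "i \<in> I" "j \<in> I" "x \<in> V" "y \<in> V" "u \<in> cell_int i" "u' \<in> cell_int j" "lft i x u = lft j y u'"
  shows "i = j" "x = y" "u = u'"
proof -
  have u: "u \<in> cell_dom i" "u' \<in> cell_dom j" using assms cell_int_subset by auto
  have "\<kappa> i u = \<kappa> j u'" using lft(4) assms u by metis
  then show i: "i = j" and uu: "u = u'" using \<kappa>_inj assms by auto
  show "x = y" using lft_eq[OF assms(1) assms(3,4) u(1)] assms(7) i uu by simp
qed

lemma cell_through:
  assumes "y \<in> X"
  obtains i x u where "i \<in> I" "x \<in> V" "u \<in> cell_int i" "y = lft i x u"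
proof -
  obtain i u where iu: "i \<in> I" "u \<in> cell_int i" "p y = \<kappa> i u" using \<kappa>_cover[OF p_in_Z[OF assms]] .
  then show ?thesis using lft_through[OF iu(1) _ assms iu(3)] cell_int_subset that by (metis subsetD)
qed

lemma weak_X: "weak_top X (I \<times> V) (\<lambda>j. cell_dom (fst j)) (\<lambda>j. lft (fst j) (snd j))"
proof (rule weak_top_covering[OF weak_Z covering])
  fix j :: "('e, 'f) cell_index \<times> 'x" assume "j \<in> I \<times> V"
  then have "fst j \<in> I" "snd j \<in> V" by auto
  then show "fst j \<in> I \<and> continuous_on (cell_dom (fst j)) (lft (fst j) (snd j)) \<and> lft (fst j) (snd j) ` cell_dom (fst j) \<subseteq> X \<and>
    (\<forall>u\<in>cell_dom (fst j). p (lft (fst j) (snd j) u) = \<kappa> (fst j) u)" using lft by blast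
next
  fix i u x assume "i \<in> I" "u \<in> cell_dom i" "x \<in> X" "p x = \<kappa> i u"
  then obtain y where "y \<in> V" "lft i y u = x" by (rule lft_through)
  then show "\<exists>j\<in>I \<times> V. fst j = i \<and> lft (fst j) (snd j) u = x" using \<open>i \<in> I\<close> by (intro bexI[of _ "(i, y)"]) auto
qed

lemma lft_Vertex [simp]: "x \<in> V \<Longrightarrow> lft Vertex x 0 = x"
  using lft(3)[of Vertex x] by simp

lemma cell_Vertex: "x \<in> V \<Longrightarrow> cell Vertex x = {x}"
  by (simp add: cell_def)

subsection \<open>Walking along edges\<close>

definition tgt :: "'e \<Rightarrow> 'x \<Rightarrow> 'x" where "tgt e x = lft (Edge e) x 1"

definition src :: "'e \<Rightarrow> 'x \<Rightarrow> 'x" where "src e y = (SOME x. x \<in> V \<and> tgt e x = y)"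

definition step :: "'e \<times> bool \<Rightarrow> 'x \<Rightarrow> 'x" where
  "step l x = (if snd l then tgt (fst l) x else src (fst l) x)"

abbreviation walk :: "'e word \<Rightarrow> 'x \<Rightarrow> 'x" where "walk \<equiv> fold step"

lemma one_in_Edge [simp]: "1 \<in> cell_dom (Edge e)" "0 \<in> cell_dom (Edge e)"
  by (auto simp: image_iff)

lemma lft_Edge_0 [simp]: "e \<in> E \<Longrightarrow> x \<in> V \<Longrightarrow> lft (Edge e) x 0 = x"
  using lft(3)[of "Edge e" x] by simp

lemma tgt_in_V: "e \<in> E \<Longrightarrow> x \<in> V \<Longrightarrow> tgt e x \<in> V"
  using lft_in_X[of "Edge e" x 1] lft(4)[of "Edge e" x 1] edge_map[of e] by (simp add: tgt_def V_def)

lemma tgt_inj: "e \<in> E \<Longrightarrow> x \<in> V \<Longrightarrow> y \<in> V \<Longrightarrow> tgt e x = tgt e y \<Longrightarrow> x = y"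
  using lft_eq[of "Edge e" x y 1] by (simp add: tgt_def)

lemma src: "e \<in> E \<Longrightarrow> y \<in> V \<Longrightarrow> src e y \<in> V \<and> tgt e (src e y) = y"
proof -
  assume e: "e \<in> E" and y: "y \<in> V"
  obtain x where "x \<in> V" "lft (Edge e) x 1 = y"
    using lft_through[of "Edge e" 1 y] e y edge_map[OF e] by (auto simp: V_def)
  then have "\<exists>x. x \<in> V \<and> tgt e x = y" by (auto simp: tgt_def)
  from someI_ex[OF this, folded src_def] show ?thesis .
qed

lemma src_tgt: "e \<in> E \<Longrightarrow> x \<in> V \<Longrightarrow> src e (tgt e x) = x"
  using src tgt_inj tgt_in_V by metis

lemma step_in_V: "fst l \<in> E \<Longrightarrow> x \<in> V \<Longrightarrow> step l x \<in> V"
  by (simp add: step_def tgt_in_V src)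

lemma walk_in_V: "fst ` set u \<subseteq> E \<Longrightarrow> x \<in> V \<Longrightarrow> walk u x \<in> V"
  by (induction u arbitrary: x) (auto simp: step_in_V)

text \<open>Edges are named by their start, so a letter that is read backwards names its edge by the
  vertex to which it leads.\<close>

definition letter_start :: "'e \<times> bool \<Rightarrow> 'x \<Rightarrow> 'x" where
  "letter_start l x = (if snd l then x else src (fst l) x)"

lemma letter_start_in_V: "fst l \<in> E \<Longrightarrow> x \<in> V \<Longrightarrow> letter_start l x \<in> V"
  by (simp add: letter_start_def src)

definition letter_lift :: "'e \<times> bool \<Rightarrow> 'x \<Rightarrow> real \<Rightarrow> 'x" where
  "letter_lift l x s = lft (Edge (fst l)) (letter_start l x) (of_real (if snd l then s else 1 - s))"

lemma letter_lift_ends: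
  assumes "fst l \<in> E" "x \<in> V"
  shows "letter_lift l x 0 = x" "letter_lift l x 1 = step l x"
  using assms src[OF assms] by (auto simp: letter_lift_def letter_start_def step_def tgt_def)

lemma of_real_in_Edge: "s \<in> {0..1} \<Longrightarrow> of_real s \<in> cell_dom (Edge e)"
  by auto

lemma letter_lift:
  assumes "fst l \<in> E" "x \<in> V"
  shows "continuous_on {0..1} (letter_lift l x)" "letter_lift l x ` {0..1} \<subseteq> X"
    "\<And>s. s \<in> {0..1} \<Longrightarrow> p (letter_lift l x s) = letter_path \<phi> l s"
proof -
  have E: "Edge (fst l) \<in> I" using assms by simp
  note L = lft[OF E letter_start_in_V[OF assms]]
  have "continuous_on {0..1} (\<lambda>s. complex_of_real (if snd l then s else 1 - s))"
    by (cases "snd l") (auto intro!: continuous_intros)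
  then show "continuous_on {0..1} (letter_lift l x)" unfolding letter_lift_def
    by (rule continuous_on_compose2[OF L(1)]) force
  show "letter_lift l x ` {0..1} \<subseteq> X" unfolding letter_lift_def
    by (rule image_subsetI, rule lft_in_X[OF E letter_start_in_V[OF assms]]) auto
  show "p (letter_lift l x s) = letter_path \<phi> l s" if "s \<in> {0..1}" for s
    using L(4)[of "of_real (if snd l then s else 1 - s)"] that
    by (auto simp: letter_lift_def letter_path_def)
qed

lemma continuous_arc: "continuous_on A (arc f j)"
  unfolding arc_def divide_inverse by (intro continuous_intros)

lemma arc_in_Face: "arc f j s \<in> cell_dom (Face f)"
  by simp

lemma arc_Suc: "arc f (Suc j) 0 = arc f j 1"
  by (simp add: arc_def add.commute)

text \<open>Arc by arc, the lifted face and the lift of the corresponding letter project to the same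
  path and start at the same vertex, so they coincide. The end of one arc is the start of the
  next.\<close>

lemma face_boundary_aux:
  assumes f: "f \<in> F" and x: "x \<in> V" and j: "j \<le> length (w f)"
  shows "lft (Face f) x (arc f j 0) = walk (take j (w f)) x \<and>
    (\<forall>k<j. \<forall>s\<in>{0..1}. lft (Face f) x (arc f k s) = letter_lift (w f ! k) (walk (take k (w f)) x) s)"
  using j
proof (induction j)
  case 0
  show ?case using lft(3)[of "Face f" x] f x by (simp add: arc_def)
next
  case (Suc j)
  let ?y = "walk (take j (w f)) x"
  have IH: "lft (Face f) x (arc f j 0) = ?y" "\<forall>k<j. \<forall>s\<in>{0..1}. lft (Face f) x (arc f k s) = letter_lift (w f ! k) (walk (take k (w f)) x) s"
    using Suc by auto
  have l: "fst (w f ! j) \<in> E" using word_letters[OF f] Suc.prems by simp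
  have yV: "?y \<in> V" using word_letters[OF f] by (intro walk_in_V x) (auto dest!: in_set_takeD)
  have FI: "Face f \<in> I" using f by simp
  have eq: "lft (Face f) x (arc f j s) = letter_lift (w f ! j) ?y s" if s: "s \<in> {0..1}" for s
  proof (rule covering_lift_unique[OF covering, of "{0..1}" "\<lambda>s. lft (Face f) x (arc f j s)" "letter_lift (w f ! j) ?y" 0])
    show "continuous_on {0..1} (\<lambda>s. lft (Face f) x (arc f j s))"
      by (rule continuous_on_compose2[OF lft(1)[OF FI x] continuous_arc]) auto
    show "(\<lambda>s. lft (Face f) x (arc f j s)) ` {0..1} \<subseteq> X" using lft_in_X[OF FI x] by auto
    show "p (lft (Face f) x (arc f j s)) = p (letter_lift (w f ! j) ?y s)" if "s \<in> {0..1}" for s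
      using letter_lift(3)[OF l yV that] lft(4)[OF FI x arc_in_Face] face_arc[OF f _ that] Suc.prems by simp
  qed (use letter_lift[OF l yV] letter_lift_ends[OF l yV] IH(1) s in auto)
  have "lft (Face f) x (arc f (Suc j) 0) = walk (take (Suc j) (w f)) x"
    using eq[of 1] letter_lift_ends[OF l yV] Suc.prems by (simp add: arc_Suc take_Suc_conv_app_nth)
  then show ?case using IH(2) eq less_Suc_eq by auto
qed

lemma face_boundary:
  assumes "f \<in> F" "x \<in> V" "j < length (w f)" "s \<in> {0..1}"
  shows "lft (Face f) x (arc f j s) = letter_lift (w f ! j) (walk (take j (w f)) x) s"
  using face_boundary_aux[OF assms(1,2) order_refl] assms(3,4) by blast

text \<open>The boundary circle of a lifted disc closes up in \<open>X\<close>, hence attaching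
  words act trivially on vertices.\<close>

lemma walk_face: "f \<in> F \<Longrightarrow> x \<in> V \<Longrightarrow> walk (w f) x = x"
proof -
  assume f: "f \<in> F" and x: "x \<in> V"
  have "arc f (length (w f)) 0 = 1" using word_nonempty[OF f] by (simp add: arc_def)
  then show ?thesis using face_boundary_aux[OF f x order_refl] lft(3)[of "Face f" x] f x by simp
qed

section \<open>Subcomplexes and closed cells\<close>

definition subcomplex :: "'x set \<Rightarrow> bool" where
  "subcomplex A \<longleftrightarrow> A \<subseteq> X \<and> (\<forall>i\<in>I. \<forall>x\<in>V. \<forall>u\<in>cell_int i. lft i x u \<in> A \<longrightarrow> lft i x ` cell_dom i \<subseteq> A)"

lemma subcomplexD:
  "subcomplex A \<Longrightarrow> i \<in> I \<Longrightarrow> x \<in> V \<Longrightarrow> u \<in> cell_int i \<Longrightarrow> lft i x u \<in> A \<Longrightarrow> u' \<in> cell_dom i \<Longrightarrow> lft i x u' \<in> A"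
  unfolding subcomplex_def by blast

lemma subcomplex_Union: "(\<And>A. A \<in> \<A> \<Longrightarrow> subcomplex A) \<Longrightarrow> subcomplex (\<Union>\<A>)"
  unfolding subcomplex_def by blast

lemma closed_edge_preimage:
  assumes A: "subcomplex A" and e: "e \<in> E" and x: "x \<in> V"
  shows "closed {s \<in> {0..1}. lft (Edge e) x (of_real s) \<in> A}"
proof (cases "\<exists>s\<in>{0<..<1}. lft (Edge e) x (of_real s) \<in> A")
  case True
  then obtain s :: real where s: "s \<in> {0<..<1}" "lft (Edge e) x (of_real s) \<in> A" by blast
  have "{s \<in> {0..1}. lft (Edge e) x (of_real s) \<in> A} = {0..1}"
    using subcomplexD[OF A _ x _ s(2)] e s(1) by auto
  then show ?thesis by simp
next
  case False
  have "{s \<in> {0..1}. lft (Edge e) x (of_real s) \<in> A} \<subseteq> {0, 1}"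
  proof
    fix s assume s: "s \<in> {s \<in> {0..1}. lft (Edge e) x (of_real s) \<in> A}"
    then have "s \<notin> {0<..<1}" using False by blast
    then show "s \<in> {0, 1}" using s by auto
  qed
  then have "finite {s \<in> {0..1}. lft (Edge e) x (of_real s) \<in> A}" by (rule finite_subset) simp
  then show ?thesis by (rule finite_imp_closed)
qed

lemma closed_letter_preimage:
  assumes A: "\<And>e x. e \<in> E \<Longrightarrow> x \<in> V \<Longrightarrow> closed {s \<in> {0..1}. lft (Edge e) x (of_real s) \<in> A}"
    and l: "fst l \<in> E" and x: "x \<in> V"
  shows "closed {s \<in> {0..1}. letter_lift l x s \<in> A}"
proof -
  let ?S = "{s \<in> {0..1}. lft (Edge (fst l)) (letter_start l x) (of_real s) \<in> A}"
  have cl: "closed ?S" by (rule A[OF l letter_start_in_V[OF l x]])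
  show ?thesis
  proof (cases "snd l")
    case True
    then show ?thesis using cl by (simp add: letter_lift_def)
  next
    case False
    have "{s \<in> {0..1}. letter_lift l x s \<in> A} = (\<lambda>s. 1 - s) ` ?S"
    proof
      show "{s \<in> {0..1}. letter_lift l x s \<in> A} \<subseteq> (\<lambda>s. 1 - s) ` ?S"
      proof
        fix s assume "s \<in> {s \<in> {0..1}. letter_lift l x s \<in> A}"
        then have "1 - s \<in> ?S" "s = 1 - (1 - s)" using False by (auto simp: letter_lift_def)
        then show "s \<in> (\<lambda>s. 1 - s) ` ?S" by blast
      qed
    qed (use False in \<open>auto simp: letter_lift_def\<close>)
    moreover have "?S = {0..1} \<inter> ?S" by auto
    then have "compact ?S" using compact_Int_closed[OF compact_Icc cl, of 0 1] by simp
    ultimately show ?thesis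
      by (auto intro!: compact_imp_closed compact_continuous_image continuous_intros)
  qed
qed

lemma circle_eq_arc:
  assumes "f \<in> F" "norm u = 1"
  obtains j s where "j < length (w f)" "s \<in> {0..<1}" "u = arc f j s"
  using circle_arc[of "length (w f)" u] assms word_nonempty[OF assms(1)] unfolding arc_def by blast

lemma word_letter_in_E: "f \<in> F \<Longrightarrow> j < length (w f) \<Longrightarrow> fst (w f ! j) \<in> E"
  using word_letters by simp

lemma walk_take_in_V: "f \<in> F \<Longrightarrow> x \<in> V \<Longrightarrow> walk (take j (w f)) x \<in> V"
  using word_letters by (intro walk_in_V) (auto dest: in_set_takeD)

text \<open>The preimage of \<open>A\<close> in a face is the whole disc or lies on the circle,
  where it is a finite union of images of preimages in edges. Closedness is therefore a question
  about edges, also for sets that are not subcomplexes, such as closed pieces of a branching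
  line.\<close>

lemma closedin_by_edges:
  assumes AX: "A \<subseteq> X"
    and A: "\<And>e x. e \<in> E \<Longrightarrow> x \<in> V \<Longrightarrow> closed {s \<in> {0..1}. lft (Edge e) x (of_real s) \<in> A}"
    and AF: "\<And>f x u. f \<in> F \<Longrightarrow> x \<in> V \<Longrightarrow> u \<in> ball 0 1 \<Longrightarrow> lft (Face f) x u \<in> A \<Longrightarrow>
      lft (Face f) x ` cball 0 1 \<subseteq> A"
  shows "closedin (top_of_set X) A"
proof (rule weak_top_closed[OF weak_X AX])
  fix j :: "('e, 'f) cell_index \<times> 'x" assume "j \<in> I \<times> V"
  then obtain i x where j: "j = (i, x)" "i \<in> I" "x \<in> V" by auto
  have "closed (cell_dom i \<inter> lft i x -` A)"
  proof (cases i)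
    case Vertex
    then have "cell_dom i \<inter> lft i x -` A \<subseteq> {0}" by auto
    then show ?thesis using finite_subset finite_imp_closed by blast
  next
    case (Edge e)
    let ?S = "{s \<in> {0..1}. lft (Edge e) x (of_real s) \<in> A}"
    have "cell_dom i \<inter> lft i x -` A = complex_of_real ` ?S" using Edge by auto
    moreover have "closed ?S" using A[OF _ j(3), of e] j(2) Edge by simp
    moreover have "?S = {0..1} \<inter> ?S" by auto
    ultimately show ?thesis
      by (metis (no_types, lifting) compact_Icc compact_Int_closed compact_continuous_image compact_imp_closed continuous_on_of_real_id)
  next
    case (Face f)
    then have f: "f \<in> F" using j by simp
    show ?thesis
    proof (cases "\<exists>u\<in>cell_int i. lft i x u \<in> A")
      case True
      then obtain u where "u \<in> cell_int i" "lft i x u \<in> A" by blast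
      then have "lft i x ` cell_dom i \<subseteq> A" using AF[OF f j(3)] Face by simp
      then have "cell_dom i \<inter> lft i x -` A = cell_dom i" by blast
      then show ?thesis using compact_imp_closed[OF compact_cell_dom] by simp
    next
      case False
      let ?S = "\<lambda>j. {s \<in> {0..1}. letter_lift (w f ! j) (walk (take j (w f)) x) s \<in> A}"
      have "cell_dom i \<inter> lft i x -` A = (\<Union>j<length (w f). arc f j ` ?S j)"
      proof
        show "cell_dom i \<inter> lft i x -` A \<subseteq> (\<Union>j<length (w f). arc f j ` ?S j)"
        proof
          fix u assume u: "u \<in> cell_dom i \<inter> lft i x -` A"
          then have "u \<notin> cell_int i" using False by auto
          then have "norm u = 1" using u Face by auto
          then obtain j s where js: "j < length (w f)" "s \<in> {0..<1}" "u = arc f j s" using circle_eq_arc[OF f] by metis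
          then have "s \<in> ?S j" using face_boundary[OF f j(3) js(1), of s] u Face by auto
          then show "u \<in> (\<Union>j<length (w f). arc f j ` ?S j)" using js by blast
        qed
        show "(\<Union>j<length (w f). arc f j ` ?S j) \<subseteq> cell_dom i \<inter> lft i x -` A"
          using face_boundary[OF f j(3)] Face by auto
      qed
      moreover have cl: "closed (arc f k ` ?S k)" if k: "k < length (w f)" for k
      proof -
        have cS: "closed (?S k)" by (rule closed_letter_preimage[OF A word_letter_in_E[OF f k] walk_take_in_V[OF f j(3)]])
        have eq: "?S k = {0..1} \<inter> ?S k" by auto
        have "compact (?S k)" by (subst eq) (rule compact_Int_closed[OF compact_Icc cS])
        then show ?thesis by (intro compact_imp_closed compact_continuous_image continuous_arc)
      qed
      have "closed (\<Union>j<length (w f). arc f j ` ?S j)" by (rule closed_UN) (use cl in simp_all)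
      ultimately show ?thesis by (simp only:)
    qed
  qed
  then show "closed (cell_dom (fst j) \<inter> lft (fst j) (snd j) -` A)" using j by simp
qed

lemma subcomplex_closedin:
  assumes A: "subcomplex A"
  shows "closedin (top_of_set X) A"
proof (rule closedin_by_edges)
  show "A \<subseteq> X" using A by (simp add: subcomplex_def)
  show "closed {s \<in> {0..1}. lft (Edge e) x (of_real s) \<in> A}" if "e \<in> E" "x \<in> V" for e x
    using A that by (rule closed_edge_preimage)
  show "lft (Face f) x ` cball 0 1 \<subseteq> A"
    if "f \<in> F" "x \<in> V" "u \<in> ball 0 1" "lft (Face f) x u \<in> A" for f x u
    using subcomplexD[OF A, of "Face f" x u] that by auto
qed

section \<open>Closed cells and incidence\<close>

definition cl :: "('e, 'f) cell_index \<Rightarrow> 'x \<Rightarrow> 'x set" where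
  "cl i x = lft i x ` cell_dom i"

lemma cell_subset_cl: "cell i x \<subseteq> cl i x"
  unfolding cell_def cl_def using cell_int_subset by blast

lemma cl_subset_X: "i \<in> I \<Longrightarrow> x \<in> V \<Longrightarrow> cl i x \<subseteq> X"
  unfolding cl_def by (rule lft(2))

lemma cell_subset_X: "i \<in> I \<Longrightarrow> x \<in> V \<Longrightarrow> cell i x \<subseteq> X"
  using cell_subset_cl cl_subset_X by blast

lemma cl_Vertex: "x \<in> V \<Longrightarrow> cl Vertex x = {x}"
  by (simp add: cl_def)

lemma in_cell_iff:
  assumes "i \<in> I" "x \<in> V" "j \<in> I" "y \<in> V" "u \<in> cell_int i"
  shows "lft i x u \<in> cell j y \<longleftrightarrow> i = j \<and> x = y"
  using lft_inj[OF assms(1,3,2,4,5)] assms(5) unfolding cell_def by blast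

lemma cell_disjoint:
  assumes "i \<in> I" "x \<in> V" "j \<in> I" "y \<in> V" "cell i x \<inter> cell j y \<noteq> {}"
  shows "i = j \<and> x = y"
proof -
  obtain u where "u \<in> cell_int i" "lft i x u \<in> cell j y" using assms(5) unfolding cell_def[of i] by blast
  then show ?thesis using in_cell_iff[OF assms(1-4)] by blast
qed

lemma cell_nonempty: "cell i x \<noteq> {}"
  using cell_int_nonempty by (simp add: cell_def)

lemma cell_inj:
  assumes "i \<in> I" "x \<in> V" "j \<in> I" "y \<in> V" "cell i x = cell j y"
  shows "i = j \<and> x = y"
  using cell_disjoint[OF assms(1-4)] assms(5) cell_nonempty by simp

lemma V_in_cell:
  assumes "i \<in> I" "x \<in> V" "u \<in> cell_int i" "lft i x u \<in> V"
  shows "i = Vertex"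
  using in_cell_iff[OF assms(1,2), of Vertex "lft i x u" u] assms(3,4) by (simp add: cell_Vertex)

lemma cell_disjoint_V: "i \<in> I \<Longrightarrow> x \<in> V \<Longrightarrow> i \<noteq> Vertex \<Longrightarrow> cell i x \<inter> V = {}"
  unfolding cell_def using V_in_cell by blast

lemma edge_point:
  assumes "e \<in> E" "y \<in> V" "s \<in> {0..1}"
  shows "s \<in> {0<..<1} \<and> lft (Edge e) y (of_real s) \<in> cell (Edge e) y \<or>
    s = 0 \<and> lft (Edge e) y (of_real s) = y \<or> s = 1 \<and> lft (Edge e) y (of_real s) = tgt e y"
proof -
  consider "s = 0" | "s = 1" | "s \<in> {0<..<1}" using assms(3) by fastforce
  then show ?thesis using assms by cases (auto simp: cell_def tgt_def)
qed

lemma cl_Edge: "e \<in> E \<Longrightarrow> x \<in> V \<Longrightarrow> cl (Edge e) x = insert x (insert (tgt e x) (cell (Edge e) x))"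
proof
  assume e: "e \<in> E" and x: "x \<in> V"
  show "cl (Edge e) x \<subseteq> insert x (insert (tgt e x) (cell (Edge e) x))"
    unfolding cl_def using edge_point[OF e x] by fastforce
  have "x \<in> cl (Edge e) x" unfolding cl_def using lft_Edge_0[OF e x] one_in_Edge(2)[of e] by (metis imageI)
  moreover have "tgt e x \<in> cl (Edge e) x" unfolding cl_def tgt_def using one_in_Edge(1)[of e] by (metis imageI)
  ultimately show "insert x (insert (tgt e x) (cell (Edge e) x)) \<subseteq> cl (Edge e) x"
    using cell_subset_cl by auto
qed

lemma letter_edge_in_face:
  assumes f: "f \<in> F" and x: "x \<in> V" and j: "j < length (w f)"
  shows "cl (Edge (fst (w f ! j))) (letter_start (w f ! j) (walk (take j (w f)) x)) \<subseteq> cl (Face f) x"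
proof -
  let ?l = "w f ! j"
  let ?y = "letter_start ?l (walk (take j (w f)) x)"
  have "lft (Edge (fst ?l)) ?y (of_real s) \<in> cl (Face f) x" if s: "s \<in> {0..1}" for s
  proof -
    let ?s = "if snd ?l then s else 1 - s"
    have "lft (Edge (fst ?l)) ?y (of_real s) = letter_lift ?l (walk (take j (w f)) x) ?s"
      by (simp add: letter_lift_def)
    also have "\<dots> = lft (Face f) x (arc f j ?s)" using face_boundary[OF f x j, of ?s] s by auto
    finally show ?thesis unfolding cl_def using arc_in_Face by auto
  qed
  then show ?thesis unfolding cl_def[of "Edge _"] by auto
qed

lemma cl_Face_point:
  assumes f: "f \<in> F" and x: "x \<in> V" and q: "q \<in> cl (Face f) x" "q \<notin> cell (Face f) x"
  shows "(\<exists>j<length (w f). q = walk (take j (w f)) x) \<or>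
    (\<exists>j<length (w f). q \<in> cell (Edge (fst (w f ! j))) (letter_start (w f ! j) (walk (take j (w f)) x)))"
proof -
  obtain u where u: "u \<in> cball 0 1" "q = lft (Face f) x u" using q(1) unfolding cl_def by auto
  then have "norm u = 1" using q(2) unfolding cell_def by force
  then obtain j s where js: "j < length (w f)" "s \<in> {0..<1}" "u = arc f j s" using circle_eq_arc[OF f] by metis
  let ?l = "w f ! j"
  let ?y = "walk (take j (w f)) x"
  have l: "fst ?l \<in> E" by (rule word_letter_in_E[OF f js(1)])
  have y: "?y \<in> V" by (rule walk_take_in_V[OF f x])
  have q: "q = letter_lift ?l ?y s" using face_boundary[OF f x js(1), of s] js u by simp
  show ?thesis
  proof (cases "s = 0")
    case True
    then show ?thesis using q letter_lift_ends[OF l y] js by auto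
  next
    case False
    then have s: "(if snd ?l then s else 1 - s) \<in> {0<..<1}" using js by auto
    have "q \<in> cell (Edge (fst ?l)) (letter_start ?l ?y)" unfolding q letter_lift_def cell_def
      by (intro imageI) (use s in auto)
    then show ?thesis using js by auto
  qed
qed

lemma vertex_in_face:
  assumes f: "f \<in> F" and x: "x \<in> V" and y: "y \<in> V"
  shows "y \<in> cl (Face f) x \<longleftrightarrow> (\<exists>j<length (w f). y = walk (take j (w f)) x)"
proof
  assume yc: "y \<in> cl (Face f) x"
  have "y \<notin> cell (Face f) x" using cell_disjoint_V[of "Face f" x] f x y by auto
  moreover have "y \<notin> cell (Edge e) z" if "e \<in> E" "z \<in> V" for e z
    using cell_disjoint_V[of "Edge e" z] that y by auto
  ultimately show "\<exists>j<length (w f). y = walk (take j (w f)) x"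
    using cl_Face_point[OF f x yc] word_letter_in_E[OF f] letter_start_in_V walk_take_in_V[OF f x] by meson
next
  assume "\<exists>j<length (w f). y = walk (take j (w f)) x"
  then obtain j where j: "j < length (w f)" "y = walk (take j (w f)) x" by blast
  have "lft (Face f) x (arc f j 0) = y"
    using face_boundary[OF f x j(1), of 0] letter_lift_ends(1)[OF word_letter_in_E[OF f j(1)] walk_take_in_V[OF f x]] j by simp
  then show "y \<in> cl (Face f) x" unfolding cl_def using arc_in_Face by (metis imageI)
qed

lemma edge_in_face:
  assumes f: "f \<in> F" and x: "x \<in> V" and e: "e \<in> E" and y: "y \<in> V"
  shows "cell (Edge e) y \<inter> cl (Face f) x \<noteq> {} \<longleftrightarrow>
      (\<exists>j<length (w f). fst (w f ! j) = e \<and> letter_start (w f ! j) (walk (take j (w f)) x) = y)"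
    and "cell (Edge e) y \<inter> cl (Face f) x \<noteq> {} \<Longrightarrow> cl (Edge e) y \<subseteq> cl (Face f) x"
proof -
  have 1: "\<exists>j<length (w f). fst (w f ! j) = e \<and> letter_start (w f ! j) (walk (take j (w f)) x) = y"
    if ne: "cell (Edge e) y \<inter> cl (Face f) x \<noteq> {}"
  proof -
    obtain q where q: "q \<in> cell (Edge e) y" "q \<in> cl (Face f) x" using ne by blast
    have "q \<notin> cell (Face f) x" using cell_disjoint[of "Edge e" y "Face f" x] q(1) e f x y by auto
    moreover have "q \<notin> V" using cell_disjoint_V[of "Edge e" y] q(1) e y by auto
    then have "q \<noteq> walk (take j (w f)) x" for j using walk_take_in_V[OF f x] by auto
    ultimately obtain j where j: "j<length (w f)" "q \<in> cell (Edge (fst (w f ! j))) (letter_start (w f ! j) (walk (take j (w f)) x))"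
      using cl_Face_point[OF f x q(2)] by blast
    have "fst (w f ! j) \<in> E" by (rule word_letter_in_E[OF f j(1)])
    moreover from this have "letter_start (w f ! j) (walk (take j (w f)) x) \<in> V"
      by (rule letter_start_in_V[OF _ walk_take_in_V[OF f x]])
    moreover have "cell (Edge e) y \<inter> cell (Edge (fst (w f ! j))) (letter_start (w f ! j) (walk (take j (w f)) x)) \<noteq> {}"
      using j(2) q(1) by blast
    ultimately have "Edge e = Edge (fst (w f ! j)) \<and> y = letter_start (w f ! j) (walk (take j (w f)) x)"
      using cell_disjoint[of "Edge e" y "Edge (fst (w f ! j))"] e y by simp
    then show ?thesis using j(1) by auto
  qed
  show "cell (Edge e) y \<inter> cl (Face f) x \<noteq> {} \<Longrightarrow> cl (Edge e) y \<subseteq> cl (Face f) x"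
    using 1 letter_edge_in_face[OF f x] by blast
  show "cell (Edge e) y \<inter> cl (Face f) x \<noteq> {} \<longleftrightarrow>
      (\<exists>j<length (w f). fst (w f ! j) = e \<and> letter_start (w f ! j) (walk (take j (w f)) x) = y)"
  proof
    assume "\<exists>j<length (w f). fst (w f ! j) = e \<and> letter_start (w f ! j) (walk (take j (w f)) x) = y"
    then have "cell (Edge e) y \<subseteq> cl (Face f) x" using letter_edge_in_face[OF f x] cell_subset_cl by blast
    then show "cell (Edge e) y \<inter> cl (Face f) x \<noteq> {}" using cell_nonempty by blast
  qed (rule 1)
qed

text \<open>A point of a closed face outside the open face is a vertex of its boundary walk or lies
  on an open edge of it, and then the whole closed edge belongs to the boundary.\<close>

lemma subcomplex_cl:
  assumes i: "i \<in> I" and x: "x \<in> V"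
  shows "subcomplex (cl i x)"
  unfolding subcomplex_def
proof (intro conjI ballI impI cl_subset_X[OF i x])
  fix j y u assume j: "j \<in> I" and y: "y \<in> V" and u: "u \<in> cell_int j" and m: "lft j y u \<in> cl i x"
  have mc: "lft j y u \<in> cell j y" using u by (simp add: cell_def)
  show "lft j y ` cell_dom j \<subseteq> cl i x"
  proof (cases "lft j y u \<in> cell i x")
    case True
    then show ?thesis using in_cell_iff[OF j y i x u] by (simp add: cl_def)
  next
    case False
    show ?thesis
    proof (cases j)
      case Vertex
      then show ?thesis using m u y by (auto simp: cl_def)
    next
      case (Edge e)
      have notV: "lft j y u \<notin> V" using V_in_cell[OF j y u] Edge by auto
      show ?thesis
      proof (cases i)
        case i': (Face f)
        then show ?thesis using edge_in_face(2)[of f x e y] m mc i x j y Edge unfolding cl_def[of "Edge e"] by auto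
      next
        case i': (Edge e')
        then have e': "e' \<in> E" using i by simp
        have "lft j y u \<in> insert x (insert (tgt e' x) (cell i x))" using m cl_Edge[OF e' x] i' by simp
        then show ?thesis using False notV x tgt_in_V[OF e' x] by (elim insertE) simp_all
      next
        case Vertex
        then have "lft j y u = x" using m x by (simp add: cl_Vertex)
        then show ?thesis using notV x by simp
      qed
    next
      case (Face g)
      have notV: "lft j y u \<notin> V" using V_in_cell[OF j y u] Face by auto
      have notE: "lft j y u \<notin> cell (Edge e) z" if "e \<in> E" "z \<in> V" for e z
        using in_cell_iff[OF j y _ _ u, of "Edge e" z] Face that by auto
      show ?thesis
      proof (cases i)
        case i': (Face f)
        then show ?thesis using cl_Face_point[of f x "lft j y u"] m False i x notV notE
            walk_take_in_V[of f x] letter_start_in_V word_letter_in_E[of f] by (metis in_I(3))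
      next
        case i': (Edge e')
        then have e': "e' \<in> E" using i by simp
        have "lft j y u \<in> insert x (insert (tgt e' x) (cell i x))" using m cl_Edge[OF e' x] i' by simp
        then show ?thesis using False notV x tgt_in_V[OF e' x] by (elim insertE) simp_all
      next
        case Vertex
        then have "lft j y u = x" using m x by (simp add: cl_Vertex)
        then show ?thesis using notV x by simp
      qed
    qed
  qed
qed

text \<open>This makes closed cells a topological notion: a homeomorphism that permutes the open
  cells also permutes their closures and so preserves incidence.\<close>

lemma cl_eq_closure:
  assumes i: "i \<in> I" and x: "x \<in> V"
  shows "top_of_set X closure_of cell i x = cl i x"
proof
  show "top_of_set X closure_of cell i x \<subseteq> cl i x"
    by (rule closure_of_minimal[OF cell_subset_cl subcomplex_closedin[OF subcomplex_cl[OF i x]]])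
  have "continuous_map (top_of_set (cell_dom i)) (top_of_set X) (lft i x)"
    using lft(1,2)[OF i x] by auto
  then have "lft i x ` (top_of_set (cell_dom i) closure_of cell_int i) \<subseteq> top_of_set X closure_of (lft i x ` cell_int i)"
    by (rule continuous_map_image_closure_subset)
  moreover have "top_of_set (cell_dom i) closure_of cell_int i = cell_dom i"
    using cell_dom_subset_closure[of i] cell_int_subset[of i] by (simp add: closure_of_subtopology Int_absorb1 Int_absorb2)
  ultimately show "cl i x \<subseteq> top_of_set X closure_of cell i x" by (simp add: cl_def cell_def)
qed

text \<open>Within the preimage of one open cell, each lifted cell is the trace of its closed cell.
  The union of all the other closed cells is again a subcomplex and therefore closed, although the
  family may be infinite.\<close>

lemma components_open_cell:
  assumes i: "i \<in> I"
  shows "components (X \<inter> p -` open_cell v \<phi> \<psi> i) = cell i ` V"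
proof (rule components_of_clopen_partition)
  let ?S = "X \<inter> p -` open_cell v \<phi> \<psi> i"
  have inS: "lft i x u \<in> ?S \<longleftrightarrow> u \<in> cell_int i" if "x \<in> V" "u \<in> cell_dom i" for x u
    using lft_in_X[OF i that] lft(4)[OF i that] \<kappa>_int_iff[OF i that(2)] by simp
  have cellS: "cell i x = ?S \<inter> cl i x" if x: "x \<in> V" for x
    using inS[OF x] cell_int_subset[of i] unfolding cell_def cl_def by auto
  show S: "?S = \<Union> (cell i ` V)"
  proof
    show "?S \<subseteq> \<Union> (cell i ` V)"
    proof
      fix y assume y: "y \<in> ?S"
      then obtain u where u: "u \<in> cell_int i" "p y = \<kappa> i u" by (auto simp: open_cell_eq)
      then obtain x where "x \<in> V" "lft i x u = y" using lft_through[OF i _ _ u(2)] y cell_int_subset by blast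
      then show "y \<in> \<Union> (cell i ` V)" using u(1) by (auto simp: cell_def)
    qed
    show "\<Union> (cell i ` V) \<subseteq> ?S" using cellS by blast
  qed
  show "connected A \<and> A \<noteq> {}" if hA: "A \<in> cell i ` V" for A
  proof -
    obtain x where x: "x \<in> V" "A = cell i x" using hA by blast
    have "continuous_on (cell_int i) (lft i x)" using lft(1)[OF i x(1)] cell_int_subset continuous_on_subset by blast
    then show ?thesis using x connected_continuous_image[OF _ connected_cell_int] cell_nonempty unfolding cell_def by auto
  qed
  show "closedin (top_of_set ?S) A \<and> closedin (top_of_set ?S) (?S - A)" if hA: "A \<in> cell i ` V" for A
  proof -
    obtain x where x: "x \<in> V" "A = cell i x" using hA by blast
    have cls: "closedin (top_of_set ?S) (?S \<inter> B)" if B: "subcomplex B" for B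
    proof -
      obtain T where "closed T" "B = X \<inter> T" using subcomplex_closedin[OF B] by (auto simp: closedin_closed)
      then show ?thesis by (auto simp: closedin_closed)
    qed
    let ?B = "\<Union> (cl i ` (V - {x}))"
    have "subcomplex ?B" by (rule subcomplex_Union) (auto intro!: subcomplex_cl i)
    moreover have "?S - A = ?S \<inter> ?B"
    proof
      show "?S - A \<subseteq> ?S \<inter> ?B" using S x cell_subset_cl by blast
      show "?S \<inter> ?B \<subseteq> ?S - A"
      proof
        fix q assume q: "q \<in> ?S \<inter> ?B"
        then obtain y where y: "y \<in> V" "y \<noteq> x" "q \<in> cl i y" by blast
        then have "q \<in> cell i y" using q cellS by auto
        then have "q \<notin> cell i x" using cell_disjoint[OF i y(1) i x(1)] y(2) by blast
        then show "q \<in> ?S - A" using q x by auto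
      qed
    qed
    ultimately show ?thesis using cls[OF subcomplex_cl[OF i x(1)]] cls x cellS by auto
  qed
qed

definition cells :: "'x set set" where
  "cells = {cell i x | i x. i \<in> I \<and> x \<in> V}"

lemma lifted_cells_eq: "lifted_cells X p (open_cell v \<phi> \<psi> ` I) = cells"
  unfolding lifted_cells_def cells_def using components_open_cell by auto

end

section \<open>Local systems and labellings\<close>

text \<open>Every abstract topology is realised on a subset of one type in the class of topological
  spaces, so that the library's coverings apply to spaces constructed inside a proof.\<close>

datatype 'a tagged = Tagged "'a topology" (untag: 'a)

instantiation tagged :: (type) topological_space
begin

definition open_tagged :: "'a tagged set \<Rightarrow> bool" where
  "open_tagged U \<longleftrightarrow> (\<forall>T. openin T {x \<in> topspace T. Tagged T x \<in> U})"

instance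
proof
  show "open (UNIV :: 'a tagged set)" by (simp add: open_tagged_def)
next
  fix S U :: "'a tagged set" assume "open S" "open U"
  moreover have "{x \<in> topspace T. Tagged T x \<in> S \<inter> U} = {x \<in> topspace T. Tagged T x \<in> S} \<inter> {x \<in> topspace T. Tagged T x \<in> U}" for T
    by auto
  ultimately show "open (S \<inter> U)" by (simp add: open_tagged_def openin_Int)
next
  fix K :: "'a tagged set set" assume K: "\<forall>S\<in>K. open S"
  have "{x \<in> topspace T. Tagged T x \<in> \<Union> K} = \<Union> ((\<lambda>S. {x \<in> topspace T. Tagged T x \<in> S}) ` K)" for T
    by auto
  then show "open (\<Union> K)" using K by (auto simp: open_tagged_def intro!: openin_Union)
qed

end

lemma openin_TaggedI:
  assumes "openin T W"
  shows "open (Tagged T ` W)"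
proof -
  have "{x \<in> topspace T'. Tagged T' x \<in> Tagged T ` W} = (if T' = T then W else {})" for T'
    using openin_subset[OF assms] by auto
  then show ?thesis using assms by (auto simp: open_tagged_def)
qed

lemma open_TaggedD: "open U \<Longrightarrow> openin T {x \<in> topspace T. Tagged T x \<in> U}"
  by (simp add: open_tagged_def)

text \<open>The bundle \<open>Z \<times> 's\<close> whose flat sections over the cell \<open>k i\<close> are the maps
  \<open>u \<mapsto> c i u \<tau>\<close>.\<close>

definition bundle_open :: "'z set \<Rightarrow> 'i set \<Rightarrow> ('i \<Rightarrow> complex set) \<Rightarrow> ('i \<Rightarrow> complex \<Rightarrow> 'z) \<Rightarrow>
    ('i \<Rightarrow> complex \<Rightarrow> 's \<Rightarrow> 's) \<Rightarrow> ('z \<times> 's) set \<Rightarrow> bool" where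
  "bundle_open Z I D k c W \<longleftrightarrow> W \<subseteq> Z \<times> UNIV \<and>
     (\<forall>i\<in>I. \<forall>\<tau>. openin (top_of_set (D i)) {u \<in> D i. (k i u, c i u \<tau>) \<in> W})"

lemma istopology_bundle: "istopology (bundle_open Z I D k c)"
  unfolding istopology_def
proof (intro conjI allI impI)
  fix S T assume S: "bundle_open Z I D k c S" and T: "bundle_open Z I D k c T"
  have "{u \<in> D i. (k i u, c i u \<tau>) \<in> S \<inter> T} = {u \<in> D i. (k i u, c i u \<tau>) \<in> S} \<inter> {u \<in> D i. (k i u, c i u \<tau>) \<in> T}" for i \<tau>
    by auto
  then show "bundle_open Z I D k c (S \<inter> T)" using S T unfolding bundle_open_def by auto
next
  fix \<K> assume K: "\<forall>S\<in>\<K>. bundle_open Z I D k c S"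
  have "{u \<in> D i. (k i u, c i u \<tau>) \<in> \<Union> \<K>} = \<Union> ((\<lambda>S. {u \<in> D i. (k i u, c i u \<tau>) \<in> S}) ` \<K>)" for i \<tau>
    by auto
  then show "bundle_open Z I D k c (\<Union> \<K>)" using K unfolding bundle_open_def
    by (intro conjI ballI allI) (fastforce, auto intro!: openin_Union)
qed

definition bundle_top where "bundle_top Z I D k c = topology (bundle_open Z I D k c)"

lemma openin_bundle: "openin (bundle_top Z I D k c) W \<longleftrightarrow> bundle_open Z I D k c W"
  unfolding bundle_top_def by (simp add: topology_inverse'[OF istopology_bundle])

lemma topspace_bundle:
  assumes "\<And>i u. i \<in> I \<Longrightarrow> u \<in> D i \<Longrightarrow> k i u \<in> Z"
  shows "topspace (bundle_top Z I D k c) = Z \<times> UNIV"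
proof
  show "topspace (bundle_top Z I D k c) \<subseteq> Z \<times> UNIV"
    unfolding topspace_def using openin_bundle unfolding bundle_open_def by blast
  have "{u \<in> D i. (k i u, c i u \<tau>) \<in> Z \<times> UNIV} = D i" if "i \<in> I" for i \<tau> using assms that by auto
  then have "openin (bundle_top Z I D k c) (Z \<times> UNIV)" unfolding openin_bundle bundle_open_def by simp
  then show "Z \<times> UNIV \<subseteq> topspace (bundle_top Z I D k c)" by (rule openin_subset)
qed

lemma openin_eventually:
  fixes D :: "'a::topological_space set"
  assumes "A \<subseteq> D" "\<And>u. u \<in> A \<Longrightarrow> \<forall>\<^sub>F u' in at u within D. u' \<in> A"
  shows "openin (top_of_set D) A"
proof (subst openin_subopen, intro ballI)
  fix u assume u: "u \<in> A"
  obtain S where S: "open S" "u \<in> S" "\<And>y. y \<in> S \<Longrightarrow> y \<noteq> u \<Longrightarrow> y \<in> D \<Longrightarrow> y \<in> A"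
    using assms(2)[OF u] unfolding eventually_at_topological by blast
  show "\<exists>T. openin (top_of_set D) T \<and> u \<in> T \<and> T \<subseteq> A"
  proof (intro exI[of _ "D \<inter> S"] conjI)
    show "openin (top_of_set D) (D \<inter> S)" using S(1) by (rule openin_open_Int)
    show "D \<inter> S \<subseteq> A" using S(3) u by blast
  qed (use S u assms(1) in auto)
qed

lemma openin_eventuallyD:
  fixes D :: "'a::topological_space set"
  assumes "openin (top_of_set D) A" "u \<in> A"
  shows "\<forall>\<^sub>F u' in at u within D. u' \<in> A"
proof -
  obtain S where "open S" "A = D \<inter> S" using assms(1) by (auto simp: openin_open)
  then show ?thesis unfolding eventually_at_topological using assms(2) by blast
qed

text \<open>A trivialisation \<open>g\<close> over \<open>U\<close>. It places the flat section with
  value \<tau> over the cell \<open>i\<close> in the sheet \<open>d i u \<tau>\<close>; flatness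
  means that \<open>d i\<close> is locally constant.\<close>

definition flat_chart :: "'z::topological_space set \<Rightarrow> 'i set \<Rightarrow> ('i \<Rightarrow> complex set) \<Rightarrow> ('i \<Rightarrow> complex \<Rightarrow> 'z) \<Rightarrow>
    ('i \<Rightarrow> complex \<Rightarrow> 's \<Rightarrow> 's) \<Rightarrow> 'z set \<Rightarrow> ('z \<Rightarrow> 's \<Rightarrow> 's) \<Rightarrow> ('i \<Rightarrow> complex \<Rightarrow> 's \<Rightarrow> 's) \<Rightarrow> bool" where
  "flat_chart Z I D k c U g d \<longleftrightarrow> openin (top_of_set Z) U \<and> (\<forall>z\<in>U. bij (g z)) \<and>
     (\<forall>i\<in>I. \<forall>u\<in>D i. k i u \<in> U \<longrightarrow> (\<forall>\<sigma> \<tau>. g (k i u) \<sigma> = c i u \<tau> \<longleftrightarrow> \<sigma> = d i u \<tau>) \<and>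
        (\<forall>\<^sub>F u' in at u within D i. d i u' = d i u))"

text \<open>The sheets over a chart are the graphs of \<open>g\<close> for a fixed fibre argument.
  They are open because the sheet that contains a flat section is locally constant along it.\<close>

lemma bundle_covering:
  fixes Z :: "'z::topological_space set" and c :: "'i \<Rightarrow> complex \<Rightarrow> 's \<Rightarrow> 's"
  assumes w: "weak_top Z I D k"
    and surj: "\<And>i u. i \<in> I \<Longrightarrow> u \<in> D i \<Longrightarrow> surj (c i u)"
    and charts: "\<And>z. z \<in> Z \<Longrightarrow> \<exists>U g d. z \<in> U \<and> flat_chart Z I D k c U g d"
  defines "T \<equiv> bundle_top Z I D k c"
  shows "covering_space (Tagged T ` (Z \<times> UNIV)) (\<lambda>y. fst (untag y)) Z"
    and "i \<in> I \<Longrightarrow> continuous_on (D i) (\<lambda>u. Tagged T (k i u, c i u \<tau>))"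
proof -
  have kZ: "k i u \<in> Z" if "i \<in> I" "u \<in> D i" for i u using weak_topD(4)[OF w that(1)] that(2) by auto
  have top: "topspace T = Z \<times> UNIV" unfolding T_def by (rule topspace_bundle[OF kZ])
  have openT: "openin (top_of_set (Tagged T ` (Z \<times> UNIV))) (Tagged T ` W)" if "bundle_open Z I D k c W" for W
  proof -
    have "openin T W" using that openin_bundle unfolding T_def by blast
    then have "open (Tagged T ` W)" by (rule openin_TaggedI)
    moreover have "Tagged T ` W \<subseteq> Tagged T ` (Z \<times> UNIV)" using that unfolding bundle_open_def by auto
    ultimately show ?thesis by (simp add: open_subset)
  qed
  have opT: "openin T W \<longleftrightarrow> bundle_open Z I D k c W" for W unfolding T_def by (rule openin_bundle)
  have pre: "bundle_open Z I D k c {x \<in> Z \<times> UNIV. Tagged T x \<in> B}" if "open B" for B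
    using open_TaggedD[OF that, of T] unfolding top opT .
  show c2: "continuous_on (D i) (\<lambda>u. Tagged T (k i u, c i u \<tau>))" if i: "i \<in> I" for i \<tau>
    unfolding continuous_on_open_invariant
  proof (intro allI impI)
    fix B :: "('z \<times> 's) tagged set" assume B: "open B"
    have "{u \<in> D i. (k i u, c i u \<tau>) \<in> {x \<in> Z \<times> UNIV. Tagged T x \<in> B}} = D i \<inter> (\<lambda>u. Tagged T (k i u, c i u \<tau>)) -` B"
      using kZ[OF i] by auto
    then have "openin (top_of_set (D i)) (D i \<inter> (\<lambda>u. Tagged T (k i u, c i u \<tau>)) -` B)"
      using pre[OF B, unfolded bundle_open_def, THEN conjunct2, rule_format, OF i, of \<tau>] by (simp only:)
    then show "\<exists>A. open A \<and> A \<inter> D i = (\<lambda>u. Tagged T (k i u, c i u \<tau>)) -` B \<inter> D i"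
      unfolding openin_open by (auto simp: Int_commute)
  qed
  let ?Y = "Tagged T ` (Z \<times> UNIV)" and ?\<pi> = "\<lambda>y. fst (untag y)"
  have cont: "continuous_on ?Y ?\<pi>"
    unfolding continuous_on_open_invariant
  proof (intro allI impI)
    fix B :: "'z set" assume B: "open B"
    have "bundle_open Z I D k c ((Z \<inter> B) \<times> UNIV)" unfolding bundle_open_def
    proof (intro conjI ballI allI)
      fix i \<tau> assume i: "i \<in> I"
      have "{u \<in> D i. (k i u, c i u \<tau>) \<in> (Z \<inter> B) \<times> UNIV} = D i \<inter> k i -` B" using kZ[OF i] by auto
      then show "openin (top_of_set (D i)) {u \<in> D i. (k i u, c i u \<tau>) \<in> (Z \<inter> B) \<times> UNIV}"
        using continuous_openin_preimage_gen[OF weak_topD(3)[OF w i] B] by simp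
    qed auto
    from openT[OF this] obtain A where A: "open A" "Tagged T ` ((Z \<inter> B) \<times> UNIV) = ?Y \<inter> A" unfolding openin_open by auto
    moreover have "Tagged T ` ((Z \<inter> B) \<times> UNIV) = ?\<pi> -` B \<inter> ?Y" by auto
    ultimately show "\<exists>A. open A \<and> A \<inter> ?Y = ?\<pi> -` B \<inter> ?Y" by (intro exI[of _ A]) (simp add: Int_commute)
  qed
  show "covering_space ?Y ?\<pi> Z"
  proof (rule covering_spaceI[OF cont])
    show "?\<pi> ` ?Y = Z" by force
    fix z assume z: "z \<in> Z"
    obtain U g d where zU: "z \<in> U" and fc: "flat_chart Z I D k c U g d"
      using charts[OF z] by blast
    have U: "openin (top_of_set Z) U" "z \<in> U" "\<And>z'. z' \<in> U \<Longrightarrow> bij (g z')"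
      using zU fc by (simp_all add: flat_chart_def)
    have iff: "g (k i u) \<sigma> = c i u \<tau> \<longleftrightarrow> \<sigma> = d i u \<tau>"
      and ev: "\<forall>\<^sub>F u' in at u within D i. d i u' = d i u" if "i \<in> I" "u \<in> D i" "k i u \<in> U" for i u \<sigma> \<tau>
      using fc that by (simp_all add: flat_chart_def)
    have UZ: "U \<subseteq> Z" using U(1) openin_imp_subset by blast
    have evU: "\<forall>\<^sub>F u' in at u within D i. u' \<in> D i \<and> k i u' \<in> U" if "i \<in> I" "u \<in> D i" "k i u \<in> U" for i u
    proof -
      have "openin (top_of_set (D i)) (D i \<inter> k i -` U)"
        by (rule continuous_openin_preimage[OF weak_topD(3)[OF w that(1)] _ U(1)]) (use kZ that(1) in auto)
      from openin_eventuallyD[OF this, of u] show ?thesis using that by simp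
    qed
    define sheet where "sheet \<sigma> = Tagged T ` ((\<lambda>z'. (z', g z' \<sigma>)) ` U)" for \<sigma>
    show "\<exists>T'. z \<in> T' \<and> openin (top_of_set Z) T' \<and> (\<exists>vv. \<Union> vv = ?Y \<inter> ?\<pi> -` T' \<and>
        (\<forall>u\<in>vv. openin (top_of_set ?Y) u) \<and> pairwise disjnt vv \<and> (\<forall>u\<in>vv. \<exists>q. homeomorphism u T' ?\<pi> q))"
    proof (intro exI[of _ U] conjI U(1,2) exI[of _ "range sheet"])
      show "\<Union> (range sheet) = ?Y \<inter> ?\<pi> -` U"
      proof
        show "\<Union> (range sheet) \<subseteq> ?Y \<inter> ?\<pi> -` U" using UZ unfolding sheet_def by auto
        show "?Y \<inter> ?\<pi> -` U \<subseteq> \<Union> (range sheet)"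
        proof
          fix y assume "y \<in> ?Y \<inter> ?\<pi> -` U"
          then obtain z' s where y: "y = Tagged T (z', s)" "z' \<in> U" by auto
          obtain \<sigma> where "s = g z' \<sigma>" using surjD[OF bij_is_surj[OF U(3)[OF y(2)]], of s] by blast
          then show "y \<in> \<Union> (range sheet)" using y unfolding sheet_def by auto
        qed
      qed
      show "\<forall>u\<in>range sheet. openin (top_of_set ?Y) u"
      proof
        fix u assume "u \<in> range sheet"
        then obtain \<sigma> where s: "u = sheet \<sigma>" by blast
        have "bundle_open Z I D k c ((\<lambda>z'. (z', g z' \<sigma>)) ` U)" unfolding bundle_open_def
        proof (intro conjI ballI allI)
          show "(\<lambda>z'. (z', g z' \<sigma>)) ` U \<subseteq> Z \<times> UNIV" using UZ by auto
          fix i \<tau> assume i: "i \<in> I"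
          have eq: "{u \<in> D i. (k i u, c i u \<tau>) \<in> (\<lambda>z'. (z', g z' \<sigma>)) ` U} = {u \<in> D i. k i u \<in> U \<and> \<sigma> = d i u \<tau>}"
            using iff[OF i] by (auto simp: image_iff) metis+
          show "openin (top_of_set (D i)) {u \<in> D i. (k i u, c i u \<tau>) \<in> (\<lambda>z'. (z', g z' \<sigma>)) ` U}"
            unfolding eq
          proof (rule openin_eventually)
            fix u assume "u \<in> {u \<in> D i. k i u \<in> U \<and> \<sigma> = d i u \<tau>}"
            then have u: "u \<in> D i" "k i u \<in> U" "\<sigma> = d i u \<tau>" by auto
            show "\<forall>\<^sub>F u' in at u within D i. u' \<in> {u \<in> D i. k i u \<in> U \<and> \<sigma> = d i u \<tau>}"
              using evU[OF i u(1,2)] ev[OF i u(1,2)] by eventually_elim (use u(3) in simp)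
          qed auto
        qed
        then show "openin (top_of_set ?Y) u" using openT s unfolding sheet_def by simp
      qed
      show "pairwise disjnt (range sheet)"
      proof (rule pairwiseI)
        fix a b assume ab: "a \<in> range sheet" "b \<in> range sheet" "a \<noteq> b"
        then obtain \<sigma> \<sigma>' where s: "a = sheet \<sigma>" "b = sheet \<sigma>'" "\<sigma> \<noteq> \<sigma>'" by blast
        have "g z' \<sigma> \<noteq> g z' \<sigma>'" if "z' \<in> U" for z'
          using injD[OF bij_is_inj[OF U(3)[OF that]]] s(3) by blast
        then show "disjnt a b" unfolding s disjnt_def sheet_def by auto
      qed
      show "\<forall>u\<in>range sheet. \<exists>q. homeomorphism u U ?\<pi> q"
      proof
        fix u assume "u \<in> range sheet"
        then obtain \<sigma> where s: "u = sheet \<sigma>" by blast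
        let ?q = "\<lambda>z'. Tagged T (z', g z' \<sigma>)"
        have "continuous_on U ?q" unfolding continuous_on_open_invariant
        proof (intro allI impI)
          fix B :: "('z \<times> 's) tagged set" assume B: "open B"
          have "openin (top_of_set Z) (U \<inter> ?q -` B)"
          proof (rule weak_top_open[OF w])
            fix i assume i: "i \<in> I"
            show "openin (top_of_set (D i)) (D i \<inter> k i -` (U \<inter> ?q -` B))"
            proof (rule openin_eventually)
              fix u assume u: "u \<in> D i \<inter> k i -` (U \<inter> ?q -` B)"
              then have u': "u \<in> D i" "k i u \<in> U" by auto
              \<comment> \<open>Surjectivity of \<open>c i u\<close> provides a flat section through
                the given point, and near \<open>u\<close> the sheet stays on this section.\<close>
              obtain \<tau> where \<tau>: "c i u \<tau> = g (k i u) \<sigma>" using surj[OF i u'(1)] by (metis surjD)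
              then have \<sigma>: "\<sigma> = d i u \<tau>" using iff[OF i u'] by metis
              let ?A = "{u \<in> D i. (k i u, c i u \<tau>) \<in> {x \<in> Z \<times> UNIV. Tagged T x \<in> B}}"
              have "openin (top_of_set (D i)) ?A" using pre[OF B] i unfolding bundle_open_def by blast
              moreover have "u \<in> ?A" using u \<tau> UZ by auto
              ultimately have "\<forall>\<^sub>F u' in at u within D i. u' \<in> ?A" by (rule openin_eventuallyD)
              then show "\<forall>\<^sub>F u' in at u within D i. u' \<in> D i \<inter> k i -` (U \<inter> ?q -` B)"
                using evU[OF i u'] ev[OF i u']
              proof eventually_elim
                case (elim u1)
                then have "g (k i u1) \<sigma> = c i u1 \<tau>" using iff[OF i, of u1 \<sigma> \<tau>] \<sigma> by simp
                then show ?case using elim by simp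
              qed
            qed auto
          qed (use UZ in auto)
          then obtain A where "open A" "U \<inter> ?q -` B = Z \<inter> A" by (auto simp: openin_open)
          then show "\<exists>A. open A \<and> A \<inter> U = ?q -` B \<inter> U" using UZ by (intro exI[of _ A]) blast
        qed
        moreover have "continuous_on u ?\<pi>" using cont by (rule continuous_on_subset) (use s UZ sheet_def in auto)
        ultimately have "homeomorphism u U ?\<pi> ?q"
          unfolding homeomorphism_def s sheet_def by (auto simp: image_image)
        then show "\<exists>q. homeomorphism u U ?\<pi> q" by blast
      qed
    qed
  qed
qed

locale simple_cover = cell_cover Z v \<phi> \<psi> E F w X p
  for Z :: "'z::topological_space set" and v :: 'z
    and \<phi> :: "'e \<Rightarrow> real \<Rightarrow> 'z" and \<psi> :: "'f \<Rightarrow> complex \<Rightarrow> 'z" and E :: "'e set" and F :: "'f set"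
    and w :: "'f \<Rightarrow> 'e word" and X :: "'x::topological_space set" and p :: "'x \<Rightarrow> 'z" +
  assumes simply_connected: "simply_connected X"
begin

lemma locally_path_connected_X: "locally path_connected X"
  by (rule weak_top_locally_path_connected[OF weak_X])

lemma liftable_X:
  assumes "covering_space Y q S" "continuous_on X h" "h ` X \<subseteq> S"
  shows "liftable Y q h X"
  by (rule simply_connected_lift[OF assms(1) simply_connected locally_path_connected_X assms(2,3)])

lemma connected_X: "connected X"
proof -
  have "path_connected X" unfolding path_connected_def
    using simply_connected_path_exists[OF simply_connected] by metis
  then show ?thesis by (rule path_connected_imp_connected)
qed

text \<open>The bundle with these flat sections is a covering of \<open>Z\<close>, so
  \<open>p\<close> lifts to it over the simply connected \<open>X\<close>. The fibre coordinate of
  this lift is the labelling.\<close>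

lemma flat_labelling:
  fixes c :: "('e, 'f) cell_index \<Rightarrow> complex \<Rightarrow> 's \<Rightarrow> 's"
  assumes surj: "\<And>i u. i \<in> I \<Longrightarrow> u \<in> cell_dom i \<Longrightarrow> surj (c i u)"
    and charts: "\<And>z. z \<in> Z \<Longrightarrow> \<exists>U g d. z \<in> U \<and> flat_chart Z I cell_dom \<kappa> c U g d"
    and base: "\<And>i. i \<in> I \<Longrightarrow> c i (cell_base i) = id"
    and x0: "x0 \<in> V"
  obtains L where "L x0 = s0" "\<And>i x u. i \<in> I \<Longrightarrow> x \<in> V \<Longrightarrow> u \<in> cell_dom i \<Longrightarrow> L (lft i x u) = c i u (L x)"
proof -
  define T where "T = bundle_top Z I cell_dom \<kappa> c"
  let ?Y = "Tagged T ` (Z \<times> UNIV)" and ?\<pi> = "\<lambda>y. fst (untag y)"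
  have cov: "covering_space ?Y ?\<pi> Z" unfolding T_def
    by (rule bundle_covering(1)[OF weak_Z]) (fact surj, fact charts)
  have con: "continuous_on (cell_dom i) (\<lambda>u. Tagged T (\<kappa> i u, c i u \<tau>))" if "i \<in> I" for i \<tau> unfolding T_def
    by (rule bundle_covering(2)[OF weak_Z _ _ that]) (fact surj, fact charts)
  have "liftable ?Y ?\<pi> p X"
    by (rule liftable_X[OF cov covering_space_imp_continuous[OF covering]]) (use p_in_Z in auto)
  moreover have "Tagged T (v, s0) \<in> ?Y" "?\<pi> (Tagged T (v, s0)) = p x0" using v_in_Z p_V[OF x0] by auto
  ultimately obtain G where G: "continuous_on X G" "G ` X \<subseteq> ?Y" "G x0 = Tagged T (v, s0)"
    "\<And>x. x \<in> X \<Longrightarrow> ?\<pi> (G x) = p x" using V_in_X[OF x0] by (elim liftableE) auto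
  have Geq: "G x = Tagged T (p x, snd (untag (G x)))" if "x \<in> X" for x
    using G(2) G(4)[OF that] that by (metis (no_types, lifting) imageE image_subset_iff prod.collapse tagged.sel)
  show ?thesis
  proof (rule that[of "\<lambda>x. snd (untag (G x))"])
    show "snd (untag (G x0)) = s0" using G(3) by simp
    fix i x u assume i: "i \<in> I" and x: "x \<in> V" and u: "u \<in> cell_dom i"
    let ?\<tau> = "snd (untag (G x))"
    note L = lft[OF i x]
    have "G (lft i x u) = Tagged T (\<kappa> i u, c i u ?\<tau>)"
    proof (rule covering_lift_unique[OF cov convex_connected[OF convex_cell_dom[of i]], of "\<lambda>u. G (lft i x u)" _ "cell_base i"])
      show "continuous_on (cell_dom i) (\<lambda>u. G (lft i x u))"
        by (rule continuous_on_compose2[OF G(1) L(1,2)])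
      show "continuous_on (cell_dom i) (\<lambda>u. Tagged T (\<kappa> i u, c i u ?\<tau>))" by (rule con[OF i])
      show "(\<lambda>u. G (lft i x u)) ` cell_dom i \<subseteq> ?Y" using L(2) G(2) by blast
      show "(\<lambda>u. Tagged T (\<kappa> i u, c i u ?\<tau>)) ` cell_dom i \<subseteq> ?Y" using \<kappa>_in_Z[OF i] by auto
      show "?\<pi> (G (lft i x u)) = ?\<pi> (Tagged T (\<kappa> i u, c i u ?\<tau>))" if "u \<in> cell_dom i" for u
        using G(4)[OF lft_in_X[OF i x that]] L(4)[OF that] by simp
      show "G (lft i x (cell_base i)) = Tagged T (\<kappa> i (cell_base i), c i (cell_base i) ?\<tau>)"
        using L(3) base[OF i] \<kappa>_base[OF i] Geq[OF V_in_X[OF x]] p_V[OF x] by simp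
    qed (use u cell_base_in in auto)
    then show "snd (untag (G (lft i x u))) = c i u ?\<tau>" by simp
  qed
qed

end

subsection \<open>Angles\<close>

lemma cis_Arg2pi: "u \<noteq> 0 \<Longrightarrow> cis (Arg2pi u) = sgn u"
  using Arg2pi_eq[of u] by (simp add: cis_conv_exp sgn_eq field_simps)

lemma cis_eq_cisE:
  assumes "cis a = cis b"
  obtains k :: int where "a = b + 2 * pi * of_int k"
proof -
  have "sin a = sin b \<and> cos a = cos b" using assms by (simp add: complex_eq_iff)
  then show ?thesis using that unfolding sin_cos_eq_iff by blast
qed

lemma periodic_int:
  fixes P :: "real \<Rightarrow> 'a"
  assumes "\<And>t. P (t + c) = P t"
  shows "P (t + c * of_int k) = P t"
proof (induction k)
  case (nonneg n)
  show ?case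
  proof (induction n)
    case (Suc n)
    have "P (t + c * of_int (int (Suc n))) = P ((t + c * of_int (int n)) + c)" by (simp add: algebra_simps)
    then show ?case using Suc assms by simp
  qed simp
next
  case (neg n)
  show ?case
  proof (induction n)
    case 0
    show ?case using assms[of "t - c"] by simp
  next
    case (Suc n)
    have "P (t + c * of_int (- int (Suc n))) = P ((t + c * of_int (- int (Suc (Suc n)))) + c)" by (simp add: algebra_simps)
    then show ?case using Suc assms by simp
  qed
qed

text \<open>\<open>Arg2pi\<close> jumps at the positive real axis, but only by a full turn, to which
  a property of period \<open>N\<close> is insensitive.\<close>

lemma angle_eventually:
  assumes u0: "u0 \<noteq> 0" and N: "N > (0::real)" and per: "\<And>t. P (t + N) = P t"
    and ev: "\<forall>\<^sub>F t in nhds (Arg2pi u0 * N / (2 * pi)). P t"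
  shows "\<forall>\<^sub>F u in nhds u0. P (Arg2pi u * N / (2 * pi))"
proof -
  \<comment> \<open>The angle measured from \<open>u0\<close>: \<open>Arg (u / u0)\<close> is
    continuous near \<open>u0\<close> and differs from the change of \<open>Arg2pi\<close> by full
    turns.\<close>
  define h where "h u = Arg2pi u0 * N / (2 * pi) + Arg (u / u0) * N / (2 * pi)" for u
  have h0: "h u0 = Arg2pi u0 * N / (2 * pi)" using u0 by (simp add: h_def)
  have "isCont (\<lambda>u. Arg (u / u0)) u0"
    by (rule isCont_o2[where g = Arg]) (use u0 in \<open>auto intro!: continuous_intros continuous_at_Arg\<close>)
  then have "isCont h u0" unfolding h_def by (intro continuous_intros) auto
  then have "filterlim h (nhds (h u0)) (nhds u0)"
    by (simp add: continuous_at tendsto_at_iff_tendsto_nhds)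
  then have 1: "\<forall>\<^sub>F u in nhds u0. P (h u)" using ev h0 by (simp add: filterlim_iff)
  have 2: "\<forall>\<^sub>F u in nhds u0. u \<noteq> 0" by (rule t1_space_nhds[OF u0])
  show ?thesis using 1 2
  proof eventually_elim
    case (elim u)
    have "u = u / u0 * u0" using u0 by simp
    then have "sgn u = sgn (u / u0) * sgn u0" by (metis sgn_mult)
    then have "cis (Arg2pi u) = cis (Arg (u / u0) + Arg2pi u0)"
      using u0 elim(2) by (simp add: cis_Arg2pi cis_Arg cis_mult[symmetric])
    then obtain k :: int where "Arg2pi u = Arg (u / u0) + Arg2pi u0 + 2 * pi * of_int k" by (rule cis_eq_cisE)
    then have "Arg2pi u * N / (2 * pi) = h u + N * of_int k" unfolding h_def by (simp add: field_simps)
    then show ?case using periodic_int[of P N "h u" k, OF per] elim(1) by simp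
  qed
qed

lemma eventually_floor:
  assumes "(t0::real) \<notin> \<int>"
  shows "\<forall>\<^sub>F t in nhds t0. \<lfloor>t\<rfloor> = \<lfloor>t0\<rfloor> \<and> t \<notin> \<int>"
proof -
  let ?S = "{real_of_int \<lfloor>t0\<rfloor><..<of_int \<lfloor>t0\<rfloor> + 1}"
  have "real_of_int \<lfloor>t0\<rfloor> \<noteq> t0" using assms Ints_of_int by metis
  then have "real_of_int \<lfloor>t0\<rfloor> < t0" using of_int_floor_le[of t0] by (rule order.not_eq_order_implies_strict)
  then have "t0 \<in> ?S" using real_of_int_floor_add_one_gt[of t0] by simp
  moreover have "open ?S" by simp
  moreover have "\<lfloor>t\<rfloor> = \<lfloor>t0\<rfloor> \<and> t \<notin> \<int>" if "t \<in> ?S" for t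
  proof
    show fl: "\<lfloor>t\<rfloor> = \<lfloor>t0\<rfloor>" using that by (simp add: floor_eq_iff)
    show "t \<notin> \<int>" using that fl by (auto elim!: Ints_cases)
  qed
  ultimately show ?thesis unfolding eventually_nhds by blast
qed

subsection \<open>Labellings with prescribed transitions along the edges\<close>

definition letter_act :: "('e \<Rightarrow> 's \<Rightarrow> 's) \<Rightarrow> 'e \<times> bool \<Rightarrow> 's \<Rightarrow> 's" where
  "letter_act \<beta> l = (if snd l then \<beta> (fst l) else inv_into UNIV (\<beta> (fst l)))"

locale transitions = one_vertex Z v \<phi> \<psi> E F w
  for Z :: "'z::topological_space set" and v :: 'z
    and \<phi> :: "'e \<Rightarrow> real \<Rightarrow> 'z" and \<psi> :: "'f \<Rightarrow> complex \<Rightarrow> 'z" and E :: "'e set" and F :: "'f set"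
    and w :: "'f \<Rightarrow> 'e word" +
  fixes \<beta> :: "'e \<Rightarrow> 's \<Rightarrow> 's"
  assumes bij_\<beta>: "e \<in> E \<Longrightarrow> bij (\<beta> e)"
    and relation: "f \<in> F \<Longrightarrow> fold (letter_act \<beta>) (w f) \<sigma> = \<sigma>"
begin

section \<open>Transport of frames around a face\<close>

definition angle :: "'f \<Rightarrow> complex \<Rightarrow> real" where
  "angle f u = Arg2pi u * real (length (w f)) / (2 * pi)"

text \<open>Transport from the base of the face to its corner number \<open>k\<close>. Corners are
  counted modulo the length of the word, so that angles may be shifted by full turns.\<close>

definition corner :: "'f \<Rightarrow> int \<Rightarrow> 's \<Rightarrow> 's" where
  "corner f k = fold (letter_act \<beta>) (take (nat (k mod int (length (w f)))) (w f))"

definition letter_at :: "'f \<Rightarrow> int \<Rightarrow> 'e \<times> bool" where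
  "letter_at f k = w f ! nat (k mod int (length (w f)))"

text \<open>The frame of an edge sits at its start, which is the beginning of an arc with a positive
  letter and the end of an arc with a negative one. At the corners it is the frame of the
  vertex.\<close>

definition rim :: "'f \<Rightarrow> real \<Rightarrow> 's \<Rightarrow> 's" where
  "rim f t = (if t \<in> \<int> \<or> snd (letter_at f \<lfloor>t\<rfloor>) then corner f \<lfloor>t\<rfloor> else corner f (\<lfloor>t\<rfloor> + 1))"

text \<open>The transition from the frame at the base point of a cell to the frame of the open cell
  containing the point with parameter \<open>u\<close>; the frame of an edge is the one at its start.\<close>

fun frame :: "('e, 'f) cell_index \<Rightarrow> complex \<Rightarrow> 's \<Rightarrow> 's" where
  "frame Vertex u = id"
| "frame (Edge e) u = (if u = 1 then \<beta> e else id)"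
| "frame (Face f) u = (if norm u = 1 then rim f (angle f u) else id)"

definition rep :: "'z \<Rightarrow> ('e, 'f) cell_index \<times> complex" where
  "rep z = (SOME r. fst r \<in> I \<and> snd r \<in> cell_int (fst r) \<and> \<kappa> (fst r) (snd r) = z)"

lemma length_pos: "f \<in> F \<Longrightarrow> length (w f) > 0"
  using word_nonempty by simp

lemma bij_letter_act: "fst l \<in> E \<Longrightarrow> bij (letter_act \<beta> l)"
  by (simp add: letter_act_def bij_\<beta> bij_imp_bij_inv)

lemma bij_fold_act: "fst ` set u \<subseteq> E \<Longrightarrow> bij (fold (letter_act \<beta>) u)"
proof (induction u)
  case (Cons l u)
  then have "bij (fold (letter_act \<beta>) u \<circ> letter_act \<beta> l)" by (intro bij_comp bij_letter_act) auto
  then show ?case by (simp only: fold.simps)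
qed (simp add: bij_id)

lemma bij_corner: "f \<in> F \<Longrightarrow> bij (corner f k)"
  unfolding corner_def using word_letters by (intro bij_fold_act) (auto dest!: in_set_takeD)

lemma bij_rim: "f \<in> F \<Longrightarrow> bij (rim f t)"
  by (simp add: rim_def bij_corner)

lemma letter_at_in_E: "f \<in> F \<Longrightarrow> fst (letter_at f k) \<in> E"
  using length_pos[of f] word_letters[of f "letter_at f k"] unfolding letter_at_def
  by (simp add: nat_less_iff)

lemma corner_Suc:
  assumes f: "f \<in> F"
  shows "corner f (k + 1) \<sigma> = letter_act \<beta> (letter_at f k) (corner f k \<sigma>)"
proof -
  let ?n = "length (w f)"
  define j where "j = nat (k mod int ?n)"
  have n: "0 < ?n" by (rule length_pos[OF f])
  have j: "j < ?n" "int j = k mod int ?n" using n by (auto simp: j_def nat_less_iff)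
  have k1: "(k + 1) mod int ?n = (int j + 1) mod int ?n" unfolding j(2) by (simp add: mod_simps)
  have S: "fold (letter_act \<beta>) (take (Suc j) (w f)) \<sigma> = letter_act \<beta> (letter_at f k) (corner f k \<sigma>)"
    using j(1) by (simp add: take_Suc_conv_app_nth letter_at_def corner_def j_def)
  show ?thesis
  proof (cases "Suc j < ?n")
    case True
    then have "nat ((k + 1) mod int ?n) = Suc j" unfolding k1 by (simp add: nat_add_distrib)
    then show ?thesis using S by (simp add: corner_def[of f "k+1"])
  next
    \<comment> \<open>The last letter returns to corner 0. Consistency there is the hypothesis that
      the attaching word acts trivially.\<close>
    case False
    then have n': "Suc j = ?n" using j by simp
    then have "int j + 1 = int ?n" by simp
    then have "(k + 1) mod int ?n = 0" unfolding k1 by (simp only: mod_self)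
    then have "corner f (k + 1) \<sigma> = \<sigma>" by (simp add: corner_def)
    moreover have "take (Suc j) (w f) = w f" using n' by simp
    ultimately show ?thesis using S relation[OF f] by simp
  qed
qed

lemma corner_periodic: "corner f (k + int (length (w f))) = corner f k"
  by (simp add: corner_def)

lemma letter_at_periodic: "letter_at f (k + int (length (w f))) = letter_at f k"
  by (simp add: letter_at_def)

lemma Ints_shift: "t + real n \<in> \<int> \<longleftrightarrow> t \<in> \<int>"
  by (metis Ints_add Ints_diff Ints_of_nat add_diff_cancel_right')

lemma floor_shift: "\<lfloor>t + real n\<rfloor> = \<lfloor>t\<rfloor> + int n"
  by (metis floor_add_int of_int_of_nat_eq)

lemma rim_periodic: "rim f (t + real (length (w f))) = rim f t"
proof -
  have "\<lfloor>t\<rfloor> + int (length (w f)) + 1 = (\<lfloor>t\<rfloor> + 1) + int (length (w f))" by simp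
  then show ?thesis unfolding rim_def Ints_shift floor_shift by (simp only: corner_periodic letter_at_periodic)
qed

lemma angle_local:
  assumes "f \<in> F" "u0 \<noteq> 0" "\<And>t. P (t + real (length (w f))) = P t" "\<forall>\<^sub>F t in nhds (angle f u0). P t"
  shows "\<forall>\<^sub>F u in at u0 within D. P (angle f u)"
proof -
  have "\<forall>\<^sub>F u in nhds u0. P (angle f u)" unfolding angle_def
    by (rule angle_eventually[OF assms(2) _ assms(3) assms(4)[unfolded angle_def]]) (use length_pos[OF assms(1)] in auto)
  then show ?thesis by (auto simp: eventually_at_filter elim: eventually_mono)
qed

lemma rim_local:
  assumes "f \<in> F" "u0 \<noteq> 0" "angle f u0 \<notin> \<int>"
  shows "\<forall>\<^sub>F u in at u0 within D. rim f (angle f u) = rim f (angle f u0) \<and> angle f u \<notin> \<int>"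
proof (rule angle_local[OF assms(1,2)])
  show "(rim f (t + real (length (w f))) = rim f (angle f u0) \<and> t + real (length (w f)) \<notin> \<int>)
    = (rim f t = rim f (angle f u0) \<and> t \<notin> \<int>)" for t
    by (simp add: rim_periodic Ints_shift)
  show "\<forall>\<^sub>F t in nhds (angle f u0). rim f t = rim f (angle f u0) \<and> t \<notin> \<int>"
    using eventually_floor[OF assms(3)] by eventually_elim (use assms(3) in \<open>auto simp: rim_def\<close>)
qed

lemma filterlim_shift_nhds: "filterlim (\<lambda>t. t + c) (nhds (t0 + c)) (nhds (t0::real))"
  by (intro tendsto_add tendsto_const filterlim_ident)

lemma corner_local:
  assumes "f \<in> F" "u0 \<noteq> 0" "angle f u0 + 1/2 \<notin> \<int>"
  shows "\<forall>\<^sub>F u in at u0 within D. corner f \<lfloor>angle f u + 1/2\<rfloor> = corner f \<lfloor>angle f u0 + 1/2\<rfloor> \<and> angle f u + 1/2 \<notin> \<int>"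
proof (rule angle_local[OF assms(1,2)])
  have *: "t + real (length (w f)) + 1/2 = t + 1/2 + real (length (w f))" for t by simp
  show "(corner f \<lfloor>t + real (length (w f)) + 1/2\<rfloor> = corner f \<lfloor>angle f u0 + 1/2\<rfloor> \<and> t + real (length (w f)) + 1/2 \<notin> \<int>)
    = (corner f \<lfloor>t + 1/2\<rfloor> = corner f \<lfloor>angle f u0 + 1/2\<rfloor> \<and> t + 1/2 \<notin> \<int>)" for t
    unfolding * Ints_shift floor_shift corner_periodic by simp
  have "\<forall>\<^sub>F t in nhds (angle f u0). \<lfloor>t + 1/2\<rfloor> = \<lfloor>angle f u0 + 1/2\<rfloor> \<and> t + 1/2 \<notin> \<int>"
    using eventually_floor[OF assms(3)] filterlim_shift_nhds[of "1/2" "angle f u0"] unfolding filterlim_iff by blast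
  then show "\<forall>\<^sub>F t in nhds (angle f u0). corner f \<lfloor>t + 1/2\<rfloor> = corner f \<lfloor>angle f u0 + 1/2\<rfloor> \<and> t + 1/2 \<notin> \<int>"
    by eventually_elim simp
qed

lemma rep_\<kappa>:
  assumes "i \<in> I" "u \<in> cell_int i"
  shows "rep (\<kappa> i u) = (i, u)"
proof -
  have "\<exists>r. fst r \<in> I \<and> snd r \<in> cell_int (fst r) \<and> \<kappa> (fst r) (snd r) = \<kappa> i u"
    using assms by (intro exI[of _ "(i, u)"]) simp
  from someI_ex[OF this, folded rep_def] have r: "fst (rep (\<kappa> i u)) \<in> I"
    "snd (rep (\<kappa> i u)) \<in> cell_int (fst (rep (\<kappa> i u)))" "\<kappa> (fst (rep (\<kappa> i u))) (snd (rep (\<kappa> i u))) = \<kappa> i u" by auto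
  show ?thesis using \<kappa>_inj[OF r(1) assms(1) r(2) assms(2) r(3)] by (simp add: prod_eq_iff)
qed

lemma rep_v: "rep v = (Vertex, 0)"
  using rep_\<kappa>[of Vertex 0] by simp

lemma rep_Edge:
  assumes "e \<in> E" "s \<in> {0..1}"
  shows "rep (\<phi> e s) = (if s \<in> {0<..<1} then (Edge e, of_real s) else (Vertex, 0))"
proof (cases "s \<in> {0<..<1}")
  case True
  then show ?thesis using rep_\<kappa>[of "Edge e" "of_real s"] assms by simp
next
  case False
  then have "s = 0 \<or> s = 1" using assms by auto
  then show ?thesis using False edge_map[OF assms(1)] rep_v by auto
qed

lemma face_circle:
  assumes f: "f \<in> F" and u: "norm u = 1"
  shows "angle f u \<in> \<int> \<Longrightarrow> \<psi> f u = v"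
    and "\<psi> f u = letter_path \<phi> (letter_at f \<lfloor>angle f u\<rfloor>) (frac (angle f u))"
proof -
  let ?t = "angle f u" and ?n = "length (w f)"
  have n: "0 < ?n" by (rule length_pos[OF f])
  have t0: "0 \<le> ?t" unfolding angle_def using Arg2pi_ge_0[of u] by simp
  have tn: "?t < ?n" unfolding angle_def using Arg2pi_lt_2pi[of u] n by (simp add: field_simps)
  have fl: "0 \<le> \<lfloor>?t\<rfloor>" "\<lfloor>?t\<rfloor> < int ?n" using t0 tn by (auto simp: floor_less_iff)
  have j: "nat \<lfloor>?t\<rfloor> < ?n" using fl by (simp add: nat_less_iff)
  have l: "letter_at f \<lfloor>?t\<rfloor> = w f ! nat \<lfloor>?t\<rfloor>" using fl by (simp add: letter_at_def)
  have "real (nat \<lfloor>?t\<rfloor>) + frac ?t = ?t" using fl by (simp add: frac_def)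
  moreover have "2 * pi * ?t / ?n = Arg2pi u" unfolding angle_def using n by simp
  moreover have "u \<noteq> 0" using u by auto
  then have "u = cis (Arg2pi u)" using u by (simp add: cis_Arg2pi sgn_eq)
  ultimately have "u = arc f (nat \<lfloor>?t\<rfloor>) (frac ?t)" unfolding arc_def by simp
  moreover have "frac ?t \<in> {0..1}" using frac_lt_1[of ?t] by (simp add: less_imp_le)
  ultimately show eq: "\<psi> f u = letter_path \<phi> (letter_at f \<lfloor>?t\<rfloor>) (frac ?t)"
    using face_arc[OF f j] l by metis
  show "\<psi> f u = v" if "?t \<in> \<int>"
  proof -
    have "frac ?t = 0" using that by (simp only: frac_eq_0_iff)
    from eq[unfolded this] show ?thesis using edge_map[OF letter_at_in_E[OF f, of "\<lfloor>?t\<rfloor>"]] by (simp add: letter_path_def)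
  qed
qed

lemma rep_Face:
  assumes f: "f \<in> F" and u: "u \<in> cball 0 1"
  shows "norm u < 1 \<Longrightarrow> rep (\<psi> f u) = (Face f, u)"
    and "norm u = 1 \<Longrightarrow> angle f u \<in> \<int> \<Longrightarrow> rep (\<psi> f u) = (Vertex, 0)"
    and "norm u = 1 \<Longrightarrow> angle f u \<notin> \<int> \<Longrightarrow> rep (\<psi> f u) = (Edge (fst (letter_at f \<lfloor>angle f u\<rfloor>)),
           of_real (if snd (letter_at f \<lfloor>angle f u\<rfloor>) then frac (angle f u) else 1 - frac (angle f u)))"
proof -
  show "norm u < 1 \<Longrightarrow> rep (\<psi> f u) = (Face f, u)" using rep_\<kappa>[of "Face f" u] f by simp
  show "norm u = 1 \<Longrightarrow> angle f u \<in> \<int> \<Longrightarrow> rep (\<psi> f u) = (Vertex, 0)" using face_circle(1)[OF f] rep_v by simp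
  assume n: "norm u = 1" and t: "angle f u \<notin> \<int>"
  have fr: "0 < frac (angle f u)" "frac (angle f u) < 1" using t frac_lt_1 by auto
  let ?l = "letter_at f \<lfloor>angle f u\<rfloor>"
  have eq: "\<psi> f u = \<phi> (fst ?l) (if snd ?l then frac (angle f u) else 1 - frac (angle f u))"
    using face_circle(2)[OF f n] by (simp add: letter_path_def)
  show "rep (\<psi> f u) = (Edge (fst ?l), of_real (if snd ?l then frac (angle f u) else 1 - frac (angle f u)))"
    unfolding eq using rep_Edge[OF letter_at_in_E[OF f]] fr by simp
qed

lemma inv_eq_iff: "bij h \<Longrightarrow> inv_into UNIV h \<sigma> = \<tau> \<longleftrightarrow> \<sigma> = h \<tau>"
  by (metis bij_inv_eq_iff)

section \<open>Charts around open faces, open edges and the vertex\<close>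

lemma face_chart:
  "flat_chart Z I cell_dom \<kappa> frame {z \<in> Z. \<exists>f. fst (rep z) = Face f} (\<lambda>z. id) (\<lambda>i u. id)"
proof -
  let ?U = "{z \<in> Z. \<exists>f. fst (rep z) = Face f}"
  have pre: "u \<in> cell_int i \<and> (\<exists>f. i = Face f)" if h: "i \<in> I" "u \<in> cell_dom i" "\<kappa> i u \<in> ?U" for i u
  proof (cases "u \<in> cell_int i")
    case True
    then show ?thesis using h rep_\<kappa>[OF h(1) True] by simp
  next
    case False
    obtain j u' where "j \<in> I" "u' \<in> cell_int j" "\<kappa> i u = \<kappa> j u'" "\<And>f. j \<noteq> Face f"
      using boundary_\<kappa>[OF h(1,2) False] by blast
    then show ?thesis using h(3) rep_\<kappa>[of j u'] by simp
  qed
  have "openin (top_of_set Z) ?U"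
  proof (rule weak_top_open[OF weak_Z])
    fix i assume i: "i \<in> I"
    show "openin (top_of_set (cell_dom i)) (cell_dom i \<inter> \<kappa> i -` ?U)"
    proof (cases "\<exists>f. i = Face f")
      case True
      then obtain f where f: "i = Face f" by blast
      have "cell_dom i \<inter> \<kappa> i -` ?U = cell_dom i \<inter> ball 0 1"
      proof (intro equalityI subsetI)
        fix u assume u: "u \<in> cell_dom i \<inter> \<kappa> i -` ?U"
        then have "u \<in> cell_int i" using pre[OF i, of u] by blast
        then show "u \<in> cell_dom i \<inter> ball 0 1" using u f by simp
      next
        fix u assume u: "u \<in> cell_dom i \<inter> ball 0 1"
        then have "rep (\<kappa> i u) = (i, u)" using rep_\<kappa>[OF i, of u] f by simp
        then show "u \<in> cell_dom i \<inter> \<kappa> i -` ?U" using u \<kappa>_in_Z[OF i, of u] f by simp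
      qed
      then show ?thesis using openin_open_Int[OF open_ball, of "cell_dom i"] by (simp only:)
    next
      case False
      then have "cell_dom i \<inter> \<kappa> i -` ?U = {}" using pre[OF i] by blast
      then show ?thesis by simp
    qed
  qed auto
  moreover have "id \<sigma> = frame i u \<tau> \<longleftrightarrow> \<sigma> = id \<tau>" if "i \<in> I" "u \<in> cell_dom i" "\<kappa> i u \<in> ?U" for i u \<sigma> \<tau>
    using pre[OF that] by auto
  ultimately show ?thesis unfolding flat_chart_def by (simp add: bij_id)
qed

text \<open>All open edges, and of each face the open sectors between the rays from its centre to
  its corners.\<close>

definition edge_zone where
  "edge_zone = {z \<in> Z. case rep z of (Vertex, u) \<Rightarrow> False | (Edge e, u) \<Rightarrow> True | (Face f, u) \<Rightarrow> u \<noteq> 0 \<and> angle f u \<notin> \<int>}"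

definition edge_frame where
  "edge_frame z = (case rep z of (Vertex, u) \<Rightarrow> id | (Edge e, u) \<Rightarrow> id | (Face f, u) \<Rightarrow> inv_into UNIV (rim f (angle f u)))"

fun edge_flat :: "('e, 'f) cell_index \<Rightarrow> complex \<Rightarrow> 's \<Rightarrow> 's" where
  "edge_flat (Face f) u = rim f (angle f u)"
| "edge_flat i u = id"

lemma edge_zone_Edge: "e \<in> E \<Longrightarrow> s \<in> {0..1} \<Longrightarrow> \<phi> e s \<in> edge_zone \<longleftrightarrow> s \<in> {0<..<1}"
  unfolding edge_zone_def using rep_Edge[of e s] edge_in_Z[of e s] by simp

lemma edge_zone_Face: "f \<in> F \<Longrightarrow> u \<in> cball 0 1 \<Longrightarrow> \<psi> f u \<in> edge_zone \<longleftrightarrow> u \<noteq> 0 \<and> angle f u \<notin> \<int>"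
  unfolding edge_zone_def using rep_Face[of f u] \<kappa>_in_Z[of "Face f" u]
  by (cases "norm u = 1"; cases "angle f u \<in> \<int>") auto

lemma edge_chart: "flat_chart Z I cell_dom \<kappa> frame edge_zone edge_frame edge_flat"
proof -
  have v: "v \<notin> edge_zone" unfolding edge_zone_def by (simp add: rep_v)
  have "openin (top_of_set Z) edge_zone"
  proof (rule weak_top_open[OF weak_Z])
    show "edge_zone \<subseteq> Z" by (auto simp: edge_zone_def)
    fix i assume i: "i \<in> I"
    show "openin (top_of_set (cell_dom i)) (cell_dom i \<inter> \<kappa> i -` edge_zone)"
    proof (cases i)
      case Vertex
      then have "cell_dom i \<inter> \<kappa> i -` edge_zone = {}" using v by auto
      then show ?thesis by simp
    next
      case (Edge e)
      then have "cell_dom i \<inter> \<kappa> i -` edge_zone = cell_dom i \<inter> Re -` {0<..<1}"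
        using edge_zone_Edge[of e] i by auto
      moreover have "open (Re -` {0<..<1})" by (auto intro!: open_vimage continuous_intros)
      ultimately show ?thesis by (simp add: openin_open_Int)
    next
      case (Face f)
      then have f: "f \<in> F" using i by simp
      show ?thesis
      proof (rule openin_eventually)
        fix u assume u: "u \<in> cell_dom i \<inter> \<kappa> i -` edge_zone"
        then have u': "u \<noteq> 0" "angle f u \<notin> \<int>" using edge_zone_Face[OF f, of u] Face by auto
        have "\<forall>\<^sub>F u1 in at u within cell_dom i. u1 \<in> cell_dom i" by (simp add: eventually_at_filter)
        moreover have "\<forall>\<^sub>F u1 in at u within cell_dom i. u1 \<noteq> 0"
          using t1_space_nhds[OF u'(1)] by (auto simp: eventually_at_filter elim: eventually_mono)
        ultimately show "\<forall>\<^sub>F u1 in at u within cell_dom i. u1 \<in> cell_dom i \<inter> \<kappa> i -` edge_zone"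
          using rim_local[OF f u'] by eventually_elim (use edge_zone_Face[OF f] Face in auto)
      qed auto
    qed
  qed
  moreover have "bij (edge_frame z)" if "z \<in> edge_zone" for z
  proof -
    have "z \<in> Z" using that by (simp add: edge_zone_def)
    then obtain i u where "i \<in> I" "u \<in> cell_int i" "z = \<kappa> i u" by (rule \<kappa>_cover)
    then show ?thesis unfolding edge_frame_def using rep_\<kappa>[of i u]
      by (cases i) (auto simp: bij_id[unfolded id_def] bij_rim bij_imp_bij_inv)
  qed
  moreover have "(\<forall>\<sigma> \<tau>. edge_frame (\<kappa> i u) \<sigma> = frame i u \<tau> \<longleftrightarrow> \<sigma> = edge_flat i u \<tau>) \<and>
        (\<forall>\<^sub>F u' in at u within cell_dom i. edge_flat i u' = edge_flat i u)"
    if i: "i \<in> I" and u: "u \<in> cell_dom i" and U: "\<kappa> i u \<in> edge_zone" for i u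
  proof (cases i)
    case Vertex
    then show ?thesis using U v by simp
  next
    case (Edge e)
    then obtain s where s: "u = of_real s" "s \<in> {0..1}" using u by auto
    then have s': "s \<in> {0<..<1}" using edge_zone_Edge[of e s] U Edge i by simp
    then have "u \<noteq> 1" using s by auto
    then show ?thesis using Edge rep_Edge[of e s] s s' i unfolding edge_frame_def by simp
  next
    case (Face f)
    then have f: "f \<in> F" and uc: "u \<in> cball 0 1" using i u by auto
    have u': "u \<noteq> 0" "angle f u \<notin> \<int>" using edge_zone_Face[OF f uc] Face U by auto
    have "\<forall>\<^sub>F u' in at u within cell_dom i. edge_flat i u' = edge_flat i u"
      using rim_local[OF f u'] by eventually_elim (simp add: Face)
    moreover have "edge_frame (\<psi> f u) \<sigma> = frame (Face f) u \<tau> \<longleftrightarrow> \<sigma> = rim f (angle f u) \<tau>" for \<sigma> \<tau>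
    proof (cases "norm u = 1")
      case True
      then show ?thesis unfolding edge_frame_def using rep_Face(3)[OF f uc True u'(2)] by simp
    next
      case False
      then have "norm u < 1" using uc by auto
      then show ?thesis unfolding edge_frame_def using rep_Face(1)[OF f uc] inv_eq_iff[OF bij_rim[OF f]] by simp
    qed
    ultimately show ?thesis using Face by simp
  qed
  ultimately show ?thesis unfolding flat_chart_def by blast
qed

text \<open>The star of the vertex: edges without their midpoints, and of each face the sectors
  between the rays to the midpoints of its arcs. Adding 1/2 before taking the floor selects the
  corner nearest to an angle.\<close>

definition vertex_zone where
  "vertex_zone = {z \<in> Z. case rep z of (Vertex, u) \<Rightarrow> True | (Edge e, u) \<Rightarrow> Re u \<noteq> 1/2 | (Face f, u) \<Rightarrow> u \<noteq> 0 \<and> angle f u + 1/2 \<notin> \<int>}"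

definition vertex_frame where
  "vertex_frame z = (case rep z of (Vertex, u) \<Rightarrow> id | (Edge e, u) \<Rightarrow> (if Re u < 1/2 then id else inv_into UNIV (\<beta> e))
     | (Face f, u) \<Rightarrow> inv_into UNIV (corner f \<lfloor>angle f u + 1/2\<rfloor>))"

fun vertex_flat :: "('e, 'f) cell_index \<Rightarrow> complex \<Rightarrow> 's \<Rightarrow> 's" where
  "vertex_flat Vertex u = id"
| "vertex_flat (Edge e) u = (if Re u < 1/2 then id else \<beta> e)"
| "vertex_flat (Face f) u = corner f \<lfloor>angle f u + 1/2\<rfloor>"

lemma half_Ints: "(t::real) + 1/2 \<in> \<int> \<longleftrightarrow> frac t = 1/2"
proof
  assume "t + 1/2 \<in> \<int>"
  then obtain k where k: "t + 1/2 = of_int k" by (auto elim: Ints_cases)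
  then have "t = of_int k - 1/2" by simp
  then have "\<lfloor>t\<rfloor> = k - 1" by (simp add: floor_eq_iff)
  then show "frac t = 1/2" using k by (simp add: frac_def)
next
  assume "frac t = 1/2"
  then have "t + 1/2 = of_int (\<lfloor>t\<rfloor> + 1)" by (simp add: frac_def)
  then show "t + 1/2 \<in> \<int>" using Ints_of_int by metis
qed

lemma vertex_zone_Edge: "e \<in> E \<Longrightarrow> s \<in> {0..1} \<Longrightarrow> \<phi> e s \<in> vertex_zone \<longleftrightarrow> s \<noteq> 1/2"
  unfolding vertex_zone_def using rep_Edge[of e s] edge_in_Z[of e s] by auto

lemma vertex_zone_Face: "f \<in> F \<Longrightarrow> u \<in> cball 0 1 \<Longrightarrow> \<psi> f u \<in> vertex_zone \<longleftrightarrow> u \<noteq> 0 \<and> angle f u + 1/2 \<notin> \<int>"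
proof -
  assume f: "f \<in> F" and u: "u \<in> cball 0 1"
  have Z: "\<psi> f u \<in> Z" using \<kappa>_in_Z[of "Face f" u] f u by simp
  consider "norm u < 1" | "norm u = 1" "angle f u \<in> \<int>" | "norm u = 1" "angle f u \<notin> \<int>" using u by fastforce
  then show ?thesis
  proof cases
    case 1
    then show ?thesis using rep_Face(1)[OF f u] Z by (simp add: vertex_zone_def)
  next
    case 2
    then have "frac (angle f u) = 0" by (simp only: frac_eq_0_iff)
    then have "angle f u + 1/2 \<notin> \<int>" unfolding half_Ints by (simp del: frac_eq_0_iff)
    then show ?thesis using rep_Face(2)[OF f u 2] Z 2(1) by (auto simp add: vertex_zone_def)
  next
    case 3
    then show ?thesis using rep_Face(3)[OF f u 3] Z unfolding half_Ints by (auto simp add: vertex_zone_def)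
  qed
qed

lemma corner_step_back:
  assumes "f \<in> F" "\<not> snd (letter_at f k)"
  shows "\<beta> (fst (letter_at f k)) (corner f (k + 1) \<sigma>) = corner f k \<sigma>"
proof -
  have "surj (\<beta> (fst (letter_at f k)))" using bij_\<beta>[OF letter_at_in_E[OF assms(1)]] by (rule bij_is_surj)
  then show ?thesis unfolding corner_Suc[OF assms(1)] letter_act_def using assms(2) by (simp add: surj_f_inv_f)
qed

text \<open>On the boundary circle a point is seen through its edge, whose frame sits at the start.
  On the half of the edge next to its end the factor \<beta> makes up the difference to the nearest
  corner.\<close>

lemma vertex_frame_rim:
  assumes f: "f \<in> F" and u: "norm u = 1" and t: "angle f u + 1/2 \<notin> \<int>"
  shows "vertex_frame (\<psi> f u) \<sigma> = rim f (angle f u) \<tau> \<longleftrightarrow> \<sigma> = corner f \<lfloor>angle f u + 1/2\<rfloor> \<tau>"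
proof -
  let ?t = "angle f u"
  let ?l = "letter_at f \<lfloor>?t\<rfloor>"
  have uc: "u \<in> cball 0 1" using u by simp
  have fr: "frac ?t \<noteq> 1/2" using t half_Ints by auto
  have lE: "fst ?l \<in> E" by (rule letter_at_in_E[OF f])
  show ?thesis
  proof (cases "?t \<in> \<int>")
    case True
    then have "\<lfloor>?t + 1/2\<rfloor> = \<lfloor>?t\<rfloor>" by (auto elim!: Ints_cases simp: floor_eq_iff)
    then show ?thesis using rep_Face(2)[OF f uc u True] True by (simp add: vertex_frame_def rim_def)
  next
    case False
    note r = rep_Face(3)[OF f uc u False]
    have fl: "?t = \<lfloor>?t\<rfloor> + frac ?t" by (simp add: frac_def)
    have small: "\<lfloor>?t + 1/2\<rfloor> = \<lfloor>?t\<rfloor>" if "frac ?t < 1/2"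
      using that fl frac_ge_0[of ?t] unfolding floor_eq_iff by linarith
    have large: "\<lfloor>?t + 1/2\<rfloor> = \<lfloor>?t\<rfloor> + 1" if "frac ?t > 1/2"
      using that fl frac_lt_1[of ?t] unfolding floor_eq_iff by (simp only: of_int_add of_int_1) linarith
    show ?thesis
    proof (cases "snd ?l")
      case True
      have step: "corner f (\<lfloor>?t\<rfloor> + 1) \<tau> = \<beta> (fst ?l) (corner f \<lfloor>?t\<rfloor> \<tau>)"
        using corner_Suc[OF f] True by (simp add: letter_act_def)
      consider "frac ?t < 1/2" | "frac ?t > 1/2" using fr by linarith
      then show ?thesis
        by cases (use r True small large step inv_eq_iff[OF bij_\<beta>[OF lE]] in \<open>simp_all add: vertex_frame_def rim_def\<close>)
    next
      case neg: False
      have step: "corner f \<lfloor>?t\<rfloor> \<tau> = \<beta> (fst ?l) (corner f (\<lfloor>?t\<rfloor> + 1) \<tau>)"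
        using corner_step_back[OF f neg] by simp
      consider "frac ?t < 1/2" | "frac ?t > 1/2" using fr by linarith
      then show ?thesis
        by cases (use r neg False small large step inv_eq_iff[OF bij_\<beta>[OF lE]] in \<open>simp_all add: vertex_frame_def rim_def\<close>)
    qed
  qed
qed

lemma vertex_chart: "flat_chart Z I cell_dom \<kappa> frame vertex_zone vertex_frame vertex_flat"
proof -
  have v: "v \<in> vertex_zone" unfolding vertex_zone_def by (simp add: rep_v v_in_Z)
  have "openin (top_of_set Z) vertex_zone"
  proof (rule weak_top_open[OF weak_Z])
    show "vertex_zone \<subseteq> Z" by (auto simp: vertex_zone_def)
    fix i assume i: "i \<in> I"
    show "openin (top_of_set (cell_dom i)) (cell_dom i \<inter> \<kappa> i -` vertex_zone)"
    proof (cases i)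
      case Vertex
      then have "cell_dom i \<inter> \<kappa> i -` vertex_zone = cell_dom i" using v by auto
      then show ?thesis by simp
    next
      case (Edge e)
      then have "cell_dom i \<inter> \<kappa> i -` vertex_zone = cell_dom i \<inter> Re -` (- {1/2})"
        using vertex_zone_Edge[of e] i by auto
      moreover have "open (Re -` (- {1/2}))" by (auto intro!: open_vimage continuous_intros)
      ultimately show ?thesis by (simp add: openin_open_Int)
    next
      case (Face f)
      then have f: "f \<in> F" using i by simp
      show ?thesis
      proof (rule openin_eventually)
        fix u assume u: "u \<in> cell_dom i \<inter> \<kappa> i -` vertex_zone"
        then have u': "u \<noteq> 0" "angle f u + 1/2 \<notin> \<int>" using vertex_zone_Face[OF f, of u] Face by auto
        have "\<forall>\<^sub>F u1 in at u within cell_dom i. u1 \<in> cell_dom i" by (simp add: eventually_at_filter)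
        moreover have "\<forall>\<^sub>F u1 in at u within cell_dom i. u1 \<noteq> 0"
          using t1_space_nhds[OF u'(1)] by (auto simp: eventually_at_filter elim: eventually_mono)
        ultimately show "\<forall>\<^sub>F u1 in at u within cell_dom i. u1 \<in> cell_dom i \<inter> \<kappa> i -` vertex_zone"
          using corner_local[OF f u'] by eventually_elim (use vertex_zone_Face[OF f] Face in auto)
      qed auto
    qed
  qed
  moreover have "bij (vertex_frame z)" if "z \<in> vertex_zone" for z
  proof -
    have "z \<in> Z" using that by (simp add: vertex_zone_def)
    then obtain i u where "i \<in> I" "u \<in> cell_int i" "z = \<kappa> i u" by (rule \<kappa>_cover)
    then show ?thesis unfolding vertex_frame_def using rep_\<kappa>[of i u]
      by (cases i) (auto simp: bij_id[unfolded id_def] bij_corner bij_\<beta> bij_imp_bij_inv)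
  qed
  moreover have "(\<forall>\<sigma> \<tau>. vertex_frame (\<kappa> i u) \<sigma> = frame i u \<tau> \<longleftrightarrow> \<sigma> = vertex_flat i u \<tau>) \<and>
        (\<forall>\<^sub>F u' in at u within cell_dom i. vertex_flat i u' = vertex_flat i u)"
    if i: "i \<in> I" and u: "u \<in> cell_dom i" and U: "\<kappa> i u \<in> vertex_zone" for i u
  proof (cases i)
    case Vertex
    then show ?thesis by (simp add: vertex_frame_def rep_v)
  next
    case (Edge e)
    then obtain s where s: "u = of_real s" "s \<in> {0..1}" using u by auto
    have e: "e \<in> E" using i Edge by simp
    have s': "s \<noteq> 1/2" using vertex_zone_Edge[OF e s(2)] U Edge s by simp
    have "vertex_frame (\<phi> e s) \<sigma> = frame (Edge e) u \<tau> \<longleftrightarrow> \<sigma> = vertex_flat (Edge e) u \<tau>" for \<sigma> \<tau>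
      using rep_Edge[OF e s(2)] s s' inv_eq_iff[OF bij_\<beta>[OF e]]
      by (auto simp: vertex_frame_def complex_eq_iff)
    moreover have "\<forall>\<^sub>F u' in at u within cell_dom i. (Re u' < 1/2) = (Re u < 1/2)"
    proof -
      have "\<forall>\<^sub>F u' in nhds u. (Re u' < 1/2) = (Re u < 1/2)"
      proof (cases "s < 1/2")
        case True
        then have "u \<in> Re -` {..<1/2}" using s by simp
        moreover have "open (Re -` {..<1/2})" by (auto intro!: open_vimage continuous_intros)
        ultimately show ?thesis unfolding eventually_nhds using True s by (intro exI[of _ "Re -` {..<1/2}"]) auto
      next
        case False
        then have "u \<in> Re -` {1/2<..}" using s s' by simp
        moreover have "open (Re -` {1/2<..})" by (auto intro!: open_vimage continuous_intros)
        ultimately show ?thesis unfolding eventually_nhds using False s by (intro exI[of _ "Re -` {1/2<..}"]) auto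
      qed
      then show ?thesis by (auto simp: eventually_at_filter elim: eventually_mono)
    qed
    then have "\<forall>\<^sub>F u' in at u within cell_dom i. vertex_flat i u' = vertex_flat i u"
      by eventually_elim (simp add: Edge)
    ultimately show ?thesis using Edge s by simp
  next
    case (Face f)
    then have f: "f \<in> F" and uc: "u \<in> cball 0 1" using i u by auto
    have u': "u \<noteq> 0" "angle f u + 1/2 \<notin> \<int>" using vertex_zone_Face[OF f uc] Face U by auto
    have "\<forall>\<^sub>F u' in at u within cell_dom i. vertex_flat i u' = vertex_flat i u"
      using corner_local[OF f u'] by eventually_elim (simp add: Face)
    moreover have "vertex_frame (\<psi> f u) \<sigma> = frame (Face f) u \<tau> \<longleftrightarrow> \<sigma> = vertex_flat (Face f) u \<tau>" for \<sigma> \<tau>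
    proof (cases "norm u = 1")
      case True
      then show ?thesis using vertex_frame_rim[OF f True u'(2)] by simp
    next
      case False
      then have "norm u < 1" using uc by auto
      then show ?thesis unfolding vertex_frame_def using rep_Face(1)[OF f uc] inv_eq_iff[OF bij_corner[OF f]] by simp
    qed
    ultimately show ?thesis using Face by simp
  qed
  ultimately show ?thesis unfolding flat_chart_def by blast
qed

lemma charts_cover:
  assumes "z \<in> Z"
  shows "\<exists>U g d. z \<in> U \<and> flat_chart Z I cell_dom \<kappa> frame U g d"
proof -
  obtain i u where iu: "i \<in> I" "u \<in> cell_int i" "z = \<kappa> i u" using \<kappa>_cover[OF assms] .
  note r = rep_\<kappa>[OF iu(1,2), folded iu(3)]
  show ?thesis
  proof (cases i)
    case Vertex
    then have "z \<in> vertex_zone" using r assms by (simp add: vertex_zone_def)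
    then show ?thesis by (intro exI conjI) (assumption, rule vertex_chart)
  next
    case (Edge e)
    then have "z \<in> edge_zone" using r assms by (simp add: edge_zone_def)
    then show ?thesis by (intro exI conjI) (assumption, rule edge_chart)
  next
    case (Face f)
    then have "z \<in> {z \<in> Z. \<exists>f. fst (rep z) = Face f}" using r assms by simp
    then show ?thesis by (intro exI conjI) (assumption, rule face_chart)
  qed
qed

lemma surj_frame: "i \<in> I \<Longrightarrow> surj (frame i u)"
  by (cases i) (auto simp: bij_is_surj bij_\<beta> bij_rim)

lemma frame_base: "i \<in> I \<Longrightarrow> frame i (cell_base i) = id"
proof -
  have "Arg2pi 1 = 0" by (simp add: Arg2pi_eq_0)
  then show "i \<in> I \<Longrightarrow> frame i (cell_base i) = id"
    by (cases i) (auto simp: angle_def rim_def corner_def)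
qed

end

text \<open>The covering of \<open>Z\<close> with monodromy \<beta> becomes trivial over
  \<open>X\<close>, which turns a transition rule into a function on vertices. Vertices are then
  proved different by their labels.\<close>

theorem (in simple_cover) edge_labelling:
  fixes \<beta> :: "'e \<Rightarrow> 's \<Rightarrow> 's"
  assumes "\<And>e. e \<in> E \<Longrightarrow> bij (\<beta> e)"
    and "\<And>f \<sigma>. f \<in> F \<Longrightarrow> fold (letter_act \<beta>) (w f) \<sigma> = \<sigma>"
    and x0: "x0 \<in> V"
  obtains L where "L x0 = s0" "\<And>e x. e \<in> E \<Longrightarrow> x \<in> V \<Longrightarrow> L (tgt e x) = \<beta> e (L x)"
proof -
  interpret transitions Z v \<phi> \<psi> E F w \<beta>
    by unfold_locales (fact assms(1), fact assms(2))
  show ?thesis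
  proof (rule flat_labelling[of frame x0 s0])
    show "surj (frame i u)" if "i \<in> I" for i u using that by (rule surj_frame)
    show "\<exists>U g d. z \<in> U \<and> flat_chart Z I cell_dom \<kappa> frame U g d" if "z \<in> Z" for z using that by (rule charts_cover)
    show "frame i (cell_base i) = id" if "i \<in> I" for i using that by (rule frame_base)
    fix L assume L: "L x0 = s0" "\<And>i x u. i \<in> I \<Longrightarrow> x \<in> V \<Longrightarrow> u \<in> cell_dom i \<Longrightarrow> L (lft i x u) = frame i u (L x)"
    show ?thesis
    proof (rule that[of L, OF L(1)])
      fix e x assume "e \<in> E" "x \<in> V"
      then show "L (tgt e x) = \<beta> e (L x)"
        using L(2)[of "Edge e" x 1] one_in_Edge(1)[of e] unfolding tgt_def by simp
    qed
  qed (rule x0)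
qed

section \<open>The automorphism group of a cell complex\<close>

locale cell_family =
  fixes X :: "'x::topological_space set" and C :: "'x set set"
  assumes cell_sub: "\<sigma> \<in> C \<Longrightarrow> \<sigma> \<subseteq> X" and nonempty_family: "C \<noteq> {}"
begin

abbreviation H where "H \<equiv> cell_homeos X C"

lemma carrier_H: "f \<in> carrier H \<longleftrightarrow> f \<in> Bij X \<and> (\<exists>g. homeomorphism X X f g) \<and> (\<lambda>\<sigma>. f ` \<sigma>) ` C = C"
  by (simp add: cell_homeos_def)

lemma H_D:
  assumes "f \<in> carrier H"
  shows "f \<in> Bij X" "\<exists>g. homeomorphism X X f g" "(\<lambda>\<sigma>. f ` \<sigma>) ` C = C"
  using assms by (simp_all add: carrier_H)

lemma H_I: "f \<in> Bij X \<Longrightarrow> homeomorphism X X f g \<Longrightarrow> (\<lambda>\<sigma>. f ` \<sigma>) ` C = C \<Longrightarrow> f \<in> carrier H"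
  unfolding carrier_H by (intro conjI exI)

lemma mult_H: "f \<in> carrier H \<Longrightarrow> g \<in> carrier H \<Longrightarrow> f \<otimes>\<^bsub>H\<^esub> g = compose X f g"
  by (simp add: cell_homeos_def BijGroup_def)

lemma one_H: "\<one>\<^bsub>H\<^esub> = (\<lambda>x\<in>X. x)"
  by (simp add: cell_homeos_def BijGroup_def)

lemma compose_image: "\<sigma> \<subseteq> X \<Longrightarrow> compose X f g ` \<sigma> = f ` g ` \<sigma>"
  by (force simp: compose_def)

lemma homeomorphism_compose_restrict:
  assumes "homeomorphism X X f f'" "homeomorphism X X g g'"
  shows "homeomorphism X X (compose X f g) (g' \<circ> f')"
proof -
  have h: "homeomorphism X X (f \<circ> g) (g' \<circ> f')" by (rule homeomorphism_compose[OF assms(2,1)])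
  show ?thesis by (rule homeomorphism_cong[OF h]) (auto simp: compose_def)
qed

lemma subgroup_H: "subgroup (carrier H) (BijGroup X)"
proof (rule group.subgroupI[OF group_BijGroup])
  show "carrier H \<subseteq> carrier (BijGroup X)" by (auto simp: carrier_H BijGroup_def)
  have "homeomorphism X X (\<lambda>x\<in>X. x) (\<lambda>x. x)"
    by (rule homeomorphism_cong[OF homeomorphism_ident[of X]]) simp_all
  moreover have "(\<lambda>x\<in>X. x) ` \<sigma> = \<sigma>" if "\<sigma> \<in> C" for \<sigma> using cell_sub[OF that] by force
  then have "(\<lambda>\<sigma>. (\<lambda>x\<in>X. x) ` \<sigma>) ` C = C" by (simp cong: image_cong)
  ultimately have "(\<lambda>x\<in>X. x) \<in> carrier H" using H_I[OF id_Bij] by simp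
  then show "carrier H \<noteq> {}" by blast
next
  fix f g assume fg: "f \<in> carrier H" "g \<in> carrier H"
  obtain f' where f': "homeomorphism X X f f'" using H_D(2)[OF fg(1)] ..
  obtain g' where g': "homeomorphism X X g g'" using H_D(2)[OF fg(2)] ..
  from f' g' have hc: "homeomorphism X X (compose X f g) (g' \<circ> f')" by (rule homeomorphism_compose_restrict)
  have "(\<lambda>\<sigma>. compose X f g ` \<sigma>) ` C = (\<lambda>\<sigma>. f ` \<sigma>) ` (\<lambda>\<sigma>. g ` \<sigma>) ` C"
    unfolding image_image by (rule image_cong[OF HOL.refl]) (simp add: compose_image cell_sub image_image)
  then have "(\<lambda>\<sigma>. compose X f g ` \<sigma>) ` C = C" by (simp only: H_D(3)[OF fg(1)] H_D(3)[OF fg(2)])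
  then have "compose X f g \<in> carrier H" by (rule H_I[OF compose_Bij[OF H_D(1)[OF fg(1)] H_D(1)[OF fg(2)]] hc])
  then show "f \<otimes>\<^bsub>BijGroup X\<^esub> g \<in> carrier H" using H_D(1)[OF fg(1)] H_D(1)[OF fg(2)] by (simp add: BijGroup_def)
next
  fix f assume f: "f \<in> carrier H"
  obtain f' where f': "homeomorphism X X f f'" and fB: "f \<in> Bij X" and fC: "(\<lambda>\<sigma>. f ` \<sigma>) ` C = C" using H_D[OF f] by (elim exE)
  have inv: "inv\<^bsub>BijGroup X\<^esub> f = (\<lambda>x\<in>X. inv_into X f x)" by (rule inv_BijGroup[OF fB])
  have eq: "(\<lambda>x\<in>X. inv_into X f x) x = f' x" if "x \<in> X" for x
  proof -
    have "inj_on f X" using fB by (simp add: Bij_def bij_betw_def)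
    moreover have "f' x \<in> X" "f (f' x) = x" using f' that unfolding homeomorphism_def by auto
    ultimately show ?thesis using that by (metis inv_into_f_f restrict_apply')
  qed
  have "homeomorphism X X (\<lambda>x\<in>X. inv_into X f x) f"
    by (rule homeomorphism_cong[OF homeomorphism_symD[OF f']]) (use eq in auto)
  moreover have "(\<lambda>\<sigma>. (\<lambda>x\<in>X. inv_into X f x) ` \<sigma>) ` C = C"
  proof -
    have "(\<lambda>x\<in>X. inv_into X f x) ` f ` \<sigma> = \<sigma>" if "\<sigma> \<in> C" for \<sigma>
    proof -
      have "(\<lambda>x\<in>X. inv_into X f x) (f x) = x" if "x \<in> \<sigma>" for x
        using cell_sub[OF \<open>\<sigma> \<in> C\<close>] that fB by (auto simp: Bij_def bij_betw_def)
      then have "(\<lambda>x. (\<lambda>x\<in>X. inv_into X f x) (f x)) ` \<sigma> = (\<lambda>x. x) ` \<sigma>" by (rule image_cong[OF HOL.refl])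
      then show ?thesis unfolding image_image by simp
    qed
    then have "(\<lambda>\<sigma>. (\<lambda>x\<in>X. inv_into X f x) ` \<sigma>) ` (\<lambda>\<sigma>. f ` \<sigma>) ` C = C"
      by (simp add: image_image cong: image_cong)
    then show ?thesis using fC by simp
  qed
  ultimately show "inv\<^bsub>BijGroup X\<^esub> f \<in> carrier H"
    unfolding inv by (intro H_I[OF restrict_inv_into_Bij[OF fB]])
qed

lemma group_H: "group H"
proof -
  have "H = BijGroup X\<lparr>carrier := carrier H\<rparr>" by (simp add: cell_homeos_def)
  then show ?thesis using subgroup.subgroup_is_group[OF subgroup_H group_BijGroup] by simp
qed

sublocale H: group H by (rule group_H)

lemma H_mapsto: "f \<in> carrier H \<Longrightarrow> x \<in> X \<Longrightarrow> f x \<in> X"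
  using funcset_mem[OF Bij_imp_funcset[OF H_D(1)]] by blast

lemma H_inj: "f \<in> carrier H \<Longrightarrow> inj_on f X"
  by (simp add: carrier_H Bij_def bij_betw_def)

lemma H_cell: "f \<in> carrier H \<Longrightarrow> \<sigma> \<in> C \<Longrightarrow> f ` \<sigma> \<in> C"
  using H_D(3)[of f] by blast

lemma mult_apply: "f \<in> carrier H \<Longrightarrow> g \<in> carrier H \<Longrightarrow> x \<in> X \<Longrightarrow> (f \<otimes>\<^bsub>H\<^esub> g) x = f (g x)"
  by (simp add: mult_H compose_def)

lemma mult_image: "f \<in> carrier H \<Longrightarrow> g \<in> carrier H \<Longrightarrow> \<sigma> \<subseteq> X \<Longrightarrow> (f \<otimes>\<^bsub>H\<^esub> g) ` \<sigma> = f ` g ` \<sigma>"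
  by (simp add: mult_H compose_image)

lemma inv_apply: "f \<in> carrier H \<Longrightarrow> x \<in> X \<Longrightarrow> (inv\<^bsub>H\<^esub> f) (f x) = x"
  using mult_apply[of "inv\<^bsub>H\<^esub> f" f x] by (simp add: one_H)

lemma inv_image:
  assumes "f \<in> carrier H" "\<sigma> \<subseteq> X"
  shows "(inv\<^bsub>H\<^esub> f) ` f ` \<sigma> = \<sigma>"
proof -
  have "(inv\<^bsub>H\<^esub> f) (f x) = x" if "x \<in> \<sigma>" for x using assms inv_apply that by blast
  then show ?thesis by (simp add: image_image)
qed

lemma cell_trivial_iff: "f \<in> cell_trivial X C \<longleftrightarrow> f \<in> carrier H \<and> (\<forall>\<sigma>\<in>C. f ` \<sigma> = \<sigma>)"
  by (simp add: cell_trivial_def)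

lemma normal_trivial: "normal (cell_trivial X C) H"
  unfolding H.normal_inv_iff
proof (intro conjI ballI)
  show "subgroup (cell_trivial X C) H"
  proof (rule H.subgroupI)
    show "cell_trivial X C \<subseteq> carrier H" by (auto simp: cell_trivial_iff)
    have "\<one>\<^bsub>H\<^esub> \<in> cell_trivial X C" unfolding cell_trivial_iff
    proof (intro conjI ballI H.one_closed)
      fix \<sigma> assume "\<sigma> \<in> C"
      then show "\<one>\<^bsub>H\<^esub> ` \<sigma> = \<sigma>" using cell_sub[of \<sigma>] unfolding one_H by force
    qed
    then show "cell_trivial X C \<noteq> {}" by blast
    fix f assume f: "f \<in> cell_trivial X C"
    then have fH: "f \<in> carrier H" by (simp add: cell_trivial_iff)
    have "(inv\<^bsub>H\<^esub> f) ` \<sigma> = \<sigma>" if "\<sigma> \<in> C" for \<sigma>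
      using inv_image[OF fH cell_sub[OF that]] f that by (simp add: cell_trivial_iff)
    then show "inv\<^bsub>H\<^esub> f \<in> cell_trivial X C" using fH by (simp add: cell_trivial_iff)
    fix g assume g: "g \<in> cell_trivial X C"
    then show "f \<otimes>\<^bsub>H\<^esub> g \<in> cell_trivial X C" using f by (simp add: cell_trivial_iff mult_image cell_sub)
  qed
  fix f g assume f: "f \<in> carrier H" and g: "g \<in> cell_trivial X C"
  have gH: "g \<in> carrier H" using g by (simp add: cell_trivial_iff)
  have "(f \<otimes>\<^bsub>H\<^esub> g \<otimes>\<^bsub>H\<^esub> inv\<^bsub>H\<^esub> f) ` \<sigma> = \<sigma>" if s: "\<sigma> \<in> C" for \<sigma>
  proof -
    have i: "(inv\<^bsub>H\<^esub> f) ` \<sigma> \<in> C" using H_cell[OF H.inv_closed[OF f] s] .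
    then have "g ` (inv\<^bsub>H\<^esub> f) ` \<sigma> = (inv\<^bsub>H\<^esub> f) ` \<sigma>" using g by (simp add: cell_trivial_iff)
    moreover have "f ` (inv\<^bsub>H\<^esub> f) ` \<sigma> = \<sigma>" using inv_image[OF H.inv_closed[OF f] cell_sub[OF s]] f by simp
    ultimately show ?thesis using f gH i s by (simp add: mult_image cell_sub)
  qed
  then show "f \<otimes>\<^bsub>H\<^esub> g \<otimes>\<^bsub>H\<^esub> inv\<^bsub>H\<^esub> f \<in> cell_trivial X C" using f gH by (simp add: cell_trivial_iff)
qed

lemma group_Aut: "group (Aut X C)"
  unfolding Aut_def by (rule normal.factorgroup_is_group[OF normal_trivial])

lemma aut_class_eq:
  assumes f: "f \<in> carrier H"
  shows "aut_class X C f = {h \<in> carrier H. \<forall>\<sigma>\<in>C. h ` \<sigma> = f ` \<sigma>}"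
proof
  show "aut_class X C f \<subseteq> {h \<in> carrier H. \<forall>\<sigma>\<in>C. h ` \<sigma> = f ` \<sigma>}"
  proof
    fix h assume "h \<in> aut_class X C f"
    then obtain n where n: "n \<in> cell_trivial X C" "h = n \<otimes>\<^bsub>H\<^esub> f" by (auto simp: aut_class_def r_coset_def)
    then have "n \<in> carrier H" by (simp add: cell_trivial_iff)
    then show "h \<in> {h \<in> carrier H. \<forall>\<sigma>\<in>C. h ` \<sigma> = f ` \<sigma>}"
      using n f by (auto simp: mult_image cell_sub cell_trivial_iff H_cell)
  qed
  show "{h \<in> carrier H. \<forall>\<sigma>\<in>C. h ` \<sigma> = f ` \<sigma>} \<subseteq> aut_class X C f"
  proof
    fix h assume h: "h \<in> {h \<in> carrier H. \<forall>\<sigma>\<in>C. h ` \<sigma> = f ` \<sigma>}"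
    let ?n = "h \<otimes>\<^bsub>H\<^esub> inv\<^bsub>H\<^esub> f"
    have "?n ` \<sigma> = \<sigma>" if s: "\<sigma> \<in> C" for \<sigma>
    proof -
      have i: "(inv\<^bsub>H\<^esub> f) ` \<sigma> \<in> C" using H_cell[OF H.inv_closed[OF f] s] .
      have "f ` (inv\<^bsub>H\<^esub> f) ` \<sigma> = \<sigma>" using inv_image[OF H.inv_closed[OF f] cell_sub[OF s]] f by simp
      then show ?thesis using h i f s by (simp add: mult_image cell_sub)
    qed
    then have "?n \<in> cell_trivial X C" using h f by (simp add: cell_trivial_iff)
    moreover have "h = ?n \<otimes>\<^bsub>H\<^esub> f" using h f by (simp add: H.m_assoc)
    ultimately show "h \<in> aut_class X C f" unfolding aut_class_def r_coset_def by blast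
  qed
qed

lemma aut_class_self: "f \<in> carrier H \<Longrightarrow> f \<in> aut_class X C f"
  by (simp add: aut_class_eq)

lemma aut_class_eq_iff:
  assumes "f \<in> carrier H" "g \<in> carrier H"
  shows "aut_class X C f = aut_class X C g \<longleftrightarrow> (\<forall>\<sigma>\<in>C. f ` \<sigma> = g ` \<sigma>)"
proof
  assume "aut_class X C f = aut_class X C g"
  then have "f \<in> aut_class X C g" using aut_class_self[OF assms(1)] by simp
  then show "\<forall>\<sigma>\<in>C. f ` \<sigma> = g ` \<sigma>" unfolding aut_class_eq[OF assms(2)] by simp
next
  assume eq: "\<forall>\<sigma>\<in>C. f ` \<sigma> = g ` \<sigma>"
  have "(\<forall>\<sigma>\<in>C. h ` \<sigma> = f ` \<sigma>) = (\<forall>\<sigma>\<in>C. h ` \<sigma> = g ` \<sigma>)" for h :: "'x \<Rightarrow> 'x"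
    by (rule ball_cong) (use eq in simp_all)
  then show "aut_class X C f = aut_class X C g"
    unfolding aut_class_eq[OF assms(1)] aut_class_eq[OF assms(2)] by simp
qed

lemma carrier_Aut: "carrier (Aut X C) = aut_class X C ` carrier H"
  by (auto simp: Aut_def FactGroup_def RCOSETS_def aut_class_def)

lemma mult_Aut:
  assumes "f \<in> carrier H" "g \<in> carrier H"
  shows "aut_class X C f \<otimes>\<^bsub>Aut X C\<^esub> aut_class X C g = aut_class X C (f \<otimes>\<^bsub>H\<^esub> g)"
  using normal.rcos_sum[OF normal_trivial assms] by (simp add: Aut_def FactGroup_def aut_class_def)

section \<open>Discreteness tested on finite sets of cells\<close>

definition stab_open :: "'x set \<Rightarrow> 'x set \<Rightarrow> ('x \<Rightarrow> 'x) set set" where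
  "stab_open \<sigma> \<tau> = {\<alpha> \<in> carrier (Aut X C). \<forall>f\<in>\<alpha>. f ` \<sigma> = \<tau>}"

lemma stab_open_iff:
  assumes "f \<in> carrier H" "\<sigma> \<in> C"
  shows "aut_class X C f \<in> stab_open \<sigma> \<tau> \<longleftrightarrow> f ` \<sigma> = \<tau>"
proof
  assume "aut_class X C f \<in> stab_open \<sigma> \<tau>"
  then show "f ` \<sigma> = \<tau>" using aut_class_self[OF assms(1)] unfolding stab_open_def by blast
next
  assume "f ` \<sigma> = \<tau>"
  moreover have "h ` \<sigma> = f ` \<sigma>" if "h \<in> aut_class X C f" for h
    using that assms(2) unfolding aut_class_eq[OF assms(1)] by blast
  ultimately show "aut_class X C f \<in> stab_open \<sigma> \<tau>"
    unfolding stab_open_def carrier_Aut using assms(1) by blast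
qed

lemma aut_topology_eq: "aut_topology X C = topology_generated_by {stab_open \<sigma> \<tau> | \<sigma> \<tau>. \<sigma> \<in> C \<and> \<tau> \<in> C}"
  by (simp add: aut_topology_def stab_open_def)

text \<open>The classes that agree with \<open>f\<close> on \<open>F\<close> form an open set. For
  \<open>g\<close> in such a class, the product of the inverse of \<open>f\<close> with
  \<open>g\<close> fixes the cells of \<open>F\<close>, so it is trivial and the open set is a
  single point.\<close>

lemma aut_discreteI:
  assumes F: "finite F" "F \<subseteq> C" and triv: "\<And>f. f \<in> carrier H \<Longrightarrow> (\<And>\<sigma>. \<sigma> \<in> F \<Longrightarrow> f ` \<sigma> = \<sigma>) \<Longrightarrow> f \<in> cell_trivial X C"
  shows "aut_discrete X C"
proof -
  let ?B = "{stab_open \<sigma> \<tau> | \<sigma> \<tau>. \<sigma> \<in> C \<and> \<tau> \<in> C}"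
  \<comment> \<open>\<open>F\<close> may be empty, and the finite intersection of open sets below
    needs at least one member.\<close>
  obtain \<sigma>0 where s0: "\<sigma>0 \<in> C" using nonempty_family by blast
  have single: "openin (aut_topology X C) {\<alpha>}" if \<alpha>: "\<alpha> \<in> carrier (Aut X C)" for \<alpha>
  proof -
    obtain f where f: "f \<in> carrier H" "\<alpha> = aut_class X C f" using \<alpha> by (auto simp: carrier_Aut)
    let ?K = "(\<lambda>\<sigma>. stab_open \<sigma> (f ` \<sigma>)) ` insert \<sigma>0 F"
    have "openin (aut_topology X C) (\<Inter>?K)"
    proof (rule openin_Inter)
      show "finite ?K" using F by simp
      show "?K \<noteq> {}" by simp
      fix U assume "U \<in> ?K"
      then obtain \<sigma> where s: "\<sigma> \<in> insert \<sigma>0 F" "U = stab_open \<sigma> (f ` \<sigma>)" by blast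
      then have "\<sigma> \<in> C" using s0 F by blast
      then have "U \<in> ?B" using H_cell[OF f(1)] s(2) by blast
      then show "openin (aut_topology X C) U" unfolding aut_topology_eq by (rule topology_generated_by_Basis)
    qed
    moreover have "\<Inter>?K = {\<alpha>}"
    proof
      show "{\<alpha>} \<subseteq> \<Inter>?K" using f s0 F by (auto simp: stab_open_iff)
      show "\<Inter>?K \<subseteq> {\<alpha>}"
      proof
        fix \<beta> assume b: "\<beta> \<in> \<Inter>?K"
        then have "\<beta> \<in> carrier (Aut X C)" by (simp add: stab_open_def)
        then obtain g where g: "g \<in> carrier H" "\<beta> = aut_class X C g" by (auto simp: carrier_Aut)
        have gf: "g ` \<sigma> = f ` \<sigma>" if "\<sigma> \<in> F" for \<sigma>
        proof -
          have "\<sigma> \<in> C" using that F by blast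
          moreover have "\<beta> \<in> stab_open \<sigma> (f ` \<sigma>)" using b that by blast
          ultimately show ?thesis using stab_open_iff[OF g(1)] g(2) by simp
        qed
        let ?h = "inv\<^bsub>H\<^esub> f \<otimes>\<^bsub>H\<^esub> g"
        have "?h \<in> cell_trivial X C"
        proof (rule triv)
          fix \<sigma> assume s: "\<sigma> \<in> F"
          then have "\<sigma> \<subseteq> X" using F cell_sub by blast
          then show "?h ` \<sigma> = \<sigma>" using f g gf[OF s] by (simp add: mult_image inv_image)
        qed (use f g in simp)
        moreover have "g = f \<otimes>\<^bsub>H\<^esub> ?h" using f g by (simp add: H.m_assoc[symmetric])
        ultimately have "g ` \<sigma> = f ` \<sigma>" if "\<sigma> \<in> C" for \<sigma>
          using f(1) that by (metis cell_sub cell_trivial_iff mult_image)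
        then have "\<beta> = \<alpha>" using f g by (simp add: aut_class_eq_iff)
        then show "\<beta> \<in> {\<alpha>}" by simp
      qed
    qed
    ultimately show ?thesis by simp
  qed
  show ?thesis unfolding aut_discrete_def topology_eq openin_discrete_topology
  proof (intro allI iffI)
    fix U assume "openin (aut_topology X C) U"
    then have "U \<subseteq> topspace (aut_topology X C)" by (rule openin_subset)
    also have "\<dots> \<subseteq> carrier (Aut X C)"
      unfolding aut_topology_eq topology_generated_by_topspace by (auto simp: stab_open_def)
    finally show "U \<subseteq> carrier (Aut X C)" .
  next
    fix U assume U: "U \<subseteq> carrier (Aut X C)"
    have "openin (aut_topology X C) (\<Union> ((\<lambda>\<alpha>. {\<alpha>}) ` U))"
      by (rule openin_Union) (use single U in blast)
    then show "openin (aut_topology X C) U" by simp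
  qed
qed

text \<open>Open sets are unions of finite intersections of basic ones, so membership of a class is
  secured by the images of finitely many cells. An open singleton would leave no room for a
  nontrivial automorphism that fixes these cells.\<close>

lemma generated_open_agree:
  assumes "generate_topology_on {stab_open \<sigma> \<tau> | \<sigma> \<tau>. \<sigma> \<in> C \<and> \<tau> \<in> C} U"
  shows "\<forall>f\<in>carrier H. aut_class X C f \<in> U \<longrightarrow>
    (\<exists>F. finite F \<and> F \<subseteq> C \<and> (\<forall>g\<in>carrier H. (\<forall>\<sigma>\<in>F. g ` \<sigma> = f ` \<sigma>) \<longrightarrow> aut_class X C g \<in> U))"
  using assms
proof induction
  case (Int U W)
  show ?case
  proof (intro ballI impI)
    fix f assume f: "f \<in> carrier H" "aut_class X C f \<in> U \<inter> W"
    obtain F where F: "finite F" "F \<subseteq> C" "\<forall>g\<in>carrier H. (\<forall>\<sigma>\<in>F. g ` \<sigma> = f ` \<sigma>) \<longrightarrow> aut_class X C g \<in> U"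
      using Int.IH(1)[rule_format, OF f(1)] f(2) by auto
    obtain G where G: "finite G" "G \<subseteq> C" "\<forall>g\<in>carrier H. (\<forall>\<sigma>\<in>G. g ` \<sigma> = f ` \<sigma>) \<longrightarrow> aut_class X C g \<in> W"
      using Int.IH(2)[rule_format, OF f(1)] f(2) by auto
    show "\<exists>F. finite F \<and> F \<subseteq> C \<and> (\<forall>g\<in>carrier H. (\<forall>\<sigma>\<in>F. g ` \<sigma> = f ` \<sigma>) \<longrightarrow> aut_class X C g \<in> U \<inter> W)"
      by (intro exI[of _ "F \<union> G"]) (use F G in auto)
  qed
next
  case (UN K)
  show ?case
  proof (intro ballI impI)
    fix f assume f: "f \<in> carrier H" "aut_class X C f \<in> \<Union>K"
    then obtain U where U: "U \<in> K" "aut_class X C f \<in> U" by blast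
    from UN.IH[OF U(1), rule_format, OF f(1) U(2)]
    obtain F where "finite F" "F \<subseteq> C" "\<forall>g\<in>carrier H. (\<forall>\<sigma>\<in>F. g ` \<sigma> = f ` \<sigma>) \<longrightarrow> aut_class X C g \<in> U" by (elim exE conjE)
    then show "\<exists>F. finite F \<and> F \<subseteq> C \<and> (\<forall>g\<in>carrier H. (\<forall>\<sigma>\<in>F. g ` \<sigma> = f ` \<sigma>) \<longrightarrow> aut_class X C g \<in> \<Union>K)"
      using U(1) by (intro exI[of _ F]) auto
  qed
next
  case (Basis s)
  then obtain \<sigma> \<tau> where s: "s = stab_open \<sigma> \<tau>" "\<sigma> \<in> C" by blast
  show ?case
  proof (intro ballI impI)
    fix f assume f: "f \<in> carrier H" "aut_class X C f \<in> s"
    show "\<exists>F. finite F \<and> F \<subseteq> C \<and> (\<forall>g\<in>carrier H. (\<forall>\<sigma>\<in>F. g ` \<sigma> = f ` \<sigma>) \<longrightarrow> aut_class X C g \<in> s)"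
      by (intro exI[of _ "{\<sigma>}"]) (use s f stab_open_iff in auto)
  qed
qed auto

lemma not_aut_discreteI:
  assumes "\<And>F. finite F \<Longrightarrow> F \<subseteq> C \<Longrightarrow> \<exists>f\<in>carrier H. (\<forall>\<sigma>\<in>F. f ` \<sigma> = \<sigma>) \<and> f \<notin> cell_trivial X C"
  shows "\<not> aut_discrete X C"
proof
  let ?one = "aut_class X C \<one>\<^bsub>H\<^esub>"
  assume "aut_discrete X C"
  then have "openin (aut_topology X C) {?one}" unfolding aut_discrete_def carrier_Aut by simp
  then have "generate_topology_on {stab_open \<sigma> \<tau> | \<sigma> \<tau>. \<sigma> \<in> C \<and> \<tau> \<in> C} {?one}"
    unfolding aut_topology_eq openin_topology_generated_by_iff .
  from generated_open_agree[OF this, rule_format, OF H.one_closed] obtain F where F: "finite F" "F \<subseteq> C"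
    "\<forall>g\<in>carrier H. (\<forall>\<sigma>\<in>F. g ` \<sigma> = \<one>\<^bsub>H\<^esub> ` \<sigma>) \<longrightarrow> aut_class X C g \<in> {?one}" by auto
  have one: "\<one>\<^bsub>H\<^esub> ` \<sigma> = \<sigma>" if "\<sigma> \<in> C" for \<sigma> using cell_sub[OF that] unfolding one_H by force
  obtain f where f: "f \<in> carrier H" "\<forall>\<sigma>\<in>F. f ` \<sigma> = \<sigma>" "f \<notin> cell_trivial X C" using assms[OF F(1,2)] by blast
  have "\<forall>\<sigma>\<in>F. f ` \<sigma> = \<one>\<^bsub>H\<^esub> ` \<sigma>" using f(2) one F(2) by (simp add: subset_iff)
  then have "aut_class X C f = ?one" using F(3) f(1) by blast
  then have "\<forall>\<sigma>\<in>C. f ` \<sigma> = \<one>\<^bsub>H\<^esub> ` \<sigma>" using aut_class_eq_iff[OF f(1) H.one_closed] by blast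
  then show False using f(1,3) one by (simp add: cell_trivial_iff)
qed

end

section \<open>Cellular homeomorphisms of the covering\<close>

context cell_cover
begin

lemma V_nonempty: "V \<noteq> {}"
proof -
  obtain x where "x \<in> X" "p x = v" using covering_space_imp_surjective[OF covering] v_in_Z by auto
  then show ?thesis by (auto simp: V_def)
qed

lemma cells_I: "i \<in> I \<Longrightarrow> x \<in> V \<Longrightarrow> cell i x \<in> cells"
  by (auto simp: cells_def)

lemma cells_E:
  assumes "\<sigma> \<in> cells"
  obtains i x where "i \<in> I" "x \<in> V" "\<sigma> = cell i x"
  using assms by (auto simp: cells_def)

sublocale aut: cell_family X cells
proof
  show "\<sigma> \<subseteq> X" if "\<sigma> \<in> cells" for \<sigma> using that cell_subset_X by (elim cells_E) simp
  show "cells \<noteq> {}" using V_nonempty cells_I[of Vertex] by auto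
qed

text \<open>Separates vertices from all other cells by cardinality, which every bijection
  respects.\<close>

lemma cell_not_singleton:
  assumes "i \<in> I" "x \<in> V" "i \<noteq> Vertex"
  shows "cell i x \<noteq> {q}"
proof -
  obtain u u' where u: "u \<in> cell_int i" "u' \<in> cell_int i" "u \<noteq> u'"
  proof (cases i)
    case (Edge e)
    have "complex_of_real (1/2) \<in> of_real ` {0<..<1}" "complex_of_real (1/3) \<in> of_real ` {0<..<1}"
      by (rule imageI, simp)+
    moreover have "complex_of_real (1/2) \<noteq> of_real (1/3)" unfolding of_real_eq_iff by simp
    ultimately show ?thesis using Edge that by simp
  next
    case (Face f)
    show ?thesis by (rule that[of 0 "1/2"]) (use Face in auto)
  qed (use assms in simp)
  then have "lft i x u \<noteq> lft i x u'" using lft_inj(3)[OF assms(1,1,2,2)] by blast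
  moreover have "lft i x u \<in> cell i x" "lft i x u' \<in> cell i x" using u by (auto simp: cell_def)
  ultimately show ?thesis by (metis singletonD)
qed

lemma aut_cell:
  assumes "f \<in> carrier aut.H" "i \<in> I" "x \<in> V"
  obtains j y where "j \<in> I" "y \<in> V" "f ` cell i x = cell j y"
  using aut.H_cell[OF assms(1) cells_I[OF assms(2,3)]] by (rule cells_E)

lemma aut_vertex:
  assumes f: "f \<in> carrier aut.H" and x: "x \<in> V"
  shows "f x \<in> V"
proof -
  obtain j y where jy: "j \<in> I" "y \<in> V" "f ` cell Vertex x = cell j y" using aut_cell[OF f _ x, of Vertex] by auto
  then have s: "cell j y = {f x}" using cell_Vertex[OF x] by simp
  then have "j = Vertex" using cell_not_singleton[OF jy(1,2)] by blast
  then show ?thesis using s jy(2) cell_Vertex by simp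
qed

lemma aut_inv_apply:
  assumes f: "f \<in> carrier aut.H" and q: "q \<in> X"
  shows "(inv\<^bsub>aut.H\<^esub> f) (f q) = q" "f ((inv\<^bsub>aut.H\<^esub> f) q) = q"
  using aut.inv_apply[OF f q] aut.inv_apply[OF aut.H.inv_closed[OF f] q] f by simp_all

lemma aut_vertex_iff:
  assumes f: "f \<in> carrier aut.H" and q: "q \<in> X"
  shows "f q \<in> V \<longleftrightarrow> q \<in> V"
  using aut_vertex[OF f, of q] aut_vertex[OF aut.H.inv_closed[OF f], of "f q"] aut_inv_apply(1)[OF f q] by auto

lemma aut_cl:
  assumes f: "f \<in> carrier aut.H" and i: "i \<in> I" "x \<in> V" and j: "j \<in> I" "y \<in> V" and eq: "f ` cell i x = cell j y"
  shows "f ` cl i x = cl j y"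
proof -
  obtain g where g: "homeomorphism X X f g" using aut.H_D(2)[OF f] ..
  have "homeomorphic_map (top_of_set X) (top_of_set X) f"
    unfolding homeomorphic_map_maps homeomorphic_maps_def
    by (rule exI[of _ g]) (use g in \<open>auto simp: homeomorphism_def\<close>)
  from homeomorphic_map_closure_of[OF this, of "cell i x"]
  have "top_of_set X closure_of cell j y = f ` (top_of_set X closure_of cell i x)"
    using cell_subset_X[OF i] eq by simp
  then show ?thesis using cl_eq_closure[OF i] cl_eq_closure[OF j] by simp
qed

lemma cl_Int_V_Edge: "e \<in> E \<Longrightarrow> x \<in> V \<Longrightarrow> cl (Edge e) x \<inter> V = {x, tgt e x}"
  using cl_Edge[of e x] cell_disjoint_V[of "Edge e" x] tgt_in_V[of e x] by auto

text \<open>The image is not a vertex, by cardinality. It is not a face, because the boundary of a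
  face contains an open edge, while the boundary of an edge consists of vertices, which go to
  vertices.\<close>

lemma aut_edge:
  assumes f: "f \<in> carrier aut.H" and e: "e \<in> E" and x: "x \<in> V"
  obtains e' y where "e' \<in> E" "y \<in> V" "f ` cell (Edge e) x = cell (Edge e') y" "{f x, f (tgt e x)} = {y, tgt e' y}"
proof -
  have eI: "Edge e \<in> I" using e by simp
  obtain j y where jy: "j \<in> I" "y \<in> V" "f ` cell (Edge e) x = cell j y" using aut_cell[OF f eI x] .
  note cl = aut_cl[OF f eI x jy]
  have sub: "cl (Edge e) x \<subseteq> X" by (rule cl_subset_X[OF eI x])
  show ?thesis
  proof (cases j)
    case Vertex
    then have "f ` cell (Edge e) x = {y}" using jy cell_Vertex by simp
    moreover obtain a where a: "a \<in> cell (Edge e) x" using cell_nonempty by blast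
    ultimately have "f b = f a" if "b \<in> cell (Edge e) x" for b using that by (metis imageI singletonD)
    then have "cell (Edge e) x = {a}"
      using a inj_onD[OF aut.H_inj[OF f]] cell_subset_X[OF eI x] by blast
    then show ?thesis using cell_not_singleton[OF eI x] by blast
  next
    case (Face h)
    have h: "h \<in> F" using jy Face by simp
    have n: "0 < length (w h)" using word_nonempty[OF h] by simp
    define e0 where "e0 = fst (w h ! 0)"
    define y0 where "y0 = letter_start (w h ! 0) y"
    have e0: "e0 \<in> E" unfolding e0_def by (rule word_letter_in_E[OF h n])
    have y0: "y0 \<in> V" unfolding y0_def by (rule letter_start_in_V[OF word_letter_in_E[OF h n] jy(2)])
    have sub0: "cl (Edge e0) y0 \<subseteq> cl (Face h) y" using letter_edge_in_face[OF h jy(2) n] by (simp add: e0_def y0_def)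
    obtain q where q: "q \<in> cell (Edge e0) y0" using cell_nonempty by blast
    then have "q \<in> cl (Face h) y" using cell_subset_cl sub0 by blast
    then obtain q' where q': "q' \<in> cl (Edge e) x" "q = f q'" using cl Face by blast
    have "q \<notin> cell (Face h) y" using cell_disjoint[of "Edge e0" y0 "Face h" y] q e0 y0 h jy(2) by auto
    then have "q' \<notin> cell (Edge e) x" using jy(3) q'(2) Face by blast
    then have "q' \<in> V" using q'(1) cl_Edge[OF e x] x tgt_in_V[OF e x] by auto
    then have "q \<in> V" using aut_vertex[OF f] q'(2) by simp
    then show ?thesis using cell_disjoint_V[of "Edge e0" y0] q e0 y0 by auto
  next
    case (Edge e')
    have e': "e' \<in> E" using jy Edge by simp
    have "f ` (cl (Edge e) x \<inter> V) = cl (Edge e') y \<inter> V"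
    proof
      show "f ` (cl (Edge e) x \<inter> V) \<subseteq> cl (Edge e') y \<inter> V" using cl Edge aut_vertex[OF f] by auto
      show "cl (Edge e') y \<inter> V \<subseteq> f ` (cl (Edge e) x \<inter> V)"
      proof
        fix q assume q: "q \<in> cl (Edge e') y \<inter> V"
        then obtain a where a: "a \<in> cl (Edge e) x" "q = f a" using cl Edge by auto
        then have "a \<in> V" using q aut_vertex_iff[OF f, of a] sub by auto
        then show "q \<in> f ` (cl (Edge e) x \<inter> V)" using a by blast
      qed
    qed
    then have "f ` {x, tgt e x} = {y, tgt e' y}" using cl_Int_V_Edge[OF e x] cl_Int_V_Edge[OF e' jy(2)] by simp
    then show ?thesis using that[OF e' jy(2)] jy(3) Edge by simp
  qed
qed

text \<open>By elimination: the inverse automorphism takes one-point cells to one-point cells and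
  edges to edges.\<close>

lemma aut_face:
  assumes f: "f \<in> carrier aut.H" and h: "h \<in> F" and x: "x \<in> V"
  obtains h' y where "h' \<in> F" "y \<in> V" "f ` cell (Face h) x = cell (Face h') y" "f ` cl (Face h) x = cl (Face h') y"
proof -
  have hI: "Face h \<in> I" using h by simp
  have invH: "inv\<^bsub>aut.H\<^esub> f \<in> carrier aut.H" using f by simp
  obtain j y where jy: "j \<in> I" "y \<in> V" "f ` cell (Face h) x = cell j y" using aut_cell[OF f hI x] .
  have bk: "(inv\<^bsub>aut.H\<^esub> f) ` cell j y = cell (Face h) x"
    using aut.inv_image[OF f cell_subset_X[OF hI x]] jy(3) by simp
  show ?thesis
  proof (cases j)
    case Vertex
    then have "cell (Face h) x = {(inv\<^bsub>aut.H\<^esub> f) y}" using bk cell_Vertex[OF jy(2)] by simp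
    then show ?thesis using cell_not_singleton[OF hI x] by simp
  next
    case (Edge e)
    then have "e \<in> E" using jy by simp
    then obtain e' z where "e' \<in> E" "z \<in> V" "(inv\<^bsub>aut.H\<^esub> f) ` cell (Edge e) y = cell (Edge e') z"
      using aut_edge[OF invH _ jy(2)] by metis
    then show ?thesis using bk Edge cell_inj[OF hI x, of "Edge e'" z] by simp
  next
    case (Face h')
    then show ?thesis using that[of h' y] jy aut_cl[OF f hI x jy] by simp
  qed
qed

lemma aut_edge_in_face:
  assumes f: "f \<in> carrier aut.H" and sub: "A \<subseteq> X" "B \<subseteq> X"
  shows "f ` A \<inter> f ` B \<noteq> {} \<longleftrightarrow> A \<inter> B \<noteq> {}"
  using inj_on_image_Int[OF aut.H_inj[OF f] sub] by (metis image_is_empty)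

text \<open>After the reparametrisation \<open>r\<close>, the image of a lifted cell is a lift of
  the characteristic map of \<open>i'\<close>, hence by uniqueness one of the named lifts. The
  reflection of the complex is the case where \<open>r\<close> is not the identity.\<close>

lemma lift_image_cell:
  assumes g: "continuous_on X g" "g ` X \<subseteq> X" and i: "i \<in> I" "x \<in> V" and i': "i' \<in> I"
    and r: "continuous_on (cell_dom i') r" "r ` cell_dom i' \<subseteq> cell_dom i" "r ` cell_int i' = cell_int i"
    and p: "\<And>u. u \<in> cell_dom i' \<Longrightarrow> p (g (lft i x (r u))) = \<kappa> i' u"
  shows "g (lft i x (r (cell_base i'))) \<in> V"
    and "u \<in> cell_dom i' \<Longrightarrow> g (lft i x (r u)) = lft i' (g (lft i x (r (cell_base i')))) u"
    and "g ` cell i x = cell i' (g (lft i x (r (cell_base i'))))"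
proof -
  let ?k = "\<lambda>u. g (lft i x (r u))"
  have "continuous_on (cell_dom i') (\<lambda>u. lft i x (r u))"
    by (rule continuous_on_compose2[OF lft(1)[OF i] r(1,2)])
  then have kc: "continuous_on (cell_dom i') ?k"
    by (rule continuous_on_compose2[OF g(1)]) (use r(2) lft_in_X[OF i] in blast)
  have kX: "?k ` cell_dom i' \<subseteq> X" using g(2) r(2) lft_in_X[OF i] by blast
  note l = lft_unique[OF i' kc kX p]
  show "?k (cell_base i') \<in> V" by (rule l(1))
  show eq: "u \<in> cell_dom i' \<Longrightarrow> ?k u = lft i' (?k (cell_base i')) u" for u by (rule l(2))
  have "g ` cell i x = ?k ` cell_int i'" unfolding cell_def r(3)[symmetric] by (simp add: image_image)
  also have "\<dots> = lft i' (?k (cell_base i')) ` cell_int i'"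
    by (rule image_cong[OF HOL.refl], rule eq) (use cell_int_subset in blast)
  finally show "g ` cell i x = cell i' (?k (cell_base i'))" by (simp add: cell_def)
qed

text \<open>Only the composite of \<open>g\<close> with \<open>p\<close> enters, and this composite
  is known for maps that are obtained by lifting.\<close>

definition cellular :: "('x \<Rightarrow> 'x) \<Rightarrow> bool" where
  "cellular g \<longleftrightarrow> (\<forall>i\<in>I. \<forall>x\<in>V. \<exists>i'\<in>I. \<exists>r. continuous_on (cell_dom i') r \<and> r ` cell_dom i' \<subseteq> cell_dom i \<and>
     r ` cell_int i' = cell_int i \<and> (\<forall>u\<in>cell_dom i'. p (g (lft i x (r u))) = \<kappa> i' u))"

lemma cellular_image:
  assumes g: "continuous_on X g" "g ` X \<subseteq> X" "cellular g" and s: "\<sigma> \<in> cells"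
  shows "g ` \<sigma> \<in> cells"
proof -
  obtain i x where ix: "i \<in> I" "x \<in> V" "\<sigma> = cell i x" using s by (rule cells_E)
  obtain i' r where ir: "i' \<in> I" "continuous_on (cell_dom i') r" "r ` cell_dom i' \<subseteq> cell_dom i"
     "r ` cell_int i' = cell_int i" "\<forall>u\<in>cell_dom i'. p (g (lft i x (r u))) = \<kappa> i' u"
    using g(3)[unfolded cellular_def, rule_format, OF ix(1,2)] by blast
  note l = lift_image_cell[OF g(1,2) ix(1,2) ir(1-4) ir(5)[rule_format]]
  show ?thesis using cells_I[OF ir(1) l(1)] l(3) ix(3) by simp
qed

lemma cellular_in_H:
  assumes g: "continuous_on X g" "g ` X \<subseteq> X" "cellular g"
    and h: "continuous_on X h" "h ` X \<subseteq> X" "cellular h"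
    and gh: "\<And>x. x \<in> X \<Longrightarrow> h (g x) = x" "\<And>x. x \<in> X \<Longrightarrow> g (h x) = x"
  shows "restrict g X \<in> carrier aut.H"
proof (rule aut.H_I)
  have hom: "homeomorphism X X g h" unfolding homeomorphism_def
  proof (intro conjI ballI g h gh)
    have "x \<in> g ` X" "x \<in> h ` X" if "x \<in> X" for x
      using imageI[of "h x" X g] imageI[of "g x" X h] g(2) h(2) gh that by auto
    then show "g ` X = X" "h ` X = X" using g(2) h(2) by auto
  qed
  then show "homeomorphism X X (restrict g X) h" by (rule homeomorphism_cong) simp_all
  have "bij_betw g X X" using g(2) h(2) gh by (intro bij_betw_byWitness[where f' = h]) auto
  then show "restrict g X \<in> Bij X" by (simp add: Bij_def cong: bij_betw_cong)
  have eq: "restrict g X ` \<sigma> = g ` \<sigma>" if "\<sigma> \<in> cells" for \<sigma> using aut.cell_sub[OF that] by force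
  have "\<sigma> \<in> (\<lambda>\<sigma>. g ` \<sigma>) ` cells" if s: "\<sigma> \<in> cells" for \<sigma>
  proof -
    have "g (h x) = x" if "x \<in> \<sigma>" for x using gh(2) aut.cell_sub[OF s] that by blast
    then have "\<sigma> = g ` h ` \<sigma>" by (simp add: image_image)
    then show ?thesis using cellular_image[OF h s] by blast
  qed
  then have "(\<lambda>\<sigma>. g ` \<sigma>) ` cells = cells" using cellular_image[OF g] by blast
  then show "(\<lambda>\<sigma>. restrict g X ` \<sigma>) ` cells = cells" using eq by (simp cong: image_cong)
qed

lemma homeomorphism_in_H:
  assumes f: "f \<in> Bij X" and g: "homeomorphism X X f g" and c: "cellular f" "cellular g"
  shows "f \<in> carrier aut.H"
proof -
  have "restrict f X \<in> carrier aut.H"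
    by (rule cellular_in_H[of f g]) (use g c in \<open>auto simp: homeomorphism_def\<close>)
  moreover have "restrict f X = f" using f by (simp add: Bij_def extensional_restrict)
  ultimately show ?thesis by simp
qed

subsection \<open>Connectedness of the 1-skeleton\<close>

definition reach :: "'x \<Rightarrow> 'x \<Rightarrow> bool" where
  "reach x y \<longleftrightarrow> (\<exists>u. fst ` set u \<subseteq> E \<and> walk u x = y)"

lemma reach_refl: "reach x x"
  unfolding reach_def by (rule exI[of _ "[]"]) simp

lemma reach_step: "fst l \<in> E \<Longrightarrow> reach x y \<Longrightarrow> reach x (step l y)"
  unfolding reach_def by (elim exE conjE, rule_tac x = "u @ [l]" in exI) auto

lemma step_step: "fst l \<in> E \<Longrightarrow> y \<in> V \<Longrightarrow> step (fst l, \<not> snd l) (step l y) = y"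
  by (simp add: step_def src src_tgt)

lemma reach_step_iff:
  assumes "fst l \<in> E" "y \<in> V"
  shows "reach x (step l y) \<longleftrightarrow> reach x y"
  using reach_step[OF assms(1)] reach_step[of "(fst l, \<not> snd l)" x "step l y"] step_step[OF assms] assms(1) by auto

lemma reach_walk_iff: "fst ` set u \<subseteq> E \<Longrightarrow> y \<in> V \<Longrightarrow> reach x (walk u y) \<longleftrightarrow> reach x y"
  by (induction u arbitrary: y) (auto simp: reach_step_iff step_in_V)

lemma reach_letter_start: "fst l \<in> E \<Longrightarrow> y \<in> V \<Longrightarrow> reach x (letter_start l y) \<longleftrightarrow> reach x y"
  using reach_step_iff[of l y x] by (auto simp: letter_start_def step_def)

text \<open>The cells in the boundary of a face have their bases on its boundary walk, and this walk
  starts at the base of the face.\<close>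

lemma cl_bases:
  assumes i: "i \<in> I" "x \<in> V" and j: "j \<in> I" "y \<in> V" and ne: "cell j y \<inter> cl i x \<noteq> {}"
  shows "reach z x \<longleftrightarrow> reach z y"
proof -
  obtain q where q: "q \<in> cell j y" "q \<in> cl i x" using ne by blast
  have uniq: "k = j \<and> a = y" if "k \<in> I" "a \<in> V" "q \<in> cell k a" for k a
    using cell_disjoint[OF that(1,2) j] that(3) q(1) by blast
  have same: ?thesis if "q \<in> cell i x" using uniq[OF i that] by simp
  have ver: "a = y" if "a \<in> V" "q = a" for a using uniq[of Vertex a] that cell_Vertex by simp
  show ?thesis
  proof (cases i)
    case Vertex
    then have "q = x" using q(2) i by (simp add: cl_Vertex)
    then show ?thesis using ver[OF i(2)] by simp
  next
    case (Edge e)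
    then have e: "e \<in> E" using i by simp
    have "reach z (tgt e x) \<longleftrightarrow> reach z x" using reach_step_iff[of "(e, True)" x z] e i(2) by (simp add: step_def)
    moreover have "q = x \<or> q = tgt e x \<or> q \<in> cell i x" using q(2) cl_Edge[OF e i(2)] Edge by simp
    ultimately show ?thesis using same ver[OF i(2)] ver[OF tgt_in_V[OF e i(2)]] by metis
  next
    case (Face f)
    then have f: "f \<in> F" using i by simp
    have wE: "fst ` set (take k (w f)) \<subseteq> E" for k using word_letters[OF f] by (auto dest: in_set_takeD)
    have wr: "reach z (walk (take k (w f)) x) \<longleftrightarrow> reach z x" for k by (rule reach_walk_iff[OF wE i(2)])
    show ?thesis
    proof (cases "q \<in> cell i x")
      case False
      consider k where "k < length (w f)" "q = walk (take k (w f)) x"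
        | k where "k < length (w f)" "q \<in> cell (Edge (fst (w f ! k))) (letter_start (w f ! k) (walk (take k (w f)) x))"
        using cl_Face_point[OF f i(2)] q(2) False Face by metis
      then show ?thesis
      proof cases
        case 1
        then show ?thesis using ver[OF walk_take_in_V[OF f i(2)]] wr by metis
      next
        case 2
        have lE: "fst (w f ! k) \<in> E" by (rule word_letter_in_E[OF f 2(1)])
        have "letter_start (w f ! k) (walk (take k (w f)) x) = y"
          using uniq[OF _ letter_start_in_V[OF lE walk_take_in_V[OF f i(2)]] 2(2)] lE by simp
        then show ?thesis using reach_letter_start[OF lE walk_take_in_V[OF f i(2)], where x = z] wr by metis
      qed
    qed (rule same)
  qed
qed

end

context simple_cover
begin

text \<open>The cells with reachable base and those with unreachable base form two disjoint
  subcomplexes. Both are closed and together they cover the connected space \<open>X\<close>, so one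
  of them is empty.\<close>

lemma all_reachable:
  assumes x0: "x0 \<in> V" and y: "y \<in> V"
  shows "reach x0 y"
proof (rule ccontr)
  assume ny: "\<not> reach x0 y"
  define A where "A b = \<Union> {cell i x | i x. i \<in> I \<and> x \<in> V \<and> reach x0 x = b}" for b
  have sub: "subcomplex (A b)" for b
    unfolding subcomplex_def
  proof (intro conjI ballI impI)
    show "A b \<subseteq> X" using cell_subset_X unfolding A_def by blast
    fix i x u assume i: "i \<in> I" "x \<in> V" and u: "u \<in> cell_int i" "lft i x u \<in> A b"
    obtain i1 x1 where 1: "i1 \<in> I" "x1 \<in> V" "reach x0 x1 = b" "lft i x u \<in> cell i1 x1" using u(2) unfolding A_def by blast
    have b: "reach x0 x = b" using in_cell_iff[OF i 1(1,2) u(1)] 1 by simp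
    show "lft i x ` cell_dom i \<subseteq> A b"
    proof
      fix q assume "q \<in> lft i x ` cell_dom i"
      then have q: "q \<in> cl i x" by (simp add: cl_def)
      then have "q \<in> X" using cl_subset_X[OF i] by blast
      then obtain j z u' where j: "j \<in> I" "z \<in> V" "u' \<in> cell_int j" "q = lft j z u'" by (rule cell_through)
      then have qc: "q \<in> cell j z" by (simp add: cell_def)
      then have "reach x0 z = b" using cl_bases[OF i j(1,2)] q b by blast
      then show "q \<in> A b" unfolding A_def using j(1,2) qc by blast
    qed
  qed
  have "closedin (top_of_set X) (A True)" "closedin (top_of_set X) (A False)"
    using subcomplex_closedin[OF sub] by blast+
  moreover have "X \<subseteq> A True \<union> A False"
  proof
    fix q assume "q \<in> X"
    then obtain j z u' where j: "j \<in> I" "z \<in> V" "u' \<in> cell_int j" "q = lft j z u'" by (rule cell_through)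
    then have "q \<in> cell j z" by (simp add: cell_def)
    then have "q \<in> A (reach x0 z)" unfolding A_def using j(1,2) by blast
    then show "q \<in> A True \<union> A False" by (cases "reach x0 z") auto
  qed
  moreover have "A True \<inter> A False = {}"
  proof (rule ccontr)
    assume "A True \<inter> A False \<noteq> {}"
    then obtain q where q: "q \<in> A True" "q \<in> A False" by blast
    obtain i x where 1: "i \<in> I" "x \<in> V" "reach x0 x = True" "q \<in> cell i x" using q(1) unfolding A_def by blast
    obtain j z where 2: "j \<in> I" "z \<in> V" "reach x0 z = False" "q \<in> cell j z" using q(2) unfolding A_def by blast
    have "i = j \<and> x = z" using cell_disjoint[OF 1(1,2) 2(1,2)] 1 2 by blast
    then show False using 1 2 by simp
  qed
  moreover have "x0 \<in> A True" unfolding A_def using x0 reach_refl cell_Vertex[OF x0] in_I(1) by blast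
  moreover have "y \<in> A False" unfolding A_def using y ny cell_Vertex[OF y] in_I(1) by blast
  ultimately show False using connected_X unfolding connected_closedin by blast
qed

subsection \<open>Lifting maps of the base and deck transformations\<close>

lemma lift_self:
  assumes q: "continuous_on X q" "q ` X \<subseteq> Z" and x0: "x0 \<in> X" "y0 \<in> X" "p y0 = q x0"
  obtains g where "continuous_on X g" "g ` X \<subseteq> X" "g x0 = y0" "\<And>x. x \<in> X \<Longrightarrow> p (g x) = q x"
  using liftableE[OF liftable_X[OF covering q] x0] by metis

lemma self_unique:
  assumes "continuous_on X g" "g ` X \<subseteq> X" "continuous_on X h" "h ` X \<subseteq> X" "\<And>x. x \<in> X \<Longrightarrow> p (g x) = p (h x)"
    and "x0 \<in> X" "g x0 = h x0" "x \<in> X"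
  shows "g x = h x"
  by (rule covering_lift_unique[OF covering connected_X assms(1-7) assms(8)])

lemma continuous_p: "continuous_on X p" and p_image: "p ` X \<subseteq> Z"
  using covering_space_imp_continuous[OF covering] p_in_Z by auto

text \<open>The map \<open>p\<close> lifts through itself with \<open>x\<close> going to
  \<open>y\<close>, and also with \<open>y\<close> going to \<open>x\<close>. The composites are
  lifts of \<open>p\<close> with a fixed point and therefore the identity.\<close>

lemma deck_exists:
  assumes x: "x \<in> V" and y: "y \<in> V"
  obtains d where "d \<in> deck_transformations X p" "d x = y"
proof -
  note xX = V_in_X[OF x] and yX = V_in_X[OF y]
  have pxy: "p y = p x" "p x = p y" using p_V[OF x] p_V[OF y] by auto
  obtain g where g: "continuous_on X g" "g ` X \<subseteq> X" "g x = y" "\<And>z. z \<in> X \<Longrightarrow> p (g z) = p z"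
    using lift_self[OF continuous_p p_image xX yX pxy(1)] by metis
  obtain h where h: "continuous_on X h" "h ` X \<subseteq> X" "h y = x" "\<And>z. z \<in> X \<Longrightarrow> p (h z) = p z"
    using lift_self[OF continuous_p p_image yX xX pxy(2)] by metis
  have hg: "h (g z) = z" if "z \<in> X" for z
  proof (rule self_unique[where g = "\<lambda>z. h (g z)" and h = "\<lambda>z. z" and ?x0.0 = x])
    show "continuous_on X (\<lambda>z. h (g z))" by (rule continuous_on_compose2[OF h(1) g(1,2)])
    show "p (h (g z)) = p z" if "z \<in> X" for z using h(4)[of "g z"] g(2,4) that by auto
  qed (use g h xX that in \<open>auto simp: image_subset_iff\<close>)
  have gh: "g (h z) = z" if "z \<in> X" for z
  proof (rule self_unique[where g = "\<lambda>z. g (h z)" and h = "\<lambda>z. z" and ?x0.0 = y])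
    show "continuous_on X (\<lambda>z. g (h z))" by (rule continuous_on_compose2[OF g(1) h(1,2)])
    show "p (g (h z)) = p z" if "z \<in> X" for z using g(4)[of "h z"] h(2,4) that by auto
  qed (use g h yX that in \<open>auto simp: image_subset_iff\<close>)
  have "z \<in> g ` X" "z \<in> h ` X" if "z \<in> X" for z
    using imageI[of "h z" X g] imageI[of "g z" X h] g(2) h(2) hg gh that by auto
  then have img: "g ` X = X" "h ` X = X" using g(2) h(2) by auto
  then have "homeomorphism X X g h" unfolding homeomorphism_def using g(1) h(1) hg gh by simp
  then have "homeomorphism X X (restrict g X) h" by (rule homeomorphism_cong) simp_all
  moreover have "bij_betw g X X" using g(2) h(2) gh hg by (intro bij_betw_byWitness[where f' = h]) auto
  then have "restrict g X \<in> Bij X" by (simp add: Bij_def cong: bij_betw_cong)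
  ultimately have "restrict g X \<in> deck_transformations X p" using g(4) by (auto simp: deck_transformations_def)
  then show ?thesis using that[of "restrict g X"] g(3) xX by simp
qed

lemma deck_D:
  assumes "d \<in> deck_transformations X p"
  shows "d \<in> Bij X" "\<exists>g. homeomorphism X X d g" "\<And>x. x \<in> X \<Longrightarrow> p (d x) = p x"
    "continuous_on X d" "d ` X \<subseteq> X"
  using assms by (auto simp: deck_transformations_def homeomorphism_def)

lemma cellular_over_id:
  assumes "\<And>x. x \<in> X \<Longrightarrow> p (d x) = p x"
  shows "cellular d"
  unfolding cellular_def
proof (intro ballI)
  fix i x assume i: "i \<in> I" "x \<in> V"
  show "\<exists>i'\<in>I. \<exists>r. continuous_on (cell_dom i') r \<and> r ` cell_dom i' \<subseteq> cell_dom i \<and>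
     r ` cell_int i' = cell_int i \<and> (\<forall>u\<in>cell_dom i'. p (d (lft i x (r u))) = \<kappa> i' u)"
    by (rule bexI[OF _ i(1)], rule exI[of _ "\<lambda>u. u"]) (use assms lft_in_X[OF i] lft(4)[OF i] in simp)
qed

lemma deck_in_H:
  assumes d: "d \<in> deck_transformations X p"
  shows "d \<in> carrier aut.H"
proof -
  obtain g where g: "homeomorphism X X d g" using deck_D(2)[OF d] ..
  have pg: "p (g x) = p x" if "x \<in> X" for x
  proof -
    have "g x \<in> X" "d (g x) = x" using g that unfolding homeomorphism_def by auto
    then show ?thesis using deck_D(3)[OF d, of "g x"] by simp
  qed
  show ?thesis by (rule homeomorphism_in_H[OF deck_D(1)[OF d] g cellular_over_id[OF deck_D(3)[OF d]] cellular_over_id[OF pg]])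
qed

lemma deck_lft:
  assumes d: "d \<in> deck_transformations X p" and i: "i \<in> I" "x \<in> V"
  shows "u \<in> cell_dom i \<Longrightarrow> d (lft i x u) = lft i (d x) u" and "d ` cell i x = cell i (d x)"
proof -
  have pd: "p (d (lft i x u)) = \<kappa> i u" if "u \<in> cell_dom i" for u
    using deck_D(3)[OF d lft_in_X[OF i that]] lft(4)[OF i that] by simp
  note l = lift_image_cell[OF deck_D(4,5)[OF d] i i(1), where r = "\<lambda>u. u"]
  show "u \<in> cell_dom i \<Longrightarrow> d (lft i x u) = lft i (d x) u" using l(2)[of u] pd lft(3)[OF i] by simp
  show "d ` cell i x = cell i (d x)" using l(3) pd lft(3)[OF i] by simp
qed

lemma deck_V: "d \<in> deck_transformations X p \<Longrightarrow> x \<in> V \<Longrightarrow> d x \<in> V"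
  by (rule aut_vertex[OF deck_in_H])

lemma deck_tgt: "d \<in> deck_transformations X p \<Longrightarrow> e \<in> E \<Longrightarrow> x \<in> V \<Longrightarrow> d (tgt e x) = tgt e (d x)"
  using deck_lft(1)[of d "Edge e" x 1] one_in_Edge(1)[of e] by (simp add: tgt_def)

lemma deck_src: "d \<in> deck_transformations X p \<Longrightarrow> e \<in> E \<Longrightarrow> x \<in> V \<Longrightarrow> d (src e x) = src e (d x)"
  using deck_tgt[of d e "src e x"] src[of e x] src_tgt[of e "d (src e x)"] deck_V[of d "src e x"] by auto

lemma deck_walk: "d \<in> deck_transformations X p \<Longrightarrow> fst ` set u \<subseteq> E \<Longrightarrow> x \<in> V \<Longrightarrow> d (walk u x) = walk u (d x)"
proof (induction u arbitrary: x)
  case (Cons l u)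
  then have "d (step l x) = step l (d x)" by (simp add: step_def deck_tgt deck_src)
  then show ?case using Cons step_in_V[of l x] by simp
qed simp

lemma deck_unique:
  assumes "d \<in> deck_transformations X p" "d' \<in> deck_transformations X p" "x \<in> X" "d x = d' x"
  shows "d = d'"
proof
  fix y
  show "d y = d' y"
  proof (cases "y \<in> X")
    case True
    then show ?thesis
      using self_unique[OF deck_D(4,5)[OF assms(1)] deck_D(4,5)[OF assms(2)] _ assms(3,4) True]
        deck_D(3)[OF assms(1)] deck_D(3)[OF assms(2)] by simp
  next
    case False
    then show ?thesis using deck_D(1)[OF assms(1)] deck_D(1)[OF assms(2)] by (simp add: Bij_def extensional_def)
  qed
qed

end

text \<open>An equivalence along each edge is asked for, because walks also traverse edges
  backwards.\<close>

lemma (in simple_cover) vertex_induct: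
  assumes x0: "x0 \<in> V" "P x0" and step: "\<And>e x. e \<in> E \<Longrightarrow> x \<in> V \<Longrightarrow> P x \<longleftrightarrow> P (tgt e x)" and y: "y \<in> V"
  shows "P y"
proof -
  have st: "P (step l x)" if "fst l \<in> E" "x \<in> V" "P x" for l x
    using that step[OF that(1,2)] step[OF that(1), of "src (fst l) x"] src[OF that(1,2)] by (auto simp: step_def)
  have "P (walk u x)" if "fst ` set u \<subseteq> E" "x \<in> V" "P x" for u x
    using that by (induction u arbitrary: x) (auto simp: step_in_V st)
  then show ?thesis using all_reachable[OF x0(1) y] x0 unfolding reach_def by blast
qed

section \<open>The covering of the complex of the Baumslag-Solitar group\<close>

locale bs_cover =
  fixes m n :: nat and Z :: "'z::topological_space set" and v :: 'z
    and \<phi> :: "z_edge \<Rightarrow> real \<Rightarrow> 'z" and \<psi> :: "nat \<Rightarrow> complex \<Rightarrow> 'z"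
    and X :: "'x::topological_space set" and p :: "'x \<Rightarrow> 'z"
  assumes m_pos: "m \<ge> 1" and n_pos: "n \<ge> 1" and is_Z: "is_Z m n Z v \<phi> \<psi>" and universal: "universal_cover X p Z"

sublocale bs_cover \<subseteq> simple_cover Z v \<phi> \<psi> "z_edges m n" "{..<gcd m n}" "z_word m n" X p
proof
  show "one_vertex_complex Z v \<phi> \<psi> (z_edges m n) {..<gcd m n} (z_word m n)" using is_Z by (simp add: is_Z_def)
  show "z_word m n f \<noteq> []" for f by (simp add: z_word_def)
  show "fst l \<in> z_edges m n" if "f \<in> {..<gcd m n}" "l \<in> set (z_word m n f)" for f l
    using that m_pos by (auto simp: z_word_def z_edges_def)
  show "covering_space X p Z" "simply_connected X" using universal by (simp_all add: universal_cover_def)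
qed

context bs_cover
begin

abbreviation k :: nat where "k \<equiv> gcd m n"
abbreviation A :: "'x \<Rightarrow> 'x" where "A \<equiv> tgt Edge_a"

lemma k_pos: "k > 0"
  using m_pos by simp

lemma edges [simp]: "Edge_a \<in> z_edges m n" "Edge_t i \<in> z_edges m n \<longleftrightarrow> i < k"
  by (auto simp: z_edges_def)

lemma length_z_word: "length (z_word m n i) = m div k + n div k + 2"
  by (simp add: z_word_def)

lemma z_word_nth:
  assumes "j < length (z_word m n i)"
  shows "z_word m n i ! j = (if j = 0 then (Edge_t i, True) else if j \<le> m div k then (Edge_a, True)
    else if j = m div k + 1 then (Edge_t ((i + 1) mod k), False) else (Edge_a, False))"
  using assms by (auto simp: z_word_def nth_append nth_Cons')

subsection \<open>Heights\<close>

lemma fold_letter_act_id: "\<beta> e = id \<Longrightarrow> fold (letter_act \<beta>) (replicate c (e, b)) \<sigma> = \<sigma>"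
  by (induction c) (simp_all add: letter_act_def)

text \<open>Each attaching word contains one \<open>t\<close>-letter of each sign, so counting
  \<open>t\<close>-letters with sign is consistent.\<close>

lemma height_exists: "\<exists>h :: 'x \<Rightarrow> int. \<forall>x\<in>V. h (A x) = h x \<and> (\<forall>i<k. h (tgt (Edge_t i) x) = h x + 1)"
proof -
  define \<beta> :: "z_edge \<Rightarrow> int \<Rightarrow> int" where "\<beta> e = (case e of Edge_a \<Rightarrow> id | Edge_t i \<Rightarrow> (\<lambda>h. h + 1))" for e
  obtain x0 where x0: "x0 \<in> V" using V_nonempty by blast
  have bt: "bij (\<lambda>h::int. h + 1)" by (rule bij_betw_byWitness[where f' = "\<lambda>h. h - 1"]) auto
  have inv: "inv_into UNIV (\<lambda>h::int. h + 1) (s + 1) = s" for s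
    using inv_f_f[OF bij_is_inj[OF bt], of s] by simp
  obtain L where L: "L x0 = (0::int)" "\<And>e x. e \<in> z_edges m n \<Longrightarrow> x \<in> V \<Longrightarrow> L (tgt e x) = \<beta> e (L x)"
  proof (rule edge_labelling[of \<beta> x0 0])
    show "bij (\<beta> e)" for e using bt by (cases e) (simp_all add: \<beta>_def)
    show "fold (letter_act \<beta>) (z_word m n f) \<sigma> = \<sigma>" for f \<sigma>
      by (simp add: z_word_def fold_letter_act_id \<beta>_def letter_act_def inv)
  qed (use x0 that in auto)
  then show ?thesis by (intro exI[of _ L]) (simp add: \<beta>_def)
qed

definition height :: "'x \<Rightarrow> int" where
  "height = (SOME h. \<forall>x\<in>V. h (A x) = h x \<and> (\<forall>i<k. h (tgt (Edge_t i) x) = h x + 1))"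

lemma height_A: "x \<in> V \<Longrightarrow> height (A x) = height x"
  and height_T: "x \<in> V \<Longrightarrow> i < k \<Longrightarrow> height (tgt (Edge_t i) x) = height x + 1"
  using someI_ex[OF height_exists, folded height_def] by auto

lemma height_src: "x \<in> V \<Longrightarrow> height (src Edge_a x) = height x"
  using height_A[of "src Edge_a x"] src[of Edge_a x] by simp

lemma height_walk_a: "x \<in> V \<Longrightarrow> height (walk (replicate c (Edge_a, b)) x) = height x"
  by (induction c arbitrary: x) (auto simp: step_def height_A height_src tgt_in_V src)

subsection \<open>Rotating the labels of the edges at one height\<close>

text \<open>Renaming the edges \<open>t_i\<close> and the faces cyclically carries attaching words
  to attaching words.\<close>

fun rot :: "nat \<Rightarrow> (z_edge, nat) cell_index \<Rightarrow> (z_edge, nat) cell_index" where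
  "rot c Vertex = Vertex"
| "rot c (Edge Edge_a) = Edge Edge_a"
| "rot c (Edge (Edge_t i)) = Edge (Edge_t ((i + c) mod k))"
| "rot c (Face i) = Face ((i + c) mod k)"

lemma rot_simps: "i \<in> I \<Longrightarrow> rot c i \<in> I" "cell_dom (rot c i) = cell_dom i" "cell_int (rot c i) = cell_int i"
    "cell_base (rot c i) = cell_base i"
  using k_pos by (cases "(c, i)" rule: rot.cases; simp)+

lemma rot_rot:
  assumes "(c + c') mod k = 0" "i \<in> I"
  shows "rot c' (rot c i) = i"
proof -
  have "((j + c) mod k + c') mod k = j" if "j < k" for j
  proof -
    have "((j + c) mod k + c') mod k = (j + (c + c')) mod k" by (simp add: mod_simps add.assoc)
    also have "\<dots> = (j + (c + c') mod k) mod k" by (simp only: mod_simps)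
    finally show ?thesis using assms(1) that by simp
  qed
  then show ?thesis using assms(2) by (cases "(c, i)" rule: rot.cases) simp_all
qed

text \<open>Cells are selected by the height of their base. Both \<open>t\<close>-edges of a face
  start at the height of its base, so a face is rotated exactly when its \<open>t\<close>-edges
  are.\<close>

definition shift :: "nat \<Rightarrow> int \<Rightarrow> 'x \<Rightarrow> (z_edge, nat) cell_index \<Rightarrow> (z_edge, nat) cell_index" where
  "shift c N x i = (if height x = N then rot c i else i)"

text \<open>The covering map with the rotation applied at one height. As it depends on heights it is
  defined on \<open>X\<close>, cell by cell; the chosen \<open>r\<close> is unique because open
  cells are disjoint and injectively parametrised.\<close>

definition twist :: "nat \<Rightarrow> int \<Rightarrow> 'x \<Rightarrow> 'z" where
  "twist c N q = (let r = (SOME r. fst r \<in> I \<and> fst (snd r) \<in> V \<and> snd (snd r) \<in> cell_int (fst r) \<and>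
      q = lft (fst r) (fst (snd r)) (snd (snd r))) in \<kappa> (shift c N (fst (snd r)) (fst r)) (snd (snd r)))"

lemma shift_simps: "i \<in> I \<Longrightarrow> shift c N x i \<in> I" "cell_dom (shift c N x i) = cell_dom i" "cell_int (shift c N x i) = cell_int i"
    "cell_base (shift c N x i) = cell_base i" "shift c N x Vertex = Vertex" "shift c N x (Edge Edge_a) = Edge Edge_a"
  by (auto simp: shift_def rot_simps)

lemma twist_int:
  assumes "i \<in> I" "x \<in> V" "u \<in> cell_int i"
  shows "twist c N (lft i x u) = \<kappa> (shift c N x i) u"
proof -
  define r where "r = (SOME r. fst r \<in> I \<and> fst (snd r) \<in> V \<and> snd (snd r) \<in> cell_int (fst r) \<and>
      lft i x u = lft (fst r) (fst (snd r)) (snd (snd r)))"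
  have "\<exists>r. fst r \<in> I \<and> fst (snd r) \<in> V \<and> snd (snd r) \<in> cell_int (fst r) \<and>
      lft i x u = lft (fst r) (fst (snd r)) (snd (snd r))"
    using assms by (intro exI[of _ "(i, x, u)"]) simp
  from someI_ex[OF this, folded r_def]
  have r: "fst r \<in> I" "fst (snd r) \<in> V" "snd (snd r) \<in> cell_int (fst r)" "lft i x u = lft (fst r) (fst (snd r)) (snd (snd r))" by auto
  have "i = fst r" "x = fst (snd r)" "u = snd (snd r)" using lft_inj[OF assms(1) r(1) assms(2) r(2) assms(3) r(3,4)] by auto
  then show ?thesis unfolding twist_def r_def[symmetric] Let_def by simp
qed

lemma twist_V: "x \<in> V \<Longrightarrow> twist c N x = v"
  using twist_int[of Vertex x 0 c N] by (simp add: shift_simps)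

lemma \<kappa>_edge_ends: "e \<in> z_edges m n \<Longrightarrow> \<kappa> (Edge e) 0 = v" "e \<in> z_edges m n \<Longrightarrow> \<kappa> (Edge e) 1 = v"
  using edge_map by auto

lemma twist_edge:
  assumes e: "e \<in> z_edges m n" and x: "x \<in> V" and s: "s \<in> {0..1}"
  shows "twist c N (lft (Edge e) x (of_real s)) = \<kappa> (shift c N x (Edge e)) (of_real s)"
proof -
  obtain e' where e': "shift c N x (Edge e) = Edge e'" "e' \<in> z_edges m n"
    using shift_simps(1)[of "Edge e" c N x] e by (cases e) (auto simp: shift_def split: if_splits)
  consider "s = 0" | "s = 1" | "s \<in> {0<..<1}" using s by fastforce
  then show ?thesis
  proof cases
    case 1
    then show ?thesis using e' e x \<kappa>_edge_ends by (simp add: twist_V)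
  next
    case 2
    then show ?thesis using e' e x \<kappa>_edge_ends twist_V[OF tgt_in_V[OF e x]] by (simp add: tgt_def)
  next
    case 3
    then show ?thesis using twist_int[of "Edge e" x "of_real s"] e x by simp
  qed
qed

lemma arc_indep: "arc i j s = arc i' j s"
  by (simp add: arc_def length_z_word)

text \<open>Inside cells this is the definition. On the boundary of a face, the words of the
  original and of the rotated face differ only in the indices of the \<open>t\<close>-letters, and
  these are the indices of the rotated edges.\<close>

lemma twist_lft:
  assumes i: "i \<in> I" and x: "x \<in> V" and u: "u \<in> cell_dom i"
  shows "twist c N (lft i x u) = \<kappa> (shift c N x i) u"
proof (cases "u \<in> cell_int i")
  case True
  then show ?thesis by (rule twist_int[OF i x])
next
  case False
  show ?thesis
  proof (cases i)
    case Vertex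
    then show ?thesis using False u by simp
  next
    case (Edge e)
    then obtain s where s: "u = of_real s" "s \<in> {0..1}" using u by auto
    then show ?thesis using twist_edge[of e x s] Edge i x by simp
  next
    case (Face f)
    then have f: "f < k" and nu: "norm u = 1" using i u False by auto
    then have fF: "f \<in> {..<k}" by simp
    obtain j s where js: "j < length (z_word m n f)" "s \<in> {0..<1}" "u = arc f j s" using circle_eq_arc[OF fF nu] by metis
    have s: "s \<in> {0..1}" using js by auto
    define f' where "f' = (if height x = N then (f + c) mod k else f)"
    have f': "f' \<in> {..<k}" "shift c N x i = Face f'" using f k_pos Face by (auto simp: f'_def shift_def)
    let ?l = "z_word m n f ! j" and ?l' = "z_word m n f' ! j"
    define y where "y = walk (take j (z_word m n f)) x"
    have y: "y \<in> V" unfolding y_def by (rule walk_take_in_V[OF fF x])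
    have lE: "fst ?l \<in> z_edges m n" by (rule word_letter_in_E[OF fF js(1)])
    have lV: "letter_start ?l y \<in> V" by (rule letter_start_in_V[OF lE y])
    have j': "j < length (z_word m n f')" using js(1) by (simp add: length_z_word)
    have "snd ?l' = snd ?l" unfolding z_word_nth[OF js(1)] z_word_nth[OF j'] by simp
    moreover have "shift c N (letter_start ?l y) (Edge (fst ?l)) = Edge (fst ?l')"
    proof -
      consider "j = 0" | "j = m div k + 1" | "j \<noteq> 0" "j \<noteq> m div k + 1" by blast
      then show ?thesis
      proof cases
        case 1
        then have "letter_start ?l y = x" using z_word_nth[OF js(1)] by (simp add: letter_start_def y_def)
        then show ?thesis using 1 z_word_nth[OF js(1)] z_word_nth[OF j'] by (simp add: shift_def f'_def)
      next
        \<comment> \<open>The second \<open>t\<close>-letter is read backwards. Its edge ends one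
          level above \<open>x\<close>, so it starts at the height of \<open>x\<close> and is
          rotated together with the face.\<close>
        case 2
        then have l: "?l = (Edge_t ((f + 1) mod k), False)" "?l' = (Edge_t ((f' + 1) mod k), False)"
          using z_word_nth[OF js(1)] z_word_nth[OF j'] by simp_all
        have "take j (z_word m n f) = (Edge_t f, True) # replicate (m div k) (Edge_a, True)"
          using 2 by (simp add: z_word_def)
        then have "height y = height x + 1" unfolding y_def using f x
          by (simp add: step_def height_walk_a tgt_in_V height_T del: fold_replicate)
        moreover have "height y = height (letter_start ?l y) + 1"
          using height_T[OF lV, of "(f + 1) mod k"] src[OF lE y] l k_pos by (simp add: letter_start_def)
        ultimately have "height (letter_start ?l y) = height x" by simp
        moreover have "((f + 1) mod k + c) mod k = ((f + c) mod k + 1) mod k" by (simp add: mod_simps ac_simps)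
        ultimately show ?thesis using l by (simp add: shift_def f'_def)
      next
        case 3
        then have "fst ?l = Edge_a" "fst ?l' = Edge_a" unfolding z_word_nth[OF js(1)] z_word_nth[OF j'] by simp_all
        then show ?thesis by (simp add: shift_simps)
      qed
    qed
    moreover have "lft i x u = letter_lift ?l y s" unfolding y_def js(3) Face by (rule face_boundary[OF fF x js(1) s])
    ultimately have "twist c N (lft i x u) = \<kappa> (Edge (fst ?l')) (of_real (if snd ?l' then s else 1 - s))"
      using twist_edge[OF lE lV, of "if snd ?l then s else 1 - s"] s by (simp add: letter_lift_def)
    also have "\<dots> = \<psi> f' (arc f' j s)" using face_arc[OF f'(1) j' s] by (simp add: letter_path_def)
    finally show ?thesis using f'(2) js(3) arc_indep[of f j s f'] by simp
  qed
qed

lemma continuous_twist: "continuous_on X (twist c N)"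
proof (rule weak_top_continuous[OF weak_X])
  fix j :: "(z_edge, nat) cell_index \<times> 'x" assume "j \<in> I \<times> V"
  then have j: "fst j \<in> I" "snd j \<in> V" by auto
  have "continuous_on (cell_dom (fst j)) (\<kappa> (shift c N (snd j) (fst j)))"
    using continuous_\<kappa>[OF shift_simps(1)[OF j(1), of c N "snd j"]] shift_simps(2)[of c N "snd j" "fst j"] by simp
  then show "continuous_on (cell_dom (fst j)) (\<lambda>u. twist c N (lft (fst j) (snd j) u))"
    by (rule continuous_on_eq) (simp add: twist_lft[OF j])
qed

lemma twist_in_Z: "twist c N ` X \<subseteq> Z"
proof
  fix z assume "z \<in> twist c N ` X"
  then obtain q where q: "q \<in> X" "z = twist c N q" by blast
  obtain i x u where r: "i \<in> I" "x \<in> V" "u \<in> cell_int i" "q = lft i x u" using q(1) by (rule cell_through)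
  then show "z \<in> Z" using q(2) twist_int[OF r(1-3)] \<kappa>_int_in_Z[OF shift_simps(1)[OF r(1)]] shift_simps(3) by metis
qed

lemma twist_lift_lft:
  assumes f: "continuous_on X f" "f ` X \<subseteq> X" "\<And>q. q \<in> X \<Longrightarrow> p (f q) = twist c N q" and i: "i \<in> I" "x \<in> V" and u: "u \<in> cell_dom i"
  shows "f x \<in> V" "f (lft i x u) = lft (shift c N x i) (f x) u"
proof -
  let ?i = "shift c N x i"
  have pp: "p (f (lft i x ((\<lambda>u. u) u))) = \<kappa> ?i u" if "u \<in> cell_dom ?i" for u
    using f(3) lft_in_X[OF i] twist_lft[OF i] that by (simp add: shift_simps)
  note l = lift_image_cell[OF f(1,2) i shift_simps(1)[OF i(1), of c N x], where r = "\<lambda>u. u"]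
  have b: "f (lft i x (cell_base ?i)) = f x" using lft(3)[OF i] by (simp add: shift_simps)
  show "f x \<in> V" using l(1) pp b by (simp add: shift_simps)
  show "f (lft i x u) = lft ?i (f x) u" using l(2)[of u] pp b u by (simp add: shift_simps)
qed

text \<open>Rotation changes only the indices of \<open>t\<close>-edges, so an edge and its image
  raise the height by the same amount.\<close>

lemma twist_lift_height:
  assumes f: "continuous_on X f" "f ` X \<subseteq> X" "\<And>q. q \<in> X \<Longrightarrow> p (f q) = twist c N q" and x0: "x0 \<in> V" "f x0 = x0" and x: "x \<in> V"
  shows "height (f x) = height x"
proof (rule vertex_induct[OF x0(1) _ _ x])
  show "height (f x0) = height x0" using x0 by simp
  fix e x assume e: "e \<in> z_edges m n" and x: "x \<in> V"
  note l = twist_lift_lft[OF f _ x, of "Edge e"]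
  have fx: "f x \<in> V" using l(1)[of 1] e one_in_Edge(1)[of e] by simp
  have "f (tgt e x) = lft (shift c N x (Edge e)) (f x) 1" using l(2)[of 1] e one_in_Edge(1)[of e] by (simp add: tgt_def)
  then have "height (f (tgt e x)) - height (f x) = height (tgt e x) - height x"
    using e x fx k_pos by (cases e) (auto simp: shift_def tgt_def[symmetric] height_A height_T)
  then show "height (f x) = height x \<longleftrightarrow> height (f (tgt e x)) = height (tgt e x)" by linarith
qed

text \<open>Since \<open>f\<close> preserves heights, the second twist meets exactly the cells
  rotated by the first and restores their indices. Thus \<open>g\<close> after \<open>f\<close> is a
  lift of \<open>p\<close> with fixed point \<open>x0\<close>.\<close>

lemma twist_lift_inverse:
  assumes f: "continuous_on X f" "f ` X \<subseteq> X" "\<And>q. q \<in> X \<Longrightarrow> p (f q) = twist c N q" "f x0 = x0"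
    and g: "continuous_on X g" "g ` X \<subseteq> X" "\<And>q. q \<in> X \<Longrightarrow> p (g q) = twist c' N q" "g x0 = x0"
    and x0: "x0 \<in> V" and c: "(c + c') mod k = 0" and q: "q \<in> X"
  shows "g (f q) = q"
proof (rule self_unique[where g = "\<lambda>q. g (f q)" and h = "\<lambda>q. q" and ?x0.0 = x0])
  show "continuous_on X (\<lambda>q. g (f q))" by (rule continuous_on_compose2[OF g(1) f(1,2)])
  show "p (g (f q)) = p q" if "q \<in> X" for q
  proof -
    obtain i x u where r: "i \<in> I" "x \<in> V" "u \<in> cell_int i" "q = lft i x u" using \<open>q \<in> X\<close> by (rule cell_through)
    have u: "u \<in> cell_dom i" using r(3) cell_int_subset by blast
    note l = twist_lift_lft[OF f(1-3) r(1,2) u]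
    have fx: "f q \<in> X" using f(2) that by blast
    have "p (g (f q)) = \<kappa> (shift c' N (f x) (shift c N x i)) u"
      using g(3)[OF fx] l r(4) twist_lft[OF shift_simps(1)[OF r(1)] l(1)] u by (simp add: shift_simps)
    moreover have "shift c' N (f x) (shift c N x i) = i"
      using twist_lift_height[OF f(1-3) x0 f(4) r(2)] rot_rot[OF c r(1)] by (simp add: shift_def)
    ultimately show ?thesis using lft(4)[OF r(1,2) u] r(4) by simp
  qed
qed (use f g x0 V_in_X q in \<open>auto simp: image_subset_iff\<close>)

lemma cellular_twist_lift:
  assumes f: "\<And>q. q \<in> X \<Longrightarrow> p (f q) = twist c N q"
  shows "cellular f"
  unfolding cellular_def
proof (intro ballI)
  fix i x assume i: "i \<in> I" "x \<in> V"
  show "\<exists>i'\<in>I. \<exists>r. continuous_on (cell_dom i') r \<and> r ` cell_dom i' \<subseteq> cell_dom i \<and>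
     r ` cell_int i' = cell_int i \<and> (\<forall>u\<in>cell_dom i'. p (f (lft i x (r u))) = \<kappa> i' u)"
    by (rule bexI[OF _ shift_simps(1)[OF i(1), of c N x]], rule exI[of _ "\<lambda>u. u"])
      (use f lft_in_X[OF i] twist_lft[OF i] in \<open>simp add: shift_simps\<close>)
qed

lemma shear_exists:
  assumes x0: "x0 \<in> V"
  shows "\<exists>f\<in>carrier aut.H. f x0 = x0 \<and> (\<forall>i\<in>I. \<forall>x\<in>V. f x \<in> V \<and> (\<forall>u\<in>cell_dom i. f (lft i x u) = lft (shift 1 N x i) (f x) u))"
proof -
  note xX = V_in_X[OF x0]
  have pv: "p x0 = twist c N x0" for c using p_V[OF x0] twist_V[OF x0] by simp
  obtain f where f: "continuous_on X f" "f ` X \<subseteq> X" "f x0 = x0" "\<And>q. q \<in> X \<Longrightarrow> p (f q) = twist 1 N q"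
    using lift_self[OF continuous_twist twist_in_Z xX xX pv] by metis
  \<comment> \<open>Rotating by \<open>k - 1\<close> further steps completes a full turn, which
    makes \<open>g\<close> the inverse of \<open>f\<close>.\<close>
  obtain g where g: "continuous_on X g" "g ` X \<subseteq> X" "g x0 = x0" "\<And>q. q \<in> X \<Longrightarrow> p (g q) = twist (k - 1) N q"
    using lift_self[OF continuous_twist twist_in_Z xX xX pv] by metis
  have c: "(1 + (k - 1)) mod k = 0" "(k - 1 + 1) mod k = 0" using k_pos by simp_all
  have "restrict f X \<in> carrier aut.H"
  proof (rule cellular_in_H[OF f(1,2) _ g(1,2)])
    show "cellular f" "cellular g" using cellular_twist_lift f(4) g(4) by blast+
    show "g (f q) = q" if "q \<in> X" for q by (rule twist_lift_inverse[OF f(1,2,4,3) g(1,2,4,3) x0 c(1) that])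
    show "f (g q) = q" if "q \<in> X" for q by (rule twist_lift_inverse[OF g(1,2,4,3) f(1,2,4,3) x0 c(2) that])
  qed
  moreover have "restrict f X x0 = x0" using f(3) xX by simp
  moreover have "restrict f X x \<in> V" if "x \<in> V" for x
    using twist_lift_lft(1)[OF f(1,2,4) _ that, of Vertex 0] V_in_X[OF that] by simp
  moreover have "restrict f X (lft i x u) = lft (shift 1 N x i) (restrict f X x) u" if "i \<in> I" "x \<in> V" "u \<in> cell_dom i" for i x u
    using twist_lift_lft(2)[OF f(1,2,4) that] V_in_X[OF that(2)] lft_in_X[OF that] by simp
  ultimately show ?thesis by (intro bexI[of _ "restrict f X"]) auto
qed

text \<open>The automorphism rotating the \<open>t\<close>-edges that start at height \<open>N\<close> and fixing \<open>x0\<close> fixes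
  every cell reachable from \<open>x0\<close> below height \<open>N\<close>, so these automorphisms tend to the identity.\<close>

theorem not_discrete:
  assumes k2: "k \<ge> 2"
  shows "\<not> aut_discrete X cells"
proof (rule aut.not_aut_discreteI)
  fix G assume G: "finite G" "G \<subseteq> cells"
  obtain x0 where x0: "x0 \<in> V" using V_nonempty by blast
  have "\<forall>N. \<exists>f. f \<in> carrier aut.H \<and> f x0 = x0 \<and> (\<forall>i\<in>I. \<forall>x\<in>V. f x \<in> V \<and> (\<forall>u\<in>cell_dom i. f (lft i x u) = lft (shift 1 N x i) (f x) u))"
    using shear_exists[OF x0] by blast
  from choice[OF this] obtain f where f: "\<forall>N. f N \<in> carrier aut.H \<and> f N x0 = x0 \<and> (\<forall>i\<in>I. \<forall>x\<in>V. f N x \<in> V \<and> (\<forall>u\<in>cell_dom i. f N (lft i x u) = lft (shift 1 N x i) (f N x) u))" ..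
  have fH: "f N \<in> carrier aut.H" and fx0: "f N x0 = x0" for N using f by auto
  have fV: "f N x \<in> V" if "x \<in> V" for N x using f that in_I(1) by blast
  have fl: "f N (lft i x u) = lft (shift 1 N x i) (f N x) u" if "i \<in> I" "x \<in> V" "u \<in> cell_dom i" for N i x u
    using f that by blast
  have fc: "f N ` cell i x = cell (shift 1 N x i) (f N x)" if "i \<in> I" "x \<in> V" for N i x
  proof -
    have "f N ` lft i x ` cell_int i = lft (shift 1 N x i) (f N x) ` cell_int i"
      unfolding image_image by (rule image_cong[OF HOL.refl], rule fl[OF that]) (use cell_int_subset in blast)
    then show ?thesis by (simp add: cell_def shift_simps)
  qed
  have ft: "f N (tgt e x) = tgt e (f N x)" if "e \<in> z_edges m n" "x \<in> V" "height x \<noteq> N" for N e x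
    using fl[of "Edge e" x 1 N] that one_in_Edge(1)[of e] by (simp add: tgt_def shift_def)
  \<comment> \<open>Once \<open>N\<close> exceeds the height of the start of an edge,
    \<open>f N\<close> commutes with passing along it, so one end is fixed exactly when the other
    is. A vertex is joined to \<open>x0\<close> by finitely many edges.\<close>
  have fix_V: "\<forall>\<^sub>F N in at_top. f N x = x" if x: "x \<in> V" for x
  proof (rule vertex_induct[OF x0 _ _ x])
    show "\<forall>\<^sub>F N in at_top. f N x0 = x0" using fx0 by simp
    fix e x assume e: "e \<in> z_edges m n" and x: "x \<in> V"
    have "\<forall>\<^sub>F N in at_top. height x < N" by (rule eventually_gt_at_top)
    then have "\<forall>\<^sub>F N in at_top. f N x = x \<longleftrightarrow> f N (tgt e x) = tgt e x"
    proof eventually_elim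
      case (elim N)
      then have "f N (tgt e x) = tgt e (f N x)" using ft[OF e x] by simp
      then show ?case using tgt_inj[OF e fV[OF x] x] by auto
    qed
    then show "(\<forall>\<^sub>F N in at_top. f N x = x) \<longleftrightarrow> (\<forall>\<^sub>F N in at_top. f N (tgt e x) = tgt e x)"
      by (rule eventually_subst)
  qed
  have "\<forall>\<^sub>F N in at_top. f N ` \<sigma> = \<sigma>" if s: "\<sigma> \<in> cells" for \<sigma>
  proof -
    obtain i x where ix: "i \<in> I" "x \<in> V" "\<sigma> = cell i x" using s by (rule cells_E)
    show ?thesis using fix_V[OF ix(2)] eventually_gt_at_top[of "height x"]
      by eventually_elim (simp add: ix fc shift_def)
  qed
  then have "\<forall>\<^sub>F N in at_top. \<forall>\<sigma>\<in>G. f N ` \<sigma> = \<sigma>"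
    using G by (subst eventually_ball_finite_distrib) auto
  then have "\<forall>\<^sub>F N in at_top. height x0 \<le> N \<and> (\<forall>\<sigma>\<in>G. f N ` \<sigma> = \<sigma>)"
    using eventually_ge_at_top[of "height x0"] by eventually_elim simp
  then obtain N where N: "height x0 \<le> N" "\<forall>\<sigma>\<in>G. f N ` \<sigma> = \<sigma>"
    using eventually_happens by fastforce
  have t0: "Edge_t 0 \<in> z_edges m n" using k_pos by simp
  have up: "(tgt (Edge_t 0) ^^ j) x0 \<in> V \<and> height ((tgt (Edge_t 0) ^^ j) x0) = height x0 + int j" for j
    by (induction j) (use x0 t0 k_pos in \<open>simp_all add: tgt_in_V height_T\<close>)
  \<comment> \<open>A vertex at height exactly \<open>N\<close>, reached from \<open>x0\<close>
    along \<open>t_0\<close>-edges. There \<open>f N\<close> turns a \<open>t_0\<close>-edge into a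
    \<open>t_1\<close>-edge, and these differ because \<open>k\<close> is at least 2.\<close>
  define y where "y = (tgt (Edge_t 0) ^^ nat (N - height x0)) x0"
  have y: "y \<in> V" "height y = N" using up[of "nat (N - height x0)"] N(1) by (simp_all add: y_def)
  have "f N ` cell (Edge (Edge_t 0)) y = cell (Edge (Edge_t 1)) (f N y)"
    using fc[of "Edge (Edge_t 0)" y N] y t0 k2 by (simp add: shift_def)
  then have "f N ` cell (Edge (Edge_t 0)) y \<noteq> cell (Edge (Edge_t 0)) y"
    using cell_inj[of "Edge (Edge_t 1)" "f N y" "Edge (Edge_t 0)" y] fV[OF y(1)] y(1) k2 t0 by auto
  moreover have "cell (Edge (Edge_t 0)) y \<in> cells" using cells_I[of "Edge (Edge_t 0)" y] y t0 by simp
  ultimately have "f N \<notin> cell_trivial X cells" unfolding aut.cell_trivial_iff by blast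
  then show "\<exists>f\<in>carrier aut.H. (\<forall>\<sigma>\<in>G. f ` \<sigma> = \<sigma>) \<and> f \<notin> cell_trivial X cells" using fH N(2) by blast
qed

end

section \<open>Coprime parameters\<close>

locale bs_coprime = bs_cover m n Z v \<phi> \<psi> X p
  for m n :: nat and Z :: "'z::topological_space set" and v :: 'z
    and \<phi> :: "z_edge \<Rightarrow> real \<Rightarrow> 'z" and \<psi> :: "nat \<Rightarrow> complex \<Rightarrow> 'z"
    and X :: "'x::topological_space set" and p :: "'x \<Rightarrow> 'z" +
  assumes gcd1: "gcd m n = 1"
begin

abbreviation T :: "'x \<Rightarrow> 'x" where "T \<equiv> tgt (Edge_t 0)"
abbreviation Ea :: "(z_edge, nat) cell_index" where "Ea \<equiv> Edge Edge_a"
abbreviation Et :: "(z_edge, nat) cell_index" where "Et \<equiv> Edge (Edge_t 0)"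
abbreviation Fc :: "(z_edge, nat) cell_index" where "Fc \<equiv> Face 0"

lemma pos [simp]: "0 < m" "0 < n"
  using m_pos n_pos by simp_all

lemma step_pair: "step (e, True) x = tgt e x" "step (e, False) x = src e x"
  by (simp_all add: step_def)

lemma E_cases: "e \<in> z_edges m n \<Longrightarrow> e = Edge_a \<or> e = Edge_t 0"
  using gcd1 by (auto simp: z_edges_def)

lemma t_in [simp]: "Edge_t 0 \<in> z_edges m n"
  using gcd1 by (simp add: z_edges_def)

lemma F_in [simp]: "0 \<in> {..<gcd m n}"
  using gcd1 by simp

lemma I_cases: "i \<in> I \<Longrightarrow> i = Vertex \<or> i = Ea \<or> i = Et \<or> i = Fc"
  by (cases i) (auto simp: cell_indices_def z_edges_def gcd1)

lemma word_eq: "z_word m n 0 = [(Edge_t 0, True)] @ replicate m (Edge_a, True) @ [(Edge_t 0, False)] @ replicate n (Edge_a, False)"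
  using gcd1 by (simp add: z_word_def)

definition az :: "int \<Rightarrow> 'x \<Rightarrow> 'x" where
  "az j x = (if 0 \<le> j then (A ^^ nat j) x else (src Edge_a ^^ nat (- j)) x)"

lemma az_0 [simp]: "az 0 x = x"
  by (simp add: az_def)

lemma az_V: "x \<in> V \<Longrightarrow> az j x \<in> V"
proof -
  assume x: "x \<in> V"
  have "(A ^^ i) x \<in> V" "(src Edge_a ^^ i) x \<in> V" for i by (induction i) (use x in \<open>auto simp: tgt_in_V src\<close>)
  then show ?thesis by (simp add: az_def)
qed

lemma az_Suc:
  assumes x: "x \<in> V"
  shows "az (j + 1) x = A (az j x)"
proof (cases "0 \<le> j")
  case True
  then show ?thesis by (simp add: az_def nat_add_distrib)
next
  case False
  define i where "i = nat (- j - 1)"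
  have j: "j = - int (Suc i)" using False by (simp add: i_def)
  have sV: "(src Edge_a ^^ i) x \<in> V" by (induction i) (use x in \<open>auto simp: src\<close>)
  have "nat (- j) = Suc i" unfolding j by (simp only: minus_minus nat_int)
  then have "az j x = src Edge_a ((src Edge_a ^^ i) x)" using False by (simp add: az_def)
  then have "A (az j x) = (src Edge_a ^^ i) x" using src[OF _ sV, of Edge_a] by simp
  moreover have "az (j + 1) x = (src Edge_a ^^ i) x"
    using j by (cases i) (simp_all add: az_def nat_add_distrib)
  ultimately show ?thesis by simp
qed

lemma az_pred:
  assumes x: "x \<in> V" and eq: "A y = az j x" and y: "y \<in> V"
  shows "y = az (j - 1) x"
proof (rule tgt_inj[of Edge_a])
  show "A y = A (az (j - 1) x)" unfolding eq using az_Suc[OF x, of "j - 1"] by simp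
qed (use y az_V[OF x] in simp_all)

lemma az_add: "x \<in> V \<Longrightarrow> az (i + j) x = az i (az j x)"
proof (induction i rule: int_induct[where k = 0])
  case base
  show ?case by simp
next
  case (step1 i)
  have "az (i + 1 + j) x = A (az (i + j) x)" using az_Suc[OF step1.prems, of "i + j"] by (simp add: algebra_simps)
  then show ?case using step1 az_Suc[OF az_V[OF step1.prems]] by simp
next
  case (step2 i)
  have "A (az (i - 1 + j) x) = az i (az j x)"
    using step2 az_Suc[OF step2.prems, of "i - 1 + j"] by (simp add: algebra_simps)
  then show ?case by (rule az_pred[OF az_V[OF step2.prems]]) (rule az_V[OF step2.prems])
qed

lemma A_az: "x \<in> V \<Longrightarrow> A x = az 1 x"
  using az_Suc[of x 0] by simp

lemma src_az: "x \<in> V \<Longrightarrow> src Edge_a x = az (- 1) x"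
  by (simp add: az_def)

lemma az_cancel [simp]: "x \<in> V \<Longrightarrow> az i (az (- i) x) = x" "x \<in> V \<Longrightarrow> az (- i) (az i x) = x"
  using az_add[of x i "- i"] az_add[of x "- i" i] by simp_all

lemma walk_a: "x \<in> V \<Longrightarrow> walk (replicate c (Edge_a, True)) x = az (int c) x"
    "x \<in> V \<Longrightarrow> walk (replicate c (Edge_a, False)) x = az (- int c) x"
proof -
  show "x \<in> V \<Longrightarrow> walk (replicate c (Edge_a, True)) x = az (int c) x"
  proof (induction c arbitrary: x)
    case (Suc c)
    then show ?case using az_add[OF Suc.prems, of "int c" 1] by (simp add: step_pair tgt_in_V A_az az_V algebra_simps del: fold_replicate)
  qed simp
  show "x \<in> V \<Longrightarrow> walk (replicate c (Edge_a, False)) x = az (- int c) x"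
  proof (induction c arbitrary: x)
    case (Suc c)
    then show ?case using az_add[OF Suc.prems, of "- int c" "- 1"] by (simp add: step_pair src src_az az_V algebra_simps del: fold_replicate)
  qed simp
qed

lemma T_V: "x \<in> V \<Longrightarrow> T x \<in> V"
  by (rule tgt_in_V) simp_all

text \<open>The boundary walk of the face at \<open>x\<close> closes up; this is the defining
  relation of the group read as a walk.\<close>

lemma bs_relation:
  assumes x: "x \<in> V"
  shows "az (int m) (T x) = T (az (int n) x)"
proof -
  let ?y = "src (Edge_t 0) (az (int m) (T x))"
  have y: "?y \<in> V" "T ?y = az (int m) (T x)" using src[of "Edge_t 0" "az (int m) (T x)"] az_V[OF T_V[OF x]] by simp_all
  have "az (- int n) ?y = x"
    using walk_face[of 0 x] x y T_V[OF x] by (simp add: word_eq walk_a step_pair del: fold_replicate)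
  then have "?y = az (int n) x" using y az_cancel(1)[of ?y "int n"] by metis
  then show ?thesis using y by simp
qed

subsection \<open>Distinguishing vertices\<close>

text \<open>The label \<open>(b, h)\<close> stands for the affine map \<open>x \<mapsto> (n/m)^h x + b\<close>, where \<open>a\<close> acts as
  \<open>x \<mapsto> x + 1\<close> and \<open>t\<close> as \<open>x \<mapsto> (n/m) x\<close>.\<close>

lemma labels_exist: "\<exists>L :: 'x \<Rightarrow> real \<times> int. \<forall>x\<in>V.
    L (A x) = (fst (L x) + (real n / real m) powi snd (L x), snd (L x)) \<and> L (T x) = (fst (L x), snd (L x) + 1)"
proof -
  define r where "r = real n / real m"
  have r0: "r \<noteq> 0" using m_pos n_pos by (simp add: r_def)
  define fa where "fa s = (fst s + r powi snd s, snd s)" for s :: "real \<times> int"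
  define ft where "ft s = (fst s, snd s + 1)" for s :: "real \<times> int"
  define \<beta> where "\<beta> e = (case e of Edge_a \<Rightarrow> fa | Edge_t i \<Rightarrow> ft)" for e
  have ba: "bij fa" by (rule bij_betw_byWitness[where f' = "\<lambda>s. (fst s - r powi snd s, snd s)"]) (auto simp: fa_def)
  have bt: "bij ft" by (rule bij_betw_byWitness[where f' = "\<lambda>s. (fst s, snd s - 1)"]) (auto simp: ft_def)
  have ia: "inv_into UNIV fa (b, h) = (b - r powi h, h)" for b h
    by (rule inv_f_eq[OF bij_is_inj[OF ba]]) (simp add: fa_def)
  have it: "inv_into UNIV ft (b, h) = (b, h - 1)" for b h
    by (rule inv_f_eq[OF bij_is_inj[OF bt]]) (simp add: ft_def)
  have pa: "fold (letter_act \<beta>) (replicate c (Edge_a, True)) (b, h) = (b + real c * r powi h, h)" for c b h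
    by (induction c arbitrary: b) (simp_all add: letter_act_def \<beta>_def fa_def algebra_simps)
  have na: "fold (letter_act \<beta>) (replicate c (Edge_a, False)) (b, h) = (b - real c * r powi h, h)" for c b h
    by (induction c arbitrary: b) (simp_all add: letter_act_def \<beta>_def ia algebra_simps)
  \<comment> \<open>The two horizontal sides of a face are equally long in the label,
    \<open>m\<close> steps on the upper level and \<open>n\<close> steps on the lower one. This
    dictates the ratio \<open>n / m\<close>.\<close>
  have rel: "real m * r powi (h + 1) = real n * r powi h" for h
    using m_pos r0 by (simp add: power_int_add_1 r_def)
  obtain x0 where x0: "x0 \<in> V" using V_nonempty by blast
  obtain L where L: "L x0 = (0, 0)" "\<And>e x. e \<in> z_edges m n \<Longrightarrow> x \<in> V \<Longrightarrow> L (tgt e x) = \<beta> e (L x)"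
  proof (rule edge_labelling[of \<beta> x0 "(0, 0)"])
    show "bij (\<beta> e)" for e using ba bt by (cases e) (simp_all add: \<beta>_def)
    show "fold (letter_act \<beta>) (z_word m n f) \<sigma> = \<sigma>" if "f \<in> {..<gcd m n}" for f \<sigma>
    proof -
      have "f = 0" using that gcd1 by simp
      moreover obtain b h where "\<sigma> = (b, h)" by (cases \<sigma>)
      ultimately show ?thesis unfolding \<open>f = 0\<close> word_eq
        using rel[of h] by (simp add: pa na letter_act_def[of \<beta> "(Edge_t 0, True)"] letter_act_def[of \<beta> "(Edge_t 0, False)"] \<beta>_def ft_def it del: fold_replicate)
    qed
  qed (use x0 that in auto)
  then show ?thesis by (intro exI[of _ L]) (simp add: \<beta>_def fa_def ft_def r_def)
qed

definition lab :: "'x \<Rightarrow> real \<times> int" where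
  "lab = (SOME L. \<forall>x\<in>V. L (A x) = (fst (L x) + (real n / real m) powi snd (L x), snd (L x)) \<and> L (T x) = (fst (L x), snd (L x) + 1))"

lemma lab_A: "x \<in> V \<Longrightarrow> lab (A x) = (fst (lab x) + (real n / real m) powi snd (lab x), snd (lab x))"
  and lab_T: "x \<in> V \<Longrightarrow> lab (T x) = (fst (lab x), snd (lab x) + 1)"
  using someI_ex[OF labels_exist, folded lab_def] by auto

lemma lab_az: "x \<in> V \<Longrightarrow> lab (az j x) = (fst (lab x) + of_int j * (real n / real m) powi snd (lab x), snd (lab x))"
proof (induction j rule: int_induct[where k = 0])
  case (step1 i)
  then show ?case using az_Suc[OF step1.prems, of i] lab_A[OF az_V[OF step1.prems, of i]] by (simp add: algebra_simps)
next
  case (step2 i)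
  then show ?case using az_Suc[OF step2.prems, of "i - 1"] lab_A[OF az_V[OF step2.prems, of "i - 1"]]
    by (cases "lab (az (i - 1) x)") (simp add: algebra_simps)
qed simp

text \<open>Along a branching line the label moves in steps of a power of \<open>n / m\<close>,
  which is not zero, so the line never closes.\<close>

lemma az_inj: "x \<in> V \<Longrightarrow> az i x = az j x \<longleftrightarrow> i = j"
proof
  assume x: "x \<in> V" and eq: "az i x = az j x"
  have "(real n / real m) powi snd (lab x) \<noteq> 0" using m_pos n_pos by simp
  moreover have "of_int i * (real n / real m) powi snd (lab x) = of_int j * (real n / real m) powi snd (lab x)"
    using lab_az[OF x, of i] lab_az[OF x, of j] unfolding eq by (metis add_left_cancel fst_conv)
  ultimately show "i = j" by (auto simp only: mult_cancel_right of_int_eq_iff)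
qed simp

lemma level_az: "x \<in> V \<Longrightarrow> snd (lab (az j x)) = snd (lab x)"
  by (simp add: lab_az)

lemma level_T: "x \<in> V \<Longrightarrow> snd (lab (T x)) = snd (lab x) + 1"
  by (simp add: lab_T)

lemma az_neq_T: "x \<in> V \<Longrightarrow> az i x \<noteq> az j (T x)"
  using level_az[of x i] level_az[of "T x" j] level_T[of x] T_V[of x] by auto

subsection \<open>The boundary of a face\<close>

text \<open>Incidence is phrased as a property of some position on the boundary word, so that it
  splits under concatenation and the four runs of the relator can be treated separately.\<close>

definition passes :: "(z_edge \<times> bool \<Rightarrow> 'x \<Rightarrow> bool) \<Rightarrow> z_edge word \<Rightarrow> 'x \<Rightarrow> bool" where
  "passes P u x \<longleftrightarrow> (\<exists>j<length u. P (u ! j) (walk (take j u) x))"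

lemma passes_Nil [simp]: "passes P [] x \<longleftrightarrow> False"
  by (simp add: passes_def)

lemma passes_Cons [simp]: "passes P (l # u) x \<longleftrightarrow> P l x \<or> passes P u (step l x)"
  unfolding passes_def by (simp add: Ex_less_Suc2)

lemma passes_append: "passes P (u @ u') x \<longleftrightarrow> passes P u x \<or> passes P u' (walk u x)"
  by (induction u arbitrary: x) auto

lemma passes_a:
  assumes "x \<in> V"
  shows "passes P (replicate c (Edge_a, True)) x \<longleftrightarrow> (\<exists>j<c. P (Edge_a, True) (az (int j) x))"
    and "passes P (replicate c (Edge_a, False)) x \<longleftrightarrow> (\<exists>j<c. P (Edge_a, False) (az (- int j) x))"
proof -
  show "passes P (replicate c (Edge_a, True)) x \<longleftrightarrow> (\<exists>j<c. P (Edge_a, True) (az (int j) x))"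
    unfolding passes_def by (auto simp: walk_a[OF assms] simp del: fold_replicate)
  show "passes P (replicate c (Edge_a, False)) x \<longleftrightarrow> (\<exists>j<c. P (Edge_a, False) (az (- int j) x))"
    unfolding passes_def by (auto simp: walk_a[OF assms] simp del: fold_replicate)
qed

lemma passes_face:
  assumes x: "x \<in> V"
  shows "(\<exists>j<length (z_word m n 0). P (z_word m n 0 ! j) (walk (take j (z_word m n 0)) x)) \<longleftrightarrow>
    P (Edge_t 0, True) x \<or> (\<exists>j<m. P (Edge_a, True) (az (int j) (T x))) \<or>
    P (Edge_t 0, False) (az (int m) (T x)) \<or> (\<exists>j<n. P (Edge_a, False) (az (- int j) (az (int n) x)))"
proof -
  have s: "step (Edge_t 0, False) (az (int m) (T x)) = az (int n) x"
    using bs_relation[OF x] src_tgt[of "Edge_t 0" "az (int n) x"] az_V[OF x] by (simp add: step_pair)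
  have "(\<exists>j<length (z_word m n 0). P (z_word m n 0 ! j) (walk (take j (z_word m n 0)) x)) \<longleftrightarrow> passes P (z_word m n 0) x"
    by (simp add: passes_def)
  also have "\<dots> \<longleftrightarrow> P (Edge_t 0, True) x \<or> (\<exists>j<m. P (Edge_a, True) (az (int j) (T x))) \<or>
    P (Edge_t 0, False) (az (int m) (T x)) \<or> (\<exists>j<n. P (Edge_a, False) (az (- int j) (az (int n) x)))"
    unfolding word_eq using x s T_V[OF x] az_V[OF x] az_V[OF T_V[OF x]]
    by (simp add: passes_append passes_a walk_a step_pair(1)[of "Edge_t 0"] del: fold_replicate)
  finally show ?thesis .
qed

lemma face_t:
  assumes x: "x \<in> V" and z: "z \<in> V"
  shows "cell Et z \<inter> cl Fc x \<noteq> {} \<longleftrightarrow> z = x \<or> z = az (int n) x"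
proof -
  have s: "src (Edge_t 0) (az (int m) (T x)) = az (int n) x"
    using bs_relation[OF x] src_tgt[of "Edge_t 0" "az (int n) x"] az_V[OF x] by simp
  show ?thesis
    unfolding edge_in_face(1)[OF F_in x t_in z]
      passes_face[OF x, of "\<lambda>l y. fst l = Edge_t 0 \<and> letter_start l y = z"]
    using s by (auto simp: letter_start_def)
qed

lemma face_a:
  assumes x: "x \<in> V" and z: "z \<in> V"
  shows "cell Ea z \<inter> cl Fc x \<noteq> {} \<longleftrightarrow> (\<exists>j<m. z = az (int j) (T x)) \<or> (\<exists>j<n. z = az (int j) x)"
proof -
  \<comment> \<open>A letter that is read backwards names its edge by the start, one step before the
    current vertex; hence the \<open>- 1\<close>.\<close>
  have e: "letter_start (Edge_a, False) (az (- int j) (az (int n) x)) = az (int n - int j - 1) x" for j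
    using az_add[OF x, of "- int j" "int n"] az_add[OF x, of "-1" "int n - int j"] src_az[OF az_V[OF az_V[OF x]], of "- int j" "int n"]
    by (simp add: letter_start_def algebra_simps)
  have eq: "(\<exists>j<n. az (int n - int j - 1) x = z) \<longleftrightarrow> (\<exists>j<n. z = az (int j) x)"
  proof
    assume "\<exists>j<n. az (int n - int j - 1) x = z"
    then obtain j where "j < n" "az (int n - int j - 1) x = z" by blast
    then show "\<exists>j<n. z = az (int j) x" by (intro exI[of _ "n - j - 1"]) (auto simp: of_nat_diff algebra_simps)
  next
    assume "\<exists>j<n. z = az (int j) x"
    then obtain j where "j < n" "z = az (int j) x" by blast
    then show "\<exists>j<n. az (int n - int j - 1) x = z" by (intro exI[of _ "n - j - 1"]) (auto simp: of_nat_diff algebra_simps)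
  qed
  show ?thesis
    unfolding edge_in_face(1)[OF F_in x edges(1) z]
      passes_face[OF x, of "\<lambda>l y. fst l = Edge_a \<and> letter_start l y = z"] e eq[symmetric]
    by (auto simp: letter_start_def)
qed

lemma face_vertex:
  assumes x: "x \<in> V" and z: "z \<in> V"
  shows "z \<in> cl Fc x \<longleftrightarrow> (\<exists>j. 0 \<le> j \<and> j \<le> int m \<and> z = az j (T x)) \<or> (\<exists>j. 0 \<le> j \<and> j \<le> int n \<and> z = az j x)"
proof -
  have e: "az (- int j) (az (int n) x) = az (int n - int j) x" for j
    using az_add[OF x, of "- int j" "int n"] by (simp add: algebra_simps)
  have 1: "(\<exists>j<m. z = az (int j) (T x)) \<or> z = az (int m) (T x) \<longleftrightarrow> (\<exists>j. 0 \<le> j \<and> j \<le> int m \<and> z = az j (T x))"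
  proof
    assume "(\<exists>j<m. z = az (int j) (T x)) \<or> z = az (int m) (T x)"
    then show "\<exists>j. 0 \<le> j \<and> j \<le> int m \<and> z = az j (T x)"
    proof
      assume "\<exists>j<m. z = az (int j) (T x)"
      then obtain j where "j < m" "z = az (int j) (T x)" by blast
      then show ?thesis by (intro exI[of _ "int j"]) simp
    qed (intro exI[of _ "int m"], simp)
  next
    assume "\<exists>j. 0 \<le> j \<and> j \<le> int m \<and> z = az j (T x)"
    then obtain j where j: "0 \<le> j" "j \<le> int m" "z = az j (T x)" by blast
    show "(\<exists>j<m. z = az (int j) (T x)) \<or> z = az (int m) (T x)"
    proof (cases "j = int m")
      case False
      then have "nat j < m" "z = az (int (nat j)) (T x)" using j by auto
      then show ?thesis by blast
    qed (use j in simp)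
  qed
  have 2: "z = x \<or> (\<exists>j<n. z = az (int n - int j) x) \<longleftrightarrow> (\<exists>j. 0 \<le> j \<and> j \<le> int n \<and> z = az j x)"
  proof
    assume "z = x \<or> (\<exists>j<n. z = az (int n - int j) x)"
    then show "\<exists>j. 0 \<le> j \<and> j \<le> int n \<and> z = az j x"
    proof
      assume "\<exists>j<n. z = az (int n - int j) x"
      then obtain j where "j < n" "z = az (int n - int j) x" by blast
      then show ?thesis by (intro exI[of _ "int n - int j"]) simp
    qed (intro exI[of _ 0], simp)
  next
    assume "\<exists>j. 0 \<le> j \<and> j \<le> int n \<and> z = az j x"
    then obtain j where j: "0 \<le> j" "j \<le> int n" "z = az j x" by blast
    show "z = x \<or> (\<exists>j<n. z = az (int n - int j) x)"
    proof (cases "j = 0")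
      case False
      then have "nat (int n - j) < n" "z = az (int n - int (nat (int n - j))) x" using j by auto
      then show ?thesis by blast
    qed (use j in simp)
  qed
  show ?thesis
    unfolding vertex_in_face[OF F_in x z] passes_face[OF x, of "\<lambda>l y. z = y"] e 1[symmetric] 2[symmetric] by blast
qed

lemma face_line:
  assumes x: "x \<in> V"
  shows "az j x \<in> cl Fc x \<longleftrightarrow> 0 \<le> j \<and> j \<le> int n"
    and "az j (T x) \<in> cl Fc x \<longleftrightarrow> 0 \<le> j \<and> j \<le> int m"
proof -
  show "az j x \<in> cl Fc x \<longleftrightarrow> 0 \<le> j \<and> j \<le> int n"
    unfolding face_vertex[OF x az_V[OF x]] by (simp add: az_neq_T[OF x] az_inj[OF x])
  show "az j (T x) \<in> cl Fc x \<longleftrightarrow> 0 \<le> j \<and> j \<le> int m"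
    unfolding face_vertex[OF x az_V[OF T_V[OF x]]] by (simp add: az_neq_T[OF x, symmetric] az_inj[OF T_V[OF x]])
qed

lemma aut_Fc:
  assumes f: "f \<in> carrier aut.H" and x: "x \<in> V"
  obtains y where "y \<in> V" "f ` cell Fc x = cell Fc y" "f ` cl Fc x = cl Fc y"
proof -
  obtain h y where h: "h \<in> {..<k}" "y \<in> V" "f ` cell Fc x = cell (Face h) y" "f ` cl Fc x = cl (Face h) y"
    using aut_face[OF f F_in x] by metis
  then have "h = 0" using gcd1 by simp
  then show ?thesis using h that by simp
qed

lemma aut_mem_iff: "f \<in> carrier aut.H \<Longrightarrow> S \<subseteq> X \<Longrightarrow> q \<in> X \<Longrightarrow> f q \<in> f ` S \<longleftrightarrow> q \<in> S"
  using inj_on_image_mem_iff[OF aut.H_inj] by blast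

lemma cl_X: "i \<in> I \<Longrightarrow> x \<in> V \<Longrightarrow> cl i x \<subseteq> X" "i \<in> I \<Longrightarrow> x \<in> V \<Longrightarrow> cell i x \<subseteq> X"
  using cl_subset_X cell_subset_X by auto

lemma Et_I [simp]: "Et \<in> I" "Ea \<in> I" "Fc \<in> I"
  using t_in edges(1) F_in in_I by blast+

end

section \<open>The case of distinct coprime parameters\<close>

locale bs_rigid = bs_coprime m n Z v \<phi> \<psi> X p
  for m n :: nat and Z :: "'z::topological_space set" and v :: 'z
    and \<phi> :: "z_edge \<Rightarrow> real \<Rightarrow> 'z" and \<psi> :: "nat \<Rightarrow> complex \<Rightarrow> 'z"
    and X :: "'x::topological_space set" and p :: "'x \<Rightarrow> 'z" +
  assumes m_neq_n: "m \<noteq> n"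
begin

text \<open>A \<open>t\<close>-edge lies on at most two faces and an \<open>a\<close>-edge on \<open>m + n \<ge> 3\<close> faces.\<close>

lemma a_not_t:
  assumes f: "f \<in> carrier aut.H" and x: "x \<in> V" and z: "z \<in> V"
  shows "f ` cell Ea x \<noteq> cell Et z"
proof
  assume eq: "f ` cell Ea x = cell Et z"
  have img: "\<exists>y'. y' \<in> V \<and> f ` cell Fc y = cell Fc y' \<and> (y' = z \<or> y' = az (- int n) z)"
    if y: "y \<in> V" "cell Ea x \<inter> cl Fc y \<noteq> {}" for y
  proof -
    obtain y' where y': "y' \<in> V" "f ` cell Fc y = cell Fc y'" "f ` cl Fc y = cl Fc y'" using aut_Fc[OF f y(1)] .
    have "f ` cell Ea x \<inter> f ` cl Fc y \<noteq> {}"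
      using aut_edge_in_face[OF f cl_X(2)[OF Et_I(2) x] cl_X(1)[OF Et_I(3) y(1)]] y(2) by blast
    then have "z = y' \<or> z = az (int n) y'" using eq y'(3) face_t[OF y'(1) z] by simp
    then have "y' = z \<or> y' = az (- int n) z" using az_cancel(2)[OF y'(1), of "int n"] by metis
    then show ?thesis using y' by blast
  qed
  have inj: "y = y2" if "y \<in> V" "y2 \<in> V" "f ` cell Fc y = f ` cell Fc y2" for y y2
  proof -
    have "cell Fc y = cell Fc y2"
      using inj_on_image_eq_iff[OF aut.H_inj[OF f] cl_X(2)[OF Et_I(3) that(1)] cl_X(2)[OF Et_I(3) that(2)]] that(3) by blast
    then show ?thesis using cell_inj[OF Et_I(3) that(1) Et_I(3) that(2)] by simp
  qed
  \<comment> \<open>The only faces on a \<open>t\<close>-edge are based at \<open>z\<close> and at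
    the vertex \<open>n\<close> steps before it, so three faces on the \<open>a\<close>-edge would
    have to share two images.\<close>
  have pig: False if y: "y1 \<in> V" "y2 \<in> V" "y3 \<in> V" "y1 \<noteq> y2" "y1 \<noteq> y3" "y2 \<noteq> y3"
    "cell Ea x \<inter> cl Fc y1 \<noteq> {}" "cell Ea x \<inter> cl Fc y2 \<noteq> {}" "cell Ea x \<inter> cl Fc y3 \<noteq> {}" for y1 y2 y3
  proof -
    obtain y1' where 1: "f ` cell Fc y1 = cell Fc y1'" "y1' = z \<or> y1' = az (- int n) z" using img[OF y(1,7)] by blast
    obtain y2' where 2: "f ` cell Fc y2 = cell Fc y2'" "y2' = z \<or> y2' = az (- int n) z" using img[OF y(2,8)] by blast
    obtain y3' where 3: "f ` cell Fc y3 = cell Fc y3'" "y3' = z \<or> y3' = az (- int n) z" using img[OF y(3,9)] by blast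
    have "y1' \<noteq> y2'" "y1' \<noteq> y3'" "y2' \<noteq> y3'" using inj y(1-6) 1(1) 2(1) 3(1) by metis+
    then show False using 1(2) 2(2) 3(2) by metis
  qed
  \<comment> \<open>Bases of faces on the edge at \<open>x\<close>: the face at \<open>x\<close> has
    it on its lower side, the face at \<open>s\<close> on its upper side. A third face is based at
    \<open>b\<close> if \<open>n \<ge> 2\<close> and at \<open>c\<close> if
    \<open>m \<ge> 2\<close>; one of these holds because \<open>m\<close> and \<open>n\<close>
    differ.\<close>
  define s where "s = src (Edge_t 0) x"
  have s: "s \<in> V" "T s = x" using src[OF t_in x] by (simp_all add: s_def)
  define b where "b = az (- 1) x"
  have b: "b \<in> V" "az 1 b = x" using az_V[OF x] az_cancel(1)[OF x, of 1] by (simp_all add: b_def)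
  define c where "c = src (Edge_t 0) b"
  have c: "c \<in> V" "T c = b" using src[OF t_in b(1)] by (simp_all add: c_def)
  have xb: "x \<noteq> b" using az_inj[OF x, of 0 "- 1"] by (simp add: b_def)
  have lev: "snd (lab s) = snd (lab x) - 1" "snd (lab b) = snd (lab x)" "snd (lab c) = snd (lab x) - 1"
    using level_T[OF s(1)] level_T[OF c(1)] level_az[OF x] s c by (simp_all add: b_def)
  have xs: "x \<noteq> s" "b \<noteq> s" "x \<noteq> c" using lev by auto
  have sc: "s \<noteq> c" using s c xb by auto
  have fx: "cell Ea x \<inter> cl Fc x \<noteq> {}" unfolding face_a[OF x x] by (rule disjI2, rule exI[of _ 0]) simp
  have fs: "cell Ea x \<inter> cl Fc s \<noteq> {}" unfolding face_a[OF s(1) x] by (rule disjI1, rule exI[of _ 0]) (simp add: s)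
  show False
  proof (cases "n \<ge> 2")
    case True
    have "cell Ea x \<inter> cl Fc b \<noteq> {}" unfolding face_a[OF b(1) x] by (rule disjI2, rule exI[of _ 1]) (use True b in simp)
    then show False using pig[OF x b(1) s(1) xb xs(1,2) fx _ fs] by blast
  next
    case False
    then have "m \<ge> 2" using m_neq_n m_pos n_pos by linarith
    then have "cell Ea x \<inter> cl Fc c \<noteq> {}" unfolding face_a[OF c(1) x] by (intro disjI1 exI[of _ 1]) (simp add: c b)
    then show False using pig[OF x s(1) c(1) xs(1,3) sc fx fs] by blast
  qed
qed

section \<open>Edges, lines and the sign of an automorphism\<close>

lemma aut_a:
  assumes f: "f \<in> carrier aut.H" and x: "x \<in> V"
  obtains z where "z \<in> V" "f ` cell Ea x = cell Ea z" "{f x, f (A x)} = {z, A z}"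
proof -
  obtain e' z where z: "e' \<in> z_edges m n" "z \<in> V" "f ` cell Ea x = cell (Edge e') z" "{f x, f (A x)} = {z, tgt e' z}"
    using aut_edge[OF f edges(1) x] by metis
  have "e' = Edge_a" using E_cases[OF z(1)] a_not_t[OF f x z(2)] z(3) by auto
  then show ?thesis using z that by simp
qed

lemma aut_t:
  assumes f: "f \<in> carrier aut.H" and x: "x \<in> V"
  obtains z where "z \<in> V" "f ` cell Et x = cell Et z" "{f x, f (T x)} = {z, T z}"
proof -
  obtain e' z where z: "e' \<in> z_edges m n" "z \<in> V" "f ` cell Et x = cell (Edge e') z" "{f x, f (T x)} = {z, tgt e' z}"
    using aut_edge[OF f t_in x] by metis
  have "e' \<noteq> Edge_a"
  proof
    assume "e' = Edge_a"
    then have "(inv\<^bsub>aut.H\<^esub> f) ` cell Ea z = cell Et x" using aut.inv_image[OF f cl_X(2)[OF Et_I(1) x]] z(3) by simp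
    then show False using a_not_t[OF aut.H.inv_closed[OF f] z(2) x] by simp
  qed
  then have "e' = Edge_t 0" using E_cases[OF z(1)] by blast
  then show ?thesis using z that by simp
qed

text \<open>The sign by which \<open>f\<close> multiplies translations at \<open>x\<close>. It turns
  out to be the same at all vertices and equal to the orientation character.\<close>

definition chi :: "('x \<Rightarrow> 'x) \<Rightarrow> 'x \<Rightarrow> int" where
  "chi f x = (if f (A x) = A (f x) then 1 else - 1)"

lemma chi_cases: "chi f x = 1 \<or> chi f x = - 1"
  by (simp add: chi_def)

lemma aut_A:
  assumes f: "f \<in> carrier aut.H" and x: "x \<in> V"
  shows "f (A x) = az (chi f x) (f x)"
proof -
  have fx: "f x \<in> V" by (rule aut_vertex[OF f x])
  obtain z where z: "z \<in> V" "{f x, f (A x)} = {z, A z}" using aut_a[OF f x] by metis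
  show ?thesis
  proof (cases "f (A x) = A (f x)")
    case True
    then show ?thesis using A_az[OF fx] by (simp add: chi_def)
  next
    case False
    then have "f x = A z \<and> f (A x) = z" using z(2) by (auto simp: doubleton_eq_iff)
    then show ?thesis using False az_cancel(2)[OF z(1), of 1] A_az[OF z(1)] by (simp add: chi_def)
  qed
qed

lemma aut_eq: "f \<in> carrier aut.H \<Longrightarrow> x \<in> V \<Longrightarrow> y \<in> V \<Longrightarrow> f x = f y \<longleftrightarrow> x = y"
  using aut.H_inj[of f] V_in_X unfolding inj_on_def by blast

text \<open>A change of sign would fold the line at \<open>A x\<close>: then \<open>x\<close> and
  \<open>A (A x)\<close> would have the same image.\<close>

lemma chi_A:
  assumes f: "f \<in> carrier aut.H" and x: "x \<in> V"
  shows "chi f (A x) = chi f x"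
proof (rule ccontr)
  assume ne: "chi f (A x) \<noteq> chi f x"
  have Ax: "A x \<in> V" using tgt_in_V[OF edges(1) x] .
  have fx: "f x \<in> V" by (rule aut_vertex[OF f x])
  have "f (A (A x)) = az (chi f (A x) + chi f x) (f x)"
    using aut_A[OF f Ax] aut_A[OF f x] az_add[OF fx] by simp
  moreover have "chi f (A x) + chi f x = 0" using ne chi_cases[of f x] chi_cases[of f "A x"] by auto
  ultimately have "A (A x) = x" using aut_eq[OF f tgt_in_V[OF edges(1) Ax] x] by simp
  then have "az 2 x = az 0 x" using A_az[OF Ax] A_az[OF x] az_add[OF x, of 1 1] by simp
  then show False using az_inj[OF x, of 2 0] by simp
qed

lemma aut_az:
  assumes f: "f \<in> carrier aut.H" and x: "x \<in> V"
  shows "f (az j x) = az (chi f x * j) (f x) \<and> chi f (az j x) = chi f x"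
proof (induction j rule: int_induct[where k = 0])
  case (step1 i)
  have V: "az i x \<in> V" by (rule az_V[OF x])
  have fx: "f x \<in> V" by (rule aut_vertex[OF f x])
  have "f (az (i + 1) x) = az (chi f x) (az (chi f x * i) (f x))"
    using aut_A[OF f V] step1 az_Suc[OF x, of i] by simp
  then show ?case using chi_A[OF f V] step1 az_Suc[OF x, of i] az_add[OF fx, of "chi f x" "chi f x * i"]
    by (simp add: algebra_simps)
next
  case (step2 i)
  have V: "az (i - 1) x \<in> V" by (rule az_V[OF x])
  have fx: "f x \<in> V" by (rule aut_vertex[OF f x])
  have S: "A (az (i - 1) x) = az i x" using az_Suc[OF x, of "i - 1"] by simp
  have c: "chi f (az (i - 1) x) = chi f x" using chi_A[OF f V] step2 S by simp
  have "az (chi f x) (f (az (i - 1) x)) = az (chi f x * i) (f x)"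
    using aut_A[OF f V] step2 S c by simp
  then have "f (az (i - 1) x) = az (- chi f x) (az (chi f x * i) (f x))"
    using az_cancel(2)[OF aut_vertex[OF f V], of "chi f x"] by metis
  then show ?case using c az_add[OF fx, of "- chi f x" "chi f x * i"] by (simp add: algebra_simps)
qed simp

text \<open>A line carrying a side of a face meets that face in an interval of vertices. If a map of
  sign \<open>c\<close> matches two such intervals, with 0 going to the lower or to the upper end,
  then the lengths agree and \<open>c\<close> is determined by the end. Testing 1, \<open>M\<close>
  and \<open>N\<close> suffices.\<close>

lemma interval_reflect:
  fixes c M N :: int
  assumes "c = 1 \<or> c = - 1" "M \<ge> 1" "N \<ge> 1"
  shows "(\<And>j. 0 \<le> j \<and> j \<le> N \<longleftrightarrow> 0 \<le> c * j \<and> c * j \<le> M) \<Longrightarrow> c = 1 \<and> N = M"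
    and "(\<And>j. 0 \<le> j \<and> j \<le> N \<longleftrightarrow> 0 \<le> c * j + M \<and> c * j + M \<le> M) \<Longrightarrow> c = - 1 \<and> N = M"
proof -
  assume *: "\<And>j. 0 \<le> j \<and> j \<le> N \<longleftrightarrow> 0 \<le> c * j \<and> c * j \<le> M"
  show "c = 1 \<and> N = M" using assms *[of N] *[of M] *[of 1] by auto
next
  assume *: "\<And>j. 0 \<le> j \<and> j \<le> N \<longleftrightarrow> 0 \<le> c * j + M \<and> c * j + M \<le> M"
  show "c = - 1 \<and> N = M" using assms *[of N] *[of M] *[of 1] by auto
qed

lemma face_line_image:
  assumes f: "f \<in> carrier aut.H" and x: "x \<in> V" and y: "f ` cl Fc x = cl Fc y"
  shows "az (chi f x * j) (f x) \<in> cl Fc y \<longleftrightarrow> 0 \<le> j \<and> j \<le> int n"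
    and "az (chi f (T x) * j) (f (T x)) \<in> cl Fc y \<longleftrightarrow> 0 \<le> j \<and> j \<le> int m"
proof -
  note cX = cl_X(1)[OF Et_I(3) x]
  show "az (chi f x * j) (f x) \<in> cl Fc y \<longleftrightarrow> 0 \<le> j \<and> j \<le> int n"
    using aut_mem_iff[OF f cX V_in_X[OF az_V[OF x]], of j] aut_az[OF f x, of j] face_line(1)[OF x, of j] y by simp
  show "az (chi f (T x) * j) (f (T x)) \<in> cl Fc y \<longleftrightarrow> 0 \<le> j \<and> j \<le> int m"
    using aut_mem_iff[OF f cX V_in_X[OF az_V[OF T_V[OF x]]], of j] aut_az[OF f T_V[OF x], of j] face_line(2)[OF x, of j] y by simp
qed

text \<open>If the \<open>t\<close>-edge were turned upside down, the lower side of the face, of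
  length \<open>n\<close>, would go onto the upper side of the image face, of length
  \<open>m\<close>. The two cases arise because the image may be either of the two
  \<open>t\<close>-edges of that face.\<close>

lemma aut_T:
  assumes f: "f \<in> carrier aut.H" and x: "x \<in> V"
  shows "f (T x) = T (f x)" "f ` cell Et x = cell Et (f x)"
proof -
  obtain z where z: "z \<in> V" "f ` cell Et x = cell Et z" "{f x, f (T x)} = {z, T z}" using aut_t[OF f x] .
  obtain y where y: "y \<in> V" "f ` cell Fc x = cell Fc y" "f ` cl Fc x = cl Fc y" using aut_Fc[OF f x] .
  have "cell Et x \<inter> cl Fc x \<noteq> {}" using face_t[OF x x] by simp
  then have "cell Et z \<inter> cl Fc y \<noteq> {}"
    using aut_edge_in_face[OF f cl_X(2)[OF Et_I(1) x] cl_X(1)[OF Et_I(3) x]] z(2) y(3) by simp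
  then have zy: "z = y \<or> z = az (int n) y" using face_t[OF y(1) z(1)] by simp
  have "f x = z"
  proof (rule ccontr)
    assume "f x \<noteq> z"
    then have fx: "f x = T z" using z(3) by (auto simp: doubleton_eq_iff)
    have pos: "int m \<ge> 1" "int n \<ge> 1" using m_pos n_pos by auto
    note mem = face_line_image(1)[OF f x y(3), unfolded fx]
    from zy show False
    proof
      assume "z = y"
      then have "0 \<le> j \<and> j \<le> int n \<longleftrightarrow> 0 \<le> chi f x * j \<and> chi f x * j \<le> int m" for j
        using mem[of j] face_line(2)[OF y(1), of "chi f x * j"] by simp
      then have "int n = int m" using interval_reflect(1)[OF chi_cases pos] by blast
      then show False using m_neq_n by simp
    next
      assume "z = az (int n) y"
      then have "T z = az (int m) (T y)" using bs_relation[OF y(1)] by simp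
      then have "0 \<le> j \<and> j \<le> int n \<longleftrightarrow> 0 \<le> chi f x * j + int m \<and> chi f x * j + int m \<le> int m" for j
        using mem[of j] face_line(2)[OF y(1), of "chi f x * j + int m"] az_add[OF T_V[OF y(1)], of "chi f x * j" "int m"] by simp
      then have "int n = int m" using interval_reflect(2)[OF chi_cases pos] by blast
      then show False using m_neq_n by simp
    qed
  qed
  then show "f (T x) = T (f x)" "f ` cell Et x = cell Et (f x)" using z by (auto simp: doubleton_eq_iff)
qed

text \<open>The \<open>t\<close>-edge at \<open>x\<close> goes to the first or to the second
  \<open>t\<close>-edge of the image face. In the first case both horizontal sides are traversed
  forwards, in the second both backwards. So the two lines have the same sign, and sign 1 means that
  the base of the face goes to the base.\<close>

lemma aut_face_image:
  assumes f: "f \<in> carrier aut.H" and x: "x \<in> V"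
  shows "chi f (T x) = chi f x" "chi f x = 1 \<Longrightarrow> f ` cell Fc x = cell Fc (f x)"
proof -
  obtain y where y: "y \<in> V" "f ` cell Fc x = cell Fc y" "f ` cl Fc x = cl Fc y" using aut_Fc[OF f x] .
  have fx: "f x \<in> V" by (rule aut_vertex[OF f x])
  have "cell Et x \<inter> cl Fc x \<noteq> {}" using face_t[OF x x] by simp
  then have "cell Et (f x) \<inter> cl Fc y \<noteq> {}"
    using aut_edge_in_face[OF f cl_X(2)[OF Et_I(1) x] cl_X(1)[OF Et_I(3) x]] aut_T(2)[OF f x] y(3) by simp
  then have fy: "f x = y \<or> f x = az (int n) y" using face_t[OF y(1) fx] by simp
  have pos: "int m \<ge> 1" "int n \<ge> 1" using m_pos n_pos by auto
  note mem = face_line_image[OF f x y(3), unfolded aut_T(1)[OF f x]]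
  from fy have "chi f (T x) = chi f x \<and> (chi f x = 1 \<longrightarrow> f x = y)"
  proof
    assume e: "f x = y"
    have h1: "0 \<le> j \<and> j \<le> int n \<longleftrightarrow> 0 \<le> chi f x * j \<and> chi f x * j \<le> int n" for j
      using mem(1)[of j] face_line(1)[OF y(1), of "chi f x * j"] e by simp
    have h2: "0 \<le> j \<and> j \<le> int m \<longleftrightarrow> 0 \<le> chi f (T x) * j \<and> chi f (T x) * j \<le> int m" for j
      using mem(2)[of j] face_line(2)[OF y(1), of "chi f (T x) * j"] e by simp
    have "chi f x = 1" "chi f (T x) = 1"
      using interval_reflect(1)[OF chi_cases pos(2,2) h1] interval_reflect(1)[OF chi_cases pos(1,1) h2] by simp_all
    then show ?thesis using e by simp
  next
    assume e: "f x = az (int n) y"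
    have Te: "T (f x) = az (int m) (T y)" by (simp only: e bs_relation[OF y(1)])
    have h1: "0 \<le> j \<and> j \<le> int n \<longleftrightarrow> 0 \<le> chi f x * j + int n \<and> chi f x * j + int n \<le> int n" for j
      using mem(1)[of j] face_line(1)[OF y(1), of "chi f x * j + int n"] e az_add[OF y(1), of "chi f x * j" "int n"] by simp
    have c1: "chi f x = - 1" using interval_reflect(2)[OF chi_cases pos(2,2) h1] by simp
    have h2: "0 \<le> j \<and> j \<le> int m \<longleftrightarrow> 0 \<le> chi f (T x) * j + int m \<and> chi f (T x) * j + int m \<le> int m" for j
      using mem(2)[of j] face_line(2)[OF y(1), of "chi f (T x) * j + int m"] Te
        az_add[OF T_V[OF y(1)], of "chi f (T x) * j" "int m"] by simp
    have "chi f (T x) = - 1" using interval_reflect(2)[OF chi_cases pos(1,1) h2] by simp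
    then show ?thesis using c1 by simp
  qed
  then show "chi f (T x) = chi f x" "chi f x = 1 \<Longrightarrow> f ` cell Fc x = cell Fc (f x)" using y(2) by auto
qed

lemma chi_const:
  assumes f: "f \<in> carrier aut.H" and x: "x \<in> V" and y: "y \<in> V"
  shows "chi f y = chi f x"
proof (rule vertex_induct[OF x _ _ y])
  fix e z assume "e \<in> z_edges m n" and z: "z \<in> V"
  then have "e = Edge_a \<or> e = Edge_t 0" by (simp only: E_cases)
  then show "chi f z = chi f x \<longleftrightarrow> chi f (tgt e z) = chi f x"
    using chi_A[OF f z] aut_face_image(1)[OF f z] by auto
qed simp

text \<open>An edge is named by its start, which for sign -1 is the image of the other end. For
  statements about whole lines it is enough to know the edge up to translation.\<close>

lemma aut_cell_a:
  assumes f: "f \<in> carrier aut.H" and x: "x \<in> V"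
  shows "chi f x = 1 \<Longrightarrow> f ` cell Ea x = cell Ea (f x)"
    and "\<exists>j. f ` cell Ea x = cell Ea (az j (f x))"
proof -
  have fx: "f x \<in> V" by (rule aut_vertex[OF f x])
  obtain z where z: "z \<in> V" "f ` cell Ea x = cell Ea z" "{f x, f (A x)} = {z, A z}" using aut_a[OF f x] .
  show "chi f x = 1 \<Longrightarrow> f ` cell Ea x = cell Ea (f x)"
  proof -
    assume "chi f x = 1"
    then have "f (A x) = az 1 (f x)" using aut_A[OF f x] by simp
    moreover have "az 1 (az 1 z) \<noteq> z" using az_inj[OF z(1), of 2 0] az_add[OF z(1), of 1 1] by simp
    ultimately have "z = f x" using z(3) A_az[OF z(1)] by (auto simp: doubleton_eq_iff)
    then show ?thesis using z by simp
  qed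
  have "f x = z \<or> f x = az 1 z" using z(3) A_az[OF z(1)] by (auto simp: doubleton_eq_iff)
  then have "z = az 0 (f x) \<or> z = az (- 1) (f x)" using az_cancel(2)[OF z(1), of 1] by auto
  then show "\<exists>j. f ` cell Ea x = cell Ea (az j (f x))" using z(2) by blast
qed

text \<open>With sign 1 the automorphism commutes with both kinds of edges, so it agrees with the
  deck transformation on all vertices reached from \<open>x0\<close>; the other cells follow their
  bases.\<close>

lemma aut_eq_deck:
  assumes f: "f \<in> carrier aut.H" and x0: "x0 \<in> V" and c: "chi f x0 = 1"
    and d: "d \<in> deck_transformations X p" "d x0 = f x0" and s: "\<sigma> \<in> cells"
  shows "f ` \<sigma> = d ` \<sigma>"
proof -
  have c1: "chi f x = 1" if "x \<in> V" for x using chi_const[OF f x0 that] c by simp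
  have fd: "f x = d x" if x: "x \<in> V" for x
  proof (rule vertex_induct[OF x0 _ _ x])
    show "f x0 = d x0" using d by simp
    fix e x assume e: "e \<in> z_edges m n" and x: "x \<in> V"
    have "f (tgt e x) = tgt e (f x)"
      using E_cases[OF e] aut_A[OF f x] c1[OF x] A_az[OF aut_vertex[OF f x]] aut_T(1)[OF f x] by auto
    then show "f x = d x \<longleftrightarrow> f (tgt e x) = d (tgt e x)"
      using deck_tgt[OF d(1) e x] tgt_inj[OF e aut_vertex[OF f x] deck_V[OF d(1) x]] by auto
  qed
  obtain i x where ix: "i \<in> I" "x \<in> V" "\<sigma> = cell i x" using s by (rule cells_E)
  have "d ` cell i x = cell i (f x)" using deck_lft(2)[OF d(1) ix(1,2)] fd[OF ix(2)] by simp
  moreover have "f ` cell i x = cell i (f x)"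
    using I_cases[OF ix(1)] aut_cell_a(1)[OF f ix(2) c1[OF ix(2)]] aut_T(2)[OF f ix(2)] aut_face_image(2)[OF f ix(2) c1[OF ix(2)]]
      cell_Vertex[OF ix(2)] cell_Vertex[OF aut_vertex[OF f ix(2)]] by auto
  ultimately show ?thesis using ix(3) by simp
qed

text \<open>Fixing two neighbours on a branching line forces sign 1, and the deck transformation
  that fixes \<open>x0\<close> is the identity on \<open>X\<close>.\<close>

theorem discrete_rigid: "aut_discrete X cells"
proof -
  obtain x0 where x0: "x0 \<in> V" using V_nonempty by blast
  have Ax: "A x0 \<in> V" by (rule tgt_in_V[OF edges(1) x0])
  show ?thesis
  proof (rule aut.aut_discreteI)
    show "finite {cell Vertex x0, cell Vertex (A x0)}" by simp
    show "{cell Vertex x0, cell Vertex (A x0)} \<subseteq> cells" using x0 Ax cells_I[of Vertex] by simp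
    fix f assume f: "f \<in> carrier aut.H" and fixed: "\<And>\<sigma>. \<sigma> \<in> {cell Vertex x0, cell Vertex (A x0)} \<Longrightarrow> f ` \<sigma> = \<sigma>"
    have fx: "f x0 = x0" "f (A x0) = A x0" using fixed[of "cell Vertex x0"] fixed[of "cell Vertex (A x0)"] x0 Ax
      by (simp_all add: cell_Vertex)
    then have c: "chi f x0 = 1" by (simp add: chi_def)
    obtain d where d: "d \<in> deck_transformations X p" "d x0 = x0" using deck_exists[OF x0 x0] .
    have dc: "d ` \<sigma> = \<sigma>" if s: "\<sigma> \<in> cells" for \<sigma>
    proof -
      have "d q = q" if "q \<in> X" for q
        by (rule self_unique[OF deck_D(4,5)[OF d(1)] continuous_on_id, where ?x0.0 = x0])
          (use deck_D(3)[OF d(1)] d(2) V_in_X[OF x0] that in auto)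
      then have "d q = q" if "q \<in> \<sigma>" for q using aut.cell_sub[OF s] that by blast
      then show ?thesis by simp
    qed
    have dx: "d x0 = f x0" using d(2) fx(1) by simp
    have "f ` \<sigma> = \<sigma>" if "\<sigma> \<in> cells" for \<sigma>
      using aut_eq_deck[OF f x0 c d(1) dx that] dc[OF that] by (rule HOL.trans)
    then show "f \<in> cell_trivial X cells" using f by (simp add: aut.cell_trivial_iff)
  qed
qed

end

section \<open>The square tiling\<close>

locale bs_square = bs_coprime m n Z v \<phi> \<psi> X p
  for m n :: nat and Z :: "'z::topological_space set" and v :: 'z
    and \<phi> :: "z_edge \<Rightarrow> real \<Rightarrow> 'z" and \<psi> :: "nat \<Rightarrow> complex \<Rightarrow> 'z"
    and X :: "'x::topological_space set" and p :: "'x \<Rightarrow> 'z" +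
  assumes m1: "m = 1" and n1: "n = 1"
begin

fun vec :: "z_edge \<times> bool \<Rightarrow> real \<times> int" where
  "vec (Edge_a, b) = (if b then 1 else - 1, 0)"
| "vec (Edge_t i, b) = (0, if b then 1 else - 1)"

definition letters :: "(z_edge \<times> bool) set" where
  "letters = {(Edge_a, True), (Edge_a, False), (Edge_t 0, True), (Edge_t 0, False)}"

lemma letters_in_E: "l \<in> letters \<Longrightarrow> fst l \<in> z_edges m n"
  by (auto simp: letters_def simp del: edges intro: edges(1) t_in)

lemma step_V: "l \<in> letters \<Longrightarrow> x \<in> V \<Longrightarrow> step l x \<in> V"
  using step_in_V letters_in_E by blast

lemma lab_tgt: "x \<in> V \<Longrightarrow> lab (A x) = lab x + (1, 0)" "x \<in> V \<Longrightarrow> lab (T x) = lab x + (0, 1)"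
  using lab_A[of x] lab_T[of x] m1 n1 by (simp_all add: plus_prod_def)

lemma lab_step:
  assumes l: "l \<in> letters" and x: "x \<in> V"
  shows "lab (step l x) = lab x + vec l"
proof -
  have a: "lab (src Edge_a x) = lab x + (- 1, 0)"
    using lab_tgt(1)[of "src Edge_a x"] src[OF edges(1) x] by (simp add: prod_eq_iff)
  have t: "lab (src (Edge_t 0) x) = lab x + (0, - 1)"
    using lab_tgt(2)[of "src (Edge_t 0) x"] src[OF t_in x] by (simp add: prod_eq_iff)
  show ?thesis using l lab_tgt[OF x] a t by (auto simp: letters_def step_def)
qed

lemma vec_inj: "l \<in> letters \<Longrightarrow> l' \<in> letters \<Longrightarrow> vec l = vec l' \<Longrightarrow> l = l'"
  by (auto simp: letters_def)

lemma step_inj: "l \<in> letters \<Longrightarrow> l' \<in> letters \<Longrightarrow> x \<in> V \<Longrightarrow> step l x = step l' x \<Longrightarrow> l = l'"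
  using lab_step[of l x] lab_step[of l' x] vec_inj[of l l'] by simp

lemma commute_AT: "x \<in> V \<Longrightarrow> T (A x) = A (T x)"
  using bs_relation[of x] A_az[of x] A_az[OF T_V, of x] m1 n1 by simp

lemma step_commute:
  assumes x: "x \<in> V"
  shows "step (Edge_t 0, b) (step (Edge_a, b') x) = step (Edge_a, b') (step (Edge_t 0, b) x)"
proof -
  have 1: "T (src Edge_a y) = src Edge_a (T y)" if y: "y \<in> V" for y
  proof -
    have s: "src Edge_a y \<in> V" "A (src Edge_a y) = y" using src[OF edges(1) y] by auto
    then have "A (T (src Edge_a y)) = T y" using commute_AT[OF s(1)] by simp
    then show ?thesis using src_tgt[OF edges(1) T_V[OF s(1)]] by simp
  qed
  have 2: "src (Edge_t 0) (A y) = A (src (Edge_t 0) y)" if y: "y \<in> V" for y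
  proof -
    have s: "src (Edge_t 0) y \<in> V" "T (src (Edge_t 0) y) = y" using src[OF t_in y] by auto
    then have "T (A (src (Edge_t 0) y)) = A y" using commute_AT[OF s(1)] by simp
    then show ?thesis using src_tgt[OF t_in tgt_in_V[OF edges(1) s(1)]] by simp
  qed
  have 3: "src (Edge_t 0) (src Edge_a y) = src Edge_a (src (Edge_t 0) y)" if y: "y \<in> V" for y
  proof -
    have s: "src (Edge_t 0) y \<in> V" "T (src (Edge_t 0) y) = y" using src[OF t_in y] by auto
    have "T (src Edge_a (src (Edge_t 0) y)) = src Edge_a y" using 1[OF s(1)] s(2) by simp
    moreover have "src Edge_a (src (Edge_t 0) y) \<in> V" using src[OF edges(1) s(1)] by auto
    ultimately show ?thesis using src_tgt[OF t_in] by metis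
  qed
  show ?thesis using commute_AT[OF x] 1[OF x] 2[OF x] 3[OF x] by (cases b; cases b') (simp_all add: step_def)
qed

text \<open>Two neighbours of \<open>x\<close> in perpendicular directions of the grid have only
  \<open>x\<close> and the opposite corner of a square as common neighbours.\<close>

lemma common_neighbour:
  assumes x: "x \<in> V" and l: "l1 \<in> letters" "l2 \<in> letters" "l \<in> letters" "l' \<in> letters"
    and diff: "fst l1 \<noteq> fst l2" and eq: "step l (step l1 x) = step l' (step l2 x)"
  shows "step l (step l1 x) = x \<or> step l (step l1 x) = step l2 (step l1 x)"
proof -
  have "vec l + vec l1 = vec l' + vec l2"
    using lab_step[OF l(3) step_V[OF l(1) x]] lab_step[OF l(4) step_V[OF l(2) x]] lab_step[OF l(1) x] lab_step[OF l(2) x] eq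
    by (simp add: prod_eq_iff)
  then have "l = l2 \<or> l = (fst l1, \<not> snd l1)"
    using l diff unfolding letters_def by auto
  then show ?thesis using step_step[OF letters_in_E[OF l(1)] x] by auto
qed

text \<open>Horizontal and vertical edges may be exchanged here, so nothing is claimed about the
  direction of \<open>l'\<close>.\<close>

lemma aut_step:
  assumes f: "f \<in> carrier aut.H" and x: "x \<in> V" and l: "l \<in> letters"
  obtains l' where "l' \<in> letters" "f (step l x) = step l' (f x)"
proof -
  note goal = that
  have lE: "fst l \<in> z_edges m n" by (rule letters_in_E[OF l])
  define y where "y = letter_start l x"
  have y: "y \<in> V" unfolding y_def by (rule letter_start_in_V[OF lE x])
  have ends: "{x, step l x} = {y, tgt (fst l) y}"
    using src[OF lE x] by (auto simp: y_def letter_start_def step_def)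
  obtain e' z where z: "e' \<in> z_edges m n" "z \<in> V" "{f y, f (tgt (fst l) y)} = {z, tgt e' z}"
    using aut_edge[OF f lE y] by metis
  have "f ` {x, step l x} = {z, tgt e' z}" unfolding ends using z(3) by simp
  then consider "f x = z" "f (step l x) = tgt e' z" | "f x = tgt e' z" "f (step l x) = z"
    by (auto simp: doubleton_eq_iff)
  then show ?thesis
  proof cases
    case 1
    then show ?thesis using E_cases[OF z(1)] by (intro goal[of "(e', True)"]) (auto simp: letters_def step_def)
  next
    case 2
    then show ?thesis using E_cases[OF z(1)] src_tgt[OF z(1,2)] by (intro goal[of "(e', False)"]) (auto simp: letters_def step_def)
  qed
qed

text \<open>A diagonal vertex is, besides \<open>x\<close>, the only common neighbour of two fixed
  vertices, so it is fixed. Then every neighbour of \<open>step l0 x\<close> is fixed except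
  possibly the one straight ahead, and injectivity leaves that one no other image.\<close>

lemma fixed_star_step:
  assumes f: "f \<in> carrier aut.H" and x: "x \<in> V" and fx: "f x = x" "\<And>l. l \<in> letters \<Longrightarrow> f (step l x) = step l x"
    and l0: "l0 \<in> letters" and l: "l \<in> letters"
  shows "f (step l (step l0 x)) = step l (step l0 x)"
proof -
  let ?y = "step l0 x"
  have y: "?y \<in> V" by (rule step_V[OF l0 x])
  have fy: "f ?y = ?y" by (rule fx(2)[OF l0])
  have opp: "(fst l0, \<not> snd l0) \<in> letters" using l0 by (auto simp: letters_def)
  have back': "f (step (fst l0, \<not> snd l0) ?y) = step (fst l0, \<not> snd l0) ?y"
    using step_step[OF letters_in_E[OF l0] x] fx(1) by simp
  have eqf: "a = b" if "a \<in> V" "b \<in> V" "f a = f b" for a b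
    using inj_onD[OF aut.H_inj[OF f] that(3)] V_in_X that by blast
  have side: "f (step l1 ?y) = step l1 ?y" if l1: "l1 \<in> letters" and d: "fst l1 \<noteq> fst l0" for l1
  proof -
    have com: "step l1 ?y = step l0 (step l1 x)"
    proof -
      obtain e0 b0 e1 b1 where "l0 = (e0, b0)" "l1 = (e1, b1)" by (cases l0; cases l1)
      then show ?thesis using l0 l1 d step_commute[OF x, of b1 b0] step_commute[OF x, of b0 b1] by (auto simp: letters_def)
    qed
    obtain l' where l': "l' \<in> letters" "f (step l1 ?y) = step l' ?y" using aut_step[OF f y l1] fy by metis
    obtain l'' where l'': "l'' \<in> letters" "f (step l0 (step l1 x)) = step l'' (step l1 x)"
      using aut_step[OF f step_V[OF l1 x] l0] fx(2)[OF l1] by metis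
    have "step l' ?y = step l'' (step l1 x)" using l'(2) l''(2) com by simp
    then have "step l' ?y = x \<or> step l' ?y = step l1 ?y"
      by (rule common_neighbour[OF x l0 l1 l'(1) l''(1) d[symmetric]])
    moreover have "step l' ?y \<noteq> x"
    proof
      assume "step l' ?y = x"
      then have "f (step l1 ?y) = f x" using l'(2) fx(1) by simp
      then have "step l1 ?y = x" using eqf[OF step_V[OF l1 y] x] by blast
      then have "vec l1 + vec l0 = 0" using lab_step[OF l1 y] lab_step[OF l0 x] by (simp add: prod_eq_iff zero_prod_def)
      then show False using l1 l0 d by (auto simp: letters_def zero_prod_def)
    qed
    ultimately show ?thesis using l'(2) by simp
  qed
  show ?thesis
  proof (cases "l = l0")
    case False
    then have "fst l \<noteq> fst l0 \<or> l = (fst l0, \<not> snd l0)" by (cases l; cases l0) auto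
    then show ?thesis using side[OF l] back' by auto
  next
    case True
    obtain l' where l': "l' \<in> letters" "f (step l ?y) = step l' ?y" using aut_step[OF f y l] fy by metis
    have "l' = l0"
    proof (rule ccontr)
      assume "l' \<noteq> l0"
      then have "fst l' \<noteq> fst l0 \<or> l' = (fst l0, \<not> snd l0)" by (cases l'; cases l0) auto
      then have "f (step l' ?y) = step l' ?y" using side[OF l'(1)] back' by auto
      then have "step l ?y = step l' ?y" using eqf[OF step_V[OF l y] step_V[OF l'(1) y]] l'(2) by simp
      then show False using step_inj[OF l l'(1) y] True \<open>l' \<noteq> l0\<close> by simp
    qed
    then show ?thesis using l'(2) True by simp
  qed
qed

lemma fixed_star_all:
  assumes f: "f \<in> carrier aut.H" and x0: "x0 \<in> V" and fx: "f x0 = x0" "\<And>l. l \<in> letters \<Longrightarrow> f (step l x0) = step l x0"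
    and x: "x \<in> V"
  shows "f x = x"
proof -
  define P where "P y \<longleftrightarrow> f y = y \<and> (\<forall>l\<in>letters. f (step l y) = step l y)" for y
  have step: "P (step l y)" if "l \<in> letters" "y \<in> V" "P y" for l y
    using that fixed_star_step[OF f that(2) _ _ that(1)] unfolding P_def by blast
  have L: "l \<in> letters" if "fst l \<in> z_edges m n" for l
    using E_cases[OF that] by (cases l) (auto simp: letters_def)
  have "P (walk u y)" if "fst ` set u \<subseteq> z_edges m n" "y \<in> V" "P y" for u y
    using that
  proof (induction u arbitrary: y)
    case (Cons l u)
    have "l \<in> letters" using Cons.prems L by simp
    then show ?case using Cons step step_V by simp
  qed simp
  then have "P x" using all_reachable[OF x0 x] x0 fx unfolding reach_def P_def by blast
  then show ?thesis by (simp add: P_def)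
qed

text \<open>In the grid an edge is determined by its end points and a face by its set of vertices,
  whose least element is the base.\<close>

lemma fixed_vertices_trivial:
  assumes f: "f \<in> carrier aut.H" and fx: "\<And>x. x \<in> V \<Longrightarrow> f x = x"
  shows "f \<in> cell_trivial X cells"
proof -
  have lab0: "lab (tgt e x) = lab x + vec (e, True)" if "e \<in> z_edges m n" "x \<in> V" for e x
    using E_cases[OF that(1)] lab_tgt[OF that(2)] by auto
  have edge: "f ` cell (Edge e) x = cell (Edge e) x" if e: "e \<in> z_edges m n" and x: "x \<in> V" for e x
  proof -
    obtain e' y where y: "e' \<in> z_edges m n" "y \<in> V" "f ` cell (Edge e) x = cell (Edge e') y" "{f x, f (tgt e x)} = {y, tgt e' y}"
      using aut_edge[OF f e x] by metis
    have "{x, tgt e x} = {y, tgt e' y}" using y(4) fx[OF x] fx[OF tgt_in_V[OF e x]] by simp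
    then consider "x = y" "tgt e x = tgt e' y" | "x = tgt e' y" "y = tgt e x" by (auto simp: doubleton_eq_iff)
    then show ?thesis
    proof cases
      case 1
      then have "vec (e, True) = vec (e', True)" using lab0[OF e x] lab0[OF y(1,2)] by simp
      then have "e = e'" using E_cases[OF e] E_cases[OF y(1)] by auto
      then show ?thesis using 1 y(3) by simp
    next
      case 2
      then have "vec (e, True) + vec (e', True) = 0" using lab0[OF e x] lab0[OF y(1,2)] by (simp add: prod_eq_iff)
      then show ?thesis using E_cases[OF e] E_cases[OF y(1)] by (auto simp: zero_prod_def)
    qed
  qed
  have face: "f ` cell Fc x = cell Fc x" if x: "x \<in> V" for x
  proof -
    obtain y where y: "y \<in> V" "f ` cell Fc x = cell Fc y" "f ` cl Fc x = cl Fc y" using aut_Fc[OF f x] .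
    have same: "z \<in> cl Fc y \<longleftrightarrow> z \<in> cl Fc x" if "z \<in> V" for z
      using aut_mem_iff[OF f cl_X(1)[OF Et_I(3) x] V_in_X[OF that]] y(3) fx[OF that] by simp
    have self: "z \<in> cl Fc z" if "z \<in> V" for z using face_line(1)[OF that, of 0] by simp
    have lab_az1: "lab (az j z) = lab z + (of_int j, 0)" if "z \<in> V" for j z
      using lab_az[OF that, of j] m1 n1 by (simp add: prod_eq_iff)
    \<comment> \<open>All vertices of a face lie weakly above and to the right of its base, so two
      faces that contain each other's bases coincide.\<close>
    have offs: "z' = z \<or> (fst (lab z') > fst (lab z) \<or> snd (lab z') > snd (lab z)) \<and> fst (lab z') \<ge> fst (lab z) \<and> snd (lab z') \<ge> snd (lab z)"
      if z: "z \<in> V" "z' \<in> V" "z' \<in> cl Fc z" for z z'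
    proof -
      from z(3) consider j where "0 \<le> j" "z' = az j (T z)" | j where "0 \<le> j" "z' = az j z"
        unfolding face_vertex[OF z(1,2)] by blast
      then show ?thesis
      proof cases
        case 1
        then show ?thesis using lab_az1[OF T_V[OF z(1)], of j] lab_tgt(2)[OF z(1)] by simp
      next
        case 2
        then show ?thesis using lab_az1[OF z(1), of j] by (cases "j = 0") simp_all
      qed
    qed
    have c: "y \<in> cl Fc x" "x \<in> cl Fc y" using same[OF y(1)] same[OF x] self[OF y(1)] self[OF x] by auto
    have "x = y" using offs[OF x y(1) c(1)] offs[OF y(1) x c(2)] by (metis not_le)
    then show ?thesis using y(2) by simp
  qed
  have "f ` \<sigma> = \<sigma>" if s: "\<sigma> \<in> cells" for \<sigma>
  proof -
    obtain i x where ix: "i \<in> I" "x \<in> V" "\<sigma> = cell i x" using s by (rule cells_E)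
    show ?thesis using I_cases[OF ix(1)] edge[OF edges(1) ix(2)] edge[OF t_in ix(2)] face[OF ix(2)] fx[OF ix(2)]
        cell_Vertex[OF ix(2)] unfolding ix(3) by (elim disjE) simp_all
  qed
  then show ?thesis using f by (simp add: aut.cell_trivial_iff)
qed

theorem discrete_square: "aut_discrete X cells"
proof -
  obtain x0 where x0: "x0 \<in> V" using V_nonempty by blast
  let ?G = "insert {x0} ((\<lambda>l. {step l x0}) ` letters)"
  have vc: "{x} \<in> cells" if "x \<in> V" for x using cells_I[of Vertex x] cell_Vertex[OF that] that by simp
  show ?thesis
  proof (rule aut.aut_discreteI)
    show "finite ?G" by (simp add: letters_def)
    show "?G \<subseteq> cells" using vc x0 step_V by auto
    fix f assume f: "f \<in> carrier aut.H" and fixed: "\<And>\<sigma>. \<sigma> \<in> ?G \<Longrightarrow> f ` \<sigma> = \<sigma>"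
    have "f x0 = x0" using fixed[of "{x0}"] by simp
    moreover have "f (step l x0) = step l x0" if "l \<in> letters" for l using fixed[of "{step l x0}"] that by simp
    ultimately show "f \<in> cell_trivial X cells"
      using fixed_vertices_trivial[OF f] fixed_star_all[OF f x0] by blast
  qed
qed

end

section \<open>Branching lines\<close>

context bs_coprime
begin

definition hl :: "'x \<Rightarrow> real \<Rightarrow> 'x" where
  "hl x s = lft Ea (az \<lfloor>s\<rfloor> x) (of_real (frac s))"

lemma frac_unit: "frac (s::real) \<in> {0..1}"
  using frac_lt_1[of s] by (simp add: less_imp_le)

lemma hl_segment:
  assumes x: "x \<in> V" and s: "s \<in> {of_int j..of_int j + 1}"
  shows "hl x s = lft Ea (az j x) (of_real (s - of_int j))"
proof (cases "s = of_int j + 1")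
  case True
  then have "s = of_int (j + 1)" by simp
  then show ?thesis using True az_Suc[OF x, of j] lft_Edge_0[OF edges(1) az_V[OF x, of "j + 1"]] by (simp add: hl_def tgt_def)
next
  case False
  then have "\<lfloor>s\<rfloor> = j" using s by (intro floor_unique) auto
  then show ?thesis by (simp add: hl_def frac_def)
qed

lemma hl_0 [simp]: "x \<in> V \<Longrightarrow> hl x 0 = x"
  by (simp add: hl_def)

lemma hl_of_int: "x \<in> V \<Longrightarrow> hl x (of_int j) = az j x"
  using az_V by (simp add: hl_def)

lemma hl_in_X: "x \<in> V \<Longrightarrow> hl x s \<in> X"
  unfolding hl_def by (intro lft_in_X Et_I az_V of_real_in_Edge frac_unit)

lemma p_hl:
  assumes x: "x \<in> V"
  shows "p (hl x s) = \<phi> Edge_a (frac s)"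
  unfolding hl_def using lft(4)[OF Et_I(2) az_V[OF x] of_real_in_Edge[OF frac_unit]] by simp

lemma hl_shift: "x \<in> V \<Longrightarrow> hl (az c x) s = hl x (s + of_int c)"
  by (simp add: hl_def az_add[symmetric] frac_add_of_int_right)

lemma continuous_hl_segment:
  assumes x: "x \<in> V"
  shows "continuous_on {of_int j..of_int j + 1} (hl x)"
proof -
  have "continuous_on {of_int j..of_int j + 1} (\<lambda>s. lft Ea (az j x) (of_real (s - of_int j)))"
    by (rule continuous_on_compose2[OF lft(1)[OF Et_I(2) az_V[OF x]]])
      (auto intro!: continuous_intros of_real_in_Edge simp del: of_real_diff)
  then show ?thesis by (rule continuous_on_eq) (rule hl_segment[OF x, symmetric])
qed

text \<open>Two consecutive closed segments match at an integer; the open intervals of length 2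
  around the integers then cover the real line.\<close>

lemma continuous_hl:
  assumes x: "x \<in> V"
  shows "continuous_on UNIV (hl x)"
proof -
  have "continuous_on (\<Union>j::int. {of_int j - 1<..<of_int j + 1 :: real}) (hl x)"
  proof (rule continuous_on_open_UN)
    fix j :: int
    have "continuous_on ({of_int (j - 1)..of_int (j - 1) + 1} \<union> {of_int j..of_int j + 1}) (hl x)"
      by (intro continuous_on_closed_Un closed_atLeastAtMost continuous_hl_segment[OF x])
    then show "continuous_on {of_int j - 1<..<of_int j + 1 :: real} (hl x)"
      by (rule continuous_on_subset) auto
  qed simp
  moreover have "(\<Union>j::int. {of_int j - 1<..<of_int j + 1 :: real}) = UNIV"
  proof (rule Set.set_eqI)
    fix s :: real
    have "s \<in> {of_int \<lfloor>s\<rfloor> - 1<..<of_int \<lfloor>s\<rfloor> + 1}" using floor_correct[of s] by simp linarith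
    then show "s \<in> (\<Union>j::int. {of_int j - 1<..<of_int j + 1}) \<longleftrightarrow> s \<in> UNIV" by blast
  qed
  ultimately show ?thesis by simp
qed

lemma hl_cell:
  assumes x: "x \<in> V"
  shows "hl x s = lft (if frac s = 0 then Vertex else Ea) (az \<lfloor>s\<rfloor> x) (of_real (frac s))"
    and "of_real (frac s) \<in> cell_int (if frac s = 0 then Vertex else Ea :: (z_edge, nat) cell_index)"
proof -
  show "hl x s = lft (if frac s = 0 then Vertex else Ea) (az \<lfloor>s\<rfloor> x) (of_real (frac s))"
    using lft_Edge_0[OF edges(1) az_V[OF x]] lft_Vertex[OF az_V[OF x]] by (simp add: hl_def del: frac_eq_0_iff)
  have "frac s \<noteq> 0 \<Longrightarrow> frac s \<in> {0<..<1}" using frac_lt_1[of s] frac_ge_0[of s] unfolding greaterThanLessThan_iff by linarith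
  then show "of_real (frac s) \<in> cell_int (if frac s = 0 then Vertex else Ea :: (z_edge, nat) cell_index)" by (auto simp del: frac_eq_0_iff)
qed

lemma hl_eq:
  assumes x: "x \<in> V" and y: "y \<in> V" and eq: "hl x s = hl y t"
  shows "az \<lfloor>s\<rfloor> x = az \<lfloor>t\<rfloor> y" "frac s = frac t"
proof -
  let ?i = "\<lambda>s. if frac s = 0 then Vertex else Ea"
  have I: "?i r \<in> I" for r by simp
  note h = lft_inj[OF I I az_V[OF x] az_V[OF y] hl_cell(2)[OF x] hl_cell(2)[OF y] eq[unfolded hl_cell(1)[OF x] hl_cell(1)[OF y]]]
  show "az \<lfloor>s\<rfloor> x = az \<lfloor>t\<rfloor> y" by (rule h(2))
  show "frac s = frac t" using h(3) by (simp only: of_real_eq_iff)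
qed

lemma hl_inj: "x \<in> V \<Longrightarrow> hl x s = hl x t \<longleftrightarrow> s = t"
proof
  assume x: "x \<in> V" and eq: "hl x s = hl x t"
  have "\<lfloor>s\<rfloor> = \<lfloor>t\<rfloor>" "frac s = frac t" using hl_eq[OF x x eq] az_inj[OF x] by auto
  then show "s = t" by (simp add: frac_def)
qed simp

lemma hl_in_V:
  assumes x: "x \<in> V" and "hl x t \<in> V"
  shows "t = of_int \<lfloor>t\<rfloor>"
proof -
  have "hl x t = hl (hl x t) 0" using assms by simp
  then have "frac t = frac 0" by (rule hl_eq(2)[OF assms])
  then show ?thesis by (simp add: frac_def)
qed

definition line :: "'x \<Rightarrow> 'x set" where "line x = range (hl x)"

text \<open>On an edge of the line the preimage is a translate of \<open>U\<close> cut to the unit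
  interval; any other edge meets the line at most in its end points, and open faces do not meet it.
  Being closed makes the injective map \<open>hl x\<close> a homeomorphism onto its line.\<close>

lemma closedin_hl_image:
  assumes x: "x \<in> V" and U: "closed U"
  shows "closedin (top_of_set X) (hl x ` U)"
proof (rule closedin_by_edges)
  show "hl x ` U \<subseteq> X" using hl_in_X[OF x] by blast
next
  fix e y assume e: "e \<in> z_edges m n" and y: "y \<in> V"
  show "closed {s \<in> {0..1}. lft (Edge e) y (of_real s) \<in> hl x ` U}"
  proof (cases "e = Edge_a \<and> (\<exists>j. y = az j x)")
    case True
    then obtain j where j: "e = Edge_a" "y = az j x" by blast
    have "lft (Edge e) y (of_real s) \<in> hl x ` U \<longleftrightarrow> s + of_int j \<in> U" if s: "s \<in> {0..1}" for s
    proof -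
      have "lft (Edge e) y (of_real s) = hl x (s + of_int j)"
        using hl_segment[OF x, of "s + of_int j" j] s j by simp
      then show ?thesis using hl_inj[OF x] by auto
    qed
    then have "{s \<in> {0..1}. lft (Edge e) y (of_real s) \<in> hl x ` U} = {0..1} \<inter> (\<lambda>s. s + of_int j) -` U" by auto
    moreover have "closed ({0..1} \<inter> (\<lambda>s. s + of_int j) -` U :: real set)"
      by (intro closed_Int closed_atLeastAtMost closed_vimage U continuous_intros)
    ultimately show ?thesis by simp
  next
    case False
    have "s \<in> {0, 1}" if s: "s \<in> {0..1}" "lft (Edge e) y (of_real s) \<in> hl x ` U" for s
    proof (rule ccontr)
      assume "s \<notin> {0, 1}"
      then have si: "of_real s \<in> cell_int (Edge e :: (z_edge, nat) cell_index)" using s by auto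
      obtain t where t: "lft (Edge e) y (of_real s) = hl x t" using s by blast
      have I: "Edge e \<in> I" "(if frac t = 0 then Vertex else Ea) \<in> I" using e by simp_all
      note h = lft_inj[OF I y az_V[OF x] si hl_cell(2)[OF x] t[unfolded hl_cell(1)[OF x]]]
      have "e = Edge_a" using h(1) by (simp split: if_splits)
      then show False using False h(2) by blast
    qed
    then have "{s \<in> {0..1}. lft (Edge e) y (of_real s) \<in> hl x ` U} \<subseteq> {0, 1}" by blast
    then have "finite {s \<in> {0..1}. lft (Edge e) y (of_real s) \<in> hl x ` U}" by (rule finite_subset) simp
    then show ?thesis by (rule finite_imp_closed)
  qed
next
  fix f y u assume f: "f \<in> {..<k}" and y: "y \<in> V" and u: "u \<in> ball 0 (1::real)" and m: "lft (Face f) y u \<in> hl x ` U"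
  obtain t where t: "lft (Face f) y u = hl x t" using m by blast
  have ui: "u \<in> cell_int (Face f :: (z_edge, nat) cell_index)" using u by simp
  have I: "Face f \<in> I" "(if frac t = 0 then Vertex else Ea) \<in> I" using f by simp_all
  note h = lft_inj[OF I y az_V[OF x] ui hl_cell(2)[OF x] t[unfolded hl_cell(1)[OF x]]]
  show "lft (Face f) y ` cball 0 1 \<subseteq> hl x ` U" using h(1) by (auto split: if_splits)
qed

lemma line_subset_X: "x \<in> V \<Longrightarrow> line x \<subseteq> X"
  unfolding line_def using hl_in_X by blast

lemma hl_homeomorphism:
  assumes x: "x \<in> V"
  obtains h' where "homeomorphism UNIV (line x) (hl x) h'"
proof (rule homeomorphism_injective_closed_map[of UNIV "hl x" "line x"])
  show "continuous_on UNIV (hl x)" by (rule continuous_hl[OF x])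
  show "hl x ` UNIV = line x" by (simp add: line_def)
  show "inj_on (hl x) UNIV" using hl_inj[OF x] by (simp add: inj_on_def)
  fix U :: "real set" assume "closedin (top_of_set UNIV) U"
  then have "closedin (top_of_set X) (hl x ` U)" using closedin_hl_image[OF x] by simp
  then show "closedin (top_of_set (line x)) (hl x ` U)"
    by (rule closedin_subset_trans) (use line_subset_X[OF x] in \<open>auto simp: line_def\<close>)
qed (rule that)

lemma line_az: "x \<in> V \<Longrightarrow> line (az j x) = line x"
proof -
  assume x: "x \<in> V"
  have "hl (az j x) = (\<lambda>s. hl x (s + of_int j))" by (rule ext) (rule hl_shift[OF x])
  then have "line (az j x) = hl x ` range (\<lambda>s. s + of_int j)" by (simp only: line_def image_image)
  also have "range (\<lambda>s. s + of_int j :: real) = UNIV" by (rule surj_plus_right)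
  finally show ?thesis by (simp add: line_def)
qed

lemma line_eq:
  assumes x: "x \<in> V" and y: "y \<in> V" and q: "q \<in> line x" "q \<in> line y"
  shows "line x = line y"
proof -
  obtain s t where "hl x s = hl y t" using q by (auto simp: line_def)
  then have "az \<lfloor>s\<rfloor> x = az \<lfloor>t\<rfloor> y" by (rule hl_eq(1)[OF x y])
  then show ?thesis using line_az[OF x] line_az[OF y] by metis
qed

lemma subcomplex_line:
  assumes x: "x \<in> V"
  shows "subcomplex (line x)"
proof -
  have "line x = \<Union>(range (\<lambda>j. cl Ea (az j x)))"
  proof (intro Set.set_eqI iffI)
    fix q assume "q \<in> line x"
    then obtain s where s: "q = hl x s" by (auto simp: line_def)
    have "q \<in> cl Ea (az \<lfloor>s\<rfloor> x)"
      unfolding cl_def s hl_def by (rule imageI, rule of_real_in_Edge, rule frac_unit)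
    then show "q \<in> \<Union>(range (\<lambda>j. cl Ea (az j x)))" by blast
  next
    fix q assume "q \<in> \<Union>(range (\<lambda>j. cl Ea (az j x)))"
    then obtain j s where q: "s \<in> {0..1}" "q = lft Ea (az j x) (of_real s)" by (auto simp: cl_def)
    then have "q = hl x (s + of_int j)" using hl_segment[OF x, of "s + of_int j" j] by simp
    then show "q \<in> line x" by (simp add: line_def)
  qed
  moreover have "subcomplex (\<Union>(range (\<lambda>j. cl Ea (az j x))))"
    by (rule subcomplex_Union) (use subcomplex_cl[OF Et_I(2) az_V[OF x]] in blast)
  ultimately show ?thesis by simp
qed

theorem branching_lines_eq: "branching_lines X p (\<phi> Edge_a) = line ` V"
  unfolding branching_lines_def
proof (rule components_of_clopen_partition)
  show S: "X \<inter> p -` (\<phi> Edge_a ` {0..1}) = \<Union> (line ` V)"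
  proof (intro Set.set_eqI iffI)
    fix q assume "q \<in> X \<inter> p -` (\<phi> Edge_a ` {0..1})"
    then obtain s where q: "q \<in> X" "s \<in> {0..1}" "p q = \<kappa> Ea (of_real s)" by auto
    obtain x where x: "x \<in> V" "lft Ea x (of_real s) = q"
      using lft_through[OF Et_I(2) of_real_in_Edge[OF q(2)] q(1) q(3)] .
    then have "q = hl x s" using hl_segment[OF x(1), of s 0] q(2) by simp
    then show "q \<in> \<Union> (line ` V)" using x by (auto simp: line_def)
  next
    fix q assume "q \<in> \<Union> (line ` V)"
    then obtain x s where x: "x \<in> V" "q = hl x s" by (auto simp: line_def)
    then show "q \<in> X \<inter> p -` (\<phi> Edge_a ` {0..1})" using hl_in_X p_hl[OF x(1)] frac_unit by auto
  qed
  fix L assume "L \<in> line ` V"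
  then obtain x where x: "x \<in> V" "L = line x" by blast
  show "connected L \<and> L \<noteq> {}" unfolding x(2) line_def
    by (intro conjI connected_continuous_image continuous_hl[OF x(1)]) auto
  let ?S = "X \<inter> p -` (\<phi> Edge_a ` {0..1})"
  have cl: "closedin (top_of_set ?S) B" if B: "subcomplex B" "B \<subseteq> ?S" for B
    by (rule closedin_subset_trans[OF subcomplex_closedin[OF B(1)] B(2)]) simp
  have "?S - L = \<Union> {line y | y. y \<in> V \<and> line y \<noteq> line x}"
    unfolding S x(2) using line_eq[OF x(1)] by blast
  moreover have "subcomplex (\<Union> {line y | y. y \<in> V \<and> line y \<noteq> line x})"
    by (rule subcomplex_Union) (use subcomplex_line in blast)
  ultimately have "subcomplex (?S - L)" by (simp only:)
  moreover have "subcomplex L" unfolding x(2) by (rule subcomplex_line[OF x(1)])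
  moreover have "L \<subseteq> ?S" unfolding S x(2) using x(1) by blast
  ultimately show "closedin (top_of_set ?S) L \<and> closedin (top_of_set ?S) (?S - L)"
    by (intro conjI cl Diff_subset)
qed

text \<open>A parametrisation and \<open>hl\<close> lift the same map of the real line, so they are
  equal as soon as they agree at 0, where the parametrisation takes a value over \<open>v\<close>,
  that is, a vertex.\<close>

lemma line_param_iff:
  assumes L: "L \<subseteq> X"
  shows "line_param p (\<phi> Edge_a) L h \<longleftrightarrow> (\<exists>x\<in>V. h = hl x \<and> L = line x)"
proof
  assume lp: "line_param p (\<phi> Edge_a) L h"
  then obtain h' where h': "homeomorphism UNIV L h h'" and ph: "\<And>s. p (h s) = \<phi> Edge_a (frac s)"
    by (auto simp: line_param_def)
  have cont: "continuous_on UNIV h" and im: "range h = L" using h' by (auto simp: homeomorphism_def)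
  have x: "h 0 \<in> V" using im L ph[of 0] edge_map[OF edges(1)] by (auto simp: V_def)
  have "h s = hl (h 0) s" for s
  proof (rule covering_lift_unique[OF covering connected_UNIV cont _ continuous_hl[OF x], where a = 0])
    show "range h \<subseteq> X" using im L by simp
    show "range (hl (h 0)) \<subseteq> X" using line_subset_X[OF x] by (simp add: line_def)
  qed (use ph p_hl[OF x] x in simp_all)
  then have "h = hl (h 0)" by (rule ext)
  then show "\<exists>x\<in>V. h = hl x \<and> L = line x" using x im by (metis line_def)
next
  assume "\<exists>x\<in>V. h = hl x \<and> L = line x"
  then obtain x where x: "x \<in> V" "h = hl x" "L = line x" by blast
  obtain h' where "homeomorphism UNIV (line x) (hl x) h'" using hl_homeomorphism[OF x(1)] .
  then show "line_param p (\<phi> Edge_a) L h" using x p_hl[OF x(1)] by (auto simp: line_param_def)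
qed

end

section \<open>The orientation character\<close>

context bs_rigid
begin

lemma aut_line_subset:
  assumes f: "f \<in> carrier aut.H" and x: "x \<in> V"
  shows "f ` line x \<subseteq> line (f x)"
proof
  have fx: "f x \<in> V" by (rule aut_vertex[OF f x])
  fix q assume "q \<in> f ` line x"
  then obtain s where q: "q = f (hl x s)" by (auto simp: line_def)
  show "q \<in> line (f x)"
  proof (cases "frac s = 0")
    case True
    then have "q = f (az \<lfloor>s\<rfloor> x)" using q lft_Edge_0[OF edges(1) az_V[OF x]] by (simp add: hl_def del: frac_eq_0_iff)
    then have "q = hl (f x) (of_int (chi f x * \<lfloor>s\<rfloor>))"
      using aut_az[OF f x, of "\<lfloor>s\<rfloor>"] hl_of_int[OF fx, of "chi f x * \<lfloor>s\<rfloor>"] by simp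
    then show ?thesis unfolding line_def by blast
  next
    case False
    then have "hl x s \<in> cell Ea (az \<lfloor>s\<rfloor> x)" using hl_cell[OF x, of s] by (auto simp: cell_def simp del: frac_eq_0_iff cell_int.simps)
    moreover obtain j where "f ` cell Ea (az \<lfloor>s\<rfloor> x) = cell Ea (az j (f (az \<lfloor>s\<rfloor> x)))"
      using aut_cell_a(2)[OF f az_V[OF x]] by blast
    ultimately have "q \<in> cell Ea (az (j + chi f x * \<lfloor>s\<rfloor>) (f x))"
      using q aut_az[OF f x] az_add[OF fx] by auto
    then have "q \<in> lft Ea (az (j + chi f x * \<lfloor>s\<rfloor>) (f x)) ` of_real ` {0<..<1}" by (simp add: cell_def)
    then obtain t where t: "t \<in> {0<..<1}" "q = lft Ea (az (j + chi f x * \<lfloor>s\<rfloor>) (f x)) (of_real t)" by blast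
    then have "q = hl (f x) (t + of_int (j + chi f x * \<lfloor>s\<rfloor>))"
      using hl_segment[OF fx, of "t + of_int (j + chi f x * \<lfloor>s\<rfloor>)" "j + chi f x * \<lfloor>s\<rfloor>"] by simp
    then show ?thesis unfolding line_def by blast
  qed
qed

lemma aut_line:
  assumes f: "f \<in> carrier aut.H" and x: "x \<in> V"
  shows "f ` line x = line (f x)"
proof
  show "f ` line x \<subseteq> line (f x)" by (rule aut_line_subset[OF f x])
  have fx: "f x \<in> V" by (rule aut_vertex[OF f x])
  have "(inv\<^bsub>aut.H\<^esub> f) ` line (f x) \<subseteq> line x"
    using aut_line_subset[OF aut.H.inv_closed[OF f] fx] aut_inv_apply(1)[OF f V_in_X[OF x]] by simp
  then have "f ` (inv\<^bsub>aut.H\<^esub> f) ` line (f x) \<subseteq> f ` line x" by (rule image_mono)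
  moreover have "f ` (inv\<^bsub>aut.H\<^esub> f) ` line (f x) = line (f x)"
    using aut_inv_apply(2)[OF f] line_subset_X[OF fx] by (force simp: image_image)
  ultimately show "line (f x) \<subseteq> f ` line x" by simp
qed

text \<open>In the parameters of the two lines, \<open>f\<close> becomes an injective continuous
  real function, hence strictly monotone; its values at 0 and 1 decide the direction.\<close>

lemma aut_hl:
  assumes f: "f \<in> carrier aut.H" and x: "x \<in> V"
  obtains u :: "real \<Rightarrow> real" where "\<And>s. f (hl x s) = hl (f x) (u s)"
    "chi f x = 1 \<Longrightarrow> strict_mono_on UNIV u" "chi f x = - 1 \<Longrightarrow> strict_antimono_on UNIV u"
proof -
  note goal = that
  have fx: "f x \<in> V" by (rule aut_vertex[OF f x])
  obtain h' where h': "homeomorphism UNIV (line (f x)) (hl (f x)) h'" using hl_homeomorphism[OF fx] .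
  define u where "u s = h' (f (hl x s))" for s
  have fl: "f (hl x s) \<in> line (f x)" for s using aut_line[OF f x] by (auto simp: line_def)
  have u: "f (hl x s) = hl (f x) (u s)" for s
    using fl[of s] h' by (auto simp: u_def homeomorphism_def)
  obtain f' where "homeomorphism X X f f'" using aut.H_D(2)[OF f] by blast
  then have cf: "continuous_on X f" by (simp add: homeomorphism_def)
  have "continuous_on UNIV (\<lambda>s. f (hl x s))"
    by (rule continuous_on_compose2[OF cf continuous_hl[OF x]]) (use hl_in_X[OF x] in blast)
  then have cu: "continuous_on UNIV u" unfolding u_def
    by (rule continuous_on_compose2[OF homeomorphism_cont2[OF h']]) (use fl in blast)
  have iu: "inj_on u UNIV"
  proof (rule inj_onI)
    fix s t assume "u s = u t"
    then have "f (hl x s) = f (hl x t)" by (simp add: u)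
    then have "hl x s = hl x t" using inj_onD[OF aut.H_inj[OF f]] hl_in_X[OF x] by blast
    then show "s = t" by (simp add: hl_inj[OF x])
  qed
  have mono: "strict_mono_on UNIV u \<or> strict_antimono_on UNIV u"
    using injective_eq_monotone_map[OF is_interval_univ cu] iu by blast
  have uj: "u (of_int j) = of_int (chi f x * j)" for j
  proof -
    have "hl (f x) (u (of_int j)) = hl (f x) (of_int (chi f x * j))"
      using u[of "of_int j"] aut_az[OF f x, of j] hl_of_int[OF x, of j] hl_of_int[OF fx, of "chi f x * j"] by simp
    then show ?thesis by (simp only: hl_inj[OF fx])
  qed
  have u01: "u 0 = 0" "u 1 = of_int (chi f x)" using uj[of 0] uj[of 1] by simp_all
  show ?thesis
  proof (rule goal[OF u])
    assume "chi f x = 1"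
    then show "strict_mono_on UNIV u" using mono u01 monotone_onD[of UNIV "(<)" "(>)" u 0 1] by auto
  next
    assume "chi f x = - 1"
    then show "strict_antimono_on UNIV u" using mono u01 monotone_onD[of UNIV "(<)" "(<)" u 0 1] by auto
  qed
qed

lemma preserves_orientation_line:
  assumes f: "f \<in> carrier aut.H" and x: "x \<in> V"
  shows "preserves_orientation p (\<phi> Edge_a) f (line x) \<longleftrightarrow> chi f x = 1"
proof
  have fx: "f x \<in> V" by (rule aut_vertex[OF f x])
  assume c: "chi f x = 1"
  obtain u where u: "\<And>s. f (hl x s) = hl (f x) (u s)" "strict_mono_on UNIV u"
    using aut_hl[OF f x] c by metis
  show "preserves_orientation p (\<phi> Edge_a) f (line x)"
    unfolding preserves_orientation_def
  proof (intro exI conjI)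
    show "line_param p (\<phi> Edge_a) (line x) (hl x)" using line_param_iff[OF line_subset_X[OF x]] x by blast
    show "line_param p (\<phi> Edge_a) (f ` line x) (hl (f x))"
      unfolding aut_line[OF f x] using line_param_iff[OF line_subset_X[OF fx]] fx by blast
    show "\<forall>s. f (hl x s) = hl (f x) (u s)" using u(1) by blast
    show "\<forall>s t. s < t \<longrightarrow> u s < u t" using monotone_onD[OF u(2)] by simp
  qed
next
  have fx: "f x \<in> V" by (rule aut_vertex[OF f x])
  assume "preserves_orientation p (\<phi> Edge_a) f (line x)"
  then obtain h h' u where lp: "line_param p (\<phi> Edge_a) (line x) h" "line_param p (\<phi> Edge_a) (f ` line x) h'"
    and u: "\<And>s. f (h s) = h' (u s)" "\<And>s t. s < t \<Longrightarrow> (u s :: real) < u t"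
    unfolding preserves_orientation_def by auto
  obtain y where y: "y \<in> V" "h = hl y" using lp(1) line_param_iff[OF line_subset_X[OF x]] by blast
  obtain z where z: "z \<in> V" "h' = hl z" using lp(2) line_param_iff[OF line_subset_X[OF fx]] aut_line[OF f x] by auto
  have fy: "f y \<in> V" by (rule aut_vertex[OF f y(1)])
  have y0: "f y = hl z (u 0)" using u(1)[of 0] y z by simp
  \<comment> \<open>\<open>f y\<close> is a vertex, and vertices have integer parameters on their
    line.\<close>
  then obtain c where c: "u 0 = of_int c" using hl_in_V[OF z(1), of "u 0"] fy by auto
  have "f (az 1 y) = hl z (u 1)" using u(1)[of 1] hl_of_int[OF y(1), of 1] y z by simp
  moreover have "f (az 1 y) = az (chi f y) (f y)" using aut_az[OF f y(1), of 1] by simp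
  moreover have "az (chi f y) (f y) = hl z (of_int (chi f y) + u 0)"
    using az_add[OF z(1), of "chi f y" c] hl_of_int[OF z(1), of c] hl_of_int[OF z(1), of "chi f y + c"]
    by (simp only: y0 c of_int_add)
  ultimately have "u 1 = of_int (chi f y) + u 0" using hl_inj[OF z(1)] by simp
  then have "chi f y \<noteq> - 1" using u(2)[of 0 1] by auto
  then show "chi f x = 1" using chi_cases[of f y] chi_const[OF f y(1) x] by simp
qed

lemma reverses_orientation_line:
  assumes f: "f \<in> carrier aut.H" and x: "x \<in> V" and c: "chi f x = - 1"
  shows "reverses_orientation p (\<phi> Edge_a) f (line x)"
proof -
  have fx: "f x \<in> V" by (rule aut_vertex[OF f x])
  obtain u where u: "\<And>s. f (hl x s) = hl (f x) (u s)" "strict_antimono_on UNIV u"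
    using aut_hl[OF f x] c by metis
  show ?thesis
    unfolding reverses_orientation_def
  proof (intro exI conjI)
    show "line_param p (\<phi> Edge_a) (line x) (hl x)" using line_param_iff[OF line_subset_X[OF x]] x by blast
    show "line_param p (\<phi> Edge_a) (f ` line x) (hl (f x))"
      unfolding aut_line[OF f x] using line_param_iff[OF line_subset_X[OF fx]] fx by blast
    show "\<forall>s. f (hl x s) = hl (f x) (u s)" using u(1) by blast
    show "\<forall>s t. s < t \<longrightarrow> u t < u s" using monotone_onD[OF u(2)] by simp
  qed
qed

section \<open>The orientation character equals the sign\<close>

lemma chi_class:
  assumes f: "f \<in> carrier aut.H" and g: "g \<in> aut_class X cells f" and x: "x \<in> V"
  shows "g \<in> carrier aut.H" "chi g x = chi f x"
proof -
  show "g \<in> carrier aut.H" using g unfolding aut.aut_class_eq[OF f] by blast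
  have "g y = f y" if y: "y \<in> V" for y
  proof -
    have "{y} \<in> cells" using cells_I[of Vertex y] y cell_Vertex[OF y] by simp
    then have "g ` {y} = f ` {y}" using g unfolding aut.aut_class_eq[OF f] by blast
    then show ?thesis by simp
  qed
  then show "chi g x = chi f x" using x tgt_in_V[OF edges(1) x] by (simp add: chi_def)
qed

theorem orientation_character_class:
  assumes f: "f \<in> carrier aut.H" and x: "x \<in> V"
  shows "orientation_character X p (\<phi> Edge_a) (aut_class X cells f) = chi f x"
proof -
  have c: "chi g y = chi f x" if "g \<in> aut_class X cells f" "y \<in> V" for g y
    using chi_class[OF f that] chi_const[OF f x that(2)] by simp
  have p: "preserves_orientation p (\<phi> Edge_a) g (line y) \<longleftrightarrow> chi f x = 1" if "g \<in> aut_class X cells f" "y \<in> V" for g y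
    using preserves_orientation_line[OF chi_class(1)[OF f that] that(2)] c[OF that] by simp
  have r: "reverses_orientation p (\<phi> Edge_a) g (line y)" if "g \<in> aut_class X cells f" "y \<in> V" "chi f x = - 1" for g y
    using reverses_orientation_line[OF chi_class(1)[OF f that(1,2)] that(2)] c[OF that(1,2)] that(3) by simp
  show ?thesis
  proof (cases "chi f x = 1")
    case True
    then show ?thesis unfolding orientation_character_def branching_lines_eq using p by simp
  next
    case False
    then have m: "chi f x = - 1" using chi_cases[of f x] by simp
    \<comment> \<open>The definition tests preservation first, so preservation has to fail before
      reversal counts.\<close>
    have "\<not> (\<forall>g\<in>aut_class X cells f. \<forall>L\<in>line ` V. preserves_orientation p (\<phi> Edge_a) g L)"
      using p[OF aut.aut_class_self[OF f] x] aut.aut_class_self[OF f] x False by blast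
    then show ?thesis unfolding orientation_character_def branching_lines_eq using r m by simp
  qed
qed

lemma chi_mult:
  assumes f: "f \<in> carrier aut.H" and g: "g \<in> carrier aut.H" and x: "x \<in> V"
  shows "chi (f \<otimes>\<^bsub>aut.H\<^esub> g) x = chi f x * chi g x"
proof -
  have gx: "g x \<in> V" and fgx: "f (g x) \<in> V" using aut_vertex[OF g x] aut_vertex[OF f aut_vertex[OF g x]] by simp_all
  have "(f \<otimes>\<^bsub>aut.H\<^esub> g) (A x) = f (az (chi g x) (g x))"
    using aut.mult_apply[OF f g V_in_X[OF tgt_in_V[OF edges(1) x]]] aut_A[OF g x] by simp
  also have "\<dots> = az (chi f x * chi g x) (f (g x))"
    using aut_az[OF f gx, of "chi g x"] chi_const[OF f x gx] by simp
  finally have 1: "(f \<otimes>\<^bsub>aut.H\<^esub> g) (A x) = az (chi f x * chi g x) (f (g x))" .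
  have 2: "A ((f \<otimes>\<^bsub>aut.H\<^esub> g) x) = az 1 (f (g x))"
    using aut.mult_apply[OF f g V_in_X[OF x]] A_az[OF fgx] by simp
  have "chi (f \<otimes>\<^bsub>aut.H\<^esub> g) x = (if chi f x * chi g x = 1 then 1 else - 1)"
    unfolding chi_def[of "f \<otimes>\<^bsub>aut.H\<^esub> g"] 1 2 az_inj[OF fgx] ..
  then show ?thesis using chi_cases[of f x] chi_cases[of g x] by auto
qed

lemma chi_deck:
  assumes d: "d \<in> deck_transformations X p" and x: "x \<in> V"
  shows "chi d x = 1"
  using deck_tgt[OF d edges(1) x] by (simp add: chi_def)

end

section \<open>An orientation reversing automorphism\<close>

context bs_coprime
begin

text \<open>On the face, the angle is chosen such that the reflection exchanges the arcs of the two
  \<open>t\<close>-letters of the boundary word.\<close>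

fun mir :: "(z_edge, nat) cell_index \<Rightarrow> complex \<Rightarrow> complex" where
  "mir Vertex u = u"
| "mir (Edge Edge_a) u = 1 - u"
| "mir (Edge (Edge_t i)) u = u"
| "mir (Face i) u = cis (2 * pi * (real m + 2) / real (m + n + 2)) * cnj u"

lemma mir_mir [simp]: "mir i (mir i u) = u"
proof (cases "(i, u)" rule: mir.cases)
  case (4 f w)
  have "cis t * cnj (cis t) = 1" for t by (simp add: cis_cnj cis_mult)
  then have "cis t * cnj (cis t * cnj u) = u" for t
    by (metis complex_cnj_cnj complex_cnj_mult mult.assoc mult_1)
  then show ?thesis using 4 by simp
qed simp_all

lemma continuous_mir: "continuous_on S (mir i)"
  by (cases "(i, 0 :: complex)" rule: mir.cases) (auto intro!: continuous_intros simp: fun_eq_iff cong: continuous_on_cong)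

lemma mir_subset: "mir i ` cell_dom i \<subseteq> cell_dom i" "mir i ` cell_int i \<subseteq> cell_int i"
proof -
  have r: "1 - complex_of_real x = complex_of_real (1 - x)" for x by simp
  show "mir i ` cell_dom i \<subseteq> cell_dom i" "mir i ` cell_int i \<subseteq> cell_int i"
    by (cases "(i, 0 :: complex)" rule: mir.cases; force simp: norm_mult r simp del: of_real_diff)+
qed

lemma mir_image: "mir i ` cell_int i = cell_int i"
proof
  have "u = mir i (mir i u) \<and> mir i u \<in> cell_int i" if "u \<in> cell_int i" for u
    using that mir_subset(2)[of i] by auto
  then show "cell_int i \<subseteq> mir i ` cell_int i" by blast
qed (rule mir_subset(2))

definition rho :: "'z \<Rightarrow> 'z" where
  "rho z = (let r = (SOME r. fst r \<in> I \<and> snd r \<in> cell_int (fst r) \<and> z = \<kappa> (fst r) (snd r)) in \<kappa> (fst r) (mir (fst r) (snd r)))"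

lemma rho_int:
  assumes i: "i \<in> I" and u: "u \<in> cell_int i"
  shows "rho (\<kappa> i u) = \<kappa> i (mir i u)"
proof -
  define r where "r = (SOME r. fst r \<in> I \<and> snd r \<in> cell_int (fst r) \<and> \<kappa> i u = \<kappa> (fst r) (snd r))"
  have "fst r \<in> I \<and> snd r \<in> cell_int (fst r) \<and> \<kappa> i u = \<kappa> (fst r) (snd r)"
    unfolding r_def by (rule someI[of _ "(i, u)"]) (use i u in simp)
  then have "i = fst r" "u = snd r" using \<kappa>_inj[OF i _ u] by blast+
  then show ?thesis unfolding rho_def r_def[symmetric] Let_def by simp
qed

lemma rho_v: "rho v = v"
  using rho_int[of Vertex 0] by simp

lemma rho_edge:
  assumes e: "e \<in> z_edges m n" and s: "s \<in> {0..1}"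
  shows "rho (\<phi> e s) = \<phi> e (if e = Edge_a then 1 - s else s)"
proof (cases "s \<in> {0<..<1}")
  case True
  then have "rho (\<kappa> (Edge e) (of_real s)) = \<kappa> (Edge e) (mir (Edge e) (of_real s))"
    using e by (intro rho_int) auto
  then show ?thesis by (cases e) simp_all
next
  case False
  then have "s = 0 \<or> s = 1" using s by auto
  then show ?thesis using edge_map[OF e] rho_v by auto
qed

lemma length_word: "length (z_word m n 0) = m + n + 2"
  using length_z_word[of 0] gcd1 by simp

lemma word_nth:
  assumes "j < m + n + 2"
  shows "z_word m n 0 ! j = (if j = 0 then (Edge_t 0, True) else if j \<le> m then (Edge_a, True)
    else if j = m + 1 then (Edge_t 0, False) else (Edge_a, False))"
proof -
  have "j < length (z_word m n 0)" using assms by (simp only: length_word)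
  from z_word_nth[OF this] show ?thesis by (simp only: gcd1 div_by_1 mod_by_1)
qed

text \<open>With the circle divided into \<open>m + n + 2\<close> arcs, the reflection sends
  position \<open>t\<close> to \<open>m + 2 - t\<close>. Arc \<open>j\<close> becomes arc
  \<open>m + 1 - j\<close> run backwards; if this is negative, the number of arcs is added, which
  gives \<open>2 * m + n + 3 - j\<close>.\<close>

lemma mir_arc:
  assumes "j < m + n + 2" and j': "j' = (if j \<le> m + 1 then m + 1 - j else 2 * m + n + 3 - j)"
  shows "mir Fc (arc 0 j s) = arc 0 j' (1 - s)"
proof -
  let ?N = "real (m + n + 2)"
  have "mir Fc (arc 0 j s) = cis (2 * pi * (real m + 2) / ?N) * cis (- (2 * pi * (real j + s) / ?N))"
    by (simp add: arc_def length_word cis_cnj)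
  also have "\<dots> = cis (2 * pi * (real m + 2 - (real j + s)) / ?N)"
    by (simp add: cis_mult diff_divide_distrib right_diff_distrib)
  also have "\<dots> = cis (2 * pi * (real j' + (1 - s)) / ?N)"
  proof (cases "j \<le> m + 1")
    case True
    then have "real m + 2 - (real j + s) = real j' + (1 - s)" by (simp add: j' of_nat_diff)
    then show ?thesis by (simp only:)
  next
    case False
    then have j'': "real j' = 2 * real m + real n + 3 - real j" using assms by (simp add: of_nat_diff)
    have "2 * pi * (real j' + (1 - s)) / ?N = 2 * pi * (real m + 2 - (real j + s)) / ?N + 2 * pi"
      unfolding j'' by (simp add: field_simps)
    then show ?thesis by (simp add: cis_mult[symmetric])
  qed
  finally show ?thesis by (simp add: arc_def length_word)
qed

lemma rho_\<kappa>:
  assumes i: "i \<in> I" and u: "u \<in> cell_dom i"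
  shows "rho (\<kappa> i u) = \<kappa> i (mir i u)"
proof -
  consider "i = Vertex" | e where "i = Edge e" "e \<in> z_edges m n" | "i = Fc" using I_cases[OF i] by auto
  then show ?thesis
  proof cases
    case 1
    then show ?thesis using u rho_v by simp
  next
    case 2
    then obtain s where s: "s \<in> {0..1}" "u = of_real s" using u by auto
    then show ?thesis using rho_edge[OF 2(2) s(1)] 2(1) by (cases e) simp_all
  next
    case 3
    show ?thesis
    proof (cases "norm u < 1")
      case True
      then show ?thesis using 3 by (intro rho_int i) (simp add: dist_norm)
    next
      case False
      then have "norm u = 1" using u 3 by (simp add: dist_norm)
      then obtain j s where j: "j < length (z_word m n 0)" "s \<in> {0..<1}" "u = arc 0 j s"
        using circle_eq_arc[OF F_in] by metis
      have jN: "j < m + n + 2" using j(1) length_word by simp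
      have s: "s \<in> {0..1}" "1 - s \<in> {0..1}" using j(2) by auto
      define j' where "j' = (if j \<le> m + 1 then m + 1 - j else 2 * m + n + 3 - j)"
      have j'N: "j' < m + n + 2" using jN by (auto simp: j'_def)
      have nn: "2 * m + n + 3 - j \<ge> m + 2" using jN by linarith
      have "rho (\<kappa> i u) = rho (letter_path \<phi> (z_word m n 0 ! j) s)"
        using face_arc[OF F_in j(1) s(1)] 3 j(3) by simp
      \<comment> \<open>The arcs of the two \<open>t\<close>-letters, which have opposite signs, are
        exchanged and run backwards, so points of the \<open>t\<close>-edge stay where they are;
        each of the two runs of \<open>a\<close> is reversed in itself.\<close>
      also have "\<dots> = letter_path \<phi> (z_word m n 0 ! j') (1 - s)"
        unfolding word_nth[OF jN] word_nth[OF j'N] letter_path_def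
        using rho_edge[OF edges(1) s(1)] rho_edge[OF edges(1) s(2)] rho_edge[OF t_in s(1)] rho_edge[OF t_in s(2)] jN nn
        by (auto simp add: j'_def)
      also have "\<dots> = \<kappa> i (mir i u)"
        using face_arc[OF F_in _ s(2), of j'] j'N 3 j(3) mir_arc[OF jN j'_def] length_word by simp
      finally show ?thesis .
    qed
  qed
qed

lemma continuous_rho: "continuous_on Z rho"
proof (rule weak_top_continuous[OF weak_Z])
  fix i assume i: "i \<in> I"
  have "continuous_on (cell_dom i) (\<lambda>u. \<kappa> i (mir i u))"
    by (rule continuous_on_compose2[OF continuous_\<kappa>[OF i] continuous_mir mir_subset(1)])
  then show "continuous_on (cell_dom i) (\<lambda>u. rho (\<kappa> i u))"
    by (rule continuous_on_eq) (rule rho_\<kappa>[OF i, symmetric])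
qed

lemma rho_in_Z: "z \<in> Z \<Longrightarrow> rho z \<in> Z" and rho_rho: "z \<in> Z \<Longrightarrow> rho (rho z) = z"
proof -
  assume "z \<in> Z"
  then obtain i u where iu: "i \<in> I" "u \<in> cell_int i" "z = \<kappa> i u" by (rule \<kappa>_cover)
  have m: "mir i u \<in> cell_int i" using iu(2) mir_subset(2)[of i] by blast
  show "rho z \<in> Z" unfolding iu(3) rho_int[OF iu(1,2)] by (rule \<kappa>_int_in_Z[OF iu(1) m])
  show "rho (rho z) = z" unfolding iu(3) rho_int[OF iu(1,2)] rho_int[OF iu(1) m] by simp
qed

text \<open>The reflection of \<open>Z\<close> fixes the vertex and so lifts to a map fixing
  \<open>x0\<close>. As the lift of an involution with a fixed point, this map is its own inverse.
  It carries the edge from \<open>x0\<close> to \<open>A x0\<close> to the edge that ends at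
  \<open>x0\<close>.\<close>

lemma reflection_exists:
  assumes x0: "x0 \<in> V"
  shows "\<exists>f\<in>carrier aut.H. f x0 = x0 \<and> A (f (A x0)) = x0"
proof -
  have q: "continuous_on X (\<lambda>x. rho (p x))" "(\<lambda>x. rho (p x)) ` X \<subseteq> Z"
    using continuous_on_compose2[OF continuous_rho continuous_p p_image] rho_in_Z p_in_Z by auto
  have px0: "p x0 = rho (p x0)" using p_V[OF x0] rho_v by simp
  obtain g where g: "continuous_on X g" "g ` X \<subseteq> X" "g x0 = x0" "\<And>x. x \<in> X \<Longrightarrow> p (g x) = rho (p x)"
    by (rule lift_self[where q = "\<lambda>x. rho (p x)", OF q V_in_X[OF x0] V_in_X[OF x0] px0]) (rule that)
  have gX: "g x \<in> X" if "x \<in> X" for x using g(2) that by blast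
  have gg: "g (g x) = x" if x: "x \<in> X" for x
  proof (rule self_unique[of "\<lambda>x. g (g x)" "\<lambda>x. x", OF _ _ continuous_on_id _ _ V_in_X[OF x0] _ x])
    show "continuous_on X (\<lambda>x. g (g x))" by (rule continuous_on_compose2[OF g(1) g(1) g(2)])
    show "p (g (g y)) = p y" if y: "y \<in> X" for y using g(4)[OF gX[OF y]] g(4)[OF y] rho_rho[OF p_in_Z[OF y]] by simp
  qed (use gX g(3) in auto)
  have pg: "p (g (lft i x (mir i u))) = \<kappa> i u" if i: "i \<in> I" and x: "x \<in> V" and u: "u \<in> cell_dom i" for i x u
  proof -
    have mu: "mir i u \<in> cell_dom i" using u mir_subset(1)[of i] by blast
    have "p (g (lft i x (mir i u))) = rho (\<kappa> i (mir i u))" using g(4)[OF lft_in_X[OF i x mu]] lft(4)[OF i x mu] by simp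
    then show ?thesis using rho_\<kappa>[OF i mu] by simp
  qed
  have c: "cellular g" unfolding cellular_def
  proof (intro ballI bexI exI conjI)
    fix i x assume i: "i \<in> I" and x: "x \<in> V"
    show "p (g (lft i x (mir i u))) = \<kappa> i u" if "u \<in> cell_dom i" for u by (rule pg[OF i x that])
  qed (rule continuous_mir mir_subset(1) mir_image | assumption)+
  have H: "restrict g X \<in> carrier aut.H" by (rule cellular_in_H[OF g(1,2) c g(1,2) c gg gg])
  have I: "Ea \<in> I" by simp
  note l = lift_image_cell(2)[OF g(1,2) I x0 I continuous_mir mir_subset(1) mir_image pg[OF I x0], of 1]
  have "A (g (A x0)) = x0" using l x0 g(3) by (simp add: tgt_def)
  then show ?thesis using H g(3) V_in_X[OF x0] V_in_X[OF tgt_in_V[OF edges(1) x0]] by (intro bexI[OF _ H]) simp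
qed

end

context bs_rigid
begin

lemma reversal_exists:
  assumes x0: "x0 \<in> V"
  shows "\<exists>f\<in>carrier aut.H. chi f x0 = - 1"
proof -
  obtain f where f: "f \<in> carrier aut.H" "f x0 = x0" "A (f (A x0)) = x0" using reflection_exists[OF x0] by blast
  have "f (A x0) \<noteq> A (f x0)"
  proof
    assume "f (A x0) = A (f x0)"
    then have "A (A x0) = x0" using f by simp
    then have "az 2 x0 = az 0 x0" using A_az[OF x0] A_az[OF az_V[OF x0], of 1] az_add[OF x0, of 1 1] by simp
    then show False using az_inj[OF x0, of 2 0] by simp
  qed
  then show ?thesis using f(1) by (auto simp: chi_def)
qed

end

section \<open>Presented groups\<close>

lemma pres_eq_context: "pres_eq R u v \<Longrightarrow> pres_eq R (x @ u @ y) (x @ v @ y)"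
proof (induction rule: pres_eq.induct)
  case (refl u)
  show ?case by (rule pres_eq.refl)
next
  case (sym u v)
  then show ?case by (simp only: pres_eq.sym)
next
  case (trans u v w)
  show ?case by (rule pres_eq.trans[OF trans.IH])
next
  case (cancel u g b v)
  show ?case using pres_eq.cancel[of R "x @ u" g b "v @ y"] by simp
next
  case (relator r u v)
  show ?case using pres_eq.relator[OF relator.hyps, of "x @ u" "v @ y"] by simp
qed

lemma word_class_eq_iff: "word_class R u = word_class R v \<longleftrightarrow> pres_eq R u v"
proof
  assume eq: "word_class R u = word_class R v"
  have "v \<in> word_class R v" by (simp add: word_class_def pres_eq.refl)
  then show "pres_eq R u v" unfolding eq[symmetric] by (simp add: word_class_def)
next
  assume uv: "pres_eq R u v"
  show "word_class R u = word_class R v"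
    unfolding word_class_def using pres_eq.trans[OF uv] pres_eq.trans[OF pres_eq.sym[OF uv]] by blast
qed

lemma word_class_append:
  assumes "pres_eq R u u'" "pres_eq R v v'"
  shows "word_class R (u @ v) = word_class R (u' @ v')"
proof -
  have "pres_eq R (u @ v) (u' @ v)" using pres_eq_context[OF assms(1), of "[]" v] by simp
  moreover have "pres_eq R (u' @ v) (u' @ v')" using pres_eq_context[OF assms(2), of u' "[]"] by simp
  ultimately show ?thesis unfolding word_class_eq_iff by (rule pres_eq.trans)
qed

lemma carrier_presented: "carrier (presented_group R) = range (word_class R)"
  by (simp add: presented_group_def)

lemma one_presented: "\<one>\<^bsub>presented_group R\<^esub> = word_class R []"
  by (simp add: presented_group_def)

lemma mult_presented: "word_class R u \<otimes>\<^bsub>presented_group R\<^esub> word_class R v = word_class R (u @ v)"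
proof -
  have "word_class R (u' @ v') = word_class R (u @ v)" if "u' \<in> word_class R u" "v' \<in> word_class R v" for u' v'
    using word_class_append[of R u u' v v'] that by (simp add: word_class_def)
  moreover have "u \<in> word_class R u" "v \<in> word_class R v" by (simp_all add: word_class_def pres_eq.refl)
  ultimately have "(\<Union>u'\<in>word_class R u. \<Union>v'\<in>word_class R v. word_class R (u' @ v')) = word_class R (u @ v)" by blast
  then show ?thesis by (simp add: presented_group_def)
qed

lemma word_inverse: "\<exists>u'. pres_eq R (u' @ u) []"
proof (induction u)
  case Nil
  then show ?case using pres_eq.refl[of R "[]"] by (intro exI[of _ "[]"]) simp
next
  case (Cons l u)
  then obtain u' where u': "pres_eq R (u' @ u) []" by blast
  obtain g b where l: "l = (g, b)" by (cases l)
  have "pres_eq R (u' @ [(g, \<not> b), (g, \<not> \<not> b)] @ u) (u' @ u)" by (rule pres_eq.cancel)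
  then have "pres_eq R ((u' @ [(g, \<not> b)]) @ l # u) []" using pres_eq.trans[OF _ u'] l by simp
  then show ?case by blast
qed

lemma group_presented: "group (presented_group R)"
proof (rule groupI)
  fix C assume "C \<in> carrier (presented_group R)"
  then obtain u where u: "C = word_class R u" by (auto simp: carrier_presented)
  obtain u' where "pres_eq R (u' @ u) []" using word_inverse by blast
  then have "word_class R u' \<otimes>\<^bsub>presented_group R\<^esub> C = \<one>\<^bsub>presented_group R\<^esub>"
    by (simp add: u mult_presented one_presented word_class_eq_iff)
  then show "\<exists>D\<in>carrier (presented_group R). D \<otimes>\<^bsub>presented_group R\<^esub> C = \<one>\<^bsub>presented_group R\<^esub>"
    by (auto simp: carrier_presented)
qed (auto simp: carrier_presented mult_presented one_presented)

section \<open>The action of the Baumslag-Solitar group\<close>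

context bs_coprime
begin

fun gen_edge :: "bs_gen \<Rightarrow> z_edge" where
  "gen_edge Gen_a = Edge_a"
| "gen_edge Gen_t = Edge_t 0"

abbreviation tr :: "bs_gen word \<Rightarrow> z_edge word" where
  "tr u \<equiv> map (\<lambda>l. (gen_edge (fst l), snd l)) u"

abbreviation R :: "bs_gen word set" where "R \<equiv> bs_relators m n"

lemma gen_edge_in: "gen_edge g \<in> z_edges m n"
  by (cases g) simp_all

lemma tr_in_E: "fst ` set (tr u) \<subseteq> z_edges m n"
  using gen_edge_in by auto

lemma tr_surj:
  assumes "fst ` set u \<subseteq> z_edges m n"
  obtains u' where "u = tr u'"
proof -
  have "\<exists>u'. u = tr u'" using assms
  proof (induction u)
    case (Cons l u)
    have "fst ` set u \<subseteq> z_edges m n" using Cons.prems by simp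
    then obtain u' where u': "u = tr u'" using Cons.IH by blast
    obtain e b where l: "l = (e, b)" by (cases l)
    have "e \<in> z_edges m n" using Cons.prems l by simp
    then have "e = Edge_a \<or> e = Edge_t 0" by (rule E_cases)
    then obtain g where "e = gen_edge g" by (metis gen_edge.simps)
    then have "l # u = tr ((g, b) # u')" using u' l by simp
    then show ?case by (rule exI)
  qed simp
  then show ?thesis using that by blast
qed

lemma tr_relator: "r \<in> R \<Longrightarrow> tr r = z_word m n 0"
  by (simp add: bs_relators_def word_eq)

lemma walk_tr_V: "x \<in> V \<Longrightarrow> walk (tr u) x \<in> V"
  by (rule walk_in_V[OF tr_in_E])

text \<open>A relator is the boundary word of a face and acts trivially on vertices; a cancelling
  pair runs along an edge and back.\<close>

lemma pres_eq_walk: "pres_eq R u u' \<Longrightarrow> x \<in> V \<Longrightarrow> walk (tr u) x = walk (tr u') x"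
proof (induction arbitrary: x rule: pres_eq.induct)
  case (sym u v)
  show ?case using sym.IH[OF sym.prems] by (rule HOL.sym)
next
  case (trans u v w)
  show ?case using trans.IH(1)[OF trans.prems] trans.IH(2)[OF trans.prems] by (rule HOL.trans)
next
  case (cancel u g b v)
  have y: "walk (tr u) x \<in> V" by (rule walk_tr_V[OF cancel.prems])
  have "step (gen_edge g, \<not> b) (step (gen_edge g, b) (walk (tr u) x)) = walk (tr u) x"
    using step_step[of "(gen_edge g, b)", OF _ y] gen_edge_in by simp
  then show ?case by simp
next
  case (relator r u v)
  have y: "walk (tr u) x \<in> V" by (rule walk_tr_V[OF relator.prems])
  have "walk (tr r) (walk (tr u) x) = walk (tr u) x"
    unfolding tr_relator[OF relator.hyps] by (rule walk_face[OF F_in y])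
  then show ?case by simp
qed (rule HOL.refl)

section \<open>Vertices labelled by group elements\<close>

definition gen_act :: "z_edge \<Rightarrow> bs_gen word set \<Rightarrow> bs_gen word set" where
  "gen_act e C = (if C \<in> range (word_class R)
     then C \<otimes>\<^bsub>BS m n\<^esub> word_class R [(case e of Edge_a \<Rightarrow> Gen_a | Edge_t i \<Rightarrow> Gen_t, True)] else C)"

lemma gen_act_class: "gen_act (gen_edge g) (word_class R u) = word_class R (u @ [(g, True)])"
  by (cases g) (simp_all add: gen_act_def BS_def mult_presented)

lemma class_cancel: "word_class R ((u @ [(g, b)]) @ [(g, \<not> b)]) = word_class R u"
  using pres_eq.cancel[of R u g b "[]"] by (simp add: word_class_eq_iff)

lemma bij_gen_act: "bij (gen_act e)"
proof -
  \<comment> \<open>Every \<open>t\<close>-edge index acts as the generator \<open>t\<close>, so the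
    claim holds for all edges, also for indices that do not occur in \<open>Z\<close>.\<close>
  obtain g where g: "gen_act e = gen_act (gen_edge g)"
  proof (cases e)
    case (Edge_t i)
    have "gen_act e = gen_act (gen_edge Gen_t)" by (rule ext) (simp add: gen_act_def Edge_t)
    then show ?thesis by (rule that)
  qed (use that[of Gen_a] in simp)
  define b where "b C = (if C \<in> range (word_class R) then C \<otimes>\<^bsub>BS m n\<^esub> word_class R [(g, False)] else C)" for C
  have b: "b (word_class R u) = word_class R (u @ [(g, False)])" for u
    by (simp add: b_def BS_def mult_presented)
  have out: "gen_act (gen_edge g) C = C" "b C = C" if "C \<notin> range (word_class R)" for C
    using that by (simp_all add: gen_act_def b_def)
  have "b (gen_act (gen_edge g) C) = C" "gen_act (gen_edge g) (b C) = C" for C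
  proof -
    show "b (gen_act (gen_edge g) C) = C"
      using out[of C] gen_act_class[of g] b class_cancel[of _ g True] by (cases "C \<in> range (word_class R)") auto
    show "gen_act (gen_edge g) (b C) = C"
      using out[of C] gen_act_class[of g] b class_cancel[of _ g False] by (cases "C \<in> range (word_class R)") auto
  qed
  then show ?thesis unfolding g by (intro bij_betw_byWitness[where f' = b]) auto
qed

lemma letter_act_class: "letter_act gen_act (gen_edge g, b) (word_class R u) = word_class R (u @ [(g, b)])"
proof (cases b)
  case True
  then show ?thesis by (simp add: letter_act_def gen_act_class)
next
  case False
  have "gen_act (gen_edge g) (word_class R (u @ [(g, False)])) = word_class R u"
    unfolding gen_act_class using class_cancel[of u g False] by simp
  then have "inv_into UNIV (gen_act (gen_edge g)) (word_class R u) = word_class R (u @ [(g, False)])"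
    by (rule inv_f_eq[OF bij_is_inj[OF bij_gen_act]])
  then show ?thesis using False by (simp add: letter_act_def)
qed

lemma fold_letter_act_class: "fold (letter_act gen_act) (tr u) (word_class R w) = word_class R (w @ u)"
proof (induction u arbitrary: w)
  case (Cons l u)
  then show ?case using letter_act_class[of "fst l" "snd l" w] by (cases l) simp
qed simp

text \<open>Vertices are labelled by group elements, and a walk multiplies the label on the right by
  its letters. The end of a walk from \<open>x0\<close> therefore determines the class of its word:
  the 1-skeleton of \<open>X\<close> is the Cayley graph.\<close>

lemma walk_faithful:
  assumes x0: "x0 \<in> V" and eq: "walk (tr u) x0 = walk (tr u') x0"
  shows "pres_eq R u u'"
proof -
  obtain L where L: "L x0 = word_class R []" "\<And>e x. e \<in> z_edges m n \<Longrightarrow> x \<in> V \<Longrightarrow> L (tgt e x) = gen_act e (L x)"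
  proof (rule edge_labelling[of gen_act x0 "word_class R []"])
    show "bij (gen_act e)" for e by (rule bij_gen_act)
    show "fold (letter_act gen_act) (z_word m n f) \<sigma> = \<sigma>" if f: "f \<in> {..<gcd m n}" for f \<sigma>
    proof (cases "\<sigma> \<in> range (word_class R)")
      case True
      then obtain w where w: "\<sigma> = word_class R w" by blast
      obtain r where r: "r \<in> R" by (auto simp: bs_relators_def)
      have f0: "z_word m n f = tr r" using f gcd1 tr_relator[OF r] by simp
      show ?thesis unfolding f0 w fold_letter_act_class word_class_eq_iff
        using pres_eq.relator[OF r, of w "[]"] by simp
    next
      case False
      have g: "gen_act e \<sigma> = \<sigma>" for e using False by (simp add: gen_act_def)
      then have "inv_into UNIV (gen_act e) \<sigma> = \<sigma>" for e
        by (intro inv_f_eq[OF bij_is_inj[OF bij_gen_act]])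
      then have "letter_act gen_act l \<sigma> = \<sigma>" for l using g by (simp add: letter_act_def)
      then have "fold (letter_act gen_act) w \<sigma> = \<sigma>" for w by (induction w) simp_all
      then show ?thesis .
    qed
  qed (use x0 that in auto)
  have step: "L (step l x) = letter_act gen_act l (L x)" if l: "fst l \<in> z_edges m n" and x: "x \<in> V" for l x
  proof (cases "snd l")
    case True
    then show ?thesis using L(2)[OF l x] by (simp add: step_def letter_act_def)
  next
    case False
    have s: "src (fst l) x \<in> V" "tgt (fst l) (src (fst l) x) = x" using src[OF l x] by simp_all
    have "gen_act (fst l) (L (src (fst l) x)) = L x" using L(2)[OF l s(1)] s(2) by simp
    then have "inv_into UNIV (gen_act (fst l)) (L x) = L (src (fst l) x)"
      by (rule inv_f_eq[OF bij_is_inj[OF bij_gen_act]])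
    then show ?thesis using False by (simp add: step_def letter_act_def)
  qed
  have walk: "L (walk w x) = fold (letter_act gen_act) w (L x)" if "fst ` set w \<subseteq> z_edges m n" "x \<in> V" for w x
    using that
  proof (induction w arbitrary: x)
    case (Cons l w)
    have l: "fst l \<in> z_edges m n" "fst ` set w \<subseteq> z_edges m n" using Cons.prems(1) by simp_all
    show ?case using Cons.IH[OF l(2) step_in_V[OF l(1) Cons.prems(2)]] step[OF l(1) Cons.prems(2)] by simp
  qed simp
  have "L (walk (tr w) x0) = word_class R w" for w
    unfolding walk[OF tr_in_E x0] L(1) fold_letter_act_class by simp
  then have "word_class R u = word_class R u'" using eq by metis
  then show ?thesis by (simp only: word_class_eq_iff)
qed

section \<open>The homomorphism from words to deck transformations\<close>

definition dk :: "'x \<Rightarrow> bs_gen word \<Rightarrow> 'x \<Rightarrow> 'x" where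
  "dk x0 u = (SOME d. d \<in> deck_transformations X p \<and> d x0 = walk (tr u) x0)"

lemma dk:
  assumes x0: "x0 \<in> V"
  shows "dk x0 u \<in> deck_transformations X p" "dk x0 u x0 = walk (tr u) x0"
proof -
  obtain d where "d \<in> deck_transformations X p" "d x0 = walk (tr u) x0"
    using deck_exists[OF x0 walk_tr_V[OF x0]] .
  then have "\<exists>d. d \<in> deck_transformations X p \<and> d x0 = walk (tr u) x0" by blast
  then show "dk x0 u \<in> deck_transformations X p" "dk x0 u x0 = walk (tr u) x0"
    unfolding dk_def by (metis (mono_tags, lifting) someI_ex)+
qed

definition bs_act :: "'x \<Rightarrow> bs_gen word set \<Rightarrow> ('x \<Rightarrow> 'x) set" where
  "bs_act x0 C = aut_class X cells (dk x0 (SOME u. C = word_class R u))"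

text \<open>Equivalent words lead from \<open>x0\<close> to the same vertex, so the choice of a
  representative does not matter.\<close>

lemma bs_act_class:
  assumes x0: "x0 \<in> V"
  shows "bs_act x0 (word_class R u) = aut_class X cells (dk x0 u)"
proof -
  have "word_class R u = word_class R (SOME u'. word_class R u = word_class R u')"
    by (rule someI[of _ u]) simp
  then have "pres_eq R u (SOME u'. word_class R u = word_class R u')" by (simp only: word_class_eq_iff)
  then have "walk (tr (SOME u'. word_class R u = word_class R u')) x0 = walk (tr u) x0"
    by (rule pres_eq_walk[OF _ x0, symmetric])
  then show ?thesis unfolding bs_act_def dk_def by (simp only:)
qed

text \<open>The deck transformation of \<open>u\<close> carries the walk \<open>u'\<close> from
  \<open>x0\<close> to the walk \<open>u'\<close> from the end of \<open>u\<close>, so products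
  correspond to concatenation in the same order.\<close>

lemma dk_mult:
  assumes x0: "x0 \<in> V"
  shows "dk x0 u \<otimes>\<^bsub>aut.H\<^esub> dk x0 u' = dk x0 (u @ u')"
proof -
  note d = deck_in_H[OF dk(1)[OF x0, of u]] and d' = deck_in_H[OF dk(1)[OF x0, of u']]
  let ?d = "dk x0 u \<otimes>\<^bsub>aut.H\<^esub> dk x0 u'"
  have H: "?d \<in> carrier aut.H" using d d' by (rule aut.H.m_closed)
  have "p (?d x) = p x" if x: "x \<in> X" for x
    using aut.mult_apply[OF d d' x] deck_D(3)[OF dk(1)[OF x0, of u] aut.H_mapsto[OF d' x]] deck_D(3)[OF dk(1)[OF x0, of u'] x]
    by simp
  then have "?d \<in> deck_transformations X p"
    using aut.H_D(1,2)[OF H] by (simp add: deck_transformations_def)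
  moreover have "?d x0 = dk x0 (u @ u') x0"
    using aut.mult_apply[OF d d' V_in_X[OF x0]] dk(2)[OF x0] deck_walk[OF dk(1)[OF x0] tr_in_E x0] by simp
  ultimately show ?thesis by (rule deck_unique[OF _ dk(1)[OF x0] V_in_X[OF x0]])
qed

lemma bs_act_hom:
  assumes x0: "x0 \<in> V"
  shows "bs_act x0 \<in> hom (BS m n) (Aut X cells)"
proof (rule homI)
  fix C assume "C \<in> carrier (BS m n)"
  then obtain u where "C = word_class R u" by (auto simp: BS_def carrier_presented)
  then show "bs_act x0 C \<in> carrier (Aut X cells)"
    using bs_act_class[OF x0] deck_in_H[OF dk(1)[OF x0]] by (simp add: aut.carrier_Aut)
next
  fix C D assume "C \<in> carrier (BS m n)" "D \<in> carrier (BS m n)"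
  then obtain u u' where u: "C = word_class R u" "D = word_class R u'" by (auto simp: BS_def carrier_presented)
  show "bs_act x0 (C \<otimes>\<^bsub>BS m n\<^esub> D) = bs_act x0 C \<otimes>\<^bsub>Aut X cells\<^esub> bs_act x0 D"
    unfolding u BS_def mult_presented bs_act_class[OF x0]
      aut.mult_Aut[OF deck_in_H[OF dk(1)[OF x0]] deck_in_H[OF dk(1)[OF x0]]] dk_mult[OF x0] ..
qed

lemma bs_act_inj:
  assumes x0: "x0 \<in> V"
  shows "inj_on (bs_act x0) (carrier (BS m n))"
proof (rule inj_onI)
  fix C D assume "C \<in> carrier (BS m n)" "D \<in> carrier (BS m n)" and eq: "bs_act x0 C = bs_act x0 D"
  then obtain u u' where u: "C = word_class R u" "D = word_class R u'" by (auto simp: BS_def carrier_presented)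
  have "{x0} \<in> cells" using cells_I[of Vertex x0] x0 cell_Vertex[OF x0] by simp
  moreover have "\<forall>\<sigma>\<in>cells. dk x0 u ` \<sigma> = dk x0 u' ` \<sigma>"
    using eq unfolding u bs_act_class[OF x0] aut.aut_class_eq_iff[OF deck_in_H[OF dk(1)[OF x0]] deck_in_H[OF dk(1)[OF x0]]] .
  ultimately have "dk x0 u ` {x0} = dk x0 u' ` {x0}" by blast
  then have "walk (tr u) x0 = walk (tr u') x0" using dk(2)[OF x0] by simp
  then show "C = D" unfolding u word_class_eq_iff by (rule walk_faithful[OF x0])
qed

lemma dk_along:
  assumes x0: "x0 \<in> V"
  shows "deck_along X p x0 (\<phi> (gen_edge g)) (dk x0 [(g, True)])"
proof -
  let ?i = "Edge (gen_edge g) :: (z_edge, nat) cell_index"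
  have i: "?i \<in> I" using gen_edge_in by simp
  have "dk x0 [(g, True)] x0 = tgt (gen_edge g) x0" using dk(2)[OF x0] by (simp add: step_pair)
  then have fin: "lft ?i x0 1 = dk x0 [(g, True)] x0" by (simp add: tgt_def)
  show ?thesis
    unfolding deck_along_def
  proof (intro conjI exI ballI)
    show "dk x0 [(g, True)] \<in> deck_transformations X p" by (rule dk(1)[OF x0])
    show "path (\<lambda>s. lft ?i x0 (of_real s))" unfolding path_def
      by (rule continuous_on_compose2[OF lft(1)[OF i x0]]) (auto intro!: continuous_intros of_real_in_Edge)
    show "path_image (\<lambda>s. lft ?i x0 (of_real s)) \<subseteq> X"
      unfolding path_image_def using lft_in_X[OF i x0 of_real_in_Edge] by blast
    show "pathstart (\<lambda>s. lft ?i x0 (of_real s)) = x0" using x0 gen_edge_in by (simp add: pathstart_def)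
    show "pathfinish (\<lambda>s. lft ?i x0 (of_real s)) = dk x0 [(g, True)] x0" using fin by (simp add: pathfinish_def)
    fix s :: real assume "s \<in> {0..1}"
    then show "p (lft ?i x0 (of_real s)) = \<phi> (gen_edge g) s" using lft(4)[OF i x0 of_real_in_Edge] by simp
  qed
qed

lemma bs_deck_action:
  assumes x0: "x0 \<in> V"
  shows "bs_deck_action m n X cells p \<phi> x0 (bs_act x0)"
  unfolding bs_deck_action_def
proof (intro conjI ballI)
  show "bs_act x0 \<in> hom (BS m n) (Aut X cells)" by (rule bs_act_hom[OF x0])
  have gen: "bs_act x0 (bs_elem m n g) = aut_class X cells (dk x0 [(g, True)])" for g
    unfolding bs_elem_def by (rule bs_act_class[OF x0])
  show "\<exists>f. deck_along X p x0 (\<phi> Edge_a) f \<and> bs_act x0 (bs_elem m n Gen_a) = aut_class X cells f"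
    using dk_along[OF x0, of Gen_a] gen[of Gen_a] by (intro exI[of _ "dk x0 [(Gen_a, True)]"]) simp
  show "\<exists>f. deck_along X p x0 (\<phi> (Edge_t 0)) f \<and> bs_act x0 (bs_elem m n Gen_t) = aut_class X cells f"
    using dk_along[OF x0, of Gen_t] gen[of Gen_t] by (intro exI[of _ "dk x0 [(Gen_t, True)]"]) simp
  fix C assume "C \<in> carrier (BS m n)"
  then obtain u where "C = word_class R u" by (auto simp: BS_def carrier_presented)
  then show "\<exists>f\<in>deck_transformations X p. bs_act x0 C = aut_class X cells f"
    using bs_act_class[OF x0] dk(1)[OF x0] by (intro bexI[of _ "dk x0 u"]) simp_all
qed

end

context bs_rigid
begin

theorem short_exact_bs:
  assumes x0: "x0 \<in> V"
  shows "short_exact (BS m n) (bs_act x0) (Aut X cells) (orientation_character X p (\<phi> Edge_a)) sign_img"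
proof -
  let ?\<chi> = "orientation_character X p (\<phi> Edge_a)"
  have \<chi>: "?\<chi> (aut_class X cells f) = chi f x0" if "f \<in> carrier aut.H" for f
    by (rule orientation_character_class[OF that x0])
  have hom: "?\<chi> \<in> hom (Aut X cells) sign_img"
  proof (rule homI)
    fix \<alpha> assume "\<alpha> \<in> carrier (Aut X cells)"
    then obtain f where "f \<in> carrier aut.H" "\<alpha> = aut_class X cells f" unfolding aut.carrier_Aut by blast
    then show "?\<chi> \<alpha> \<in> carrier sign_img" using \<chi> chi_cases[of f x0] by (auto simp: sign_img_def)
  next
    fix \<alpha> \<beta> assume "\<alpha> \<in> carrier (Aut X cells)" "\<beta> \<in> carrier (Aut X cells)"
    then obtain f g where fg: "f \<in> carrier aut.H" "\<alpha> = aut_class X cells f" "g \<in> carrier aut.H" "\<beta> = aut_class X cells g"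
      unfolding aut.carrier_Aut by blast
    show "?\<chi> (\<alpha> \<otimes>\<^bsub>Aut X cells\<^esub> \<beta>) = ?\<chi> \<alpha> \<otimes>\<^bsub>sign_img\<^esub> ?\<chi> \<beta>"
      unfolding fg(2,4) aut.mult_Aut[OF fg(1,3)] \<chi>[OF fg(1)] \<chi>[OF fg(3)] \<chi>[OF aut.H.m_closed[OF fg(1,3)]]
        chi_mult[OF fg(1,3) x0] by (simp add: sign_img_def)
  qed
  have deck1: "?\<chi> (aut_class X cells (dk x0 u)) = 1" for u
    unfolding \<chi>[OF deck_in_H[OF dk(1)[OF x0]]] by (rule chi_deck[OF dk(1)[OF x0] x0])
  have surj: "?\<chi> ` carrier (Aut X cells) = carrier sign_img"
  proof
    show "?\<chi> ` carrier (Aut X cells) \<subseteq> carrier sign_img" using hom by (auto simp: hom_def)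
    obtain f where f: "f \<in> carrier aut.H" "chi f x0 = - 1" using reversal_exists[OF x0] by blast
    have "- 1 \<in> ?\<chi> ` carrier (Aut X cells)"
      unfolding aut.carrier_Aut image_image using \<chi>[OF f(1)] f by (intro rev_image_eqI[OF f(1)]) simp
    moreover have "1 \<in> ?\<chi> ` carrier (Aut X cells)"
      unfolding aut.carrier_Aut image_image using deck1[of "[]"]
      by (intro rev_image_eqI[OF deck_in_H[OF dk(1)[OF x0, of "[]"]]]) simp
    ultimately show "carrier sign_img \<subseteq> ?\<chi> ` carrier (Aut X cells)" by (simp add: sign_img_def)
  qed
  have ker: "bs_act x0 ` carrier (BS m n) = kernel (Aut X cells) sign_img ?\<chi>"
  proof
    show "bs_act x0 ` carrier (BS m n) \<subseteq> kernel (Aut X cells) sign_img ?\<chi>"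
    proof
      fix \<alpha> assume "\<alpha> \<in> bs_act x0 ` carrier (BS m n)"
      then obtain u where u: "\<alpha> = aut_class X cells (dk x0 u)"
        using bs_act_class[OF x0] by (auto simp: BS_def carrier_presented)
      have "\<alpha> \<in> carrier (Aut X cells)" unfolding u aut.carrier_Aut using deck_in_H[OF dk(1)[OF x0]] by blast
      then show "\<alpha> \<in> kernel (Aut X cells) sign_img ?\<chi>" using deck1[of u] u by (simp add: kernel_def sign_img_def)
    qed
    show "kernel (Aut X cells) sign_img ?\<chi> \<subseteq> bs_act x0 ` carrier (BS m n)"
    proof
      fix \<alpha> assume "\<alpha> \<in> kernel (Aut X cells) sign_img ?\<chi>"
      then obtain f where f: "f \<in> carrier aut.H" "\<alpha> = aut_class X cells f" "?\<chi> \<alpha> = 1"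
        unfolding kernel_def aut.carrier_Aut by (auto simp: sign_img_def)
      have c: "chi f x0 = 1" using f \<chi>[OF f(1)] by simp
      \<comment> \<open>A word leading from \<open>x0\<close> to \<open>f x0\<close> gives a deck
        transformation with the same value at \<open>x0\<close>; sign 1 makes it agree with
        \<open>f\<close> on all cells.\<close>
      obtain w where w: "fst ` set w \<subseteq> z_edges m n" "walk w x0 = f x0"
        using all_reachable[OF x0 aut_vertex[OF f(1) x0]] unfolding reach_def by blast
      obtain u where u: "w = tr u" using tr_surj[OF w(1)] .
      have d: "dk x0 u x0 = f x0" using dk(2)[OF x0, of u] w(2) u by simp
      have "\<forall>\<sigma>\<in>cells. f ` \<sigma> = dk x0 u ` \<sigma>"
        using aut_eq_deck[OF f(1) x0 c dk(1)[OF x0] d] by blast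
      then have "\<alpha> = aut_class X cells (dk x0 u)"
        unfolding f(2) aut.aut_class_eq_iff[OF f(1) deck_in_H[OF dk(1)[OF x0]]] .
      then have "\<alpha> = bs_act x0 (word_class R u)" by (simp only: bs_act_class[OF x0])
      then show "\<alpha> \<in> bs_act x0 ` carrier (BS m n)" by (simp add: BS_def carrier_presented)
    qed
  qed
  show ?thesis unfolding short_exact_def
  proof (intro conjI)
    show "group (BS m n)" unfolding BS_def by (rule group_presented)
    show "bs_act x0 \<in> mon (BS m n) (Aut X cells)" using bs_act_hom[OF x0] bs_act_inj[OF x0] by (simp add: mon_def)
    show "?\<chi> \<in> epi (Aut X cells) sign_img" using hom surj by (simp add: epi_def)
  qed (rule aut.group_Aut sign_img_is_group ker)+
qed

end

theorem theorem4p8: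
  fixes m n :: nat
    and Z :: "'z::topological_space set" and v :: 'z
    and \<phi> :: "z_edge \<Rightarrow> real \<Rightarrow> 'z" and \<psi> :: "nat \<Rightarrow> complex \<Rightarrow> 'z"
    and X :: "'x::topological_space set" and p :: "'x \<Rightarrow> 'z" and C :: "'x set set"
  assumes "m \<ge> 1" and "n \<ge> 1"
    and "is_Z m n Z v \<phi> \<psi>"
    and "universal_cover X p Z"
    and "C = lifted_cells X p (z_cells m n v \<phi> \<psi>)"
  shows "(aut_discrete X C \<longleftrightarrow> gcd m n = 1) \<and>
    (gcd m n = 1 \<and> (m, n) \<noteq> (1, 1) \<longrightarrow>
      (\<forall>x0\<in>X. p x0 = v \<longrightarrow>
        (\<exists>\<iota>. bs_deck_action m n X C p \<phi> x0 \<iota> \<and>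
          short_exact (BS m n) \<iota> (Aut X C) (orientation_character X p (\<phi> Edge_a)) sign_img)))"
proof -
  interpret bs_cover m n Z v \<phi> \<psi> X p
    using assms(1-4) by (rule bs_cover.intro)
  have C: "C = cells" unfolding assms(5) z_cells_def by (rule lifted_cells_eq)
  show ?thesis
  proof (cases "gcd m n = 1")
    case False
    then have "gcd m n \<ge> 2" using k_pos by linarith
    then show ?thesis using not_discrete C False by simp
  next
    case True
    then have coprime: "bs_coprime m n Z v \<phi> \<psi> X p"
      by (intro bs_coprime.intro bs_coprime_axioms.intro bs_cover_axioms)
    show ?thesis
    proof (cases "m = n")
      case True
      then have "m = 1" "n = 1" using \<open>gcd m n = 1\<close> by simp_all
      moreover from this have "bs_square m n Z v \<phi> \<psi> X p"
        by (intro bs_square.intro bs_square_axioms.intro coprime)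
      ultimately show ?thesis using bs_square.discrete_square C \<open>gcd m n = 1\<close> by blast
    next
      case False
      interpret bs_rigid m n Z v \<phi> \<psi> X p
        by (intro bs_rigid.intro bs_rigid_axioms.intro coprime False)
      have "\<exists>\<iota>. bs_deck_action m n X C p \<phi> x0 \<iota> \<and>
          short_exact (BS m n) \<iota> (Aut X C) (orientation_character X p (\<phi> Edge_a)) sign_img"
        if "x0 \<in> X" "p x0 = v" for x0
      proof -
        have "x0 \<in> V" using that by (simp add: V_def)
        then show ?thesis unfolding C using bs_deck_action short_exact_bs by blast
      qed
      then show ?thesis using discrete_rigid C True by blast
    qed
  qed
qed

end
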